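(* Let $K(x,y)=\sum_{k\in\mathbb Z}1_{[0,1)}(x-k)1_{[0,1)}(y-k)$ be the Haar projection kernel and let $f_{n_1}(y,l)=\frac{2^l}{n_1}\sum_{i=1}^{n_1}K(2^ly,2^lX_i)$, where $X_1,X_2,\dots$ are i.i.d. with density $f$. Let $$A(l)=[2(\log2)l]^{1/2},\qquad B(l)=A(l)-\frac{\log l+\log(\pi\log2)}{2A(l)}.$$ Then for every $x\in\mathbb R$, $0<\alpha<\infty$, $0<D<\infty$, every admissible $\delta>0$, $F=[F_1,F_2]$ with $F_1<0<1<F_2$, and every sequence $l_n\in\mathcal J_n$, as $n\to\infty$, $$\sup_{f\in\mathcal D(\alpha,D,\delta,F)}\left|\Pr\nolimits_f\left\{\sqrt{\frac{n_1}{2^{l_n}}}\sup_{y\in[0,1]}\left|\frac{f_{n_1}(y,l_n)-Ef_{n_1}(y,l_n)}{\sqrt{f(y)}}\right|\le\frac x{A(l_n)}+B(l_n)\right\}-e^{-e^{-x}}\right|\to0.$$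
   Context: $n=n_1+n_2$ with $n_1/n_2$ bounded away from $0$ and $\infty$. $a_n\simeq b_n$ means that $a_n/b_n$ is bounded and bounded away from zero. $\mathcal J_n=[j_{\min},j_{\max}]\cap\mathbb N$ with integers $0<j_{\min}<j_{\max}$ (depending on $n$) satisfying $2^{j_{\min}}\simeq(n_2/\log n_2)^{1/(2r+1)}$, with $r=1$ for the Haar wavelet, and $2^{j_{\max}}\simeq n_2/(\log n_2)^4$. $\Pr_f$ is the product probability under which the $X_i$ are i.i.d. with density $f$. $\mathcal D(\alpha,D,\delta,F)$ is the set of $f:\mathbb R\to\mathbb R$ with $\int f=1$, $f\ge0$ on $\mathbb R$, $f\ge\delta$ on $F$, $\|f\|_{\alpha,\infty}\le D$; given $\alpha,D$, the pair $\delta,F$ is admissible if this set is nonempty. Here $\|f\|_{\alpha,\infty}=\sup_k|\alpha_k(f)|+\sup_{l\ge0,k}2^{l(\alpha+1/2)}|\beta_{lk}(f)|$ for bounded continuous $f$, with $\alpha_k(f)=\int f(x)\varphi(x-k)dx$, $\beta_{lk}(f)=\int f(x)2^{l/2}\psi(2^lx-k)dx$ for a scaling function $\varphi$ and associated wavelet $\psi$ with $\varphi$ $s$-regular, $s>\alpha$ ($s$ times weakly differentiable, all derivatives up to order $s$ decaying exponentially); it is the Hölder–Zygmund norm of order $\alpha$ up to equivalence. *)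

theory Defs
  imports "HOL-Probability.Probability"
begin

definition bounded_ratio :: "(nat \<Rightarrow> real) \<Rightarrow> (nat \<Rightarrow> real) \<Rightarrow> bool" (infix "\<simeq>" 50) where
  "a \<simeq> b \<longleftrightarrow>
    (\<exists>c C. 0 < c \<and> (\<forall>\<^sub>F n in sequentially. c \<le> a n / b n \<and> a n / b n \<le> C))"


definition L2_fun :: "(real \<Rightarrow> real) set" where
  "L2_fun = {g \<in> borel_measurable lborel. integrable lborel (\<lambda>x. (g x)\<^sup>2)}"

definition L2_inner :: "(real \<Rightarrow> real) \<Rightarrow> (real \<Rightarrow> real) \<Rightarrow> real" where
  "L2_inner g h = (LINT x|lborel. g x * h x)"

definition orthonormal_translates :: "(real \<Rightarrow> real) \<Rightarrow> bool" where
  "orthonormal_translates g \<longleftrightarrow> g \<in> L2_fun \<and>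
    (\<forall>k m :: int. L2_inner (\<lambda>x. g (x - of_int k)) (\<lambda>x. g (x - of_int m)) = (if k = m then 1 else 0))"

text \<open>All \<open>\<Sum>\<^sub>k c\<^sub>k g(\<cdot> - k)\<close> with square-summable \<open>c\<close>, the series converging in \<open>L\<^sup>2\<close>.\<close>

definition translate_space :: "(real \<Rightarrow> real) \<Rightarrow> (real \<Rightarrow> real) set" where
  "translate_space g = {h \<in> L2_fun. \<exists>c :: int \<Rightarrow> real.
     (\<lambda>k. (c k)\<^sup>2) summable_on UNIV \<and>
     ((\<lambda>S. LINT x|lborel. (h x - (\<Sum>k\<in>S. c k * g (x - of_int k)))\<^sup>2) \<longlongrightarrow> 0)
       (finite_subsets_at_top UNIV)}"

definition mra_space :: "(real \<Rightarrow> real) \<Rightarrow> nat \<Rightarrow> (real \<Rightarrow> real) set" where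
  "mra_space \<phi> j = {(\<lambda>x. h (2 ^ j * x)) | h. h \<in> translate_space \<phi>}"

definition scaling_function :: "(real \<Rightarrow> real) \<Rightarrow> bool" where
  "scaling_function \<phi> \<longleftrightarrow>
     orthonormal_translates \<phi> \<and>
     (\<forall>j. mra_space \<phi> j \<subseteq> mra_space \<phi> (Suc j)) \<and>
     (\<forall>g\<in>L2_fun. \<forall>\<epsilon>>0. \<exists>j. \<exists>h\<in>mra_space \<phi> j. (LINT x|lborel. (g x - h x)\<^sup>2) < \<epsilon>)"

text \<open>The translates of \<open>\<psi>\<close> form an orthonormal basis of the orthogonal complement of
  \<open>V\<^sub>0\<close> in \<open>V\<^sub>1\<close>. Such a \<open>\<psi>\<close> is only determined up to a unimodular periodic Fourier multiplier
  and need not be integrable; integrability is required so that the wavelet coefficients of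
  every bounded continuous function are defined.\<close>

definition associated_wavelet :: "(real \<Rightarrow> real) \<Rightarrow> (real \<Rightarrow> real) \<Rightarrow> bool" where
  "associated_wavelet \<phi> \<psi> \<longleftrightarrow>
     orthonormal_translates \<psi> \<and> integrable lborel \<psi> \<and>
     translate_space \<psi> = {g \<in> mra_space \<phi> 1. \<forall>h\<in>mra_space \<phi> 0. L2_inner g h = 0}"

definition test_function :: "(real \<Rightarrow> real) \<Rightarrow> bool" where
  "test_function \<eta> \<longleftrightarrow>
     (\<forall>m x. (deriv ^^ m) \<eta> differentiable (at x)) \<and> (\<exists>R. \<forall>x. R < \<bar>x\<bar> \<longrightarrow> \<eta> x = 0)"

definition locally_integrable :: "(real \<Rightarrow> real) \<Rightarrow> bool" where
  "locally_integrable g \<longleftrightarrow> (\<forall>a b. set_integrable lborel {a..b} g)"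

definition weak_derivative :: "nat \<Rightarrow> (real \<Rightarrow> real) \<Rightarrow> (real \<Rightarrow> real) \<Rightarrow> bool" where
  "weak_derivative i g g' \<longleftrightarrow> locally_integrable g \<and> locally_integrable g' \<and>
     (\<forall>\<eta>. test_function \<eta> \<longrightarrow>
        (LINT x|lborel. g x * (deriv ^^ i) \<eta> x) = (- 1) ^ i * (LINT x|lborel. g' x * \<eta> x))"

definition exponentially_decaying :: "(real \<Rightarrow> real) \<Rightarrow> bool" where
  "exponentially_decaying g \<longleftrightarrow>
     (\<exists>C c. 0 < c \<and> (AE x in lborel. \<bar>g x\<bar> \<le> C * exp (- c * \<bar>x\<bar>)))"

definition s_regular :: "nat \<Rightarrow> (real \<Rightarrow> real) \<Rightarrow> bool" where
  "s_regular s \<phi> \<longleftrightarrow> (\<forall>i\<le>s. \<exists>g. weak_derivative i \<phi> g \<and> exponentially_decaying g)"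


definition scaling_coeff :: "(real \<Rightarrow> real) \<Rightarrow> (real \<Rightarrow> real) \<Rightarrow> int \<Rightarrow> real" where
  "scaling_coeff \<phi> f k = (LINT x|lborel. f x * \<phi> (x - of_int k))"

definition wavelet_coeff :: "(real \<Rightarrow> real) \<Rightarrow> (real \<Rightarrow> real) \<Rightarrow> nat \<Rightarrow> int \<Rightarrow> real" where
  "wavelet_coeff \<psi> f l k = (LINT x|lborel. f x * (2 powr (real l / 2) * \<psi> (2 ^ l * x - of_int k)))"

definition wavelet_norm ::
  "(real \<Rightarrow> real) \<Rightarrow> (real \<Rightarrow> real) \<Rightarrow> real \<Rightarrow> (real \<Rightarrow> real) \<Rightarrow> ereal" where
  "wavelet_norm \<phi> \<psi> \<alpha> f =
     (SUP k. ereal \<bar>scaling_coeff \<phi> f k\<bar>) +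
     (SUP l. SUP k. ereal (2 powr (real l * (\<alpha> + 1 / 2)) * \<bar>wavelet_coeff \<psi> f l k\<bar>))"

text \<open>The norm is a norm on bounded continuous functions only, hence the first two conditions.\<close>

definition density_class ::
  "(real \<Rightarrow> real) \<Rightarrow> (real \<Rightarrow> real) \<Rightarrow> real \<Rightarrow> real \<Rightarrow> real \<Rightarrow> real set \<Rightarrow> (real \<Rightarrow> real) set" where
  "density_class \<phi> \<psi> \<alpha> D \<delta> F = {f.
     continuous_on UNIV f \<and> bounded (range f) \<and>
     has_bochner_integral lborel f 1 \<and> (\<forall>x. 0 \<le> f x) \<and> (\<forall>x\<in>F. \<delta> \<le> f x) \<and>
     wavelet_norm \<phi> \<psi> \<alpha> f \<le> ereal D}"


text \<open>The law of an i.i.d. sequence with density \<open>f\<close>; the observation \<open>X\<^sub>i\<close> is the \<open>i\<close>-th coordinate.\<close>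

definition iid_law :: "(real \<Rightarrow> real) \<Rightarrow> (nat \<Rightarrow> real) measure" where
  "iid_law f = (\<Pi>\<^sub>M i\<in>UNIV. density lborel (\<lambda>x. ennreal (f x)))"

definition haar_kernel :: "real \<Rightarrow> real \<Rightarrow> real" where
  "haar_kernel x y =
     (\<Sum>\<^sub>\<infinity>k\<in>(UNIV :: int set). indicat_real {0..<1} (x - of_int k) * indicat_real {0..<1} (y - of_int k))"

definition haar_estimator :: "nat \<Rightarrow> real \<Rightarrow> nat \<Rightarrow> (nat \<Rightarrow> real) \<Rightarrow> real" where
  "haar_estimator N y l X = 2 ^ l / real N * (\<Sum>i=1..N. haar_kernel (2 ^ l * y) (2 ^ l * X i))"

definition haar_deviation :: "(real \<Rightarrow> real) \<Rightarrow> nat \<Rightarrow> nat \<Rightarrow> (nat \<Rightarrow> real) \<Rightarrow> real" where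
  "haar_deviation f N l X = sqrt (real N / 2 ^ l) *
     (SUP y\<in>{0..1}. \<bar>(haar_estimator N y l X - (LINT Z|iid_law f. haar_estimator N y l Z)) / sqrt (f y)\<bar>)"

definition A_norm :: "nat \<Rightarrow> real" where
  "A_norm l = sqrt (2 * ln 2 * real l)"

definition B_norm :: "nat \<Rightarrow> real" where
  "B_norm l = A_norm l - (ln (real l) + ln (pi * ln 2)) / (2 * A_norm l)"

end

theory Submission
  imports Defs "HOL-Real_Asymp.Real_Asymp" "HOL-Computational_Algebra.Polynomial"
begin

text \<open>
  On a dyadic bin the Haar estimator is constant. Hence the event that the normalised deviation is
  at most \<open>u\<close> says that each of \<open>2 ^ l + 1\<close> bin counts differs from its mean by at most a threshold
  \<open>\<theta>\<close> (\<open>haar_deviation_le_iff\<close>; the last bin meets the unit interval in the point 1 only). The counts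
  are jointly multinomial. Read from left to right they form a Markov chain: if \<open>t\<close> observations
  have not been placed yet, the next count is binomial with parameters \<open>t\<close> and \<open>p / r\<close>, where \<open>p\<close>
  is the mass of the bin and \<open>r\<close> the mass that is left before it (\<open>occupancy_probability\<close>).

  The number of observations left, divided by the mass left, is a martingale. By a second-moment
  bound it stays within \<open>l * sqrt N\<close> of the sample size \<open>N\<close>, except with probability
  \<open>O(1 / l\<^sup>2)\<close>. While it does, every conditional probability of an exceedance is
  \<open>(1 + o(1)) * exp (- x) / 2 ^ l\<close>, and the product of the complementary probabilities tends to
  \<open>exp (- exp (- x))\<close>; \<open>occupancy_bounds\<close> turns this into inequalities. Since some mass of the
  density lies to the left of 0, the remaining mass \<open>r\<close> is bounded away from 0.

  The exceedance probability of one bin is a binomial tail at \<open>w\<close> standard deviations with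
  \<open>w \<approx> sqrt (2 * ln 2 * l)\<close>. The condition \<open>2 ^ l = O(N / (ln N) ^ 4)\<close> gives \<open>w ^ 3 = o(\<sigma>)\<close> for the
  standard deviation \<open>\<sigma>\<close> of the count, which is the range in which the tail has the Gaussian form
  \<open>exp (- w\<^sup>2 / 2) / (sqrt (2 * pi) * w)\<close>. Indeed Stirling's formula gives the probability of the
  single point at the threshold (\<open>binomial_local_limit\<close>), and from there on consecutive binomial
  probabilities decrease by a nearly constant factor, so that the tail is nearly a geometric series
  (\<open>ratio_sum_asymp\<close>, \<open>binomial_upper_tail\<close>, \<open>binomial_lower_tail\<close>).

  The statistic is normalised by the density at a point, whereas the variance of a count involves its
  average over a bin. Replacing one by the other is harmless once the modulus of continuity at scale
  \<open>1 / 2 ^ l\<close> is \<open>o(1 / l)\<close>, uniformly over the density class. This is derived from the bound on the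
  wavelet norm by duality (\<open>density_class_holder\<close>): the difference of two values of \<open>f\<close> is the limit of
  inner products of \<open>f\<close> with derivatives of smooth plateau functions; such an inner product
  telescopes over the levels of the multiresolution, and level \<open>j\<close> contributes at most the bound on
  the coefficients times the sum over \<open>k\<close> of the inner products of the test function with
  \<open>\<phi>(2 ^ j x - k)\<close>, which is small either trivially or by integration by parts.

  All limits are taken along arbitrary sequences of densities, bins and numbers of remaining
  observations. Choosing near-maximisers then gives uniformity.
\<close>

section \<open>Occupancy counts, one bin at a time\<close>

text \<open>
  Balls are offered to the bins from left to right. Of the \<open>t\<close> balls that arrive at the first bin
  each one stays with probability \<open>\<rho> 0\<close>, independently, and the others move on to the next bin.
  The value is the probability that for every \<open>k < K\<close> the number of balls that stay in bin \<open>k\<close>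
  lies in \<open>A k\<close>.
\<close>

primrec occupancy :: "nat \<Rightarrow> (nat \<Rightarrow> real) \<Rightarrow> (nat \<Rightarrow> nat set) \<Rightarrow> nat \<Rightarrow> real" where
  "occupancy 0 \<rho> A t = 1"
| "occupancy (Suc K) \<rho> A t =
     (\<Sum>m\<in>{..t} \<inter> A 0. Bernstein t m (\<rho> 0) * occupancy K (\<lambda>k. \<rho> (Suc k)) (\<lambda>k. A (Suc k)) (t - m))"

text \<open>
  If every bin accepted its count with conditional probability exactly \<open>1 - q\<close>, the answer would
  be \<open>(1 - q) ^ K\<close>. Here this is known, up to the two bounds, only while the number of balls that
  move on is good. The function \<open>b\<close> is a nonnegative supermartingale of the chain that is at least
  1 at every bad state, hence \<open>b 0 t\<close> bounds the probability of ever meeting a bad state. The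
  induction peels off the first bin, with the bounds 0 and 1 on the occupancy probability carried
  along for the bad states.
\<close>

lemma occupancy_bounds:
  fixes \<rho> :: "nat \<Rightarrow> real" and b :: "nat \<Rightarrow> nat \<Rightarrow> real"
  assumes "\<And>k. k < K \<Longrightarrow> 0 \<le> \<rho> k \<and> \<rho> k \<le> 1"
    and "\<And>k t. k < K \<Longrightarrow> t \<le> n \<Longrightarrow> good k t \<Longrightarrow>
           1 - q1 \<le> (\<Sum>m\<in>{..t} \<inter> A k. Bernstein t m (\<rho> k)) \<and>
           (\<Sum>m\<in>{..t} \<inter> A k. Bernstein t m (\<rho> k)) \<le> 1 - q2"
    and "q1 \<le> 1" "0 \<le> q1" "0 \<le> q2" "q2 \<le> 1"
    and "\<And>k t. k \<le> K \<Longrightarrow> t \<le> n \<Longrightarrow> 0 \<le> b k t"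
    and "\<And>k t. k < K \<Longrightarrow> t \<le> n \<Longrightarrow> \<not> good k t \<Longrightarrow> 1 \<le> b k t"
    and "\<And>k t. k < K \<Longrightarrow> t \<le> n \<Longrightarrow> (\<Sum>m\<le>t. Bernstein t m (\<rho> k) * b (Suc k) (t - m)) \<le> b k t"
    and "t \<le> n"
  shows "(1 - q1) ^ K - b 0 t \<le> occupancy K \<rho> A t"
    and "occupancy K \<rho> A t \<le> (1 - q2) ^ K + b 0 t"
proof -
  have "((1 - q1) ^ K - b 0 t \<le> occupancy K \<rho> A t \<and> occupancy K \<rho> A t \<le> (1 - q2) ^ K + b 0 t)
     \<and> 0 \<le> occupancy K \<rho> A t \<and> occupancy K \<rho> A t \<le> 1"
    using assms
  proof (induction K arbitrary: \<rho> A b good t)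
    case 0
    then show ?case by (auto simp: not_le)
  next
    case (Suc K)
    let ?B = "\<lambda>m. Bernstein t m (\<rho> 0)"
    let ?o = "\<lambda>m. occupancy K (\<lambda>k. \<rho> (Suc k)) (\<lambda>k. A (Suc k)) (t - m)"
    have IH: "(1 - q1) ^ K - b 1 (t - m) \<le> ?o m \<and> ?o m \<le> (1 - q2) ^ K + b 1 (t - m) \<and> 0 \<le> ?o m
        \<and> ?o m \<le> 1" for m
    proof -
      have "((1 - q1) ^ K - b (Suc 0) (t - m) \<le> ?o m \<and> ?o m \<le> (1 - q2) ^ K + b (Suc 0) (t - m)) \<and> 0
          \<le> ?o m \<and> ?o m \<le> 1"
        by (rule Suc.IH[where good = "\<lambda>k. good (Suc k)" and b = "\<lambda>k. b (Suc k)"]) (use Suc.prems in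
            auto)
      then show ?thesis by simp
    qed
    have lo: "(1 - q1) ^ K - b 1 (t - m) \<le> ?o m" and hi: "?o m \<le> (1 - q2) ^ K + b 1 (t - m)"
      and o0: "0 \<le> ?o m" and o1: "?o m \<le> 1" for m
      using IH[of m] by simp_all
    have B0: "0 \<le> ?B m" for m
      using Suc.prems(1)[of 0] by (simp add: Bernstein_nonneg)
    have sub: "(\<Sum>m\<in>{..t} \<inter> A 0. ?B m * g m) \<le> (\<Sum>m\<le>t. ?B m * g m)" if "\<And>m. m \<le> t \<Longrightarrow> 0 \<le> g m" for g
      using that B0 by (intro sum_mono2) auto
    have nn: "0 \<le> occupancy (Suc K) \<rho> A t"
      unfolding occupancy.simps by (intro sum_nonneg mult_nonneg_nonneg o0 B0)
    have "occupancy (Suc K) \<rho> A t \<le> (\<Sum>m\<in>{..t} \<inter> A 0. ?B m * 1)"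
      unfolding occupancy.simps by (intro sum_mono mult_left_mono o1 B0)
    also have "\<dots> \<le> (\<Sum>m\<le>t. ?B m * 1)" by (rule sub) simp
    finally have le1: "occupancy (Suc K) \<rho> A t \<le> 1" by simp
    have b1: "0 \<le> b 1 (t - m)" for m using Suc.prems(7)[of 1] Suc.prems(10) by auto
    have bm: "(\<Sum>m\<in>{..t} \<inter> A 0. ?B m * b 1 (t - m)) \<le> b 0 t"
      using sub[of "\<lambda>m. b 1 (t - m)"] b1 Suc.prems(9)[of 0 t] Suc.prems(10) by fastforce
    have *: "(1 - q1) ^ Suc K - b 0 t \<le> occupancy (Suc K) \<rho> A t \<and> occupancy (Suc K) \<rho> A t
        \<le> (1 - q2) ^ Suc K + b 0 t"
    proof (cases "good 0 t")
      case False
      then have "1 \<le> b 0 t" using Suc.prems(8)[of 0 t] Suc.prems(10) by auto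
      moreover have "(1 - q1) ^ Suc K \<le> 1" "0 \<le> (1 - q2) ^ Suc K"
        using Suc.prems(3-6) by (intro power_le_one zero_le_power; simp)+
      ultimately show ?thesis using nn le1 by linarith
    next
      case True
      let ?S = "\<Sum>m\<in>{..t} \<inter> A 0. ?B m"
      have S: "1 - q1 \<le> ?S" "?S \<le> 1 - q2" using Suc.prems(2)[of 0 t] True Suc.prems(10) by auto
      have "(1 - q1) ^ Suc K - b 0 t \<le> ?S * (1 - q1) ^ K - (\<Sum>m\<in>{..t} \<inter> A 0. ?B m * b 1 (t - m))"
        using bm mult_right_mono[OF S(1), of "(1 - q1) ^ K"] Suc.prems(3) by simp
      also have "\<dots> = (\<Sum>m\<in>{..t} \<inter> A 0. ?B m * ((1 - q1) ^ K - b 1 (t - m)))"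
        by (simp add: sum_distrib_right right_diff_distrib sum_subtractf)
      also have "\<dots> \<le> occupancy (Suc K) \<rho> A t"
        unfolding occupancy.simps by (intro sum_mono mult_left_mono lo B0)
      finally have 1: "(1 - q1) ^ Suc K - b 0 t \<le> occupancy (Suc K) \<rho> A t" .
      have "occupancy (Suc K) \<rho> A t \<le> (\<Sum>m\<in>{..t} \<inter> A 0. ?B m * ((1 - q2) ^ K + b 1 (t - m)))"
        unfolding occupancy.simps by (intro sum_mono mult_left_mono hi B0)
      also have "\<dots> = ?S * (1 - q2) ^ K + (\<Sum>m\<in>{..t} \<inter> A 0. ?B m * b 1 (t - m))"
        by (simp add: sum_distrib_right distrib_left sum.distrib)
      also have "\<dots> \<le> (1 - q2) ^ Suc K + b 0 t"
        using bm mult_right_mono[OF S(2), of "(1 - q2) ^ K"] Suc.prems(6) by simp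
      finally show ?thesis using 1 by simp
    qed
    show ?case using nn le1 * by simp
  qed
  then show "(1 - q1) ^ K - b 0 t \<le> occupancy K \<rho> A t" "occupancy K \<rho> A t \<le> (1 - q2) ^ K + b 0 t"
    by auto
qed

lemma prod_cylinder_measure:
  fixes \<nu> :: "real measure"
  assumes "prob_space \<nu>" "finite U" "\<And>i. i \<in> U \<Longrightarrow> G i \<in> sets \<nu>"
  shows "{X \<in> space (PiM UNIV (\<lambda>_::nat. \<nu>)). \<forall>i\<in>U. X i \<in> G i} \<in> sets (PiM UNIV (\<lambda>_::nat. \<nu>))"
    and "measure (PiM UNIV (\<lambda>_::nat. \<nu>)) {X \<in> space (PiM UNIV (\<lambda>_::nat. \<nu>)). \<forall>i\<in>U. X i \<in> G i}
        = (\<Prod>i\<in>U. measure \<nu> (G i))"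
proof -
  interpret P: product_prob_space "\<lambda>_::nat. \<nu>" UNIV
    using assms(1) by (simp add: product_prob_spaceI)
  let ?C = "{X \<in> space (PiM UNIV (\<lambda>_::nat. \<nu>)). \<forall>i\<in>U. X i \<in> G i}"
  have eq: "?C = prod_emb UNIV (\<lambda>_::nat. \<nu>) U (Pi\<^sub>E U G)"
    by (auto simp: prod_emb_def space_PiM PiE_iff)
  show "?C \<in> sets (PiM UNIV (\<lambda>_::nat. \<nu>))"
    unfolding eq using assms by (intro sets_PiM_I) auto
  show "measure (PiM UNIV (\<lambda>_::nat. \<nu>)) ?C = (\<Prod>i\<in>U. measure \<nu> (G i))"
    unfolding eq using assms by (intro P.measure_PiM_emb) auto
qed

text \<open>
  Condition on the set \<open>S\<close> of those observations that fall into the first bin. The others lie in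
  \<open>R - B 0\<close>, and one bin fewer is left. The cylinder over \<open>U\<close> carries the observations that are
  already assigned to bins, which is what makes the statement inductive. Summing over all \<open>S\<close> of
  size \<open>m\<close> yields the binomial weight with success probability \<open>p / r\<close>. The strict inequality for
  the total mass keeps all these quotients away from a zero denominator.
\<close>

lemma occupancy_probability_cylinder:
  fixes \<nu> :: "real measure" and B :: "nat \<Rightarrow> real set"
  defines "P \<equiv> PiM UNIV (\<lambda>_::nat. \<nu>)"
  assumes \<nu>: "prob_space \<nu>" and "finite U" "finite T" "U \<inter> T = {}" "\<And>i. i \<in> U \<Longrightarrow> G i \<in> sets \<nu>"
    and "R \<in> sets \<nu>" "\<And>k. k < K \<Longrightarrow> B k \<in> sets \<nu> \<and> B k \<subseteq> R"
    and "disjoint_family_on B {..<K}"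
    and "(\<Sum>k<K. measure \<nu> (B k)) < measure \<nu> R"
  shows "{X \<in> space P. (\<forall>i\<in>U. X i \<in> G i) \<and> (\<forall>i\<in>T. X i \<in> R) \<and>
            (\<forall>k<K. card {i\<in>T. X i \<in> B k} \<in> A k)} \<in> sets P \<and>
     measure P {X \<in> space P. (\<forall>i\<in>U. X i \<in> G i) \<and> (\<forall>i\<in>T. X i \<in> R) \<and>
            (\<forall>k<K. card {i\<in>T. X i \<in> B k} \<in> A k)} =
     (\<Prod>i\<in>U. measure \<nu> (G i)) * measure \<nu> R ^ card T *
     occupancy K (\<lambda>k. measure \<nu> (B k) / (measure \<nu> R - (\<Sum>j<k. measure \<nu> (B j)))) A (card T)"
  using assms(3-)
proof (induction K arbitrary: B A U T G R)
  case 0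
  have eq: "{X \<in> space P. (\<forall>i\<in>U. X i \<in> G i) \<and> (\<forall>i\<in>T. X i \<in> R)} =
     {X \<in> space P. (\<forall>i\<in>U \<union> T. X i \<in> (if i \<in> U then G i else R))}"
    using 0(3) by (auto split: if_splits)
  have "(\<Prod>i\<in>U \<union> T. measure \<nu> (if i \<in> U then G i else R)) =
      (\<Prod>i\<in>U. measure \<nu> (G i)) * (\<Prod>i\<in>T. measure \<nu> R)"
    unfolding prod.union_disjoint[OF 0(1-3)] using 0(3)
    by (intro arg_cong2[where f="(*)"] prod.cong) auto
  then have prod: "(\<Prod>i\<in>U \<union> T. measure \<nu> (if i \<in> U then G i else R)) =
      (\<Prod>i\<in>U. measure \<nu> (G i)) * measure \<nu> R ^ card T" by simp
  have *: "\<And>i. i \<in> U \<union> T \<Longrightarrow> (if i \<in> U then G i else R) \<in> sets \<nu>" using 0 by auto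
  note cyl = prod_cylinder_measure[OF \<nu>, of "U \<union> T" "\<lambda>i. if i \<in> U then G i else R",
      OF _ *, folded P_def, folded eq, unfolded prod]
  show ?case
    using cyl 0(1,2) by (simp only: eq finite_Un not_less_zero simp_thms occupancy.simps
        mult_1_right)
next
  case (Suc K)
  interpret nu: prob_space \<nu> by (rule \<nu>)
  interpret P: prob_space P unfolding P_def by (intro prob_space_PiM \<nu>)
  define p where "p = measure \<nu> (B 0)"
  define r where "r = measure \<nu> R"
  define R' where "R' = R - B 0"
  define G' where "G' S i = (if i \<in> S then B 0 else G i)" for S i
  have B0: "B 0 \<in> sets \<nu>" "B 0 \<subseteq> R" using Suc.prems(6)[of 0] by auto
  have rp: "measure \<nu> R' = r - p"
    unfolding R'_def r_def p_def using B0 Suc.prems by (intro nu.finite_measure_Diff) auto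
  have sumB: "(\<Sum>k<Suc K. measure \<nu> (B k)) = p + (\<Sum>k<K. measure \<nu> (B (Suc k)))"
    unfolding p_def by (rule sum.lessThan_Suc_shift)
  have p0: "0 \<le> p" "0 \<le> (\<Sum>k<K. measure \<nu> (B (Suc k)))" unfolding p_def by (auto intro: sum_nonneg)
  have r0: "0 < r" using Suc.prems(8) sumB p0 unfolding r_def by linarith
  let ?E = "\<lambda>S. {X \<in> space P. (\<forall>i\<in>U \<union> S. X i \<in> G' S i) \<and> (\<forall>i\<in>T - S. X i \<in> R') \<and>
            (\<forall>k<K. card {i\<in>T - S. X i \<in> B (Suc k)} \<in> A (Suc k))}"
  let ?F = "{S. S \<subseteq> T \<and> card S \<in> A 0}"
  let ?occ = "\<lambda>t. occupancy K (\<lambda>k. measure \<nu> (B (Suc k)) / (r - (\<Sum>j<Suc k. measure \<nu> (B j))))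
      (\<lambda>k. A (Suc k)) t"
  have finF: "finite ?F" using Suc.prems(2) by (auto intro: finite_subset[of _ "Pow T"])
  have disB: "B (Suc k) \<inter> B 0 = {}" if "k < K" for k
    using Suc.prems(7) that by (force simp: disjoint_family_on_def)
  have E: "?E S \<in> sets P \<and> measure P (?E S) = (\<Prod>i\<in>U. measure \<nu> (G i)) * p ^ card S * (r - p) ^
      (card T - card S) * ?occ (card T - card S)"
    if "S \<in> ?F" for S
  proof -
    have fS: "finite S" "S \<subseteq> T" using that Suc.prems(2) by (auto intro: finite_subset)
    have "?E S \<in> sets P \<and> measure P (?E S) = (\<Prod>i\<in>U \<union> S. measure \<nu> (G' S i)) * measure \<nu> R' ^ card (T
        - S) *
        occupancy K (\<lambda>k. measure \<nu> (B (Suc k)) / (measure \<nu> R' - (\<Sum>j<k. measure \<nu> (B (Suc j)))))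
            (\<lambda>k. A (Suc k)) (card (T - S))"
    proof (rule Suc.IH)
      show "finite (U \<union> S)" "finite (T - S)" "(U \<union> S) \<inter> (T - S) = {}" using Suc.prems fS by auto
      show "\<And>i. i \<in> U \<union> S \<Longrightarrow> G' S i \<in> sets \<nu>" using Suc.prems(4) B0 by (auto simp: G'_def)
      show "R' \<in> sets \<nu>" using B0 Suc.prems(5) by (auto simp: R'_def)
      show "\<And>k. k < K \<Longrightarrow> B (Suc k) \<in> sets \<nu> \<and> B (Suc k) \<subseteq> R'"
        using Suc.prems(6) disB by (force simp: R'_def)
      show "disjoint_family_on (\<lambda>k. B (Suc k)) {..<K}" using Suc.prems(7)
          by (auto simp: disjoint_family_on_def)
      show "(\<Sum>k<K. measure \<nu> (B (Suc k))) < measure \<nu> R'" using Suc.prems(8) unfolding rp sumB r_def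
          by linarith
    qed
    moreover have "(\<Prod>i\<in>U \<union> S. measure \<nu> (G' S i)) = (\<Prod>i\<in>U. measure \<nu> (G i)) * p ^ card S"
    proof -
      have "(\<Prod>i\<in>U. measure \<nu> (G' S i)) = (\<Prod>i\<in>U. measure \<nu> (G i))"
        using Suc.prems(3) fS by (intro prod.cong) (auto simp: G'_def)
      moreover have "(\<Prod>i\<in>S. measure \<nu> (G' S i)) = p ^ card S"
        by (simp add: G'_def p_def)
      ultimately show ?thesis using Suc.prems fS by (subst prod.union_disjoint) auto
    qed
    moreover have "card (T - S) = card T - card S" using fS by (simp add: card_Diff_subset)
    moreover have "measure \<nu> R' - (\<Sum>j<k. measure \<nu> (B (Suc j))) = r - (\<Sum>j<Suc k. measure \<nu> (B j))"
        for k
      unfolding rp by (simp add: sum.lessThan_Suc_shift p_def del: sum.lessThan_Suc)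
    ultimately show ?thesis by (simp only: rp simp_thms)
  qed
  have eq: "{X \<in> space P. (\<forall>i\<in>U. X i \<in> G i) \<and> (\<forall>i\<in>T. X i \<in> R) \<and> (\<forall>k<Suc K. card {i\<in>T. X i \<in> B k} \<in> A
      k)} = (\<Union>S\<in>?F. ?E S)"
    (is "?L = _")
  proof (intro set_eqI iffI)
    fix X assume X: "X \<in> ?L"
    let ?S = "{i\<in>T. X i \<in> B 0}"
    have "X \<in> ?E ?S"
    proof -
      have "{i \<in> T - ?S. X i \<in> B (Suc k)} = {i\<in>T. X i \<in> B (Suc k)}" if "k < K" for k
          using disB[OF that] by auto
      then show ?thesis using X Suc.prems(3) by (auto simp: G'_def R'_def)
    qed
    moreover have "?S \<in> ?F" using X by auto
    ultimately show "X \<in> (\<Union>S\<in>?F. ?E S)" by blast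
  next
    fix X assume "X \<in> (\<Union>S\<in>?F. ?E S)"
    then obtain S where S: "S \<subseteq> T" "card S \<in> A 0" "X \<in> ?E S" by blast
    have SG: "X i \<in> G' S i" if "i \<in> U \<union> S" for i using S(3) that by blast
    have iS: "X i \<in> B 0" if "i \<in> S" for i using SG[of i] that by (auto simp: G'_def)
    have S0: "{i\<in>T. X i \<in> B 0} = S" using S(1,3) iS by (auto simp: R'_def)
    have Sk: "{i \<in> T - S. X i \<in> B (Suc k)} = {i\<in>T. X i \<in> B (Suc k)}" if "k < K" for k
        using disB[OF that] iS by auto
    have "card {i\<in>T. X i \<in> B k} \<in> A k" if "k < Suc K" for k
      using that S S0 Sk by (cases k) auto
    moreover have "\<forall>i\<in>U. X i \<in> G i"
    proof
      fix i assume "i \<in> U"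
      moreover from this have "i \<notin> S" using S(1) Suc.prems(3) by auto
      ultimately show "X i \<in> G i" using SG[of i] by (simp add: G'_def)
    qed
    moreover have "\<forall>i\<in>T. X i \<in> R"
    proof
      fix i assume "i \<in> T"
      then show "X i \<in> R" using S(3) iS[of i] B0(2) by (cases "i \<in> S") (auto simp: R'_def)
    qed
    ultimately show "X \<in> ?L" using S(3) by auto
  qed
  have ES: "(\<forall>i\<in>U \<union> S. X i \<in> G' S i) \<and> (\<forall>i\<in>T - S. X i \<in> R')" if "X \<in> ?E S" for X S
    using that by (elim CollectE conjE) (intro conjI)
  have S_eq: "{i\<in>T. X i \<in> B 0} = S" if X: "X \<in> ?E S" and S: "S \<subseteq> T" for X S
  proof -
    have "X i \<in> B 0" if "i \<in> S" for i
      using ES[OF X, THEN conjunct1, THEN bspec, of i] that by (simp add: G'_def)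
    moreover have "X i \<notin> B 0" if "i \<in> T" "i \<notin> S" for i
      using ES[OF X, THEN conjunct2, THEN bspec, of i] that by (simp add: R'_def)
    ultimately show ?thesis using S by blast
  qed
  have disE: "disjoint_family_on ?E ?F"
    unfolding disjoint_family_on_def
  proof (intro ballI impI equals0I)
    fix S S' X assume S: "S \<in> ?F" "S' \<in> ?F" "S \<noteq> S'" and XI: "X \<in> ?E S \<inter> ?E S'"
    note X = IntD1[OF XI] IntD2[OF XI]
    have "S \<subseteq> T" "S' \<subseteq> T" using S(1,2) by simp_all
    then show False using S_eq[OF X(1)] S_eq[OF X(2)] S(3) by simp
  qed
  have "measure P ?L = (\<Sum>S\<in>?F. measure P (?E S))"
    unfolding eq using E disE finF by (intro P.finite_measure_finite_Union) auto
  also have "\<dots> = (\<Sum>S\<in>?F. (\<Prod>i\<in>U. measure \<nu> (G i)) * (p ^ card S * (r - p) ^ (card T - card S)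
      * ?occ (card T - card S)))"
    using E by (intro sum.cong) (auto simp: mult.assoc)
  also have "\<dots> = (\<Prod>i\<in>U. measure \<nu> (G i)) * (\<Sum>S\<in>?F. p ^ card S * (r - p) ^ (card T - card S)
      * ?occ (card T - card S))"
    by (simp add: sum_distrib_left)
  also have "(\<Sum>S\<in>?F. p ^ card S * (r - p) ^ (card T - card S) * ?occ (card T - card S))
     = (\<Sum>m\<in>{..card T} \<inter> A 0. \<Sum>S\<in>{S. S \<subseteq> T \<and> card S = m}. p ^ m * (r - p) ^ (card T - m)
         * ?occ (card T - m))"
  proof -
    have "(\<Sum>S\<in>?F. p ^ card S * (r - p) ^ (card T - card S) * ?occ (card T - card S)) =
       (\<Sum>m\<in>{..card T} \<inter> A 0. \<Sum>S\<in>{S\<in>?F. card S = m}. p ^ card S * (r - p) ^ (card T - card S)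
           * ?occ (card T - card S))"
      using finF Suc.prems(2) by (intro sum.group[symmetric]) (auto intro: card_mono)
    also have "\<dots> = (\<Sum>m\<in>{..card T} \<inter> A 0. \<Sum>S\<in>{S. S \<subseteq> T \<and> card S = m}. p ^ m * (r - p) ^ (card T - m)
        * ?occ (card T - m))"
      by (intro sum.cong) auto
    finally show ?thesis .
  qed
  also have "\<dots> = (\<Sum>m\<in>{..card T} \<inter> A 0. (card T choose m) * (p ^ m * (r - p) ^ (card T - m)
      * ?occ (card T - m)))"
    using Suc.prems(2) by (simp add: n_subsets)
  also have "\<dots> = (\<Sum>m\<in>{..card T} \<inter> A 0. r ^ card T * (Bernstein (card T) m (p / r) * ?occ (card T
      - m)))"
  proof (intro sum.cong refl)
    fix m assume "m \<in> {..card T} \<inter> A 0"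
    then have "r ^ card T = r ^ m * r ^ (card T - m)" by (simp flip: power_add)
    moreover have "r ^ m * (p / r) ^ m = p ^ m" using r0 by (simp add: power_divide)
    moreover have "r ^ (card T - m) * (1 - p / r) ^ (card T - m) = (r - p) ^ (card T - m)"
      using r0 by (simp flip: power_mult_distrib add: field_simps)
    ultimately show "(card T choose m) * (p ^ m * (r - p) ^ (card T - m) * ?occ (card T - m)) =
        r ^ card T * (Bernstein (card T) m (p / r) * ?occ (card T - m))"
      unfolding Bernstein_def by (simp add: mult_ac)
  qed
  also have "\<dots> = r ^ card T * occupancy (Suc K) (\<lambda>k. measure \<nu> (B k) / (measure \<nu> R
      - (\<Sum>j<k. measure \<nu> (B j)))) A (card T)"
    by (simp add: sum_distrib_left p_def r_def)
  finally have "measure P ?L = (\<Prod>i\<in>U. measure \<nu> (G i)) * (r ^ card T *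
     occupancy (Suc K) (\<lambda>k. measure \<nu> (B k) / (measure \<nu> R - (\<Sum>j<k. measure \<nu> (B j)))) A
         (card T))" .
  moreover have "?L \<in> sets P" unfolding eq using E finF by (intro sets.finite_UN) auto
  ultimately show ?case unfolding r_def by (simp only: mult.assoc simp_thms)
qed

lemma occupancy_probability:
  fixes \<nu> :: "real measure" and B :: "nat \<Rightarrow> real set"
  assumes \<nu>: "prob_space \<nu>" and "\<And>k. k < K \<Longrightarrow> B k \<in> sets \<nu>"
    and "disjoint_family_on B {..<K}" and "(\<Sum>k<K. measure \<nu> (B k)) < 1" and "finite T"
  shows "measure (PiM UNIV (\<lambda>_::nat. \<nu>)) {X \<in> space (PiM UNIV (\<lambda>_::nat. \<nu>)). \<forall>k<K. card {i\<in>T. X i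
      \<in> B k} \<in> A k} =
     occupancy K (\<lambda>k. measure \<nu> (B k) / (1 - (\<Sum>j<k. measure \<nu> (B j)))) A (card T)"
proof -
  interpret nu: prob_space \<nu> by (rule \<nu>)
  have "X i \<in> space \<nu>" if "X \<in> space (PiM UNIV (\<lambda>_::nat. \<nu>))" for X i
    using that by (auto simp: space_PiM PiE_iff)
  then have eq: "{X \<in> space (PiM UNIV (\<lambda>_::nat. \<nu>)). \<forall>k<K. card {i\<in>T. X i \<in> B k} \<in> A k} =
     {X \<in> space (PiM UNIV (\<lambda>_::nat. \<nu>)). (\<forall>i\<in>{}. X i \<in> {}) \<and> (\<forall>i\<in>T. X i \<in> space \<nu>)
         \<and> (\<forall>k<K. card {i\<in>T. X i \<in> B k} \<in> A k)}"
    by auto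
  show ?thesis
    unfolding eq
    using occupancy_probability_cylinder[OF \<nu>, of "{}" T "\<lambda>_. {}" "space \<nu>" K B A] assms
        sets.sets_into_space
    by (auto simp: nu.prob_space)
qed

text \<open>
  The number of remaining balls divided by the remaining mass is a martingale: the mass is \<open>r\<close>
  before the bin and \<open>r * (1 - \<rho>)\<close> after it. Its second moment about any centre therefore grows
  exactly by the conditional variance.
\<close>

lemma Bernstein_square_step:
  assumes r: "r \<noteq> 0" and \<rho>: "\<rho> \<noteq> 1"
  shows "(\<Sum>m\<le>t. Bernstein t m \<rho> * (real (t - m) / (r * (1 - \<rho>)) - N)\<^sup>2) =
     (real t / r - N)\<^sup>2 + real t * \<rho> * (1 - \<rho>) / (r * (1 - \<rho>))\<^sup>2"
proof -
  define r' where "r' = r * (1 - \<rho>)"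
  have r': "r' \<noteq> 0" using r \<rho> by (simp add: r'_def)
  define c where "c = real t / r' - N"
  have m2: "(\<Sum>m\<le>t. (real m)\<^sup>2 * Bernstein t m \<rho>) = real t * (real t - 1) * \<rho>\<^sup>2 + real t * \<rho>"
  proof -
    have "(\<Sum>m\<le>t. (real m)\<^sup>2 * Bernstein t m \<rho>) = (\<Sum>m\<le>t. real m * (real m - 1) * Bernstein t m \<rho>
        + real m * Bernstein t m \<rho>)"
      by (intro sum.cong) (simp_all add: algebra_simps power2_eq_square)
    then show ?thesis by (simp add: sum.distrib)
  qed
  have "(\<Sum>m\<le>t. Bernstein t m \<rho> * (real (t - m) / r' - N)\<^sup>2) =
     (\<Sum>m\<le>t. c\<^sup>2 * Bernstein t m \<rho> - 2 * c / r' * (real m * Bernstein t m \<rho>) + 1 / r'\<^sup>2 * ((real m)\<^sup>2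
         * Bernstein t m \<rho>))"
  proof (intro sum.cong refl)
    fix m assume "m \<in> {..t}"
    then have e: "real (t - m) / r' - N = c - real m / r'"
        by (simp add: c_def of_nat_diff diff_divide_distrib)
    have sq: "(c - real m / r')\<^sup>2 = c\<^sup>2 - 2 * c / r' * real m + 1 / r'\<^sup>2 * (real m)\<^sup>2"
      by (simp add: power2_diff power_divide)
    show "Bernstein t m \<rho> * (real (t - m) / r' - N)\<^sup>2 = c\<^sup>2 * Bernstein t m \<rho> - 2 * c / r' * (real m
        * Bernstein t m \<rho>) + 1 / r'\<^sup>2 * ((real m)\<^sup>2 * Bernstein t m \<rho>)"
      unfolding e sq by (simp add: algebra_simps)
  qed
  also have "\<dots> = c\<^sup>2 - 2 * c / r' * (real t * \<rho>) + 1 / r'\<^sup>2 * (real t * (real t - 1) * \<rho>\<^sup>2 + real t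
      * \<rho>)"
    by (simp only: sum.distrib sum_subtractf sum_distrib_left[symmetric] m2 sum_k_Bernstein
        sum_Bernstein mult_1_right)
  also have "\<dots> = (c - real t * \<rho> / r')\<^sup>2 + real t * \<rho> * (1 - \<rho>) / r'\<^sup>2"
    using r' by (simp add: power2_diff power_divide power_mult_distrib) (simp add: field_simps
        power2_eq_square)
  also have "c - real t * \<rho> / r' = real t / r - N"
  proof -
    have "real t / r' - real t * \<rho> / r' = real t * (1 - \<rho>) / r'"
        by (simp add: diff_divide_distrib algebra_simps)
    also have "\<dots> = real t / r" using \<rho> by (simp add: r'_def)
    finally show ?thesis by (simp add: c_def)
  qed
  finally show ?thesis unfolding r'_def .
qed

section \<open>Stirling's formula\<close>

definition stirling :: "nat \<Rightarrow> real" where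
  "stirling n = sqrt (2 * pi * real n) * (real n powr real n) * exp (- real n)"

text \<open>
  The logarithms of the quotients have increments of order \<open>1 / n\<^sup>2\<close>, so they converge.
\<close>

lemma stirling_constant_exists:
  "\<exists>L>0. (\<lambda>n. fact n / (sqrt (real n) * (real n powr real n) * exp (- real n))) \<longlonglongrightarrow> L"
proof -
  define a where "a n = ln (fact n) - (real n + 1/2) * ln (real n) + real n" for n :: nat
  have diff: "a n - a (Suc n) = (real n + 1/2) * ln (1 + 1 / real n) - 1" if "n > 0" for n
  proof -
    have "ln (1 + 1 / real n) = ln (real n + 1) - ln (real n)"
    proof -
      have "1 + 1 / real n = (real n + 1) / real n" using that by (simp add: field_simps)
      then show ?thesis using that by (simp add: ln_div)
    qed
    then have e: "ln (real n + 1) = ln (real n) + ln (1 + 1 / real n)" by simp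
    have "a (Suc n) = ln ((real n + 1) * fact n) - (real n + 1 + 1/2) * ln (real n + 1) + (real n
        + 1)"
      by (simp add: a_def add_ac)
    also have "ln ((real n + 1) * fact n) = ln (real n + 1) + ln (fact n)"
      by (subst ln_mult) auto
    finally have aS: "a (Suc n) = ln (real n + 1) + ln (fact n) - (real n + 1 + 1/2) * ln (real n
        + 1) + (real n + 1)" .
    have "a n = ln (fact n) - (real n + 1/2) * ln (real n) + real n" by (simp add: a_def)
    then show ?thesis unfolding aS e by algebra
  qed
  have "(\<lambda>n. (real n + 1/2) * ln (1 + 1 / real n) - 1) \<in> O(\<lambda>n. 1 / real n ^ 2)"
    by real_asymp
  moreover have "\<forall>\<^sub>F n in sequentially. (real n + 1/2) * ln (1 + 1 / real n) - 1 = a n - a (Suc n)"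
    using eventually_gt_at_top[of 0] by eventually_elim (simp add: diff)
  ultimately have "(\<lambda>n. a n - a (Suc n)) \<in> O(\<lambda>n. 1 / real n ^ 2)"
    by (rule landau_o.big.in_cong[THEN iffD1, rotated])
  moreover have "summable (\<lambda>n. norm (1 / real n ^ 2))"
    using inverse_power_summable[of 2, where ?'a = real] by (simp add: field_simps)
  ultimately have "summable (\<lambda>n. a n - a (Suc n))"
    using summable_comparison_test_bigo[of "\<lambda>n. 1 / real n ^ 2" "\<lambda>n. a n - a (Suc n)"] by blast
  then have "convergent (\<lambda>n. \<Sum>i<n. a i - a (Suc i))"
    by (rule summable_iff_convergent[THEN iffD1])
  then have "convergent (\<lambda>n. a 0 - a n)" by (simp add: sum_lessThan_telescope')
  then obtain c where "(\<lambda>n. a 0 - a n) \<longlonglongrightarrow> c" by (auto simp: convergent_def)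
  then have "(\<lambda>n. a 0 - (a 0 - a n)) \<longlonglongrightarrow> a 0 - c" by (intro tendsto_intros)
  then have "(\<lambda>n. exp (a n)) \<longlonglongrightarrow> exp (a 0 - c)" by (intro tendsto_exp) simp
  moreover have "\<forall>\<^sub>F n in sequentially. exp (a n) = fact n / (sqrt (real n) * (real n powr real n)
      * exp (- real n))"
    using eventually_gt_at_top[of 0]
  proof eventually_elim
    case (elim n)
    have "a n = ln (fact n) - (ln (real n) / 2 + real n * ln (real n) + - real n)"
      unfolding a_def by algebra
    then have "exp (a n) = exp (ln (fact n)) / (exp (ln (real n) / 2) * exp (real n * ln (real n))
        * exp (- real n))"
      by (simp only: exp_diff exp_add)
    moreover have "exp (ln (real n) / 2) = sqrt (real n)"
      using elim by (simp add: ln_sqrt[symmetric])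
    moreover have "exp (real n * ln (real n)) = real n powr real n"
      using elim by (simp add: powr_def)
    ultimately show ?case by simp
  qed
  ultimately have "(\<lambda>n. fact n / (sqrt (real n) * (real n powr real n) * exp (- real n)))
      \<longlonglongrightarrow> exp (a 0 - c)"
    by (rule Lim_transform_eventually)
  then show ?thesis by (intro exI[of _ "exp (a 0 - c)"]) simp
qed

text \<open>
  The partial Wallis product is an inverse squared central binomial coefficient up to elementary
  factors; this is how the constant in Stirling's formula becomes accessible.
\<close>

lemma wallis_prod: "(\<Prod>k=1..n. (4*real k^2) / (4*real k^2 - 1)) = (4 ^ n * (fact n)\<^sup>2)\<^sup>2
    / ((fact (2 * n))\<^sup>2 * (2 * real n + 1))"
proof (induction n)
  case (Suc n)
  have 1: "4 * (real (Suc n))\<^sup>2 - 1 = (2 * real n + 1) * (2 * real n + 3)"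
    by (simp add: algebra_simps power2_eq_square)
  have 2: "fact (2 * Suc n) = (2 * real n + 2) * (2 * real n + 1) * fact (2 * n)"
    by (simp add: algebra_simps)
  have 3: "fact (Suc n) = (real n + 1) * fact n" by simp
  have nz: "2 * real n + 1 \<noteq> 0" "2 * real n + 3 \<noteq> 0" "real n + 1 \<noteq> 0" by linarith+
  have alg: "(4 ^ n * F\<^sup>2)\<^sup>2 / (G\<^sup>2 * c) * (4 * (h)\<^sup>2 / (c * d)) =
     (4 ^ Suc n * (h * F)\<^sup>2)\<^sup>2 / ((2 * h * c * G)\<^sup>2 * d)"
    if "c \<noteq> 0" "d \<noteq> 0" "h \<noteq> 0" for F G c d h :: real
    using that by (simp add: power_mult_distrib divide_simps) (simp add: algebra_simps
        power2_eq_square power4_eq_xxxx)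
  have "(\<Prod>k=1..Suc n. (4*real k^2) / (4*real k^2 - 1)) =
    (4 ^ n * (fact n)\<^sup>2)\<^sup>2 / ((fact (2 * n))\<^sup>2 * (2 * real n + 1)) * (4 * (real n + 1)\<^sup>2
        / ((2 * real n + 1) * (2 * real n + 3)))"
    using Suc 1 by (simp add: add_ac)
  also have "\<dots> = (4 ^ Suc n * ((real n + 1) * fact n)\<^sup>2)\<^sup>2 / ((2 * (real n + 1) * (2 * real n + 1)
      * fact (2 * n))\<^sup>2 * (2 * real n + 3))"
    by (rule alg[OF nz])
  finally show ?case unfolding 2 3 by (simp add: algebra_simps)
qed simp

text \<open>
  With \<open>q = 4 ^ n\<close>, \<open>P = n powr n\<close> and \<open>E = exp (- n)\<close>, where \<open>s\<close> and \<open>t\<close> are the quotients of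
  \<open>fact\<close> and \<open>sqrt n * P * E\<close> at \<open>n\<close> and \<open>2 * n\<close>: the powers and exponentials cancel in the Wallis
  product, and only \<open>s\<close> and \<open>t\<close> survive.
\<close>

lemma wallis_stirling_quotient: fixes q s n P E t :: real 
  assumes "q > 0" "P > 0" "E > 0" "n > 0" "t > 0"
  shows "(q*(s^2*(n*P^2*E^2)))^2 / ((t^2*(2*n*(q*P^2)^2*(E^2)^2))*(2*n+1))
      = s^4/t^2*(n/(2*(2*n+1)))"
proof -
  define W where "W = q * P^2 * E^2"
  have W: "W \<noteq> 0" using assms by (simp add: W_def)
  have 1: "(q*(s^2*(n*P^2*E^2)))^2 = (s^4 * n^2) * W^2" unfolding W_def by algebra
  have 2: "(t^2*(2*n*(q*P^2)^2*(E^2)^2))*(2*n+1) = (t^2 * (2 * n) * (2*n+1)) * W^2" unfolding W_def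
      by algebra
  have "(s^4 * n^2) * W^2 / ((t^2 * (2 * n) * (2*n+1)) * W^2) = (s^4 * n^2) / (t^2 * (2 * n)
      * (2*n+1))"
    using W by (intro mult_divide_mult_cancel_right) simp
  also have "\<dots> = s^4/t^2*(n/(2*(2*n+1)))" using assms by (simp add: power2_eq_square)
  finally show ?thesis unfolding 1 2 .
qed

text \<open>
  If the quotients tend to \<open>L\<close>, the Wallis product tends to \<open>L\<^sup>2 / 4\<close>, which must be \<open>pi / 2\<close>.
\<close>

lemma stirling_asymp: "(\<lambda>n. fact n / stirling n) \<longlonglongrightarrow> 1"
proof -
  define s where "s n = fact n / (sqrt (real n) * (real n powr real n) * exp (- real n))"
      for n :: nat
  obtain L where L: "L > 0" "s \<longlonglongrightarrow> L" using stirling_constant_exists by (auto simp: s_def[abs_def])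
  have fact_eq: "fact n = s n * (sqrt (real n) * (real n powr real n) * exp (- real n))" if "n > 0"
      for n
    using that by (simp add: s_def)
  have L2: "(\<lambda>n. s (2 * n)) \<longlonglongrightarrow> L"
    using L(2) by (rule filterlim_compose) (auto intro!: mult_nat_left_at_top)
  have W: "(\<lambda>n. (4 ^ n * (fact n)\<^sup>2)\<^sup>2 / ((fact (2 * n))\<^sup>2 * (2 * real n + 1))) \<longlonglongrightarrow> pi / 2"
    using wallis by (simp only: wallis_prod)
  have "(\<lambda>n. (s n) ^ 4 / (s (2 * n))\<^sup>2 * (real n / (2 * (2 * real n + 1)))) \<longlonglongrightarrow> L ^ 4 / L\<^sup>2 * (1/4)"
  proof -
    have "(\<lambda>n. real n / (2 * (2 * real n + 1))) \<longlonglongrightarrow> 1/4" by real_asymp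
    from tendsto_mult[OF tendsto_divide[OF tendsto_power[OF L(2)] tendsto_power[OF L2]] this]
    show ?thesis using L(1) by simp
  qed
  moreover have "\<forall>\<^sub>F n in sequentially. (s n) ^ 4 / (s (2 * n))\<^sup>2 * (real n / (2 * (2 * real n
      + 1))) =
     (4 ^ n * (fact n)\<^sup>2)\<^sup>2 / ((fact (2 * n))\<^sup>2 * (2 * real n + 1))"
    using eventually_gt_at_top[of 0]
  proof eventually_elim
    case (elim n)
    define P where "P = real n powr real n"
    define E where "E = exp (- real n)"
    have p2: "real (2 * n) powr real (2 * n) = 4 ^ n * P\<^sup>2"
    proof -
      have "real (2 * n) powr real (2 * n) = 2 powr real (2 * n) * real n powr (real (2 * n))"
        using elim by (simp add: powr_mult)
      also have "2 powr real (2 * n) = (4::real) ^ n"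
        by (subst powr_realpow) (simp_all add: power_mult)
      also have "real n powr (real (2 * n)) = P\<^sup>2"
        unfolding P_def power2_eq_square powr_add[symmetric] by simp
      finally show ?thesis by simp
    qed
    have e2: "exp (- real (2 * n)) = E\<^sup>2"
      unfolding E_def power2_eq_square exp_add[symmetric] by simp
    have pos: "P > 0" "E > 0" "s n > 0" "s (2 * n) > 0"
      using elim by (auto simp: P_def E_def s_def intro!: divide_pos_pos mult_pos_pos)
    have f1: "(fact n)\<^sup>2 = (s n)\<^sup>2 * (real n * P\<^sup>2 * E\<^sup>2)"
      using fact_eq[OF elim] by (simp add: P_def E_def power_mult_distrib)
    have f2: "(fact (2 * n))\<^sup>2 = (s (2 * n))\<^sup>2 * (2 * real n * (4 ^ n * P\<^sup>2)\<^sup>2 * (E\<^sup>2)\<^sup>2)"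
      using fact_eq[of "2 * n"] elim unfolding p2 e2 by (simp add: power_mult_distrib)
    have nz: "P > 0" "E > 0" "s (2 * n) > 0" "real n > 0" "(4::real) ^ n > 0" using pos elim by auto
    show ?case
      unfolding f1 f2 by (rule wallis_stirling_quotient[OF nz(5,1,2,4,3), symmetric])
  qed
  ultimately have "(\<lambda>n. (4 ^ n * (fact n)\<^sup>2)\<^sup>2 / ((fact (2 * n))\<^sup>2 * (2 * real n + 1)))
      \<longlonglongrightarrow> L ^ 4 / L\<^sup>2 * (1/4)"
    by (rule Lim_transform_eventually)
  then have "L ^ 4 / L\<^sup>2 * (1/4) = pi / 2" using W LIMSEQ_unique by blast
  then have "L\<^sup>2 = 2 * pi" using L(1) by (simp add: field_simps power4_eq_xxxx power2_eq_square)
  then have Leq: "L = sqrt (2 * pi)" using L(1) real_sqrt_unique[of L "2 * pi"] by simp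
  have "(\<lambda>n. s n / sqrt (2 * pi)) \<longlonglongrightarrow> sqrt (2 * pi) / sqrt (2 * pi)"
    by (intro tendsto_divide L(2)[unfolded Leq] tendsto_const) simp
  moreover have "s n / sqrt (2 * pi) = fact n / stirling n" for n
    unfolding s_def stirling_def real_sqrt_mult by (simp add: mult_ac)
  ultimately show ?thesis by simp
qed

section \<open>A local limit theorem for binomial probabilities\<close>

text \<open>
  The Poisson rate function in terms of the relative deviation \<open>x\<close> from the mean. The binomial
  exponent is a sum of two such terms, one for the successes and one for the failures.
\<close>

definition rel_entropy :: "real \<Rightarrow> real" where
  "rel_entropy x = (1 + x) * ln (1 + x) - x"

text \<open>
  The difference vanishes at 0 and has derivative \<open>ln (1 + x) - x\<close>, which is of order \<open>x\<^sup>2\<close>.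
\<close>

lemma rel_entropy_quadratic:
  assumes "\<bar>x\<bar> \<le> 1/2"
  shows "\<bar>rel_entropy x - x\<^sup>2 / 2\<bar> \<le> 2 * \<bar>x\<bar> ^ 3"
proof -
  define k where "k y = rel_entropy y - y\<^sup>2 / 2" for y
  have d: "(k has_field_derivative (ln (1 + y) - y)) (at y within {-\<bar>x\<bar>..\<bar>x\<bar>})" if "y \<in> {-\<bar>x\<bar>..\<bar>x\<bar>}"
      for y
  proof -
    have "1 + y > 0" using that assms by auto
    then show ?thesis
      unfolding k_def rel_entropy_def
      by (auto intro!: derivative_eq_intros)
  qed
  have "norm (k x - k 0) \<le> 2 * x\<^sup>2 * norm (x - 0)"
  proof (rule field_differentiable_bound[OF _ d])
    show "norm (ln (1 + y) - y) \<le> 2 * x\<^sup>2" if "y \<in> {-\<bar>x\<bar>..\<bar>x\<bar>}" for y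
    proof -
      have y: "\<bar>y\<bar> \<le> \<bar>x\<bar>" using that by auto
      have "\<bar>ln (1 + y) - y\<bar> \<le> 2 * y\<^sup>2" using y assms
          by (intro abs_ln_one_plus_x_minus_x_bound) auto
      also have "y\<^sup>2 \<le> x\<^sup>2" using y by (rule abs_le_square_iff[THEN iffD1])
      finally show ?thesis by simp
    qed
  qed auto
  moreover have "2 * x\<^sup>2 * norm (x - 0) = 2 * \<bar>x\<bar> ^ 3"
      by (simp add: power3_eq_cube power2_eq_square)
  ultimately show ?thesis by (simp add: k_def rel_entropy_def)
qed

lemma stirling_exp: "n > 0 \<Longrightarrow> stirling n = sqrt (2 * pi * real n) * exp (real n * ln (real n)
    - real n)"
  by (simp add: stirling_def powr_def exp_diff exp_minus field_simps)

text \<open>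
  This is exact. The linear terms of the two rate functions cancel because an excess \<open>d\<close> of
  successes is a deficit \<open>d\<close> of failures.
\<close>

lemma stirling_binomial:
  fixes t m :: nat and \<rho> :: real
  defines "\<mu> \<equiv> real t * \<rho>" and "\<nu> \<equiv> real t * (1 - \<rho>)" and "d \<equiv> real m - real t * \<rho>"
  assumes "0 < m" "m < t" "0 < \<rho>" "\<rho> < 1"
  shows "stirling t / (stirling m * stirling (t - m)) * (\<rho> ^ m * (1 - \<rho>) ^ (t - m)) =
    sqrt (real t / (2 * pi * real m * real (t - m))) * exp (- (\<mu> * rel_entropy (d / \<mu>) + \<nu>
        * rel_entropy (- d / \<nu>)))"
proof -
  have pos: "\<mu> > 0" "\<nu> > 0" "real t > 0" using assms by auto
  have tm: "real (t - m) = real t - real m" using assms by simp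
  define x where "x = d / \<mu>"
  define y where "y = - d / \<nu>"
  have mux: "\<mu> * x = d" and nuy: "\<nu> * y = - d" using pos by (simp_all add: x_def y_def)
  have mx: "real m = \<mu> * (1 + x)" using mux by (simp add: distrib_left d_def \<mu>_def)
  have my: "real t - real m = \<nu> * (1 + y)"
    unfolding distrib_left nuy by (simp add: d_def \<nu>_def right_diff_distrib)
  have "\<mu> * (1 + x) > 0" using mx assms by simp
  then have x1: "1 + x > 0" using pos by (simp add: zero_less_mult_iff)
  have "\<nu> * (1 + y) > 0" using my assms by linarith
  then have y1: "1 + y > 0" using pos by (simp add: zero_less_mult_iff)
  have lm: "ln (real m) = ln (real t) + ln \<rho> + ln (1 + x)"
    unfolding mx \<mu>_def using x1 pos assms by (simp add: ln_mult)
  have ltm: "ln (real t - real m) = ln (real t) + ln (1 - \<rho>) + ln (1 + y)"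
    unfolding my \<nu>_def using y1 pos assms by (simp add: ln_mult)
  have xy: "\<mu> * x + \<nu> * y = 0" using mux nuy by simp
  have alg: "(T * a - T) - (M * (a + b + c) - M) - ((T - M) * (a + e + f) - (T - M)) + M * b
      + (T - M) * e
      = - (M * c) - (T - M) * f" for T M a b c e f :: real
    by (simp add: algebra_simps)
  have "(real t * ln (real t) - real t) - (real m * ln (real m) - real m)
      - ((real t - real m) * ln (real t - real m) - (real t - real m)) + real m * ln \<rho> + (real t
          - real m) * ln (1 - \<rho>)
     = - (real m * ln (1 + x)) - (real t - real m) * ln (1 + y)"
    unfolding lm ltm by (rule alg)
  also have "\<dots> = - (\<mu> * (1 + x) * ln (1 + x)) - \<nu> * (1 + y) * ln (1 + y)"
    using mx my by simp
  also have "\<dots> = - (\<mu> * rel_entropy x + \<nu> * rel_entropy y)"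
    unfolding rel_entropy_def using xy by algebra
  finally have ex: "(real t * ln (real t) - real t) - (real m * ln (real m) - real m)
      - ((real t - real m) * ln (real t - real m) - (real t - real m)) + real m * ln \<rho> + (real t
          - real m) * ln (1 - \<rho>)
     = - (\<mu> * rel_entropy x + \<nu> * rel_entropy y)" .
  have pow_exp: "z ^ k = exp (real k * ln z)" if "0 < z" for z :: real and k
    using that by (simp only: exp_of_nat_mult exp_ln)
  have pw: "\<rho> ^ m = exp (real m * ln \<rho>)" "(1 - \<rho>) ^ (t - m) = exp ((real t - real m) * ln (1 - \<rho>))"
    using pow_exp[of \<rho> m] pow_exp[of "1 - \<rho>" "t - m"] assms(6,7) unfolding tm by auto
  have sq: "sqrt (2 * pi * real t) / (sqrt (2 * pi * real m) * sqrt (2 * pi * (real t - real m)))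
     = sqrt (real t / (2 * pi * real m * (real t - real m)))"
  proof -
    have "c * T / (c * M * (c * k)) = T / (c * M * k)" if "c > 0" for c T M k :: real
      using that by simp
    from this[of "2 * pi" "real t" "real m" "real t - real m"]
    have "2 * pi * real t / (2 * pi * real m * (2 * pi * (real t - real m)))
        = real t / (2 * pi * real m * (real t - real m))"
      by simp
    then show ?thesis by (simp only: real_sqrt_mult[symmetric] real_sqrt_divide[symmetric])
  qed
  have "stirling t / (stirling m * stirling (t - m)) * (\<rho> ^ m * (1 - \<rho>) ^ (t - m)) =
     (sqrt (2 * pi * real t) / (sqrt (2 * pi * real m) * sqrt (2 * pi * (real t - real m)))) *
     exp ((real t * ln (real t) - real t) - (real m * ln (real m) - real m)
      - ((real t - real m) * ln (real t - real m) - (real t - real m)) + real m * ln \<rho> + (real t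
          - real m) * ln (1 - \<rho>))"
  proof -
    have "s1 * exp A / (s2 * exp B * (s3 * exp C)) * (exp D * exp E) = s1 / (s2 * s3) * exp (A - B
        - C + D + E)"
      for s1 s2 s3 A B C D E :: real by (simp add: exp_add exp_diff mult_ac)
    then show ?thesis
      using assms(4,5) unfolding pw by (simp only: stirling_exp tm zero_less_diff less_trans[OF
          assms(4,5)])
  qed
  then show ?thesis unfolding ex sq by (simp add: tm x_def y_def)
qed

lemma fact_stirling_along:
  assumes "filterlim (\<lambda>n. real (k n)) at_top sequentially"
  shows "(\<lambda>n. fact (k n) / stirling (k n)) \<longlonglongrightarrow> 1"
proof -
  have "filterlim k at_top sequentially"
    unfolding filterlim_at_top
  proof
    fix Z
    have "\<forall>\<^sub>F n in sequentially. real Z \<le> real (k n)"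
      using assms unfolding filterlim_at_top by blast
    then show "\<forall>\<^sub>F n in sequentially. Z \<le> k n" by simp
  qed
  then show ?thesis by (rule filterlim_compose[OF stirling_asymp])
qed

text \<open>
  The successes contribute the Gaussian exponent \<open>d\<^sup>2 / (2 * \<mu>)\<close> with an error of order
  \<open>d ^ 3 / \<mu>\<^sup>2\<close>. The failures have the much larger mean \<open>\<nu>\<close> and contribute only \<open>O (\<rho> * d\<^sup>2 / \<mu>)\<close>.
\<close>

lemma binomial_local_limit:
  fixes t m :: "nat \<Rightarrow> nat" and \<rho> :: "nat \<Rightarrow> real"
  defines "\<mu> \<equiv> \<lambda>n. real (t n) * \<rho> n" and "d \<equiv> \<lambda>n. real (m n) - real (t n) * \<rho> n"
  assumes \<rho>: "\<And>n. 0 < \<rho> n" "\<rho> \<longlonglongrightarrow> 0"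
    and \<mu>: "filterlim \<mu> at_top sequentially"
    and d1: "(\<lambda>n. d n / \<mu> n) \<longlonglongrightarrow> 0" and d3: "(\<lambda>n. d n ^ 3 / \<mu> n ^ 2) \<longlonglongrightarrow> 0"
    and d2: "(\<lambda>n. \<rho> n * (d n)\<^sup>2 / \<mu> n) \<longlonglongrightarrow> 0"
  shows "(\<lambda>n. Bernstein (t n) (m n) (\<rho> n) * sqrt (2 * pi * \<mu> n) * exp ((d n)\<^sup>2 / (2 * \<mu> n))) \<longlonglongrightarrow> 1"
proof -
  define \<nu> where "\<nu> n = real (t n) * (1 - \<rho> n)" for n
  define x where "x n = d n / \<mu> n" for n
  define y where "y n = - d n / \<nu> n" for n
  have ev_mu: "\<forall>\<^sub>F n in sequentially. \<mu> n > 0" using \<mu>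
      by (rule filterlim_at_top_dense[THEN iffD1, rule_format])
  have ev_rho: "\<forall>\<^sub>F n in sequentially. \<rho> n < 1/2" using \<rho>(2) by (rule order_tendstoD) simp
  have x0: "x \<longlonglongrightarrow> 0" using d1 by (simp add: x_def[abs_def])
  have "(\<lambda>n. - x n * (\<rho> n / (1 - \<rho> n))) \<longlonglongrightarrow> - 0 * (0 / (1 - 0))"
    by (intro tendsto_intros x0 \<rho>) simp
  moreover have "\<forall>\<^sub>F n in sequentially. - x n * (\<rho> n / (1 - \<rho> n)) = y n"
    using ev_mu
  proof eventually_elim
    case (elim n)
    then show ?case using \<rho>(1)[of n] by (simp add: x_def y_def \<nu>_def \<mu>_def)
  qed
  ultimately have y0: "y \<longlonglongrightarrow> 0" by (simp add: Lim_transform_eventually)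
  have ev_x: "\<forall>\<^sub>F n in sequentially. \<bar>x n\<bar> < 1/2" using tendsto_rabs[OF x0]
      by (rule order_tendstoD) simp
  have ev_y: "\<forall>\<^sub>F n in sequentially. \<bar>y n\<bar> < 1/2" using tendsto_rabs[OF y0]
      by (rule order_tendstoD) simp
  have mx: "\<forall>\<^sub>F n in sequentially. real (m n) = \<mu> n * (1 + x n)"
    using ev_mu
  proof eventually_elim
    case (elim n)
    then have "\<mu> n * x n = d n" by (simp add: x_def)
    then show ?case unfolding distrib_left by (simp add: d_def \<mu>_def)
  qed
  have m_top: "filterlim (\<lambda>n. \<mu> n * (1 + x n)) at_top sequentially"
    by (rule filterlim_at_top_mult_tendsto_pos[OF tendsto_add[OF tendsto_const x0] _ \<mu>]) simp
  then have m_top': "filterlim (\<lambda>n. real (m n)) at_top sequentially"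
    by (rule filterlim_cong[THEN iffD1, rotated -1, OF _ refl refl]) (use mx in eventually_elim,
        simp)
  have ev_nu: "\<forall>\<^sub>F n in sequentially. \<nu> n \<ge> \<mu> n \<and> \<nu> n > 0"
    using ev_rho ev_mu
  proof eventually_elim
    case (elim n)
    have "\<nu> n \<ge> real (t n) * (1/2)" "\<mu> n \<le> real (t n) * (1/2)" unfolding \<nu>_def \<mu>_def using elim
        by (intro mult_left_mono; simp)+
    then show ?case using elim by linarith
  qed
  have nu_top: "filterlim \<nu> at_top sequentially"
    by (rule filterlim_at_top_mono[OF \<mu>]) (use ev_nu in eventually_elim, simp)
  have my: "\<forall>\<^sub>F n in sequentially. real (t n) - real (m n) = \<nu> n * (1 + y n)"
    using ev_nu
  proof eventually_elim
    case (elim n)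
    then have "\<nu> n * y n = - d n" by (simp add: y_def)
    then show ?case unfolding distrib_left by (simp add: d_def \<nu>_def right_diff_distrib)
  qed
  have tm_top: "filterlim (\<lambda>n. \<nu> n * (1 + y n)) at_top sequentially"
    by (rule filterlim_at_top_mult_tendsto_pos[OF tendsto_add[OF tendsto_const y0] _ nu_top]) simp
  have ev_range: "\<forall>\<^sub>F n in sequentially. 0 < m n \<and> m n < t n"
    using mx my ev_mu ev_nu ev_x ev_y
  proof eventually_elim
    case (elim n)
    have "0 < \<mu> n * (1 + x n)" "0 < \<nu> n * (1 + y n)" using elim by (auto intro!: mult_pos_pos)
    then show ?case using elim by linarith
  qed
  have tm_top': "filterlim (\<lambda>n. real (t n - m n)) at_top sequentially"
    using tm_top
    by (rule filterlim_cong[THEN iffD1, rotated -1, OF _ refl refl]) (use my ev_range in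
        eventually_elim, simp)
  have t_top: "filterlim (\<lambda>n. real (t n)) at_top sequentially"
    by (rule filterlim_at_top_mono[OF m_top']) (use ev_range in eventually_elim, simp)
  have F: "(\<lambda>n. (fact (t n) / stirling (t n)) / ((fact (m n) / stirling (m n)) * (fact (t n - m n)
      / stirling (t n - m n)))) \<longlonglongrightarrow> 1 / (1 * 1)"
    by (intro tendsto_intros fact_stirling_along t_top m_top' tm_top') simp
  have h1: "(\<lambda>n. \<mu> n * rel_entropy (x n) - (d n)\<^sup>2 / (2 * \<mu> n)) \<longlonglongrightarrow> 0"
  proof (rule Lim_null_comparison)
    show "\<forall>\<^sub>F n in sequentially. norm (\<mu> n * rel_entropy (x n) - (d n)\<^sup>2 / (2 * \<mu> n))
        \<le> 2 * \<bar>d n ^ 3 / \<mu> n ^ 2\<bar>"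
      using ev_mu ev_x
    proof eventually_elim
      case (elim n)
      have "\<mu> n * rel_entropy (x n) - (d n)\<^sup>2 / (2 * \<mu> n) = \<mu> n * (rel_entropy (x n) - (x n)\<^sup>2 / 2)"
        using elim by (simp add: x_def field_simps power2_eq_square)
      moreover have "\<mu> n * \<bar>rel_entropy (x n) - (x n)\<^sup>2 / 2\<bar> \<le> \<mu> n * (2 * \<bar>x n\<bar> ^ 3)"
        using elim by (intro mult_left_mono rel_entropy_quadratic) auto
      moreover have "\<mu> n * (2 * \<bar>x n\<bar> ^ 3) = 2 * \<bar>d n ^ 3 / \<mu> n ^ 2\<bar>"
        using elim by (simp add: x_def abs_mult power_abs field_simps power2_eq_square
            power3_eq_cube)
      ultimately show ?case using elim by (simp add: abs_mult)
    qed
    show "(\<lambda>n. 2 * \<bar>d n ^ 3 / \<mu> n ^ 2\<bar>) \<longlonglongrightarrow> 0"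
      using tendsto_mult_right_zero[OF tendsto_rabs_zero[OF d3]] by simp
  qed
  have h2: "(\<lambda>n. \<nu> n * rel_entropy (y n)) \<longlonglongrightarrow> 0"
  proof (rule Lim_null_comparison)
    show "\<forall>\<^sub>F n in sequentially. norm (\<nu> n * rel_entropy (y n)) \<le> 3 * (\<rho> n * (d n)\<^sup>2 / \<mu> n)"
      using ev_mu ev_y ev_nu ev_rho
    proof eventually_elim
      case (elim n)
      have "2 * \<bar>y n\<bar> ^ 3 \<le> (y n)\<^sup>2"
      proof -
        have "\<bar>y n\<bar> * (y n)\<^sup>2 \<le> 1/2 * (y n)\<^sup>2" using elim by (intro mult_right_mono) auto
        moreover have "\<bar>y n\<bar> ^ 3 = \<bar>y n\<bar> * (y n)\<^sup>2" by (simp add: power3_eq_cube power2_eq_square)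
        ultimately show ?thesis by simp
      qed
      then have "\<bar>rel_entropy (y n)\<bar> \<le> 3/2 * (y n)\<^sup>2"
        using rel_entropy_quadratic[of "y n"] elim by simp
      then have "\<nu> n * \<bar>rel_entropy (y n)\<bar> \<le> \<nu> n * (3/2 * (y n)\<^sup>2)"
        using elim by (intro mult_left_mono) auto
      also have "\<dots> = 3/2 * ((d n)\<^sup>2 / \<nu> n)" using elim by (simp add: y_def power2_eq_square)
      also have "(d n)\<^sup>2 / \<nu> n = (\<rho> n * (d n)\<^sup>2 / \<mu> n) * (1 / (1 - \<rho> n))"
        using elim \<rho>(1)[of n] by (simp add: \<mu>_def \<nu>_def)
      also have "(\<rho> n * (d n)\<^sup>2 / \<mu> n) * (1 / (1 - \<rho> n)) \<le> (\<rho> n * (d n)\<^sup>2 / \<mu> n) * 2"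
        using elim \<rho>(1)[of n] by (intro mult_left_mono) (auto simp: field_simps)
      finally show ?case using elim by (simp add: abs_mult)
    qed
    show "(\<lambda>n. 3 * (\<rho> n * (d n)\<^sup>2 / \<mu> n)) \<longlonglongrightarrow> 0"
      using tendsto_mult_right_zero[OF d2] by simp
  qed
  have E: "(\<lambda>n. exp (- ((\<mu> n * rel_entropy (x n) - (d n)\<^sup>2 / (2 * \<mu> n)) + \<nu> n * rel_entropy (y n))))
      \<longlonglongrightarrow> exp (- (0 + 0))"
    by (intro tendsto_intros h1 h2)
  have S: "(\<lambda>n. sqrt (1 / ((1 + x n) * ((1 - \<rho> n) * (1 + y n)))))
      \<longlonglongrightarrow> sqrt (1 / ((1 + 0) * ((1 - 0) * (1 + 0))))"
    by (intro tendsto_intros x0 y0 \<rho>) simp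
  have "(\<lambda>n. (fact (t n) / stirling (t n)) / ((fact (m n) / stirling (m n)) * (fact (t n - m n)
      / stirling (t n - m n)))
       * sqrt (1 / ((1 + x n) * ((1 - \<rho> n) * (1 + y n))))
       * exp (- ((\<mu> n * rel_entropy (x n) - (d n)\<^sup>2 / (2 * \<mu> n)) + \<nu> n * rel_entropy (y n)))) \<longlonglongrightarrow> 1"
    using tendsto_mult[OF tendsto_mult[OF F S] E] by simp
  moreover have "\<forall>\<^sub>F n in sequentially. (fact (t n) / stirling (t n))
      / ((fact (m n) / stirling (m n)) * (fact (t n - m n) / stirling (t n - m n)))
       * sqrt (1 / ((1 + x n) * ((1 - \<rho> n) * (1 + y n))))
       * exp (- ((\<mu> n * rel_entropy (x n) - (d n)\<^sup>2 / (2 * \<mu> n)) + \<nu> n * rel_entropy (y n)))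
      = Bernstein (t n) (m n) (\<rho> n) * sqrt (2 * pi * \<mu> n) * exp ((d n)\<^sup>2 / (2 * \<mu> n))"
    using ev_mu ev_nu ev_range mx my ev_rho
  proof eventually_elim
    case (elim n)
    have range: "0 < m n" "m n < t n" and "\<rho> n < 1" using elim by auto
    let ?F = "fact (t n) / (fact (m n) * fact (t n - m n)) :: real"
    let ?S = "stirling (t n) / (stirling (m n) * stirling (t n - m n))"
    have tm: "real (t n - m n) = real (t n) - real (m n)" using elim by simp
    have nz: "stirling (t n) > 0" "stirling (m n) > 0" "stirling (t n - m n) > 0"
      using elim by (simp_all add: stirling_exp)
    have "Bernstein (t n) (m n) (\<rho> n) = ?F * (\<rho> n ^ m n * (1 - \<rho> n) ^ (t n - m n))"
      using elim by (simp add: Bernstein_def binomial_fact)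
    also have "\<dots> = ?F / ?S * (?S * (\<rho> n ^ m n * (1 - \<rho> n) ^ (t n - m n)))"
      using nz by simp
    also have "?S * (\<rho> n ^ m n * (1 - \<rho> n) ^ (t n - m n)) =
       sqrt (real (t n) / (2 * pi * real (m n) * real (t n - m n))) * exp (- (\<mu> n * rel_entropy
           (x n) + \<nu> n * rel_entropy (y n)))"
      unfolding x_def y_def \<mu>_def \<nu>_def d_def
      by (rule stirling_binomial[OF range \<rho>(1) \<open>\<rho> n < 1\<close>])
    finally have B: "Bernstein (t n) (m n) (\<rho> n)
        = ?F / ?S * (sqrt (real (t n) / (2 * pi * real (m n) * real (t n - m n))) *
       exp (- (\<mu> n * rel_entropy (x n) + \<nu> n * rel_entropy (y n))))" .
    have sq: "sqrt (real (t n) / (2 * pi * real (m n) * real (t n - m n))) * sqrt (2 * pi * \<mu> n) =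
        sqrt (1 / ((1 + x n) * ((1 - \<rho> n) * (1 + y n))))"
    proof -
      have "real (t n) / (2 * pi * real (m n) * real (t n - m n)) * (2 * pi * \<mu> n)
         = real (t n) * \<mu> n / (real (m n) * real (t n - m n))" by simp
      also have "real (m n) * real (t n - m n) = (\<mu> n * (1 + x n)) * (real (t n) * (1 - \<rho> n)
          * (1 + y n))"
        unfolding tm using elim by (simp add: \<nu>_def)
      also have "real (t n) * \<mu> n / ((\<mu> n * (1 + x n)) * (real (t n) * (1 - \<rho> n) * (1 + y n)))
         = 1 / ((1 + x n) * ((1 - \<rho> n) * (1 + y n)))"
        using elim by simp
      finally show ?thesis by (simp only: real_sqrt_mult[symmetric])
    qed
    have ex: "exp (- (\<mu> n * rel_entropy (x n) + \<nu> n * rel_entropy (y n))) * exp ((d n)\<^sup>2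
        / (2 * \<mu> n)) =
       exp (- ((\<mu> n * rel_entropy (x n) - (d n)\<^sup>2 / (2 * \<mu> n)) + \<nu> n * rel_entropy (y n)))"
      by (simp flip: exp_add)
    have FS: "(fact (t n) / stirling (t n)) / ((fact (m n) / stirling (m n)) * (fact (t n - m n)
        / stirling (t n - m n))) = ?F / ?S"
      by simp
    have *: "a * (q * e) * s * g = a * (q * s) * (e * g)" for a q e s g :: real
      by (simp only: mult_ac)
    show ?case unfolding FS B * sq ex ..
  qed
  ultimately show ?thesis by (rule Lim_transform_eventually)
qed

section \<open>Moderate deviations of binomial tails\<close>

lemma ratio_sum_upper:
  fixes c s :: "nat \<Rightarrow> real"
  assumes c: "\<And>i. c (Suc i) = s i * c i" and "0 \<le> c 0" and s0: "\<And>i. 0 \<le> s i" "\<And>i. s i \<le> s 0"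
      and "s 0 < 1"
  shows "(\<Sum>i<n. c i) \<le> c 0 / (1 - s 0)"
proof -
  have le: "0 \<le> c i \<and> c i \<le> c 0 * s 0 ^ i" for i
  proof (induction i)
    case (Suc i)
    have "s i * c i \<le> s 0 * (c 0 * s 0 ^ i)" using Suc s0 by (intro mult_mono) auto
    then show ?case using Suc s0(1)[of i] by (simp add: c mult_ac)
  qed (use assms in auto)
  have "(\<Sum>i<n. c i) \<le> (\<Sum>i<n. c 0 * s 0 ^ i)" using le by (intro sum_mono) auto
  also have "\<dots> = c 0 * ((1 - s 0 ^ n) / (1 - s 0))"
    using \<open>s 0 < 1\<close> by (simp add: sum_distrib_left[symmetric] sum_gp_strict)
  also have "\<dots> \<le> c 0 * (1 / (1 - s 0))"
    using assms s0(1)[of 0] by (intro mult_left_mono divide_right_mono) auto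
  finally show ?thesis by simp
qed

lemma ratio_sum_lower:
  fixes c s :: "nat \<Rightarrow> real"
  assumes c: "\<And>i. c (Suc i) = s i * c i" and "0 \<le> c 0" and s0: "\<And>i. 0 \<le> s i" "\<And>i. i \<le> R \<Longrightarrow> s R \<le> s i"
      and "s R < 1"
    and "R \<le> n"
  shows "c 0 * ((1 - s R ^ R) / (1 - s R)) \<le> (\<Sum>i<n. c i)"
proof -
  have nn: "0 \<le> c i" for i by (induction i) (use assms in auto)
  have le: "c 0 * s R ^ i \<le> c i" if "i \<le> R" for i
    using that
  proof (induction i)
    case (Suc i)
    have "s R * (c 0 * s R ^ i) \<le> s i * c i" using Suc s0 assms(2) by (intro mult_mono) auto
    then show ?case by (simp add: c mult_ac)
  qed simp
  have "c 0 * ((1 - s R ^ R) / (1 - s R)) = (\<Sum>i<R. c 0 * s R ^ i)"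
    using \<open>s R < 1\<close> by (simp add: sum_distrib_left[symmetric] sum_gp_strict)
  also have "\<dots> \<le> (\<Sum>i<R. c i)" using le by (intro sum_mono) auto
  also have "\<dots> \<le> (\<Sum>i<n. c i)" using nn \<open>R \<le> n\<close> by (intro sum_mono2) auto
  finally show ?thesis .
qed

text \<open>
  The terms decrease by factors \<open>s n i\<close> that themselves decrease, so the sum lies between two
  geometric sums, one with the first factor and one with the factor at index \<open>R n\<close>, cut off at
  that index. Both factors are \<open>1 - (1 + o(1)) / \<kappa> n\<close>, and the cut-off is harmless since \<open>R n\<close> is
  large compared with \<open>\<kappa> n\<close>.
\<close>

lemma ratio_sum_asymp:
  fixes c s :: "nat \<Rightarrow> nat \<Rightarrow> real" and \<kappa> :: "nat \<Rightarrow> real" and R N :: "nat \<Rightarrow> nat"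
  assumes c: "\<forall>\<^sub>F n in sequentially. (\<forall>i. c n (Suc i) = s n i * c n i) \<and> 0 < c n 0 \<and>
      (\<forall>i. 0 \<le> s n i) \<and> (\<forall>i j. i \<le> j \<longrightarrow> s n j \<le> s n i) \<and> 0 < \<kappa> n \<and> R n \<le> N n"
    and s0: "(\<lambda>n. (1 - s n 0) * \<kappa> n) \<longlonglongrightarrow> 1" and sR: "(\<lambda>n. (1 - s n (R n)) * \<kappa> n) \<longlonglongrightarrow> 1"
    and RL: "filterlim (\<lambda>n. real (R n) / \<kappa> n) at_top sequentially"
  shows "(\<lambda>n. (\<Sum>i<N n. c n i) / (c n 0 * \<kappa> n)) \<longlonglongrightarrow> 1"
proof -
  have "filterlim (\<lambda>n. ((1 - s n (R n)) * \<kappa> n) * (real (R n) / \<kappa> n)) at_top sequentially"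
    by (rule filterlim_tendsto_pos_mult_at_top[OF sR _ RL]) simp
  then have "((\<lambda>n. exp (- (((1 - s n (R n)) * \<kappa> n) * (real (R n) / \<kappa> n)))) \<longlongrightarrow> 0) sequentially"
    by (intro filterlim_compose[OF exp_at_bot] filterlim_compose[OF filterlim_uminus_at_bot_at_top])
  then have "(\<lambda>n. exp (- ((1 - s n (R n)) * real (R n)))) \<longlonglongrightarrow> 0"
    by (rule Lim_transform_eventually) (use c in eventually_elim, simp)
  then have lowlim: "(\<lambda>n. (1 - exp (- ((1 - s n (R n)) * real (R n)))) / ((1 - s n (R n)) * \<kappa> n))
      \<longlonglongrightarrow> (1 - 0) / 1"
    by (intro tendsto_divide tendsto_diff tendsto_const sR) auto
  have uplim: "(\<lambda>n. 1 / ((1 - s n 0) * \<kappa> n)) \<longlonglongrightarrow> 1 / 1"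
    by (intro tendsto_divide tendsto_const s0) auto
  have pos0: "\<forall>\<^sub>F n in sequentially. 0 < (1 - s n 0) * \<kappa> n" using s0 by (rule order_tendstoD) simp
  have posR: "\<forall>\<^sub>F n in sequentially. 0 < (1 - s n (R n)) * \<kappa> n" using sR
      by (rule order_tendstoD) simp
  show ?thesis
  proof (rule tendsto_sandwich)
    show "\<forall>\<^sub>F n in sequentially. (\<Sum>i<N n. c n i) / (c n 0 * \<kappa> n) \<le> 1 / ((1 - s n 0) * \<kappa> n)"
      using c pos0
    proof eventually_elim
      case (elim n)
      then have "s n 0 < 1" by (simp add: zero_less_mult_iff)
      then have "(\<Sum>i<N n. c n i) \<le> c n 0 / (1 - s n 0)"
        using elim by (intro ratio_sum_upper) auto
      then have "(\<Sum>i<N n. c n i) / (c n 0 * \<kappa> n) \<le> (c n 0 / (1 - s n 0)) / (c n 0 * \<kappa> n)"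
        using elim by (intro divide_right_mono) auto
      also have "\<dots> = 1 / ((1 - s n 0) * \<kappa> n)" using elim by simp
      finally show ?case .
    qed
    show "\<forall>\<^sub>F n in sequentially. (1 - exp (- ((1 - s n (R n)) * real (R n)))) / ((1 - s n (R n))
        * \<kappa> n)
        \<le> (\<Sum>i<N n. c n i) / (c n 0 * \<kappa> n)"
      using c posR
    proof eventually_elim
      case (elim n)
      then have s1: "s n (R n) < 1" by (simp add: zero_less_mult_iff)
      have "s n (R n) \<le> exp (- (1 - s n (R n)))" using exp_ge_add_one_self[of "- (1 - s n (R n))"]
          by simp
      then have "s n (R n) ^ R n \<le> exp (- (1 - s n (R n))) ^ R n" using elim
          by (intro power_mono) auto
      also have "\<dots> = exp (- ((1 - s n (R n)) * real (R n)))" unfolding exp_of_nat_mult[symmetric]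
          by (simp add: algebra_simps)
      finally have sp: "s n (R n) ^ R n \<le> exp (- ((1 - s n (R n)) * real (R n)))" .
      have "(1 - exp (- ((1 - s n (R n)) * real (R n)))) / ((1 - s n (R n)) * \<kappa> n)
          \<le> (1 - s n (R n) ^ R n) / ((1 - s n (R n)) * \<kappa> n)"
        using sp elim by (intro divide_right_mono) auto
      also have "\<dots> = (c n 0 * ((1 - s n (R n) ^ R n) / (1 - s n (R n)))) / (c n 0 * \<kappa> n)"
        using elim s1 by simp
      also have "\<dots> \<le> (\<Sum>i<N n. c n i) / (c n 0 * \<kappa> n)"
        using elim s1 by (intro divide_right_mono ratio_sum_lower) auto
      finally show ?case .
    qed
  qed (use lowlim uplim in simp_all)
qed

lemma Bernstein_Suc:
  assumes "\<rho> < 1"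
  shows "Bernstein t (Suc k) \<rho> = real (t - k) * \<rho> / ((real k + 1) * (1 - \<rho>)) * Bernstein t k \<rho>"
proof (cases "k < t")
  case True
  then obtain j where j: "t = Suc (k + j)" using less_iff_Suc_add by auto
  have "(real k + 1) * real (t choose Suc k) = real (t - k) * real (t choose k)"
  proof -
    have "Suc k * (t choose Suc k) = t * ((t - 1) choose k)"
      unfolding j by (simp only: Suc_times_binomial diff_Suc_1)
    also have "\<dots> = (t - k) * (t choose k)" by (rule binomial_absorb_comp[symmetric])
    finally have "real (Suc k * (t choose Suc k)) = real ((t - k) * (t choose k))" by simp
    then show ?thesis by (simp only: of_nat_mult of_nat_Suc add.commute)
  qed
  then have ch: "real (t choose Suc k) = real (t - k) * real (t choose k) / (real k + 1)"
    by (simp add: field_simps add_nonneg_eq_0_iff)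
  have pw: "(1 - \<rho>) ^ (t - k) = (1 - \<rho>) * (1 - \<rho>) ^ (t - Suc k)" using j by simp
  show ?thesis unfolding Bernstein_def ch pw using assms by simp
next
  case False
  then show ?thesis by (simp add: Bernstein_def)
qed

text \<open>
  In this and the next lemmas \<open>v\<close> is a deviation in units of \<open>sqrt \<mu>\<close>, which is the standard
  deviation up to a factor \<open>sqrt (1 - \<rho>)\<close>. The standing assumptions say that the cubic error of
  the Gaussian exponent, \<open>v ^ 3 / sqrt \<mu>\<close>, and the effect \<open>\<rho> * v\<^sup>2\<close> of dropping that factor from
  the exponent are negligible.
\<close>

lemma moderate_scales:
  fixes v \<mu> \<rho> :: "nat \<Rightarrow> real"
  assumes v: "filterlim v at_top sequentially" and v3: "(\<lambda>n. v n ^ 3 / sqrt (\<mu> n)) \<longlonglongrightarrow> 0"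
    and rv: "(\<lambda>n. \<rho> n * (v n)\<^sup>2) \<longlonglongrightarrow> 0" and \<rho>: "\<And>n. 0 < \<rho> n" and \<mu>: "\<And>n. 0 < \<mu> n"
  shows "(\<lambda>n. 1 / sqrt (\<mu> n)) \<longlonglongrightarrow> 0" "(\<lambda>n. v n / sqrt (\<mu> n)) \<longlonglongrightarrow> 0" "(\<lambda>n. 1 / v n) \<longlonglongrightarrow> 0"
    "\<rho> \<longlonglongrightarrow> 0" "filterlim \<mu> at_top sequentially"
proof -
  have v1: "\<forall>\<^sub>F n in sequentially. 1 \<le> v n" using v unfolding filterlim_at_top by blast
  show q: "(\<lambda>n. 1 / sqrt (\<mu> n)) \<longlonglongrightarrow> 0"
  proof (rule Lim_null_comparison[OF _ v3])
    show "\<forall>\<^sub>F n in sequentially. norm (1 / sqrt (\<mu> n)) \<le> v n ^ 3 / sqrt (\<mu> n)"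
      using v1 by eventually_elim (use \<mu> in \<open>simp add: divide_right_mono less_imp_le\<close>)
  qed
  show "(\<lambda>n. v n / sqrt (\<mu> n)) \<longlonglongrightarrow> 0"
  proof (rule Lim_null_comparison[OF _ v3])
    show "\<forall>\<^sub>F n in sequentially. norm (v n / sqrt (\<mu> n)) \<le> v n ^ 3 / sqrt (\<mu> n)"
      using v1
    proof eventually_elim
      case (elim n)
      have "v n ^ 1 \<le> v n ^ 3" using elim by (intro power_increasing) auto
      then show ?case using elim \<mu>[of n] by (simp add: divide_right_mono)
    qed
  qed
  show "(\<lambda>n. 1 / v n) \<longlonglongrightarrow> 0"
    using tendsto_inverse_0_at_top[OF v] by (simp add: field_simps)
  show "\<rho> \<longlonglongrightarrow> 0"
  proof (rule Lim_null_comparison[OF _ rv])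
    show "\<forall>\<^sub>F n in sequentially. norm (\<rho> n) \<le> \<rho> n * (v n)\<^sup>2"
      using v1
    proof eventually_elim
      case (elim n)
      have "\<rho> n * 1 \<le> \<rho> n * (v n)\<^sup>2" using elim \<rho>[of n] by (intro mult_left_mono) auto
      then show ?case using \<rho>[of n] by simp
    qed
  qed
  have "filterlim (\<lambda>n. inverse (1 / sqrt (\<mu> n))) at_top sequentially"
    by (rule filterlim_inverse_at_top[OF q]) (use \<mu> in simp)
  then have "filterlim (\<lambda>n. sqrt (\<mu> n)) at_top sequentially" by simp
  from filterlim_at_top_mult_at_top[OF this this] show "filterlim \<mu> at_top sequentially"
    using \<mu> by (simp add: less_imp_le)
qed

text \<open>
  Beyond the deviation \<open>v * sqrt \<mu>\<close> binomial probabilities decay geometrically on the scale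
  \<open>sqrt \<mu> / v\<close>. The window \<open>sqrt \<mu>\<close> is long on this scale, yet short compared with the deviation
  itself, so that the rate of decay is nearly constant in it.
\<close>

lemma moderate_offset:
  fixes v \<mu> \<rho> :: "nat \<Rightarrow> real"
  assumes v: "filterlim v at_top sequentially" and v3: "(\<lambda>n. v n ^ 3 / sqrt (\<mu> n)) \<longlonglongrightarrow> 0"
    and rv: "(\<lambda>n. \<rho> n * (v n)\<^sup>2) \<longlonglongrightarrow> 0" and \<rho>: "\<And>n. 0 < \<rho> n" and \<mu>: "\<And>n. 0 < \<mu> n"
  defines "R \<equiv> \<lambda>n. nat \<lceil>sqrt (\<mu> n)\<rceil>"
  shows "(\<lambda>n. real (R n) / (v n * sqrt (\<mu> n))) \<longlonglongrightarrow> 0"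
    and "filterlim (\<lambda>n. real (R n) / (sqrt (\<mu> n) / v n)) at_top sequentially"
proof -
  note sc = moderate_scales[OF v v3 rv \<rho> \<mu>]
  have v1: "\<forall>\<^sub>F n in sequentially. 1 \<le> v n" using v unfolding filterlim_at_top by blast
  have R: "sqrt (\<mu> n) \<le> real (R n)" "real (R n) \<le> sqrt (\<mu> n) + 1" for n
    using \<mu>[of n] unfolding R_def by (auto intro: order_trans[OF le_of_int_ceiling] simp:
        of_nat_nat)
  have lim: "(\<lambda>n. 1 / v n + 1 / v n * (1 / sqrt (\<mu> n))) \<longlonglongrightarrow> 0"
    using tendsto_add[OF sc(3) tendsto_mult[OF sc(3,1)]] by simp
  show "(\<lambda>n. real (R n) / (v n * sqrt (\<mu> n))) \<longlonglongrightarrow> 0"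
  proof (rule Lim_null_comparison[OF _ lim])
    show "\<forall>\<^sub>F n in sequentially. norm (real (R n) / (v n * sqrt (\<mu> n))) \<le> 1 / v n + 1 / v n
        * (1 / sqrt (\<mu> n))"
      using v1
    proof eventually_elim
      case (elim n)
      have "real (R n) / (v n * sqrt (\<mu> n)) \<le> (sqrt (\<mu> n) + 1) / (v n * sqrt (\<mu> n))"
        using R[of n] elim \<mu>[of n] by (intro divide_right_mono) auto
      also have "\<dots> = 1 / v n + 1 / v n * (1 / sqrt (\<mu> n))"
        using elim \<mu>[of n] by (simp add: add_divide_distrib)
      finally show ?case using elim \<mu>[of n] by simp
    qed
  qed
  show "filterlim (\<lambda>n. real (R n) / (sqrt (\<mu> n) / v n)) at_top sequentially"
  proof (rule filterlim_at_top_mono[OF v])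
    show "\<forall>\<^sub>F n in sequentially. v n \<le> real (R n) / (sqrt (\<mu> n) / v n)"
      using v1
    proof eventually_elim
      case (elim n)
      have "sqrt (\<mu> n) / (sqrt (\<mu> n) / v n) \<le> real (R n) / (sqrt (\<mu> n) / v n)"
        using elim \<mu>[of n] R[of n] by (intro divide_right_mono) auto
      then show ?case using \<mu>[of n] by simp
    qed
  qed
qed

text \<open>
  The sign \<open>\<sigma>\<close> selects the side of the mean.
\<close>

lemma moderate_local_limit:
  fixes t a :: "nat \<Rightarrow> nat" and v \<rho> :: "nat \<Rightarrow> real" and \<sigma> :: real
  defines "\<mu> \<equiv> \<lambda>n. real (t n) * \<rho> n"
  assumes v: "filterlim v at_top sequentially" and v3: "(\<lambda>n. v n ^ 3 / sqrt (\<mu> n)) \<longlonglongrightarrow> 0"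
    and rv: "(\<lambda>n. \<rho> n * (v n)\<^sup>2) \<longlonglongrightarrow> 0" and \<rho>: "\<And>n. 0 < \<rho> n" and \<mu>: "\<And>n. 0 < \<mu> n"
    and \<sigma>: "\<sigma>\<^sup>2 = 1" and a: "\<And>n. real (a n) - \<mu> n = \<sigma> * (v n * sqrt (\<mu> n))"
  shows "(\<lambda>n. Bernstein (t n) (a n) (\<rho> n) * sqrt (2 * pi * \<mu> n) * exp ((v n)\<^sup>2 / 2)) \<longlonglongrightarrow> 1"
proof -
  note sc = moderate_scales[OF v v3 rv \<rho> \<mu>]
  define d where "d n = real (a n) - \<mu> n" for n
  have sq: "sqrt (\<mu> n) * sqrt (\<mu> n) = \<mu> n" for n using \<mu>[of n] by simp
  have gen: "(\<sigma> * (x * q)) / (q * q) = \<sigma> * (x / q)" "(\<sigma> * (x * q)) ^ 3 / (q * q) ^ 2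
      = \<sigma> ^ 3 * (x ^ 3 / q)"
    "(\<sigma> * (x * q))\<^sup>2 / (q * q) = x\<^sup>2" if "q > 0" for x q :: real
    using that \<sigma> by (simp_all add: power2_eq_square power3_eq_cube power_mult_distrib)
  have d: "d n / \<mu> n = \<sigma> * (v n / sqrt (\<mu> n))" "d n ^ 3 / \<mu> n ^ 2 = \<sigma> ^ 3 * (v n ^ 3 / sqrt (\<mu> n))"
    "(d n)\<^sup>2 / \<mu> n = (v n)\<^sup>2" for n
    using gen[of "sqrt (\<mu> n)" "v n"] \<mu>[of n] unfolding d_def a sq by simp_all
  have h2: "(\<lambda>n. d n / \<mu> n) \<longlonglongrightarrow> 0" unfolding d(1) by (rule tendsto_mult_right_zero[OF sc(2)])
  have h3: "(\<lambda>n. d n ^ 3 / \<mu> n ^ 2) \<longlonglongrightarrow> 0" unfolding d(2) by (rule tendsto_mult_right_zero[OF v3])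
  have h4: "(\<lambda>n. \<rho> n * (d n)\<^sup>2 / \<mu> n) \<longlonglongrightarrow> 0" using rv by (simp add: d(3)[symmetric])
  have e: "(d n)\<^sup>2 / (2 * \<mu> n) = (v n)\<^sup>2 / 2" for n using d(3)[of n] by simp
  have "(\<lambda>n. Bernstein (t n) (a n) (\<rho> n) * sqrt (2 * pi * \<mu> n) * exp ((d n)\<^sup>2 / (2 * \<mu> n))) \<longlonglongrightarrow> 1"
    using binomial_local_limit[of \<rho> t a] \<rho> sc(4,5) h2 h3 h4 unfolding \<mu>_def d_def by blast
  then show ?thesis unfolding e .
qed

text \<open>
  Up to a factor \<open>1 + o(1)\<close>, a tail is the probability of its first point times the number
  \<open>sqrt \<mu> / v\<close> of points that matter.
\<close>

lemma tail_from_point: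
  fixes T c v \<mu> :: "nat \<Rightarrow> real"
  assumes "(\<lambda>n. T n / (c n * (sqrt (\<mu> n) / v n))) \<longlonglongrightarrow> 1"
    and "(\<lambda>n. c n * sqrt (2 * pi * \<mu> n) * exp ((v n)\<^sup>2 / 2)) \<longlonglongrightarrow> 1"
    and "\<forall>\<^sub>F n in sequentially. 0 < v n \<and> 0 < c n" "\<And>n. 0 < \<mu> n"
  shows "(\<lambda>n. T n * (sqrt (2 * pi) * v n * exp ((v n)\<^sup>2 / 2))) \<longlonglongrightarrow> 1"
proof -
  have "(\<lambda>n. T n / (c n * (sqrt (\<mu> n) / v n)) * (c n * sqrt (2 * pi * \<mu> n) * exp ((v n)\<^sup>2 / 2)))
      \<longlonglongrightarrow> 1 * 1"
    by (intro tendsto_mult assms)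
  moreover have "\<forall>\<^sub>F n in sequentially. T n / (c n * (sqrt (\<mu> n) / v n)) * (c n * sqrt (2 * pi
      * \<mu> n) * exp ((v n)\<^sup>2 / 2))
      = T n * (sqrt (2 * pi) * v n * exp ((v n)\<^sup>2 / 2))"
    using assms(3)
  proof eventually_elim
    case (elim n)
    have "sqrt (2 * pi * \<mu> n) = sqrt (2 * pi) * sqrt (\<mu> n)" by (rule real_sqrt_mult)
    then show ?case using elim assms(4)[of n] by simp
  qed
  ultimately show ?thesis by (simp add: Lim_transform_eventually)
qed

text \<open>
  At distance \<open>d + i\<close> above the mean the quotient of consecutive probabilities is
  \<open>1 - (d + i + 1 - \<rho>) / ((\<mu> + d + i + 1) * (1 - \<rho>))\<close>, which is \<open>1 - (1 + o(1)) * v / sqrt \<mu>\<close> for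
  all \<open>i\<close> that are small compared with \<open>d = v * sqrt \<mu>\<close>.
\<close>

lemma upper_tail_from_integer:
  fixes t a :: "nat \<Rightarrow> nat" and \<rho> :: "nat \<Rightarrow> real"
  defines "\<mu> \<equiv> \<lambda>n. real (t n) * \<rho> n"
  defines "v \<equiv> \<lambda>n. (real (a n) - \<mu> n) / sqrt (\<mu> n)"
  assumes v: "filterlim v at_top sequentially" and v3: "(\<lambda>n. v n ^ 3 / sqrt (\<mu> n)) \<longlonglongrightarrow> 0"
    and rv: "(\<lambda>n. \<rho> n * (v n)\<^sup>2) \<longlonglongrightarrow> 0" and \<rho>: "\<And>n. 0 < \<rho> n" and \<mu>: "\<And>n. 0 < \<mu> n"
  shows "(\<lambda>n. (\<Sum>m\<in>{a n..t n}. Bernstein (t n) m (\<rho> n)) * (sqrt (2 * pi) * v n * exp ((v n)\<^sup>2 / 2)))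
      \<longlonglongrightarrow> 1"
proof -
  note sc = moderate_scales[OF v v3 rv \<rho> \<mu>]
  define R where "R n = nat \<lceil>sqrt (\<mu> n)\<rceil>" for n
  define d where "d n = real (a n) - \<mu> n" for n
  define s where "s n i = real (t n - (a n + i)) * \<rho> n / ((real (a n + i) + 1) * (1 - \<rho> n))" for n i
  define c where "c n i = Bernstein (t n) (a n + i) (\<rho> n)" for n i
  have dv: "d n = v n * sqrt (\<mu> n)" for n using \<mu>[of n] by (simp add: v_def d_def)
  have sq: "sqrt (\<mu> n) * sqrt (\<mu> n) = \<mu> n" for n using \<mu>[of n] by simp
  have dmu: "d n / \<mu> n = v n / sqrt (\<mu> n)" for n
  proof -
    have "x * r / (r * r) = x / r" if "r > 0" for x r :: real using that by simp
    from this[of "sqrt (\<mu> n)" "v n"] show ?thesis using \<mu>[of n] unfolding dv sq by simp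
  qed
  have v0: "\<forall>\<^sub>F n in sequentially. 0 < v n" using v unfolding filterlim_at_top_dense by blast
  have \<rho>4: "\<forall>\<^sub>F n in sequentially. \<rho> n < 1/4" using sc(4) by (rule order_tendstoD) simp
  have d1: "\<forall>\<^sub>F n in sequentially. d n / \<mu> n < 1" unfolding dmu using sc(2)
      by (rule order_tendstoD) simp
  have inside: "\<forall>\<^sub>F n in sequentially. a n + i n < t n" if i: "(\<lambda>n. real (i n) / (v n * sqrt (\<mu> n)))
      \<longlonglongrightarrow> 0" for i
  proof -
    have "\<forall>\<^sub>F n in sequentially. real (i n) / (v n * sqrt (\<mu> n)) < 1" using i
        by (rule order_tendstoD) simp
    then show ?thesis using v0 \<rho>4 d1
    proof eventually_elim
      case (elim n)
      have dpos: "0 < d n" unfolding dv using elim \<mu>[of n] by simp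
      have "real (i n) < d n" using elim dpos unfolding dv[symmetric] by simp
      moreover have "d n < \<mu> n" using elim \<mu>[of n] by simp
      moreover have "4 * \<mu> n \<le> real (t n)"
        using mult_left_mono[of "\<rho> n" "1/4" "real (t n)"] elim unfolding \<mu>_def by simp
      ultimately have "real (a n + i n) < real (t n)" using \<mu>[of n] unfolding d_def of_nat_add
          by linarith
      then show ?case by simp
    qed
  qed
  have lims: "(\<lambda>n. (1 - s n (i n)) * (sqrt (\<mu> n) / v n)) \<longlonglongrightarrow> 1"
      if i: "(\<lambda>n. real (i n) / (v n * sqrt (\<mu> n))) \<longlonglongrightarrow> 0" for i
  proof -
    have "(\<lambda>n. (1 + real (i n) / (v n * sqrt (\<mu> n)) + (1 - \<rho> n) * (1 / v n * (1 / sqrt (\<mu> n)))) /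
       ((1 + v n / sqrt (\<mu> n) + real (i n) / (v n * sqrt (\<mu> n)) * (v n / sqrt (\<mu> n))
           + (1 / sqrt (\<mu> n)) * (1 / sqrt (\<mu> n))) * (1 - \<rho> n)))
       \<longlonglongrightarrow> (1 + 0 + (1 - 0) * (0 * 0)) / ((1 + 0 + 0 * 0 + 0 * 0) * (1 - 0))"
      by (intro tendsto_divide tendsto_mult tendsto_add tendsto_diff tendsto_const i sc) simp
    moreover have "\<forall>\<^sub>F n in sequentially. (1 + real (i n) / (v n * sqrt (\<mu> n)) + (1 - \<rho> n)
        * (1 / v n * (1 / sqrt (\<mu> n)))) /
       ((1 + v n / sqrt (\<mu> n) + real (i n) / (v n * sqrt (\<mu> n)) * (v n / sqrt (\<mu> n))
           + (1 / sqrt (\<mu> n)) * (1 / sqrt (\<mu> n))) * (1 - \<rho> n))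
       = (1 - s n (i n)) * (sqrt (\<mu> n) / v n)"
      using v0 \<rho>4 inside[OF i]
    proof eventually_elim
      case (elim n)
      define I where "I = real (i n)"
      define q where "q = sqrt (\<mu> n)"
      have q: "q > 0" "q * q = \<mu> n" and vp: "v n > 0" using elim(1) \<mu>[of n] sq
          by (simp_all add: q_def)
      have D: "0 < d n" "d n = v n * q" unfolding dv q_def using elim \<mu>[of n] by simp_all
      have I: "I \<ge> 0" by (simp add: I_def)
      have a: "real (a n) = \<mu> n + d n" by (simp add: d_def)
      have tr: "real (t n - (a n + i n)) * \<rho> n = \<mu> n - (\<mu> n + d n + I) * \<rho> n"
        using elim by (simp add: of_nat_diff a I_def \<mu>_def algebra_simps)
      have den: "\<mu> n + d n + I + 1 \<noteq> 0" "1 - \<rho> n \<noteq> 0" using elim D I \<mu>[of n] by auto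
      have gen: "1 - x / y = (y - x) / y" if "y \<noteq> 0" for x y :: real using that
          by (simp add: diff_divide_distrib)
      have "1 - s n (i n) = ((\<mu> n + d n + I + 1) * (1 - \<rho> n) - (\<mu> n - (\<mu> n + d n + I) * \<rho> n))
          / ((\<mu> n + d n + I + 1) * (1 - \<rho> n))"
        unfolding s_def tr of_nat_add a I_def[symmetric] using den by (intro gen) simp
      also have "(\<mu> n + d n + I + 1) * (1 - \<rho> n) - (\<mu> n - (\<mu> n + d n + I) * \<rho> n)
          = d n + I + (1 - \<rho> n)"
        by (simp add: algebra_simps)
      finally have s: "1 - s n (i n) = (d n + I + (1 - \<rho> n)) / ((\<mu> n + d n + I + 1) * (1 - \<rho> n))" .
      have lhs1: "1 + I / (v n * q) + (1 - \<rho> n) * (1 / v n * (1 / q)) = (d n + I + (1 - \<rho> n)) / d n"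
        unfolding D(2) using vp q(1) by (simp add: add_divide_distrib)
      have lhs2: "1 + v n / q + I / (v n * q) * (v n / q) + 1 / q * (1 / q) = (\<mu> n + d n + I + 1)
          / \<mu> n"
        unfolding D(2) q(2)[symmetric] using vp q(1) by (simp add: add_divide_distrib)
      have "(1 + I / (v n * q) + (1 - \<rho> n) * (1 / v n * (1 / q))) /
       ((1 + v n / q + I / (v n * q) * (v n / q) + (1 / q) * (1 / q)) * (1 - \<rho> n)) = (1 - s n (i n))
           * (\<mu> n / d n)"
        unfolding lhs1 lhs2 s by simp
      also have "\<mu> n / d n = q / v n" unfolding D(2) q(2)[symmetric] using q(1) by simp
      finally show ?case unfolding I_def q_def .
    qed
    ultimately show ?thesis by (simp add: Lim_transform_eventually)
  qed
  note off = moderate_offset[OF v v3 rv \<rho> \<mu>, folded R_def]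
  have off0: "(\<lambda>n. real 0 / (v n * sqrt (\<mu> n))) \<longlonglongrightarrow> 0" by simp
  have loc: "(\<lambda>n. Bernstein (t n) (a n) (\<rho> n) * sqrt (2 * pi * \<mu> n) * exp ((v n)\<^sup>2 / 2)) \<longlonglongrightarrow> 1"
    using moderate_local_limit[of v t \<rho> 1 a] v v3 rv \<rho> \<mu> dv unfolding \<mu>_def d_def by simp
  have "(\<lambda>n. (\<Sum>i<t n + 1 - a n. c n i) / (c n 0 * (sqrt (\<mu> n) / v n))) \<longlonglongrightarrow> 1"
  proof (rule ratio_sum_asymp[OF _ lims[OF off0] lims[OF off(1)] off(2)])
    show "\<forall>\<^sub>F n in sequentially. (\<forall>i. c n (Suc i) = s n i * c n i) \<and> 0 < c n 0 \<and>
      (\<forall>i. 0 \<le> s n i) \<and> (\<forall>i j. i \<le> j \<longrightarrow> s n j \<le> s n i) \<and> 0 < sqrt (\<mu> n) / v n \<and> R n \<le> t n + 1 - a n"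
      using v0 \<rho>4 inside[OF off(1)]
    proof eventually_elim
      case (elim n)
      have \<rho>1: "\<rho> n < 1" using elim by simp
      have "c n (Suc i) = s n i * c n i" for i
        using Bernstein_Suc[OF \<rho>1, of "t n" "a n + i"] by (simp add: c_def s_def)
      moreover have "0 < c n 0" unfolding c_def using elim \<rho>[of n] by (intro Bernstein_pos) auto
      moreover have "0 \<le> s n i" for i unfolding s_def using elim \<rho>[of n] by simp
      moreover have "s n j \<le> s n i" if "i \<le> j" for i j
        unfolding s_def using that \<rho>1 \<rho>[of n]
        by (intro frac_le mult_right_mono mult_nonneg_nonneg mult_pos_pos) auto
      ultimately show ?case using elim \<mu>[of n] by auto
    qed
  qed
  moreover have "(\<Sum>i<t n + 1 - a n. c n i) = (\<Sum>m\<in>{a n..t n}. Bernstein (t n) m (\<rho> n))" for n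
    unfolding c_def by (rule sum.reindex_bij_witness[of _ "\<lambda>m. m - a n" "\<lambda>i. a n + i"]) auto
  ultimately have "(\<lambda>n. (\<Sum>m\<in>{a n..t n}. Bernstein (t n) m (\<rho> n)) / (Bernstein (t n) (a n) (\<rho> n)
      * (sqrt (\<mu> n) / v n))) \<longlonglongrightarrow> 1"
    by (simp add: c_def)
  then show ?thesis
  proof (rule tail_from_point[OF _ loc _ \<mu>])
    show "\<forall>\<^sub>F n in sequentially. 0 < v n \<and> 0 < Bernstein (t n) (a n) (\<rho> n)"
      using v0 \<rho>4 inside[of "\<lambda>_. 0", OF off0]
      by eventually_elim (use \<rho> in \<open>auto intro!: Bernstein_pos\<close>)
  qed
qed

text \<open>
  As for the upper tail; at distance \<open>d + i\<close> below the mean the quotient is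
  \<open>1 - (d + i + \<rho>) / (\<mu> * (1 - \<rho>) + \<rho> * (d + i + 1))\<close>.
\<close>

lemma lower_tail_from_integer:
  fixes t a :: "nat \<Rightarrow> nat" and \<rho> :: "nat \<Rightarrow> real"
  defines "\<mu> \<equiv> \<lambda>n. real (t n) * \<rho> n"
  defines "v \<equiv> \<lambda>n. (\<mu> n - real (a n)) / sqrt (\<mu> n)"
  assumes v: "filterlim v at_top sequentially" and v3: "(\<lambda>n. v n ^ 3 / sqrt (\<mu> n)) \<longlonglongrightarrow> 0"
    and rv: "(\<lambda>n. \<rho> n * (v n)\<^sup>2) \<longlonglongrightarrow> 0" and \<rho>: "\<And>n. 0 < \<rho> n" and \<mu>: "\<And>n. 0 < \<mu> n"
  shows "(\<lambda>n. (\<Sum>m\<le>a n. Bernstein (t n) m (\<rho> n)) * (sqrt (2 * pi) * v n * exp ((v n)\<^sup>2 / 2))) \<longlonglongrightarrow> 1"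
proof -
  note sc = moderate_scales[OF v v3 rv \<rho> \<mu>]
  define R where "R n = nat \<lceil>sqrt (\<mu> n)\<rceil>" for n
  define d where "d n = \<mu> n - real (a n)" for n
  define s where "s n i = real (a n - i) * (1 - \<rho> n) / ((real (t n - (a n - i)) + 1) * \<rho> n)" for n i
  \<comment> \<open>the recursion persists beyond \<open>a n\<close>, because \<open>s n i = 0\<close> from \<open>i = a n\<close> on\<close>
  define c where "c n i = (if i \<le> a n then Bernstein (t n) (a n - i) (\<rho> n) else 0)" for n i
  have dv: "d n = v n * sqrt (\<mu> n)" for n using \<mu>[of n] by (simp add: v_def d_def)
  have sq: "sqrt (\<mu> n) * sqrt (\<mu> n) = \<mu> n" for n using \<mu>[of n] by simp
  have dmu: "d n / \<mu> n = v n / sqrt (\<mu> n)" for n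
  proof -
    have "x * r / (r * r) = x / r" if "r > 0" for x r :: real using that by simp
    from this[of "sqrt (\<mu> n)" "v n"] show ?thesis using \<mu>[of n] unfolding dv sq by simp
  qed
  have v0: "\<forall>\<^sub>F n in sequentially. 0 < v n" using v unfolding filterlim_at_top_dense by blast
  have \<rho>4: "\<forall>\<^sub>F n in sequentially. \<rho> n < 1/4" using sc(4) by (rule order_tendstoD) simp
  have d1: "\<forall>\<^sub>F n in sequentially. d n / \<mu> n < 1/2" unfolding dmu using sc(2)
      by (rule order_tendstoD) simp
  have inside: "\<forall>\<^sub>F n in sequentially. i n \<le> a n \<and> a n < t n"
      if i: "(\<lambda>n. real (i n) / (v n * sqrt (\<mu> n))) \<longlonglongrightarrow> 0" for i
  proof -
    have "\<forall>\<^sub>F n in sequentially. real (i n) / (v n * sqrt (\<mu> n)) < 1" using i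
        by (rule order_tendstoD) simp
    then show ?thesis using v0 \<rho>4 d1
    proof eventually_elim
      case (elim n)
      have dpos: "0 < d n" unfolding dv using elim \<mu>[of n] by simp
      have "real (i n) < d n" using elim dpos unfolding dv[symmetric] by simp
      moreover have "d n < \<mu> n / 2" using elim \<mu>[of n] by (simp add: pos_divide_less_eq)
      moreover have "4 * \<mu> n \<le> real (t n)"
        using mult_left_mono[of "\<rho> n" "1/4" "real (t n)"] elim unfolding \<mu>_def by simp
      ultimately have "real (i n) \<le> real (a n)" "real (a n) < real (t n)"
        using \<mu>[of n] dpos unfolding d_def by linarith+
      then show ?case by simp
    qed
  qed
  have lims: "(\<lambda>n. (1 - s n (i n)) * (sqrt (\<mu> n) / v n)) \<longlonglongrightarrow> 1"
      if i: "(\<lambda>n. real (i n) / (v n * sqrt (\<mu> n))) \<longlonglongrightarrow> 0" for i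
  proof -
    have "(\<lambda>n. (1 + real (i n) / (v n * sqrt (\<mu> n)) + \<rho> n * (1 / v n * (1 / sqrt (\<mu> n)))) /
       (1 - \<rho> n + \<rho> n * (v n / sqrt (\<mu> n) + real (i n) / (v n * sqrt (\<mu> n)) * (v n / sqrt (\<mu> n))
           + (1 / sqrt (\<mu> n)) * (1 / sqrt (\<mu> n)))))
       \<longlonglongrightarrow> (1 + 0 + 0 * (0 * 0)) / (1 - 0 + 0 * (0 + 0 * 0 + 0 * 0))"
      by (intro tendsto_divide tendsto_mult tendsto_add tendsto_diff tendsto_const i sc) simp
    moreover have "\<forall>\<^sub>F n in sequentially. (1 + real (i n) / (v n * sqrt (\<mu> n)) + \<rho> n * (1 / v n
        * (1 / sqrt (\<mu> n)))) /
       (1 - \<rho> n + \<rho> n * (v n / sqrt (\<mu> n) + real (i n) / (v n * sqrt (\<mu> n)) * (v n / sqrt (\<mu> n))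
           + (1 / sqrt (\<mu> n)) * (1 / sqrt (\<mu> n))))
       = (1 - s n (i n)) * (sqrt (\<mu> n) / v n)"
      using v0 \<rho>4 inside[OF i]
    proof eventually_elim
      case (elim n)
      define I where "I = real (i n)"
      define q where "q = sqrt (\<mu> n)"
      have q: "q > 0" "q * q = \<mu> n" and vp: "v n > 0" using elim(1) \<mu>[of n] sq
          by (simp_all add: q_def)
      have D: "0 < d n" "d n = v n * q" unfolding dv q_def using elim \<mu>[of n] by simp_all
      have I: "I \<ge> 0" by (simp add: I_def)
      have ai: "real (a n - i n) = \<mu> n - d n - I" using elim by (simp add: d_def I_def)
      have tr: "(real (t n - (a n - i n)) + 1) * \<rho> n = \<mu> n * (1 - \<rho> n) + \<rho> n * (d n + I + 1)"
      proof -
        have "real (t n - (a n - i n)) = real (t n) - real (a n - i n)" using elim by simp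
        then have r: "real (t n - (a n - i n)) = real (t n) - (\<mu> n - d n - I)" using ai by simp
        show ?thesis unfolding r by (simp add: \<mu>_def algebra_simps)
      qed
      have den: "\<mu> n * (1 - \<rho> n) + \<rho> n * (d n + I + 1) \<noteq> 0"
        using elim D I \<mu>[of n] \<rho>[of n] by (intro less_imp_neq[THEN not_sym] add_pos_nonneg
            mult_pos_pos mult_nonneg_nonneg) auto
      have gen: "1 - x / y = (y - x) / y" if "y \<noteq> 0" for x y :: real using that
          by (simp add: diff_divide_distrib)
      have "1 - s n (i n) = (\<mu> n * (1 - \<rho> n) + \<rho> n * (d n + I + 1) - (\<mu> n - d n - I) * (1 - \<rho> n))
          / (\<mu> n * (1 - \<rho> n) + \<rho> n * (d n + I + 1))"
        unfolding s_def tr ai by (rule gen[OF den])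
      also have "\<mu> n * (1 - \<rho> n) + \<rho> n * (d n + I + 1) - (\<mu> n - d n - I) * (1 - \<rho> n)
          = d n + I + \<rho> n"
        by (simp add: algebra_simps)
      finally have s: "1 - s n (i n) = (d n + I + \<rho> n) / (\<mu> n * (1 - \<rho> n) + \<rho> n * (d n + I + 1))" .
      have lhs1: "1 + I / (v n * q) + \<rho> n * (1 / v n * (1 / q)) = (d n + I + \<rho> n) / d n"
        unfolding D(2) using vp q(1) by (simp add: add_divide_distrib)
      have lhs2: "1 - \<rho> n + \<rho> n * (v n / q + I / (v n * q) * (v n / q) + 1 / q * (1 / q))
          = (\<mu> n * (1 - \<rho> n) + \<rho> n * (d n + I + 1)) / \<mu> n"
      proof -
        have X: "v n / q + I / (v n * q) * (v n / q) + 1 / q * (1 / q) = (d n + I + 1) / \<mu> n"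
          unfolding D(2) q(2)[symmetric] using vp q(1) by (simp add: add_divide_distrib)
        have "x + r * (y / m) = (m * x + r * y) / m" if "m > 0" for x r y m :: real
          using that by (simp add: add_divide_distrib)
        from this[OF \<mu>] show ?thesis unfolding X .
      qed
      have "(1 + I / (v n * q) + \<rho> n * (1 / v n * (1 / q))) /
       (1 - \<rho> n + \<rho> n * (v n / q + I / (v n * q) * (v n / q) + (1 / q) * (1 / q))) = (1 - s n (i n))
           * (\<mu> n / d n)"
        unfolding lhs1 lhs2 s by simp
      also have "\<mu> n / d n = q / v n" unfolding D(2) q(2)[symmetric] using q(1) by simp
      finally show ?case unfolding I_def q_def .
    qed
    ultimately show ?thesis by (simp add: Lim_transform_eventually)
  qed
  note off = moderate_offset[OF v v3 rv \<rho> \<mu>, folded R_def]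
  have off0: "(\<lambda>n. real 0 / (v n * sqrt (\<mu> n))) \<longlonglongrightarrow> 0" by simp
  have loc: "(\<lambda>n. Bernstein (t n) (a n) (\<rho> n) * sqrt (2 * pi * \<mu> n) * exp ((v n)\<^sup>2 / 2)) \<longlonglongrightarrow> 1"
  proof -
    have "real (a n) - \<mu> n = - 1 * (v n * sqrt (\<mu> n))" for n using dv[of n] by (simp add: d_def)
    then show ?thesis
      using moderate_local_limit[of v t \<rho> "- 1" a] v v3 rv \<rho> \<mu> unfolding \<mu>_def by simp
  qed
  have "(\<lambda>n. (\<Sum>i<a n + 1. c n i) / (c n 0 * (sqrt (\<mu> n) / v n))) \<longlonglongrightarrow> 1"
  proof (rule ratio_sum_asymp[OF _ lims[OF off0] lims[OF off(1)] off(2)])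
    show "\<forall>\<^sub>F n in sequentially. (\<forall>i. c n (Suc i) = s n i * c n i) \<and> 0 < c n 0 \<and>
      (\<forall>i. 0 \<le> s n i) \<and> (\<forall>i j. i \<le> j \<longrightarrow> s n j \<le> s n i) \<and> 0 < sqrt (\<mu> n) / v n \<and> R n \<le> a n + 1"
      using v0 \<rho>4 inside[OF off(1)]
    proof eventually_elim
      case (elim n)
      have \<rho>1: "\<rho> n < 1" using elim by simp
      have "c n (Suc i) = s n i * c n i" for i
      proof (cases "i < a n")
        case True
        define k where "k = a n - Suc i"
        have k: "a n - i = Suc k" "k < t n" using True elim by (auto simp: k_def)
        have "real (t n - Suc k) + 1 = real (t n - k)" using k by (simp add: of_nat_diff)
        then have s: "s n i = (real k + 1) * (1 - \<rho> n) / (real (t n - k) * \<rho> n)"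
          by (simp add: s_def k add.commute)
        have nz: "(real k + 1) * (1 - \<rho> n) \<noteq> 0" "real (t n - k) * \<rho> n \<noteq> 0" using k \<rho>1 \<rho>[of n]
            by auto
        have gen: "x = y / z * (z / y * x)" if "y \<noteq> 0" "z \<noteq> 0" for x y z :: real using that by simp
        have "Bernstein (t n) k (\<rho> n) = s n i * Bernstein (t n) (Suc k) (\<rho> n)"
          unfolding s Bernstein_Suc[OF \<rho>1] by (rule gen[OF nz])
        then show ?thesis using True k by (simp add: c_def k_def)
      next
        case False
        then show ?thesis by (simp add: c_def s_def)
      qed
      moreover have "0 < c n 0" unfolding c_def using elim \<rho>[of n] by (auto intro!: Bernstein_pos)
      moreover have "0 \<le> s n i" for i unfolding s_def using elim \<rho>[of n] by simp
      moreover have "s n j \<le> s n i" if "i \<le> j" for i j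
        unfolding s_def using that \<rho>1 \<rho>[of n]
        by (intro frac_le mult_right_mono mult_nonneg_nonneg mult_pos_pos) auto
      ultimately show ?case using elim \<mu>[of n] by auto
    qed
  qed
  moreover have "(\<Sum>i<a n + 1. c n i) = (\<Sum>m\<le>a n. Bernstein (t n) m (\<rho> n))" for n
    unfolding c_def by (rule sum.reindex_bij_witness[of _ "\<lambda>m. a n - m" "\<lambda>i. a n - i"]) auto
  ultimately have "(\<lambda>n. (\<Sum>m\<le>a n. Bernstein (t n) m (\<rho> n)) / (Bernstein (t n) (a n) (\<rho> n)
      * (sqrt (\<mu> n) / v n))) \<longlonglongrightarrow> 1"
    by (simp add: c_def)
  then show ?thesis
  proof (rule tail_from_point[OF _ loc _ \<mu>])
    show "\<forall>\<^sub>F n in sequentially. 0 < v n \<and> 0 < Bernstein (t n) (a n) (\<rho> n)"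
      using v0 \<rho>4 inside[of "\<lambda>_. 0", OF off0]
      by eventually_elim (use \<rho> in \<open>auto intro!: Bernstein_pos\<close>)
  qed
qed

text \<open>
  A real threshold is rounded to an integer before the tail is summed. This moves the deviation by
  at most \<open>1 / sqrt \<mu>\<close> and its square by \<open>O (w / sqrt \<mu>)\<close>, which tends to 0.
\<close>

lemma moderate_perturb:
  fixes v w \<mu> \<rho> :: "nat \<Rightarrow> real"
  assumes w: "filterlim w at_top sequentially" and w3: "(\<lambda>n. w n ^ 3 / sqrt (\<mu> n)) \<longlonglongrightarrow> 0"
    and rw: "(\<lambda>n. \<rho> n * (w n)\<^sup>2) \<longlonglongrightarrow> 0" and \<rho>: "\<And>n. 0 < \<rho> n" and \<mu>: "\<And>n. 0 < \<mu> n"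
    and vw: "\<forall>\<^sub>F n in sequentially. w n \<le> v n \<and> v n \<le> w n + 1 / sqrt (\<mu> n)"
  shows "filterlim v at_top sequentially" "(\<lambda>n. v n ^ 3 / sqrt (\<mu> n)) \<longlonglongrightarrow> 0" "(\<lambda>n. \<rho> n * (v n)\<^sup>2) \<longlonglongrightarrow> 0"
    "(\<lambda>n. T n * (sqrt (2 * pi) * v n * exp ((v n)\<^sup>2 / 2))) \<longlonglongrightarrow> 1 \<Longrightarrow>
     (\<lambda>n. T n * (sqrt (2 * pi) * w n * exp ((w n)\<^sup>2 / 2))) \<longlonglongrightarrow> 1"
proof -
  note sc = moderate_scales[OF w w3 rw \<rho> \<mu>]
  have w1: "\<forall>\<^sub>F n in sequentially. 1 \<le> w n" using w unfolding filterlim_at_top by blast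
  have q1: "\<forall>\<^sub>F n in sequentially. 1 / sqrt (\<mu> n) < 1" using sc(1) by (rule order_tendstoD) simp
  show vtop: "filterlim v at_top sequentially"
    by (rule filterlim_at_top_mono[OF w]) (use vw in eventually_elim, simp)
  have le2: "\<forall>\<^sub>F n in sequentially. 0 < v n \<and> v n \<le> 2 * w n"
    using vw w1 q1 by eventually_elim linarith
  show "(\<lambda>n. v n ^ 3 / sqrt (\<mu> n)) \<longlonglongrightarrow> 0"
  proof (rule Lim_null_comparison)
    show "\<forall>\<^sub>F n in sequentially. norm (v n ^ 3 / sqrt (\<mu> n)) \<le> 8 * (w n ^ 3 / sqrt (\<mu> n))"
      using le2
    proof eventually_elim
      case (elim n)
      have "v n ^ 3 \<le> (2 * w n) ^ 3" using elim by (intro power_mono) auto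
      then have "v n ^ 3 / sqrt (\<mu> n) \<le> (8 * w n ^ 3) / sqrt (\<mu> n)"
        using \<mu>[of n] by (intro divide_right_mono) (auto simp: power_mult_distrib)
      then show ?case using elim \<mu>[of n] by simp
    qed
    show "(\<lambda>n. 8 * (w n ^ 3 / sqrt (\<mu> n))) \<longlonglongrightarrow> 0" using tendsto_mult_right_zero[OF w3] by simp
  qed
  show "(\<lambda>n. \<rho> n * (v n)\<^sup>2) \<longlonglongrightarrow> 0"
  proof (rule Lim_null_comparison)
    show "\<forall>\<^sub>F n in sequentially. norm (\<rho> n * (v n)\<^sup>2) \<le> 4 * (\<rho> n * (w n)\<^sup>2)"
      using le2
    proof eventually_elim
      case (elim n)
      have "(v n)\<^sup>2 \<le> (2 * w n)\<^sup>2" using elim by (intro power_mono) auto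
      then have "\<rho> n * (v n)\<^sup>2 \<le> \<rho> n * (4 * (w n)\<^sup>2)"
        using \<rho>[of n] by (intro mult_left_mono) (auto simp: power_mult_distrib)
      then show ?case using \<rho>[of n] by simp
    qed
    show "(\<lambda>n. 4 * (\<rho> n * (w n)\<^sup>2)) \<longlonglongrightarrow> 0" using tendsto_mult_right_zero[OF rw] by simp
  qed
  have diff: "(\<lambda>n. (v n)\<^sup>2 / 2 - (w n)\<^sup>2 / 2) \<longlonglongrightarrow> 0"
  proof (rule Lim_null_comparison)
    show "\<forall>\<^sub>F n in sequentially. norm ((v n)\<^sup>2 / 2 - (w n)\<^sup>2 / 2) \<le> 2 * (w n / sqrt (\<mu> n))"
      using le2 vw w1
    proof eventually_elim
      case (elim n)
      have "(v n)\<^sup>2 - (w n)\<^sup>2 = (v n - w n) * (v n + w n)"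
          by (simp add: algebra_simps power2_eq_square)
      also have "\<dots> \<le> (1 / sqrt (\<mu> n)) * (4 * w n)" using elim \<mu>[of n] by (intro mult_mono) auto
      finally have "(v n)\<^sup>2 - (w n)\<^sup>2 \<le> 4 * (w n / sqrt (\<mu> n))" by simp
      moreover have "(w n)\<^sup>2 \<le> (v n)\<^sup>2" using elim by (intro power_mono) auto
      ultimately show ?case by simp
    qed
    show "(\<lambda>n. 2 * (w n / sqrt (\<mu> n))) \<longlonglongrightarrow> 0" using tendsto_mult_right_zero[OF sc(2)] by simp
  qed
  have ratio: "(\<lambda>n. v n / w n) \<longlonglongrightarrow> 1"
  proof (rule tendsto_sandwich[of "\<lambda>_. 1" _ _ "\<lambda>n. 1 + 1 / sqrt (\<mu> n)"])
    show "\<forall>\<^sub>F n in sequentially. 1 \<le> v n / w n" using vw w1 by eventually_elim simp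
    show "\<forall>\<^sub>F n in sequentially. v n / w n \<le> 1 + 1 / sqrt (\<mu> n)"
      using vw w1
    proof eventually_elim
      case (elim n)
      have "1 / sqrt (\<mu> n) * 1 \<le> 1 / sqrt (\<mu> n) * w n" using elim \<mu>[of n]
          by (intro mult_left_mono) auto
      then have "v n \<le> (1 + 1 / sqrt (\<mu> n)) * w n" using elim by (simp add: distrib_right)
      then show ?case using elim by (simp add: pos_divide_le_eq)
    qed
    show "(\<lambda>n. 1 + 1 / sqrt (\<mu> n)) \<longlonglongrightarrow> 1" using tendsto_add[OF tendsto_const[of 1] sc(1)] by simp
  qed simp
  assume T: "(\<lambda>n. T n * (sqrt (2 * pi) * v n * exp ((v n)\<^sup>2 / 2))) \<longlonglongrightarrow> 1"
  have "(\<lambda>n. T n * (sqrt (2 * pi) * v n * exp ((v n)\<^sup>2 / 2)) / (v n / w n * exp ((v n)\<^sup>2 / 2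
      - (w n)\<^sup>2 / 2))) \<longlonglongrightarrow> 1 / (1 * exp 0)"
    by (intro tendsto_divide tendsto_mult tendsto_exp T ratio diff) simp
  moreover have "\<forall>\<^sub>F n in sequentially. T n * (sqrt (2 * pi) * v n * exp ((v n)\<^sup>2 / 2)) / (v n / w n
      * exp ((v n)\<^sup>2 / 2 - (w n)\<^sup>2 / 2))
     = T n * (sqrt (2 * pi) * w n * exp ((w n)\<^sup>2 / 2))"
    using le2 w1
  proof eventually_elim
    case (elim n)
    then show ?case by (simp add: exp_diff)
  qed
  ultimately show "(\<lambda>n. T n * (sqrt (2 * pi) * w n * exp ((w n)\<^sup>2 / 2))) \<longlonglongrightarrow> 1"
    by (simp add: Lim_transform_eventually)
qed

text \<open>
  In the range of moderate deviations the binomial tail is asymptotic to the tail of a standard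
  normal variable, whose leading term is \<open>exp (- w\<^sup>2 / 2) / (sqrt (2 * pi) * w)\<close>.
\<close>

lemma binomial_upper_tail:
  fixes t :: "nat \<Rightarrow> nat" and \<rho> z :: "nat \<Rightarrow> real"
  defines "\<mu> \<equiv> \<lambda>n. real (t n) * \<rho> n"
  defines "w \<equiv> \<lambda>n. (z n - \<mu> n) / sqrt (\<mu> n)"
  assumes w: "filterlim w at_top sequentially" and w3: "(\<lambda>n. w n ^ 3 / sqrt (\<mu> n)) \<longlonglongrightarrow> 0"
    and rw: "(\<lambda>n. \<rho> n * (w n)\<^sup>2) \<longlonglongrightarrow> 0" and \<rho>: "\<And>n. 0 < \<rho> n" and \<mu>: "\<And>n. 0 < \<mu> n"
  shows "(\<lambda>n. (\<Sum>m | m \<le> t n \<and> z n < real m. Bernstein (t n) m (\<rho> n)) * (sqrt (2 * pi) * w n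
      * exp ((w n)\<^sup>2 / 2))) \<longlonglongrightarrow> 1"
proof -
  define a where "a n = nat (\<lfloor>z n\<rfloor> + 1)" for n
  define v where "v n = (real (a n) - \<mu> n) / sqrt (\<mu> n)" for n
  have w0: "\<forall>\<^sub>F n in sequentially. 0 < w n" using w unfolding filterlim_at_top_dense by blast
  have zpos: "\<forall>\<^sub>F n in sequentially. 0 < z n"
    using w0
  proof eventually_elim
    case (elim n)
    then have "0 < z n - \<mu> n" using \<mu>[of n] by (simp add: w_def zero_less_divide_iff)
    then show ?case using \<mu>[of n] by linarith
  qed
  have vw: "\<forall>\<^sub>F n in sequentially. w n \<le> v n \<and> v n \<le> w n + 1 / sqrt (\<mu> n)"
    using zpos
  proof eventually_elim
    case (elim n)
    then have "real (a n) = of_int \<lfloor>z n\<rfloor> + 1" unfolding a_def by simp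
    then have "z n - \<mu> n \<le> real (a n) - \<mu> n" "real (a n) - \<mu> n \<le> z n - \<mu> n + 1" by linarith+
    then show ?case unfolding w_def v_def add_divide_distrib[symmetric]
      using \<mu>[of n] by (intro conjI divide_right_mono) auto
  qed
  note p = moderate_perturb[OF w w3 rw \<rho> \<mu> vw]
  have up: "(\<lambda>n. (\<Sum>m\<in>{a n..t n}. Bernstein (t n) m (\<rho> n)) * (sqrt (2 * pi) * v n * exp ((v n)\<^sup>2
      / 2))) \<longlonglongrightarrow> 1"
    using upper_tail_from_integer[of a t \<rho>] p(1-3) \<rho> \<mu> unfolding v_def \<mu>_def by blast
  have "\<forall>\<^sub>F n in sequentially. (\<Sum>m\<in>{a n..t n}. Bernstein (t n) m (\<rho> n)) = (\<Sum>m | m \<le> t n \<and> z n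
      < real m. Bernstein (t n) m (\<rho> n))"
    using zpos
  proof eventually_elim
    case (elim n)
    have *: "a n \<le> m \<longleftrightarrow> z n < real m" for m
    proof -
      have "a n \<le> m \<longleftrightarrow> \<lfloor>z n\<rfloor> + 1 \<le> int m" unfolding a_def by (simp add: nat_le_iff)
      also have "\<dots> \<longleftrightarrow> z n < real m" by linarith
      finally show ?thesis .
    qed
    have "{a n..t n} = {m. m \<le> t n \<and> a n \<le> m}" by auto
    then have "{a n..t n} = {m. m \<le> t n \<and> z n < real m}" unfolding * .
    then show ?case by simp
  qed
  then have "\<forall>\<^sub>F n in sequentially. (\<Sum>m\<in>{a n..t n}. Bernstein (t n) m (\<rho> n)) * (sqrt (2 * pi) * v n
      * exp ((v n)\<^sup>2 / 2)) =
     (\<Sum>m | m \<le> t n \<and> z n < real m. Bernstein (t n) m (\<rho> n)) * (sqrt (2 * pi) * v n * exp ((v n)\<^sup>2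
         / 2))"
    by eventually_elim simp
  from p(4)[OF Lim_transform_eventually[OF up this]] show ?thesis .
qed

lemma binomial_lower_tail:
  fixes t :: "nat \<Rightarrow> nat" and \<rho> z :: "nat \<Rightarrow> real"
  defines "\<mu> \<equiv> \<lambda>n. real (t n) * \<rho> n"
  defines "w \<equiv> \<lambda>n. (\<mu> n - z n) / sqrt (\<mu> n)"
  assumes w: "filterlim w at_top sequentially" and w3: "(\<lambda>n. w n ^ 3 / sqrt (\<mu> n)) \<longlonglongrightarrow> 0"
    and rw: "(\<lambda>n. \<rho> n * (w n)\<^sup>2) \<longlonglongrightarrow> 0" and \<rho>: "\<And>n. 0 < \<rho> n" and \<mu>: "\<And>n. 0 < \<mu> n"
  shows "(\<lambda>n. (\<Sum>m | m \<le> t n \<and> real m < z n. Bernstein (t n) m (\<rho> n)) * (sqrt (2 * pi) * w n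
      * exp ((w n)\<^sup>2 / 2))) \<longlonglongrightarrow> 1"
proof -
  define a where "a n = nat (\<lceil>z n\<rceil> - 1)" for n
  define v where "v n = (\<mu> n - real (a n)) / sqrt (\<mu> n)" for n
  note sc = moderate_scales[OF w w3 rw \<rho> \<mu>]
  have w0: "\<forall>\<^sub>F n in sequentially. 0 < w n" using w unfolding filterlim_at_top_dense by blast
  have w1: "\<forall>\<^sub>F n in sequentially. w n / sqrt (\<mu> n) < 1" using sc(2) by (rule order_tendstoD) simp
  have r1: "\<forall>\<^sub>F n in sequentially. \<rho> n < 1" using sc(4) by (rule order_tendstoD) simp
  have zpos: "\<forall>\<^sub>F n in sequentially. 0 < z n \<and> z n < real (t n)"
    using w0 w1 r1
  proof eventually_elim
    case (elim n)
    have "w n / sqrt (\<mu> n) = (\<mu> n - z n) / \<mu> n" using \<mu>[of n] by (simp add: w_def)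
    then have "\<mu> n - z n < \<mu> n" using elim \<mu>[of n] by (simp add: pos_divide_less_eq)
    moreover have "0 < \<mu> n - z n" using elim \<mu>[of n] by (simp add: w_def zero_less_divide_iff)
    moreover have "\<mu> n \<le> real (t n)" unfolding \<mu>_def using elim \<rho>[of n] by (simp add: mult_left_le)
    ultimately show ?case by linarith
  qed
  have vw: "\<forall>\<^sub>F n in sequentially. w n \<le> v n \<and> v n \<le> w n + 1 / sqrt (\<mu> n)"
    using zpos
  proof eventually_elim
    case (elim n)
    then have "real (a n) = of_int \<lceil>z n\<rceil> - 1" unfolding a_def by simp
    then have "\<mu> n - z n \<le> \<mu> n - real (a n)" "\<mu> n - real (a n) \<le> \<mu> n - z n + 1" by linarith+
    then show ?case unfolding w_def v_def add_divide_distrib[symmetric]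
      using \<mu>[of n] by (intro conjI divide_right_mono) auto
  qed
  note p = moderate_perturb[OF w w3 rw \<rho> \<mu> vw]
  have lo: "(\<lambda>n. (\<Sum>m\<le>a n. Bernstein (t n) m (\<rho> n)) * (sqrt (2 * pi) * v n * exp ((v n)\<^sup>2 / 2))) \<longlonglongrightarrow> 1"
    using lower_tail_from_integer[of t \<rho> a] p(1-3) \<rho> \<mu> unfolding v_def \<mu>_def by blast
  have "\<forall>\<^sub>F n in sequentially. (\<Sum>m\<le>a n. Bernstein (t n) m (\<rho> n)) = (\<Sum>m | m \<le> t n \<and> real m
      < z n. Bernstein (t n) m (\<rho> n))"
    using zpos
  proof eventually_elim
    case (elim n)
    have *: "m \<le> a n \<longleftrightarrow> m \<le> t n \<and> real m < z n" for m
    proof -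
      have "m \<le> a n \<longleftrightarrow> int m \<le> \<lceil>z n\<rceil> - 1" unfolding a_def using elim by (simp add: le_nat_iff)
      also have "\<dots> \<longleftrightarrow> real m < z n" by linarith
      also have "\<dots> \<longleftrightarrow> m \<le> t n \<and> real m < z n" using elim by linarith
      finally show ?thesis .
    qed
    have "{..a n} = {m. m \<le> t n \<and> real m < z n}" unfolding atMost_def * ..
    then show ?case by simp
  qed
  then have "\<forall>\<^sub>F n in sequentially. (\<Sum>m\<le>a n. Bernstein (t n) m (\<rho> n)) * (sqrt (2 * pi) * v n
      * exp ((v n)\<^sup>2 / 2)) =
     (\<Sum>m | m \<le> t n \<and> real m < z n. Bernstein (t n) m (\<rho> n)) * (sqrt (2 * pi) * v n * exp ((v n)\<^sup>2
         / 2))"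
    by eventually_elim simp
  from p(4)[OF Lim_transform_eventually[OF lo this]] show ?thesis .
qed

section \<open>Smooth bumps and test functions\<close>

definition smooth :: "(real \<Rightarrow> real) \<Rightarrow> bool" where
  "smooth f \<longleftrightarrow> (\<forall>m x. (deriv ^^ m) f differentiable (at x))"

text \<open>
  Iterating differentiation never leaves a family that is closed under it.
\<close>

lemma smooth_family:
  assumes "f \<in> \<F>" "\<And>f. f \<in> \<F> \<Longrightarrow> \<exists>f'\<in>\<F>. \<forall>x. (f has_field_derivative f' x) (at x)"
  shows "smooth f"
  unfolding smooth_def
proof (intro allI)
  fix m x
  have "(deriv ^^ m) f \<in> \<F>"
  proof (induction m)
    case (Suc m)
    obtain f' where f': "f' \<in> \<F>" "\<forall>x. ((deriv ^^ m) f has_field_derivative f' x) (at x)"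
        using assms(2)[OF Suc] by blast
    then have "deriv ((deriv ^^ m) f) = f'" by (auto intro!: DERIV_imp_deriv)
    then show ?case using f' by simp
  qed (simp add: assms)
  then obtain f' where "\<forall>x. ((deriv ^^ m) f has_field_derivative f' x) (at x)" using assms(2)
      by blast
  then show "(deriv ^^ m) f differentiable (at x)" using real_differentiable_def by blast
qed

lemma smooth_antiderivative:
  assumes "\<And>x. (f has_field_derivative f' x) (at x)" "smooth f'"
  shows "smooth f"
  unfolding smooth_def
proof (intro allI)
  fix m x
  have d: "deriv f = f'" using assms(1) by (auto intro!: DERIV_imp_deriv)
  show "(deriv ^^ m) f differentiable (at x)"
  proof (cases m)
    case 0
    then show ?thesis using assms(1) by (auto simp: real_differentiable_def)
  next
    case (Suc k)
    then show ?thesis using assms(2) d by (simp add: smooth_def funpow_Suc_right del: funpow.simps)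
  qed
qed

lemma smooth_affine:
  assumes "smooth f"
  shows "smooth (\<lambda>z. a * f (b * z + c))"
proof -
  have d: "((deriv ^^ m) f has_field_derivative (deriv ^^ Suc m) f x) (at x)" for m x
    using assms by (simp add: smooth_def DERIV_deriv_iff_real_differentiable)
  show ?thesis
  proof (rule smooth_family[where \<F> = "{\<lambda>z. a' * (deriv ^^ m) f (b * z + c) | a' m. True}"])
    show "(\<lambda>z. a * f (b * z + c)) \<in> {\<lambda>z. a' * (deriv ^^ m) f (b * z + c) | a' m. True}"
      by (intro CollectI exI[of _ a] exI[of _ 0]) simp
  next
    fix g assume "g \<in> {\<lambda>z. a' * (deriv ^^ m) f (b * z + c) | a' m. True}"
    then obtain a' m where g: "g = (\<lambda>z. a' * (deriv ^^ m) f (b * z + c))" by blast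
    have "(g has_field_derivative (a' * b) * (deriv ^^ Suc m) f (b * z + c)) (at z)" for z
    proof -
      have "((\<lambda>z. (deriv ^^ m) f (b * z + c)) has_field_derivative (deriv ^^ Suc m) f (b * z + c)
          * b) (at z)"
        by (rule DERIV_chain'[OF _ d]) (auto intro!: derivative_eq_intros)
      then show ?thesis unfolding g using DERIV_cmult[of _ _ z UNIV a'] by (fastforce simp: mult_ac)
    qed
    then show "\<exists>g'\<in>{\<lambda>z. a' * (deriv ^^ m) f (b * z + c) | a' m. True}. \<forall>z. (g has_field_derivative
        g' z) (at z)"
      by (intro bexI[of _ "\<lambda>z. (a' * b) * (deriv ^^ Suc m) f (b * z + c)"]) blast+
  qed
qed

lemma smooth_diff:
  assumes "smooth f" "smooth g"
  shows "smooth (\<lambda>x. f x - g x)"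
proof -
  have d: "((deriv ^^ m) h has_field_derivative (deriv ^^ Suc m) h x) (at x)" if "smooth h"
      for h m x
    using that by (simp add: smooth_def DERIV_deriv_iff_real_differentiable)
  show ?thesis
  proof (rule smooth_family[where \<F> = "{\<lambda>z. (deriv ^^ m) f z - (deriv ^^ m) g z | m. True}"])
    show "(\<lambda>x. f x - g x) \<in> {\<lambda>z. (deriv ^^ m) f z - (deriv ^^ m) g z | m. True}"
      by (intro CollectI exI[of _ 0]) simp
  next
    fix h assume "h \<in> {\<lambda>z. (deriv ^^ m) f z - (deriv ^^ m) g z | m. True}"
    then obtain m where h: "h = (\<lambda>z. (deriv ^^ m) f z - (deriv ^^ m) g z)" by blast
    have "(h has_field_derivative (deriv ^^ Suc m) f z - (deriv ^^ Suc m) g z) (at z)" for z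
      unfolding h by (intro DERIV_diff d assms)
    then show "\<exists>h'\<in>{\<lambda>z. (deriv ^^ m) f z - (deriv ^^ m) g z | m. True}. \<forall>z. (h has_field_derivative
        h' z) (at z)"
      by (intro bexI[of _ "\<lambda>z. (deriv ^^ Suc m) f z - (deriv ^^ Suc m) g z"]) blast+
  qed
qed

text \<open>
  The standard bump is the case \<open>p = 1\<close>, \<open>k = 0\<close>. The rational factor in front is what
  differentiation produces, and with it the family is closed under differentiation.
\<close>

definition bump_family :: "real poly \<Rightarrow> nat \<Rightarrow> real \<Rightarrow> real" where
  "bump_family p k x = (if 0 < x \<and> x < 1 then poly p x / (x * (1 - x)) ^ k * exp (- 1
      / (x * (1 - x))) else 0)"

lemma power_div_fact_le_exp: "0 \<le> x \<Longrightarrow> x ^ n / fact n \<le> exp (x::real)"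
proof -
  assume x: "0 \<le> x"
  have s: "(\<lambda>n. x ^ n / fact n) sums exp x" using exp_converges[of x]
      by (simp add: divide_inverse mult.commute)
  have "(\<Sum>i\<in>{n}. x ^ i / fact i) \<le> (\<Sum>i. x ^ i / fact i)"
    using s x by (intro sum_le_suminf) (auto simp: sums_iff)
  then show ?thesis using s by (simp add: sums_iff)
qed

text \<open>
  The exponential beats every power of \<open>1 / (x * (1 - x))\<close>. The square on the right makes the
  function differentiable, with derivative 0, at the two ends of its support.
\<close>

lemma bump_family_bound: "\<exists>B. \<forall>x. \<bar>bump_family p k x\<bar> \<le> B * (x * (1 - x))\<^sup>2"
proof -
  have "compact (poly p ` {0..1})" by (intro compact_continuous_image continuous_intros) auto
  then obtain P where P: "\<And>x. x \<in> {0..1} \<Longrightarrow> \<bar>poly p x\<bar> \<le> P"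
    by (metis bounded_iff compact_imp_bounded imageI real_norm_def)
  have P0: "0 \<le> P" using P[of 0] by force
  have "\<bar>bump_family p k x\<bar> \<le> P * fact (k + 2) * (x * (1 - x))\<^sup>2" for x
  proof (cases "0 < x \<and> x < 1")
    case True
    define w where "w = x * (1 - x)"
    have w: "w > 0" using True by (simp add: w_def)
    define F where "F = (fact (k + 2) :: real)"
    have F: "F > 0" by (simp add: F_def)
    have "(1 / w) ^ (k + 2) / F \<le> exp (1 / w)"
      unfolding F_def using w by (intro power_div_fact_le_exp) simp
    then have "1 / w ^ (k + 2) / F \<le> exp (1 / w)" by (simp add: power_divide)
    moreover have "1 / E \<le> F * W" if "1 / W / F \<le> E" "W > 0" "E > 0" for W E
      using that F by (simp add: field_simps)
    ultimately have "1 / exp (1 / w) \<le> F * w ^ (k + 2)" using w by simp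
    then have "exp (- (1 / w)) \<le> (F * w\<^sup>2) * w ^ k"
      by (simp add: exp_minus inverse_eq_divide power_add mult_ac power2_eq_square)
    then have "exp (- (1 / w)) / w ^ k \<le> F * w\<^sup>2"
      using w by (simp add: pos_divide_le_eq)
    then have "\<bar>poly p x\<bar> * (exp (- (1 / w)) / w ^ k) \<le> P * (F * w\<^sup>2)"
      using P[of x] True w by (intro mult_mono) auto
    moreover have "\<bar>bump_family p k x\<bar> = \<bar>poly p x\<bar> * (exp (- (1 / w)) / w ^ k)"
      using True w by (simp add: bump_family_def w_def[symmetric] abs_mult)
    ultimately show ?thesis by (simp add: w_def F_def mult.assoc)
  qed (use P0 in \<open>auto simp: bump_family_def\<close>)
  then show ?thesis by blast
qed

lemma bump_family_derivative:
  "(bump_family p k has_field_derivative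
     bump_family (pderiv p * [:0, 1, -1:]\<^sup>2 - smult (real k) (p * [:1, -2:] * [:0, 1, -1:]) + p
         * [:1, -2:]) (k + 2) x) (at x)"
  (is "(_ has_field_derivative bump_family ?q _ _) _")
proof -
  consider "0 < x \<and> x < 1" | "x < 0 \<or> x > 1" | "x = 0 \<or> x = 1" by linarith
  then show ?thesis
  proof cases
    case 1
    define w where "w y = y * (1 - y)" for y :: real
    have w: "w x > 0" using 1 by (simp add: w_def)
    have dw: "(w has_field_derivative 1 - 2 * x) (at x)"
      unfolding w_def by (auto intro!: derivative_eq_intros)
    have d1: "((\<lambda>y. poly p y / w y ^ k) has_field_derivative
        (poly (pderiv p) x * w x ^ k - poly p x * (real k * w x ^ (k - 1) * (1 - 2 * x))) / (w x ^ k
            * w x ^ k)) (at x)"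
      using w by (auto intro!: derivative_eq_intros dw simp: mult_ac)
    have d2: "((\<lambda>y. exp (- 1 / w y)) has_field_derivative exp (- 1 / w x) * ((1 - 2 * x)
        / (w x * w x))) (at x)"
    proof -
      have "((\<lambda>y. - 1 / w y) has_field_derivative (0 * w x - - 1 * (1 - 2 * x)) / (w x * w x))
          (at x)"
        using w by (intro DERIV_divide DERIV_const dw) simp
      then show ?thesis using DERIV_fun_exp by fastforce
    qed
    have "((\<lambda>y. poly p y / w y ^ k * exp (- 1 / w y)) has_field_derivative
        ((poly (pderiv p) x * w x ^ k - poly p x * (real k * w x ^ (k - 1) * (1 - 2 * x)))
            / (w x ^ k * w x ^ k)) * exp (- 1 / w x)
        + (exp (- 1 / w x) * ((1 - 2 * x) / (w x * w x))) * (poly p x / w x ^ k)) (at x)"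
      by (rule DERIV_mult[OF d1 d2])
    moreover have "((poly (pderiv p) x * w x ^ k - poly p x * (real k * w x ^ (k - 1)
        * (1 - 2 * x))) / (w x ^ k * w x ^ k)) * exp (- 1 / w x)
        + (exp (- 1 / w x) * ((1 - 2 * x) / (w x * w x))) * (poly p x / w x ^ k)
            = bump_family ?q (k + 2) x"
    proof -
      have q: "poly ?q x = poly (pderiv p) x * (w x)\<^sup>2 - real k * (poly p x * (1 - 2 * x) * w x)
          + poly p x * (1 - 2 * x)"
        by (simp add: w_def algebra_simps)
      have k: "real k * w x ^ (k - 1) = real k * w x ^ k / w x" using w by (cases k) auto
      have alg: "((a * W - b * (r * d)) / (W * W)) * E + (E * (d / (v * v))) * (b / W)
          = (a * v\<^sup>2 - c * (b * d * v) + b * d) / (W * v\<^sup>2) * E"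
        if "W \<noteq> 0" "v \<noteq> 0" "r = c * W / v" for a b c d r W v E :: real
        unfolding that(3) using that(1,2) by (simp add: field_simps power2_eq_square)
      have "bump_family ?q (k + 2) x = poly ?q x / (w x ^ k * (w x)\<^sup>2) * exp (- 1 / w x)"
        using 1 unfolding bump_family_def w_def by (simp only: power_add simp_thms if_True)
      then show ?thesis unfolding q by (simp only: alg[OF _ _ k] power_not_zero less_imp_neq[OF w,
          THEN not_sym] simp_thms not_False_eq_True)
    qed
    ultimately have "((\<lambda>y. poly p y / w y ^ k * exp (- 1 / w y)) has_field_derivative bump_family ?q
        (k + 2) x) (at x)" by simp
    then show ?thesis
      by (rule has_field_derivative_transform_within_open[where S = "{0<..<1}"]) (use 1 in \<open>auto
          simp: bump_family_def w_def\<close>)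
  next
    case 2
    have "((\<lambda>y. 0) has_field_derivative 0) (at x)" by simp
    then have "(bump_family p k has_field_derivative 0) (at x)"
      by (rule has_field_derivative_transform_within_open[where S = "{..<0} \<union> {1<..}"]) (use 2 in
          \<open>auto simp: bump_family_def\<close>)
    moreover have "bump_family q j x = 0" for q j using 2 by (auto simp: bump_family_def)
    ultimately show ?thesis by (simp only:)
  next
    case 3
    obtain B where B: "\<And>x. \<bar>bump_family p k x\<bar> \<le> B * (x * (1 - x))\<^sup>2" using bump_family_bound
        by blast
    have B0: "0 \<le> B" 
    proof -
      have "0 \<le> B * (1 / 2 * (1 - 1 / 2))\<^sup>2" using B[of "1/2"] abs_ge_zero
          by (rule order_trans[rotated])
      then show ?thesis by (simp add: zero_le_mult_iff)
    qed
    have lim: "((\<lambda>y. (bump_family p k y - bump_family p k x) / (y - x)) \<longlongrightarrow> 0) (at x)"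
    proof (rule Lim_null_comparison)
      show "\<forall>\<^sub>F y in at x. norm ((bump_family p k y - bump_family p k x) / (y - x))
          \<le> 4 * B * \<bar>y - x\<bar>"
        unfolding eventually_at
      proof (intro exI conjI ballI impI)
        show "0 < (1::real)" by simp
        fix y assume "y \<noteq> x \<and> dist y x < 1"
        then have y: "\<bar>y - x\<bar> < 1" by (simp add: dist_real_def)
        have "\<bar>y * (1 - y)\<bar> \<le> 2 * \<bar>y - x\<bar>"
        proof -
          have "\<bar>y\<bar> * \<bar>1 - y\<bar> \<le> 2 * \<bar>y - x\<bar>"
            using 3
          proof
            assume "x = 0"
            then have "\<bar>y\<bar> * \<bar>1 - y\<bar> \<le> \<bar>y\<bar> * 2" using y by (intro mult_left_mono) auto
            then show ?thesis using \<open>x = 0\<close> by simp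
          next
            assume "x = 1"
            then have "\<bar>y\<bar> * \<bar>1 - y\<bar> \<le> 2 * \<bar>1 - y\<bar>" using y by (intro mult_right_mono) auto
            then show ?thesis using \<open>x = 1\<close> by (simp add: abs_minus_commute)
          qed
          then show ?thesis by (simp add: abs_mult)
        qed
        then have "(y * (1 - y))\<^sup>2 \<le> (2 * \<bar>y - x\<bar>)\<^sup>2" by (metis abs_ge_zero power2_abs power_mono)
        then have "\<bar>bump_family p k y\<bar> \<le> B * (4 * \<bar>y - x\<bar>\<^sup>2)"
          using B[of y] B0 mult_left_mono[of "(y * (1 - y))\<^sup>2" "(2 * \<bar>y - x\<bar>)\<^sup>2" B]
              by (simp add: power_mult_distrib)
        moreover have "bump_family p k x = 0" using 3 by (auto simp: bump_family_def)
        ultimately show "norm ((bump_family p k y - bump_family p k x) / (y - x)) \<le> 4 * B * \<bar>y - x\<bar>"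
        proof -
          have "B * (4 * \<bar>y - x\<bar>\<^sup>2) = (4 * B * \<bar>y - x\<bar>) * \<bar>y - x\<bar>"
              by (simp only: power2_eq_square mult_ac)
          then have "\<bar>bump_family p k y\<bar> / \<bar>y - x\<bar> \<le> 4 * B * \<bar>y - x\<bar>"
            using \<open>\<bar>bump_family p k y\<bar> \<le> B * (4 * \<bar>y - x\<bar>\<^sup>2)\<close> \<open>y \<noteq> x \<and> dist y x < 1\<close>
            by (simp only: pos_divide_le_eq[of "\<bar>y - x\<bar>"] zero_less_abs_iff right_minus_eq
                simp_thms)
          then show ?thesis using \<open>bump_family p k x = 0\<close> by simp
        qed
      qed
      show "((\<lambda>y. 4 * B * \<bar>y - x\<bar>) \<longlongrightarrow> 0) (at x)" by (auto intro!: tendsto_eq_intros)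
    qed
    have "(bump_family p k has_field_derivative 0) (at x)" using lim
        by (simp add: has_field_derivative_iff)
    moreover have "bump_family q j x = 0" for q j using 3 by (auto simp: bump_family_def)
    ultimately show ?thesis by (simp only:)
  qed
qed

lemma smooth_bump_family: "smooth (bump_family p k)"
  by (rule smooth_family[where \<F> = "range (\<lambda>(p, k). bump_family p k)"]) (use bump_family_derivative
      in \<open>force+\<close>)

definition bump :: "real \<Rightarrow> real" where
  "bump x = bump_family 1 0 x / integral {-1..2} (bump_family 1 0)"

definition smooth_step :: "real \<Rightarrow> real" where
  "smooth_step x = integral {-1..x} bump"

lemma bump_family_continuous: "continuous_on S (bump_family p k)"
  by (intro continuous_at_imp_continuous_on ballI DERIV_isCont[OF bump_family_derivative])

lemma bump_family_pos: "0 < integral {-1..2} (bump_family 1 0)"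
proof -
  let ?I = "integral {-1..2} (bump_family 1 0)"
  have nn: "0 \<le> bump_family 1 0 x" for x by (simp add: bump_family_def)
  have io: "bump_family 1 0 integrable_on {-1..2}"
      by (intro integrable_continuous_interval bump_family_continuous)
  have "0 \<le> ?I" using io nn by (intro integral_nonneg) auto
  moreover have "?I \<noteq> 0"
  proof
    assume "?I = 0"
    then have "bump_family 1 0 (1/2) = 0"
      using integral_eq_0_iff[of "-1" 2 "bump_family 1 0"] bump_family_continuous nn by auto
    then show False by (simp add: bump_family_def)
  qed
  ultimately show ?thesis by simp
qed

lemma bump_nonneg: "0 \<le> bump x"
  unfolding bump_def using bump_family_pos by (simp add: bump_family_def)

lemma bump_outside: "x \<le> 0 \<or> 1 \<le> x \<Longrightarrow> bump x = 0"
  by (auto simp: bump_def bump_family_def)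

lemma bump_continuous: "continuous_on S bump"
  unfolding bump_def[abs_def] using bump_family_pos
      by (intro continuous_intros bump_family_continuous) auto

lemma bump_integral: "integral {-1..2} bump = 1"
proof -
  have "integral {-1..2} bump = integral {-1..2} (\<lambda>x. bump_family 1 0 x * (1 / integral {-1..2}
      (bump_family 1 0)))"
    unfolding bump_def[abs_def] by simp
  also have "\<dots> = 1" unfolding integral_mult_left using bump_family_pos by simp
  finally show ?thesis .
qed

lemma smooth_bump: "smooth bump"
proof -
  have "bump = (\<lambda>z. (1 / integral {-1..2} (bump_family 1 0)) * bump_family 1 0 (1 * z + 0))"
    by (auto simp: bump_def)
  then show ?thesis using smooth_affine[OF smooth_bump_family] by metis
qed

lemma smooth_step_zero: "x \<le> 0 \<Longrightarrow> smooth_step x = 0"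
proof -
  assume "x \<le> 0"
  then have "integral {-1..x} bump = integral {-1..x} (\<lambda>_. 0)"
      by (intro integral_cong bump_outside) auto
  then show ?thesis by (simp add: smooth_step_def)
qed

lemma smooth_step_one: "1 \<le> x \<Longrightarrow> smooth_step x = 1"
proof -
  assume x: "1 \<le> x"
  have i: "bump integrable_on {a..b}" for a b
      by (intro integrable_continuous_interval bump_continuous)
  have z: "integral {1..b} bump = 0" for b
  proof -
    have "integral {1..b} bump = integral {1..b} (\<lambda>_. 0)" by (intro integral_cong bump_outside) auto
    then show ?thesis by simp
  qed
  have "integral {-1..1} bump + integral {1..x} bump = integral {-1..x} bump"
    using x i by (intro Henstock_Kurzweil_Integration.integral_combine) auto
  moreover have "integral {-1..1} bump + integral {1..2} bump = integral {-1..2} bump"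
    using i by (intro Henstock_Kurzweil_Integration.integral_combine) auto
  ultimately show ?thesis using z bump_integral by (simp add: smooth_step_def)
qed

lemma smooth_step_derivative: "(smooth_step has_field_derivative bump x) (at x)"
proof (cases "x < 0")
  case True
  have "((\<lambda>_. 0) has_field_derivative 0) (at x)" by simp
  then have "(smooth_step has_field_derivative 0) (at x)"
    by (rule has_field_derivative_transform_within_open[where S = "{..<0}"]) (use True in \<open>auto
        simp: smooth_step_zero\<close>)
  then show ?thesis using True by (simp add: bump_outside)
next
  case False
  have "((\<lambda>u. integral {-1..u} bump) has_field_derivative bump x) (at x within {-1..x+1})"
    using integral_has_real_derivative[OF bump_continuous, of x "-1" "x + 1"] False by simp
  moreover have "at x within {-1..x+1} = at x" using False by (intro at_within_Icc_at) auto
  ultimately show ?thesis unfolding smooth_step_def[abs_def] by simp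
qed

lemma smooth_step_mono: "x \<le> y \<Longrightarrow> smooth_step x \<le> smooth_step y"
  by (rule DERIV_nonneg_imp_nondecreasing) (use smooth_step_derivative bump_nonneg in blast)+

lemma smooth_step_range: "0 \<le> smooth_step x" "smooth_step x \<le> 1"
proof -
  show "0 \<le> smooth_step x" using smooth_step_mono[of 0 x] smooth_step_zero[of x] smooth_step_zero[of
      0] by (cases "x \<le> 0") auto
  show "smooth_step x \<le> 1" using smooth_step_mono[of x 1] smooth_step_one[of x] smooth_step_one[of
      1] by (cases "x \<ge> 1") auto
qed

text \<open>
  Rises from 0 to 1 on the interval from \<open>a\<close> to \<open>a + 1 / r\<close> and falls back to 0 between \<open>b\<close> and
  \<open>b + 1 / r\<close>; for large \<open>r\<close> it is a smoothed indicator of the interval from \<open>a\<close> to \<open>b\<close>.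
\<close>

definition plateau :: "real \<Rightarrow> real \<Rightarrow> real \<Rightarrow> real \<Rightarrow> real" where
  "plateau r a b z = smooth_step (r * (z - a)) - smooth_step (r * (z - b))"

text \<open>
  The derivative of the plateau: approximate unit point masses at \<open>a\<close> and, with negative sign, at
  \<open>b\<close>.
\<close>

definition dipole :: "real \<Rightarrow> real \<Rightarrow> real \<Rightarrow> real \<Rightarrow> real" where
  "dipole r a b z = r * bump (r * (z - a)) - r * bump (r * (z - b))"

lemma plateau_derivative: "(plateau r a b has_field_derivative dipole r a b z) (at z)"
  unfolding plateau_def[abs_def] dipole_def
proof (rule DERIV_diff)
  have "((\<lambda>z. smooth_step (r * (z - a))) has_field_derivative bump (r * (z - a)) * r) (at z)" for a
    by (rule DERIV_chain'[OF _ smooth_step_derivative]) (auto intro!: derivative_eq_intros)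
  then show "((\<lambda>z. smooth_step (r * (z - a))) has_field_derivative r * bump (r * (z - a))) (at z)"
    "((\<lambda>z. smooth_step (r * (z - b))) has_field_derivative r * bump (r * (z - b))) (at z)"
        by (simp_all add: mult.commute)
qed

lemma smooth_plateau: "smooth (plateau r a b)"
proof (rule smooth_antiderivative[OF plateau_derivative])
  have "dipole r a b = (\<lambda>z. r * bump (r * z + (- r * a)) - r * bump (r * z + (- r * b)))"
    by (auto simp: dipole_def algebra_simps)
  then show "smooth (dipole r a b)"
      using smooth_diff[OF smooth_affine[OF smooth_bump] smooth_affine[OF smooth_bump]] by metis
qed

lemma plateau_bounds: "0 < r \<Longrightarrow> a \<le> b \<Longrightarrow> 0 \<le> plateau r a b z \<and> plateau r a b z \<le> 1"
  unfolding plateau_def using smooth_step_mono[of "r * (z - b)" "r * (z - a)"] smooth_step_range[of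
      "r * (z - a)"] smooth_step_range[of "r * (z - b)"]
  by auto

lemma plateau_outside: "0 < r \<Longrightarrow> a \<le> b \<Longrightarrow> z \<le> a \<or> b + 1 / r \<le> z \<Longrightarrow> plateau r a b z = 0"
proof -
  assume r: "0 < r" "a \<le> b" and z: "z \<le> a \<or> b + 1 / r \<le> z"
  from z show ?thesis
  proof
    assume "z \<le> a"
    then have "r * (z - a) \<le> 0" "r * (z - b) \<le> 0" using r by (auto intro!: mult_nonneg_nonpos)
    then show ?thesis by (simp add: plateau_def smooth_step_zero)
  next
    assume "b + 1 / r \<le> z"
    then have "1 \<le> r * (z - b)" using r by (simp add: field_simps)
    moreover have "r * (z - b) \<le> r * (z - a)" using r by (intro mult_left_mono) auto
    ultimately have "1 \<le> r * (z - b)" "1 \<le> r * (z - a)" by linarith+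
    then show ?thesis by (simp add: plateau_def smooth_step_one)
  qed
qed

lemma test_function_smooth_affine:
  assumes "test_function \<eta>" "b \<noteq> 0"
  shows "test_function (\<lambda>z. \<eta> (b * z + c))"
proof -
  obtain R where R: "\<And>x. R < \<bar>x\<bar> \<Longrightarrow> \<eta> x = 0" using assms(1) by (auto simp: test_function_def)
  have "smooth (\<lambda>z. 1 * \<eta> (b * z + c))" by (rule smooth_affine) (use assms(1) in \<open>auto simp:
      smooth_def test_function_def\<close>)
  moreover have "\<eta> (b * z + c) = 0" if "(\<bar>R\<bar> + \<bar>c\<bar>) / \<bar>b\<bar> < \<bar>z\<bar>" for z
  proof (rule R)
    have "\<bar>R\<bar> + \<bar>c\<bar> < \<bar>b * z\<bar>" using that assms(2)
        by (simp add: pos_divide_less_eq abs_mult mult.commute)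
    then show "R < \<bar>b * z + c\<bar>" by linarith
  qed
  ultimately show ?thesis unfolding test_function_def smooth_def by auto
qed

lemma test_function_plateau: "0 < r \<Longrightarrow> a \<le> b \<Longrightarrow> test_function (plateau r a b)"
proof -
  assume r: "0 < r" "a \<le> b"
  have "plateau r a b z = 0" if "\<bar>a\<bar> + \<bar>b + 1 / r\<bar> < \<bar>z\<bar>" for z
    using that by (intro plateau_outside r) linarith
  then show ?thesis using smooth_plateau unfolding test_function_def smooth_def by blast
qed

lemma plateau_borel[measurable]: "plateau r a b \<in> borel_measurable borel"
  by (intro borel_measurable_continuous_onI continuous_at_imp_continuous_on ballI DERIV_isCont[OF
      plateau_derivative])

lemma bump_borel[measurable]: "bump \<in> borel_measurable borel"
  by (intro borel_measurable_continuous_onI bump_continuous)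

lemma bump_lborel: "has_bochner_integral lborel bump 1"
proof -
  have "set_integrable lborel {-1..2} bump"
      by (rule borel_integrable_atLeastAtMost') (rule bump_continuous)
  moreover have e: "indicat_real {-1..2} x *\<^sub>R bump x = bump x" for x
    using bump_outside[of x] by (cases "x \<le> 0 \<or> 1 \<le> x") (auto simp: indicator_def)
  ultimately have i: "integrable lborel bump" by (simp only: set_integrable_def)
  have "(LINT x:{-1..2}|lborel. bump x) = integral {-1..2} bump"
    by (rule set_borel_integral_eq_integral(2)) fact
  then have "(LINT x|lborel. bump x) = 1" unfolding set_lebesgue_integral_def e bump_integral
      by simp
  then show ?thesis using i by (simp add: has_bochner_integral_iff)
qed

lemma scaled_bump_lborel:
  assumes "0 < r" shows "has_bochner_integral lborel (\<lambda>z. r * bump (r * (z - a))) 1"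
proof -
  have e: "r * (z - a) = - (r * a) + r * z" for z by (simp add: algebra_simps)
  have "integrable lborel (\<lambda>z. bump (- (r * a) + r * z))"
    using lborel_integrable_real_affine_iff[of r bump "- (r * a)"] bump_lborel assms
        by (simp add: has_bochner_integral_iff)
  moreover have "(LINT x|lborel. bump x) = r * (LINT x|lborel. bump (- (r * a) + r * x))"
    using lborel_integral_real_affine[of r bump "- (r * a)"] assms by simp
  ultimately show ?thesis using bump_lborel by (simp add: has_bochner_integral_iff e)
qed

lemma dipole_L1: 
  assumes "0 < r" shows "integrable lborel (dipole r a b)" "(LINT z|lborel. \<bar>dipole r a b z\<bar>) \<le> 2"
proof -
  note i = scaled_bump_lborel[OF assms]
  show int: "integrable lborel (dipole r a b)"
    unfolding dipole_def[abs_def] using i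
        by (auto simp: has_bochner_integral_iff intro!: Bochner_Integration.integrable_diff)
  have "(LINT z|lborel. \<bar>dipole r a b z\<bar>) \<le> (LINT z|lborel. r * bump (r * (z - a)) + r * bump (r
      * (z - b)))"
  proof (rule integral_mono)
    show "integrable lborel (\<lambda>z. r * bump (r * (z - a)) + r * bump (r * (z - b)))"
      using i by (auto simp: has_bochner_integral_iff intro!: Bochner_Integration.integrable_add)
    show "\<bar>dipole r a b z\<bar> \<le> r * bump (r * (z - a)) + r * bump (r * (z - b))" for z
      unfolding dipole_def using bump_nonneg[of "r * (z - a)"] bump_nonneg[of "r * (z - b)"] assms
      by (intro order_trans[OF abs_triangle_ineq4]) (simp add: abs_mult)
  qed (use int in auto)
  also have "\<dots> = 2" using i[of a] i[of b] by (simp add: has_bochner_integral_iff)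
  finally show "(LINT z|lborel. \<bar>dipole r a b z\<bar>) \<le> 2" .
qed

section \<open>Square-integrable functions and orthonormal families\<close>

lemma L2_measurable[measurable_dest]: "f \<in> L2_fun \<Longrightarrow> f \<in> borel_measurable borel"
  by (simp add: L2_fun_def)

lemma L2_square_integrable: "f \<in> L2_fun \<Longrightarrow> integrable lborel (\<lambda>x. (f x)\<^sup>2)"
  by (simp add: L2_fun_def)

lemma L2_mult_integrable:
  assumes "f \<in> L2_fun" "g \<in> L2_fun"
  shows "integrable lborel (\<lambda>x. f x * g x)"
proof (rule Bochner_Integration.integrable_bound)
  show "integrable lborel (\<lambda>x. (f x)\<^sup>2 + (g x)\<^sup>2)"
    using assms by (intro Bochner_Integration.integrable_add L2_square_integrable)
  show "(\<lambda>x. f x * g x) \<in> borel_measurable lborel" using assms by (simp add: L2_measurable)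
  have "\<bar>a * b\<bar> \<le> a\<^sup>2 + b\<^sup>2" for a b :: real
  proof -
    have "2 * (\<bar>a\<bar> * \<bar>b\<bar>) \<le> \<bar>a\<bar>\<^sup>2 + \<bar>b\<bar>\<^sup>2" using sum_squares_bound[of "\<bar>a\<bar>" "\<bar>b\<bar>"] by simp
    moreover have "0 \<le> \<bar>a\<bar> * \<bar>b\<bar>" by simp
    ultimately show ?thesis unfolding abs_mult power2_abs by linarith
  qed
  then show "AE x in lborel. norm (f x * g x) \<le> norm ((f x)\<^sup>2 + (g x)\<^sup>2)" by simp
qed

lemma L2_add: 
  assumes "f \<in> L2_fun" "g \<in> L2_fun" shows "(\<lambda>x. f x + g x) \<in> L2_fun"
proof -
  have "integrable lborel (\<lambda>x. (f x)\<^sup>2 + (g x)\<^sup>2 + 2 * (f x * g x))"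
    using assms by (intro Bochner_Integration.integrable_add integrable_mult_right
        L2_square_integrable L2_mult_integrable)
  moreover have "(\<lambda>x. f x + g x) \<in> borel_measurable borel"
    using assms[THEN L2_measurable] by measurable
  ultimately show ?thesis by (simp add: L2_fun_def power2_sum mult.assoc)
qed

lemma L2_scale: "f \<in> L2_fun \<Longrightarrow> (\<lambda>x. c * f x) \<in> L2_fun"
  using borel_measurable_times[OF borel_measurable_const[of c] L2_measurable]
  by (simp add: L2_fun_def power_mult_distrib)

lemma L2_diff: "f \<in> L2_fun \<Longrightarrow> g \<in> L2_fun \<Longrightarrow> (\<lambda>x. f x - g x) \<in> L2_fun"
  using L2_add[of f "\<lambda>x. - 1 * g x"] L2_scale[of g "-1"] by simp

lemma L2_zero: "(\<lambda>x. 0) \<in> L2_fun" by (simp add: L2_fun_def)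

lemma L2_sum: "finite S \<Longrightarrow> (\<And>k. k \<in> S \<Longrightarrow> e k \<in> L2_fun) \<Longrightarrow> (\<lambda>x. \<Sum>k\<in>S. c k * e k x) \<in> L2_fun"
proof (induction S rule: finite_induct)
  case (insert k S)
  then have "(\<lambda>x. c k * e k x + (\<Sum>k\<in>S. c k * e k x)) \<in> L2_fun"
    by (intro L2_add L2_scale) auto
  then show ?case using insert by simp
qed (simp add: L2_zero)

lemma L2_inner_commute: "L2_inner f g = L2_inner g f"
  by (simp add: L2_inner_def mult.commute)

lemma L2_inner_diff_left:
  "f \<in> L2_fun \<Longrightarrow> g \<in> L2_fun \<Longrightarrow> h \<in> L2_fun \<Longrightarrow> L2_inner (\<lambda>x. f x - g x) h = L2_inner f h - L2_inner g h"
  by (simp add: L2_inner_def left_diff_distrib L2_mult_integrable)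

lemma L2_inner_sum_left:
  "finite S \<Longrightarrow> (\<And>k. k \<in> S \<Longrightarrow> e k \<in> L2_fun) \<Longrightarrow> h \<in> L2_fun \<Longrightarrow>
    L2_inner (\<lambda>x. \<Sum>k\<in>S. c k * e k x) h = (\<Sum>k\<in>S. c k * L2_inner (e k) h)"
  unfolding L2_inner_def
  by (simp add: sum_distrib_right mult.assoc L2_mult_integrable)

lemma L2_inner_nonneg: "0 \<le> L2_inner f f"
  by (simp add: L2_inner_def)

lemma L2_inner_self: "L2_inner f f = (LINT x|lborel. (f x)\<^sup>2)"
  by (simp add: L2_inner_def power2_eq_square)

lemma L2_Cauchy_Schwarz:
  assumes f: "f \<in> L2_fun" and g: "g \<in> L2_fun"
  shows "(L2_inner f g)\<^sup>2 \<le> L2_inner f f * L2_inner g g"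
proof -
  have "0 \<le> L2_inner f f - 2 * t * L2_inner f g + t\<^sup>2 * L2_inner g g" for t
  proof -
    have "0 \<le> L2_inner (\<lambda>x. f x - t * g x) (\<lambda>x. f x - t * g x)" by (rule L2_inner_nonneg)
    also have "\<dots> = (LINT x|lborel. (f x * f x - 2 * t * (f x * g x)) + t\<^sup>2 * (g x * g x))"
      unfolding L2_inner_def by (intro Bochner_Integration.integral_cong) (auto simp: algebra_simps
          power2_eq_square)
    also have "\<dots> = L2_inner f f - 2 * t * L2_inner f g + t\<^sup>2 * L2_inner g g"
      unfolding L2_inner_def using f g by (simp add: L2_mult_integrable)
    finally show ?thesis .
  qed
  note q = this
  show ?thesis
  proof (cases "L2_inner g g = 0")
    case True
    have "L2_inner f g = 0"
    proof (rule ccontr)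
      assume nz: "L2_inner f g \<noteq> 0"
      have "0 \<le> L2_inner f f - 2 * ((L2_inner f f + 1) / (2 * L2_inner f g)) * L2_inner f g"
        using q[of "(L2_inner f f + 1) / (2 * L2_inner f g)"] True by simp
      then show False using nz by simp
    qed
    then show ?thesis using True by simp
  next
    case False
    then have gp: "L2_inner g g > 0" using L2_inner_nonneg[of g] by linarith
    define a b c where "a = L2_inner f f" and "b = L2_inner f g" and "c = L2_inner g g"
    have "0 \<le> c * (a - 2 * (b / c) * b + (b / c)\<^sup>2 * c)"
      using q[of "b / c"] gp unfolding a_def b_def c_def by (intro mult_nonneg_nonneg) auto
    also have "\<dots> = a * c - b\<^sup>2" using gp unfolding c_def[symmetric]
        by (simp add: field_simps power2_eq_square)
    finally show ?thesis unfolding a_def b_def c_def by simp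
  qed
qed

lemma L2_Cauchy_Schwarz_abs:
  assumes "f \<in> L2_fun" "g \<in> L2_fun"
  shows "\<bar>L2_inner f g\<bar> \<le> sqrt (L2_inner f f) * sqrt (L2_inner g g)"
proof -
  have "\<bar>L2_inner f g\<bar> = sqrt ((L2_inner f g)\<^sup>2)" by simp
  also have "\<dots> \<le> sqrt (L2_inner f f * L2_inner g g)" using L2_Cauchy_Schwarz[OF assms]
      by (rule real_sqrt_le_mono)
  finally show ?thesis by (simp add: real_sqrt_mult)
qed

lemma lborel_translate_integral: "(LINT x|lborel. f (x + c)) = (LINT x|lborel. f x)"
    for f :: "real \<Rightarrow> real"
  using lborel_integral_real_affine[of 1 f c] by (simp add: add.commute)

lemma lborel_translate_integrable: "integrable lborel (\<lambda>x. f (x + c)) \<longleftrightarrow> integrable lborel f"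
    for f :: "real \<Rightarrow> real"
  using lborel_integrable_real_affine_iff[of 1 f c] by (simp add: add.commute)

lemma L2_translate: 
  assumes "f \<in> L2_fun" shows "(\<lambda>x. f (x - c)) \<in> L2_fun"
proof -
  have "integrable lborel (\<lambda>x. (f (x + (- c)))\<^sup>2)"
    using assms lborel_translate_integrable[of "\<lambda>x. (f x)\<^sup>2" "- c"] by (simp add: L2_fun_def)
  moreover have "(\<lambda>x. f (x - c)) \<in> borel_measurable borel" using L2_measurable[OF assms]
      by measurable
  ultimately show ?thesis by (simp add: L2_fun_def)
qed

locale orthonormal_family =
  fixes e :: "int \<Rightarrow> real \<Rightarrow> real"
  assumes L2: "\<And>k. e k \<in> L2_fun" and ortho: "\<And>k m. L2_inner (e k) (e m) = (if k = m then 1 else 0)"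
begin

lemma sum_inner: "finite S \<Longrightarrow> L2_inner (\<lambda>x. \<Sum>k\<in>S. c k * e k x) (e m) = (if m \<in> S then c m else 0)"
  by (simp add: L2_inner_sum_left L2 ortho if_distrib[of "\<lambda>x. _ * x"] cong: if_cong)

lemma sum_norm: 
  assumes "finite S" 
  shows "L2_inner (\<lambda>x. \<Sum>k\<in>S. c k * e k x) (\<lambda>x. \<Sum>k\<in>S. c k * e k x) = (\<Sum>k\<in>S. (c k)\<^sup>2)"
proof -
  have "L2_inner (\<lambda>x. \<Sum>k\<in>S. c k * e k x) (\<lambda>x. \<Sum>k\<in>S. c k * e k x) 
     = (\<Sum>k\<in>S. c k * L2_inner (\<lambda>x. \<Sum>k\<in>S. c k * e k x) (e k))"
    using assms by (subst L2_inner_sum_left) (auto intro: L2 L2_sum simp: L2_inner_commute[of "e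
        _"])
  also have "\<dots> = (\<Sum>k\<in>S. (c k)\<^sup>2)"
    using assms by (intro sum.cong) (simp_all add: sum_inner power2_eq_square)
  finally show ?thesis .
qed

lemma Bessel:
  assumes f: "f \<in> L2_fun" and S: "finite S"
  shows "(\<Sum>k\<in>S. (L2_inner f (e k))\<^sup>2) \<le> L2_inner f f"
proof -
  let ?s = "\<lambda>x. \<Sum>k\<in>S. L2_inner f (e k) * e k x"
  have s: "?s \<in> L2_fun" using S L2 by (intro L2_sum)
  have fs: "L2_inner f ?s = (\<Sum>k\<in>S. (L2_inner f (e k))\<^sup>2)"
    unfolding L2_inner_commute[of f ?s] using S f
    by (simp add: L2_inner_sum_left L2 power2_eq_square L2_inner_commute[of "e _" f])
  have "0 \<le> L2_inner (\<lambda>x. f x - ?s x) (\<lambda>x. f x - ?s x)" by (rule L2_inner_nonneg)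
  also have "\<dots> = L2_inner f f - L2_inner f ?s - (L2_inner f ?s - L2_inner ?s ?s)"
    using f s L2_diff[OF f s] by (simp add: L2_inner_diff_left L2_inner_commute[of f "\<lambda>x. f x
        - ?s x"] L2_inner_commute[of ?s "\<lambda>x. f x - ?s x"] L2_inner_commute[of ?s f])
  finally show ?thesis unfolding fs sum_norm[OF S] by simp
qed

lemma Bessel_summable:
  assumes "f \<in> L2_fun"
  shows "(\<lambda>k. (L2_inner f (e k))\<^sup>2) summable_on UNIV"
  by (rule nonneg_bdd_above_summable_on) (auto intro!: bdd_aboveI[of _ "L2_inner f f"] Bessel assms)

text \<open>
  Convergence in the mean is enough, by the Cauchy-Schwarz inequality.
\<close>

lemma expansion_inner:
  assumes h: "h \<in> L2_fun" and \<theta>: "\<theta> \<in> L2_fun"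
    and lim: "((\<lambda>S. LINT x|lborel. (h x - (\<Sum>k\<in>S. c k * e k x))\<^sup>2) \<longlongrightarrow> 0) (finite_subsets_at_top UNIV)"
  shows "((\<lambda>k. c k * L2_inner (e k) \<theta>) has_sum L2_inner h \<theta>) UNIV"
proof -
  let ?r = "\<lambda>S x. h x - (\<Sum>k\<in>S. c k * e k x)"
  have diff: "((\<lambda>S. L2_inner h \<theta> - (\<Sum>k\<in>S. c k * L2_inner (e k) \<theta>)) \<longlongrightarrow> 0) (finite_subsets_at_top
      UNIV)"
  proof (rule Lim_null_comparison)
    show "\<forall>\<^sub>F S in finite_subsets_at_top UNIV. norm (L2_inner h \<theta> - (\<Sum>k\<in>S. c k * L2_inner (e k) \<theta>))
        \<le> sqrt (LINT x|lborel. (?r S x)\<^sup>2) * sqrt (L2_inner \<theta> \<theta>)"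
    proof (rule eventually_finite_subsets_at_top_weakI)
      fix S :: "int set" assume S: "finite S"
      have s: "(\<lambda>x. \<Sum>k\<in>S. c k * e k x) \<in> L2_fun" using S L2 by (intro L2_sum)
      have "L2_inner h \<theta> - (\<Sum>k\<in>S. c k * L2_inner (e k) \<theta>) = L2_inner (?r S) \<theta>"
        using S by (simp add: L2_inner_diff_left[OF h s \<theta>] L2_inner_sum_left L2 \<theta>)
      then show "norm (L2_inner h \<theta> - (\<Sum>k\<in>S. c k * L2_inner (e k) \<theta>))
        \<le> sqrt (LINT x|lborel. (?r S x)\<^sup>2) * sqrt (L2_inner \<theta> \<theta>)"
        using L2_Cauchy_Schwarz_abs[OF L2_diff[OF h s] \<theta>] by (simp add: L2_inner_self)
    qed
    show "((\<lambda>S. sqrt (LINT x|lborel. (?r S x)\<^sup>2) * sqrt (L2_inner \<theta> \<theta>)) \<longlongrightarrow> 0) (finite_subsets_at_top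
        UNIV)"
      using tendsto_mult_left_zero[OF tendsto_real_sqrt[OF lim, simplified]] by simp
  qed
  show ?thesis
    unfolding has_sum_def using tendsto_diff[OF tendsto_const[of "L2_inner h \<theta>"] diff] by simp
qed

lemma expansion_coefficients:
  assumes h: "h \<in> L2_fun"
    and lim: "((\<lambda>S. LINT x|lborel. (h x - (\<Sum>k\<in>S. c k * e k x))\<^sup>2) \<longlongrightarrow> 0) (finite_subsets_at_top UNIV)"
  shows "c m = L2_inner h (e m)"
proof -
  have "((\<lambda>k. c k * L2_inner (e k) (e m)) has_sum L2_inner h (e m)) UNIV"
    by (rule expansion_inner[OF h L2 lim])
  moreover have "((\<lambda>k. c k * L2_inner (e k) (e m)) has_sum (\<Sum>k\<in>{m}. c k * L2_inner (e k) (e m)))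
      UNIV"
    by (rule has_sum_finite_neutralI[of "{m}"]) (auto simp: ortho)
  ultimately have "L2_inner h (e m) = (\<Sum>k\<in>{m}. c k * L2_inner (e k) (e m))" by (rule has_sum_unique)
  then show ?thesis by (simp add: ortho)
qed

text \<open>
  A substitute for completeness of \<open>L\<^sup>2\<close>. The coefficients are bounded, so by the bound on the
  sums of \<open>\<bar>e k x\<bar>\<close> the expansion converges at almost every point. By Fatou's lemma its square
  distance to a partial sum is at most the tail of the series of squared coefficients.
\<close>

lemma projection_exists:
  assumes f: "f \<in> L2_fun" and bnd: "AE x in lborel. \<forall>S. finite S \<longrightarrow> (\<Sum>k\<in>S. \<bar>e k x\<bar>) \<le> C"
  obtains h where "h \<in> L2_fun"
    "((\<lambda>S. LINT x|lborel. (h x - (\<Sum>k\<in>S. L2_inner f (e k) * e k x))\<^sup>2) \<longlongrightarrow> 0) (finite_subsets_at_top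
        UNIV)"
proof -
  define c where "c k = L2_inner f (e k)" for k
  define s where "s A x = (\<Sum>k\<in>A. c k * e k x)" for A x
  define I where "I n = {- int n..int n}" for n :: nat
  define h where "h x = lim (\<lambda>n. s (I n) x)" for x
  have c2: "(\<lambda>k. (c k)\<^sup>2) summable_on UNIV" unfolding c_def by (rule Bessel_summable[OF f])
  define V where "V = infsum (\<lambda>k. (c k)\<^sup>2) UNIV"
  have V: "((\<lambda>k. (c k)\<^sup>2) has_sum V) UNIV" unfolding V_def using c2 by (rule has_sum_infsum)
  have cb: "\<bar>c k\<bar> \<le> sqrt (L2_inner f f)" for k
    using L2_Cauchy_Schwarz_abs[OF f L2, of k] by (simp add: c_def ortho)
  have sL2: "finite A \<Longrightarrow> s A \<in> L2_fun" for A unfolding s_def[abs_def] by (intro L2_sum L2)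
  have finI: "finite (I n)" for n by (simp add: I_def)
  have evI: "\<forall>\<^sub>F n in sequentially. A \<subseteq> I n" if A: "finite A" for A
  proof -
    have "\<forall>\<^sub>F n in sequentially. \<forall>k\<in>A. k \<in> I n"
    proof (rule eventually_ball_finite[OF A], rule ballI)
      fix k show "\<forall>\<^sub>F n in sequentially. k \<in> I n"
        using eventually_ge_at_top[of "nat \<bar>k\<bar>"] by eventually_elim (auto simp: I_def)
    qed
    then show ?thesis by eventually_elim auto
  qed
  have Ilim: "filterlim I (finite_subsets_at_top UNIV) sequentially"
    unfolding filterlim_finite_subsets_at_top using evI finI by auto
  have conv: "AE x in lborel. (\<lambda>n. s (I n) x) \<longlonglongrightarrow> h x"
    using bnd
  proof eventually_elim
    case (elim x)
    have "(\<lambda>k. norm (c k * e k x)) summable_on UNIV"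
    proof (rule nonneg_bdd_above_summable_on)
      show "bdd_above (sum (\<lambda>k. norm (c k * e k x)) ` {F. F \<subseteq> UNIV \<and> finite F})"
      proof (rule bdd_aboveI2)
        fix F :: "int set" assume "F \<in> {F. F \<subseteq> UNIV \<and> finite F}"
        then have F: "finite F" by simp
        have "(\<Sum>k\<in>F. norm (c k * e k x)) \<le> (\<Sum>k\<in>F. sqrt (L2_inner f f) * \<bar>e k x\<bar>)"
          using cb by (intro sum_mono) (auto simp: abs_mult intro!: mult_right_mono)
        also have "\<dots> \<le> sqrt (L2_inner f f) * C"
          unfolding sum_distrib_left[symmetric] using elim F
              by (intro mult_left_mono) (auto simp: L2_inner_nonneg)
        finally show "(\<Sum>k\<in>F. norm (c k * e k x)) \<le> sqrt (L2_inner f f) * C" .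
      qed
    qed auto
    then have "(\<lambda>k. c k * e k x) summable_on UNIV" by (rule abs_summable_summable)
    then have "((\<lambda>k. c k * e k x) has_sum (infsum (\<lambda>k. c k * e k x) UNIV)) UNIV"
        by (rule has_sum_infsum)
    then have "(\<lambda>n. s (I n) x) \<longlonglongrightarrow> infsum (\<lambda>k. c k * e k x) UNIV"
      unfolding has_sum_def s_def by (rule filterlim_compose[OF _ Ilim])
    then show ?case unfolding h_def by (simp add: limI)
  qed
  have [measurable]: "s A \<in> borel_measurable borel" if "finite A" for A using sL2[OF that]
      by (rule L2_measurable)
  have hm[measurable]: "h \<in> borel_measurable borel"
    unfolding h_def[abs_def] by (intro borel_measurable_lim_metric) (simp add: finI L2_measurable[OF
        sL2])
  have norm_diff: "(\<integral>\<^sup>+x. ennreal ((s (I n) x - s A x)\<^sup>2) \<partial>lborel) \<le> ennreal (V - (\<Sum>k\<in>A. (c k)\<^sup>2))"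
    if A: "finite A" "A \<subseteq> I n" for A n
  proof -
    have d: "s (I n) x - s A x = s (I n - A) x" for x
      unfolding s_def using sum.subset_diff[OF A(2) finI, of "\<lambda>k. c k * e k x"] by simp
    have "(\<integral>\<^sup>+x. ennreal ((s (I n) x - s A x)\<^sup>2) \<partial>lborel)
        = ennreal (LINT x|lborel. (s (I n - A) x)\<^sup>2)"
      unfolding d by (rule nn_integral_eq_integral) (auto intro!: L2_square_integrable sL2 finI)
    also have "(LINT x|lborel. (s (I n - A) x)\<^sup>2) = (\<Sum>k\<in>I n - A. (c k)\<^sup>2)"
      unfolding L2_inner_self[symmetric] s_def by (rule sum_norm) (simp add: finI)
    also have "\<dots> \<le> V - (\<Sum>k\<in>A. (c k)\<^sup>2)"
    proof -
      have "(\<Sum>k\<in>I n. (c k)\<^sup>2) \<le> V" by (rule finite_sum_le_has_sum[OF V finI]) auto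
      then show ?thesis using sum.subset_diff[OF A(2) finI, of "\<lambda>k. (c k)\<^sup>2"] by simp
    qed
    finally show ?thesis by (simp add: ennreal_leI)
  qed
  have fatou: "(\<integral>\<^sup>+x. ennreal ((h x - s A x)\<^sup>2) \<partial>lborel) \<le> ennreal (V - (\<Sum>k\<in>A. (c k)\<^sup>2))"
    if A: "finite A" for A
  proof -
    have "(\<integral>\<^sup>+x. ennreal ((h x - s A x)\<^sup>2) \<partial>lborel)
        = (\<integral>\<^sup>+x. liminf (\<lambda>n. ennreal ((s (I n) x - s A x)\<^sup>2)) \<partial>lborel)"
    proof (rule nn_integral_cong_AE)
      show "AE x in lborel. ennreal ((h x - s A x)\<^sup>2)
          = liminf (\<lambda>n. ennreal ((s (I n) x - s A x)\<^sup>2))"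
        using conv
      proof eventually_elim
        case (elim x)
        have "(\<lambda>n. ennreal ((s (I n) x - s A x)\<^sup>2)) \<longlonglongrightarrow> ennreal ((h x - s A x)\<^sup>2)"
          by (intro tendsto_ennrealI tendsto_intros elim)
        then show ?case by (rule lim_imp_Liminf[OF sequentially_bot, symmetric])
      qed
    qed
    also have "\<dots> \<le> liminf (\<lambda>n. \<integral>\<^sup>+x. ennreal ((s (I n) x - s A x)\<^sup>2) \<partial>lborel)"
      by (rule nn_integral_liminf) (use A finI in measurable)
    also have "\<dots> \<le> ennreal (V - (\<Sum>k\<in>A. (c k)\<^sup>2))"
      by (rule Liminf_le) (use evI[OF A] in \<open>auto elim!: eventually_mono intro: norm_diff[OF A]\<close>)
    finally show ?thesis .
  qed
  have hA: "integrable lborel (\<lambda>x. (h x - s A x)\<^sup>2)" if A: "finite A" for A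
  proof (rule integrableI_nonneg)
    show "(\<lambda>x. (h x - s A x)\<^sup>2) \<in> borel_measurable lborel" using A by measurable
    show "(\<integral>\<^sup>+x. ennreal ((h x - s A x)\<^sup>2) \<partial>lborel) < \<infinity>"
      by (rule le_less_trans[OF fatou[OF A]]) simp
  qed auto
  have "h \<in> L2_fun" using hA[of "{}"] hm by (simp add: L2_fun_def s_def)
  moreover have "((\<lambda>S. LINT x|lborel. (h x - (\<Sum>k\<in>S. L2_inner f (e k) * e k x))\<^sup>2) \<longlongrightarrow> 0)
      (finite_subsets_at_top UNIV)"
  proof (rule tendsto_sandwich[of "\<lambda>_. 0" _ _ "\<lambda>S. V - (\<Sum>k\<in>S. (c k)\<^sup>2)"])
    show "\<forall>\<^sub>F S in finite_subsets_at_top UNIV. (LINT x|lborel. (h x - (\<Sum>k\<in>S. L2_inner f (e k)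
        * e k x))\<^sup>2) \<le> V - (\<Sum>k\<in>S. (c k)\<^sup>2)"
    proof (rule eventually_finite_subsets_at_top_weakI)
      fix S :: "int set" assume S: "finite S"
      have "0 \<le> V - (\<Sum>k\<in>S. (c k)\<^sup>2)" using finite_sum_le_has_sum[OF V S] by simp
      moreover have "ennreal (LINT x|lborel. (h x - s S x)\<^sup>2) \<le> ennreal (V - (\<Sum>k\<in>S. (c k)\<^sup>2))"
        using fatou[OF S] nn_integral_eq_integral[OF hA[OF S]] by simp
      ultimately show "(LINT x|lborel. (h x - (\<Sum>k\<in>S. L2_inner f (e k) * e k x))\<^sup>2)
          \<le> V - (\<Sum>k\<in>S. (c k)\<^sup>2)"
        unfolding s_def c_def by simp
    qed
    show "((\<lambda>S. V - (\<Sum>k\<in>S. (c k)\<^sup>2)) \<longlongrightarrow> 0) (finite_subsets_at_top UNIV)"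
      using tendsto_diff[OF tendsto_const V[unfolded has_sum_def], of V] by simp
  qed auto
  ultimately show ?thesis by (rule that)
qed

end

section \<open>Dilations and translation spaces\<close>

lemma has_sum_abs_le:
  fixes f :: "'a \<Rightarrow> real"
  assumes "(f has_sum s) UNIV" and "\<And>S. finite S \<Longrightarrow> (\<Sum>x\<in>S. \<bar>f x\<bar>) \<le> B"
  shows "\<bar>s\<bar> \<le> B"
proof (rule tendsto_upperbound)
  show "((\<lambda>S. \<bar>\<Sum>x\<in>S. f x\<bar>) \<longlongrightarrow> \<bar>s\<bar>) (finite_subsets_at_top UNIV)"
    using assms(1) unfolding has_sum_def by (rule tendsto_rabs)
  show "\<forall>\<^sub>F S in finite_subsets_at_top UNIV. \<bar>\<Sum>x\<in>S. f x\<bar> \<le> B"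
    by (rule eventually_finite_subsets_at_top_weakI) (use assms(2) sum_abs order_trans in blast)
qed simp

text \<open>
  Exchange sum and integral and bound the sum pointwise. This is one half of the Schur test.
\<close>

lemma sum_translates_inner_bound:
  fixes g u :: "real \<Rightarrow> real"
  assumes g: "integrable lborel g" and u[measurable]: "u \<in> borel_measurable borel"
    and bnd: "AE x in lborel. \<forall>S. finite S \<longrightarrow> (\<Sum>k\<in>S. \<bar>u (x - of_int k)\<bar>) \<le> C" and S: "finite S"
  shows "(\<Sum>k\<in>S. \<bar>LINT x|lborel. g x * u (x - of_int k)\<bar>) \<le> C * (LINT x|lborel. \<bar>g x\<bar>)"
proof -
  have [measurable]: "g \<in> borel_measurable borel" using g by auto
  have int: "integrable lborel (\<lambda>x. \<bar>g x\<bar> * \<bar>u (x - of_int k)\<bar>)" for k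
  proof (rule Bochner_Integration.integrable_bound)
    show "integrable lborel (\<lambda>x. C * \<bar>g x\<bar>)" using g by simp
    show "AE x in lborel. norm (\<bar>g x\<bar> * \<bar>u (x - of_int k)\<bar>) \<le> norm (C * \<bar>g x\<bar>)"
      using bnd
    proof eventually_elim
      case (elim x)
      have "\<bar>u (x - of_int k)\<bar> \<le> C" using elim[rule_format, of "{k}"] by simp
      then have "\<bar>g x\<bar> * \<bar>u (x - of_int k)\<bar> \<le> \<bar>g x\<bar> * \<bar>C\<bar>" by (intro mult_left_mono) auto
      then show ?case by (simp add: abs_mult mult.commute)
    qed
  qed measurable
  have "(\<Sum>k\<in>S. \<bar>LINT x|lborel. g x * u (x - of_int k)\<bar>) \<le> (\<Sum>k\<in>S. LINT x|lborel. \<bar>g x\<bar>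
      * \<bar>u (x - of_int k)\<bar>)"
  proof (intro sum_mono)
    fix k
    show "\<bar>LINT x|lborel. g x * u (x - of_int k)\<bar> \<le> (LINT x|lborel. \<bar>g x\<bar> * \<bar>u (x - of_int k)\<bar>)"
      using integral_norm_bound[of lborel "\<lambda>x. g x * u (x - of_int k)"] by (simp add: abs_mult)
  qed
  also have "\<dots> = (LINT x|lborel. (\<Sum>k\<in>S. \<bar>g x\<bar> * \<bar>u (x - of_int k)\<bar>))"
    using int by (simp add: Bochner_Integration.integral_sum)
  also have "\<dots> \<le> (LINT x|lborel. C * \<bar>g x\<bar>)"
  proof (rule integral_mono_AE)
    show "AE x in lborel. (\<Sum>k\<in>S. \<bar>g x\<bar> * \<bar>u (x - of_int k)\<bar>) \<le> C * \<bar>g x\<bar>"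
      using bnd
    proof eventually_elim
      case (elim x)
      then have "(\<Sum>k\<in>S. \<bar>u (x - of_int k)\<bar>) \<le> C" using S by blast
      then have "\<bar>g x\<bar> * (\<Sum>k\<in>S. \<bar>u (x - of_int k)\<bar>) \<le> \<bar>g x\<bar> * C" by (intro mult_left_mono) auto
      then show ?case by (simp add: sum_distrib_left mult.commute)
    qed
  qed (use int g in \<open>auto intro: Bochner_Integration.integrable_sum\<close>)
  finally show ?thesis by simp
qed

text \<open>
  A unitary operator that carries level \<open>J\<close> of a multiresolution to level 0. Statements about all
  levels thereby become statements about the translates of \<open>\<phi>\<close> and \<open>\<psi>\<close> alone.
\<close>

definition dilate :: "nat \<Rightarrow> (real \<Rightarrow> real) \<Rightarrow> real \<Rightarrow> real" where
  "dilate J f y = 2 powr (- real J / 2) * f (y / 2 ^ J)"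

lemma lborel_dilate_integral: "(LINT y|lborel. F (y / 2 ^ J)) = 2 ^ J * (LINT x|lborel. F x)"
    for F :: "real \<Rightarrow> real"
  using lborel_integral_real_affine[of "1 / 2 ^ J" F 0] by simp

lemma lborel_dilate_integrable: "integrable lborel (\<lambda>y. F (y / 2 ^ J)) \<longleftrightarrow> integrable lborel F"
    for F :: "real \<Rightarrow> real"
  using lborel_integrable_real_affine_iff[of "1 / 2 ^ J" F 0] by simp

lemma powr_half_square: "2 powr (- real J / 2) * 2 powr (- real J / 2) = 1 / 2 ^ J"
proof -
  have "2 powr (- real J / 2) * 2 powr (- real J / 2) = (2::real) powr (- real J)"
    unfolding powr_add[symmetric] by (rule arg_cong[where f = "(powr) 2"]) simp
  also have "\<dots> = 1 / 2 ^ J" by (simp only: powr_minus_divide powr_realpow zero_less_numeral)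
  finally show ?thesis .
qed

lemma dilate_L2: "f \<in> L2_fun \<Longrightarrow> dilate J f \<in> L2_fun"
proof -
  assume f: "f \<in> L2_fun"
  have [measurable]: "f \<in> borel_measurable borel" by (rule L2_measurable[OF f])
  have "(\<lambda>y. f (y / 2 ^ J)) \<in> L2_fun"
    using lborel_dilate_integrable[of "\<lambda>x. (f x)\<^sup>2" J] L2_square_integrable[OF f]
        by (simp add: L2_fun_def)
  then show ?thesis unfolding dilate_def[abs_def] by (rule L2_scale)
qed

lemma dilate_inner: "L2_inner (dilate J f) (dilate J g) = L2_inner f g"
proof -
  have "L2_inner (dilate J f) (dilate J g) = (LINT y|lborel. (1 / 2 ^ J) * (f (y / 2 ^ J)
      * g (y / 2 ^ J)))"
    unfolding L2_inner_def dilate_def powr_half_square[symmetric]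
    by (intro Bochner_Integration.integral_cong) (simp_all add: mult_ac)
  also have "\<dots> = (1 / 2 ^ J) * (2 ^ J * (LINT x|lborel. f x * g x))"
    by (simp add: lborel_dilate_integral[of "\<lambda>x. f x * g x" J])
  finally show ?thesis by (simp add: L2_inner_def)
qed

lemma dilate_Suc: "dilate (Suc 0) (dilate j f) = dilate (Suc j) f"
proof
  fix y
  have "2 powr (- 1 / 2) * 2 powr (- real j / 2) = (2::real) powr (- real (Suc j) / 2)"
    by (subst powr_add[symmetric]) (simp add: field_simps)
  then show "dilate (Suc 0) (dilate j f) y = dilate (Suc j) f y"
    unfolding dilate_def by (simp add: mult.assoc[symmetric] mult.commute)
qed

lemma dilate_0: "dilate 0 f = f"
  by (auto simp: dilate_def)

lemma wavelet_coeff_dilate: "L2_inner (dilate j f) (\<lambda>x. \<psi> (x - of_int m)) = wavelet_coeff \<psi> f j m"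
proof -
  have "(LINT y|lborel. dilate j f y * \<psi> (y - of_int m)) = 2 ^ j * (LINT x|lborel. 2 powr (- real j
      / 2) * f x * \<psi> (2 ^ j * x - of_int m))"
    unfolding lborel_dilate_integral[symmetric] dilate_def by simp
  also have "\<dots> = (LINT x|lborel. f x * (2 powr (real j / 2) * \<psi> (2 ^ j * x - of_int m)))"
  proof -
    have "2 powr (real j / 2) = 2 ^ j * 2 powr (- real j / 2)"
      by (simp add: powr_realpow[symmetric] powr_add[symmetric])
    then show ?thesis
      by (subst integral_mult_right_zero[symmetric], intro Bochner_Integration.integral_cong)
          (simp_all add: mult_ac)
  qed
  finally show ?thesis by (simp add: L2_inner_def wavelet_coeff_def)
qed

lemma orthonormal_translatesD: "orthonormal_translates g
    \<Longrightarrow> orthonormal_family (\<lambda>k x. g (x - of_int k))"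
  unfolding orthonormal_translates_def by unfold_locales (auto intro: L2_translate)

lemma translate_space_L2: "h \<in> translate_space g \<Longrightarrow> h \<in> L2_fun"
  by (simp add: translate_space_def)

lemma translate_space_expand:
  assumes "orthonormal_translates g" "h \<in> translate_space g" "\<theta> \<in> L2_fun"
  shows "((\<lambda>k. L2_inner h (\<lambda>x. g (x - of_int k)) * L2_inner (\<lambda>x. g (x - of_int k)) \<theta>) has_sum
      L2_inner h \<theta>) UNIV"
proof -
  interpret orthonormal_family "\<lambda>k x. g (x - of_int k)"
      by (rule orthonormal_translatesD[OF assms(1)])
  obtain c where h: "h \<in> L2_fun" and
    c: "((\<lambda>S. LINT x|lborel. (h x - (\<Sum>k\<in>S. c k * g (x - of_int k)))\<^sup>2) \<longlongrightarrow> 0) (finite_subsets_at_top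
        UNIV)"
    using assms(2) unfolding translate_space_def by blast
  show ?thesis
    unfolding expansion_coefficients[OF h c, symmetric] by (rule expansion_inner[OF h assms(3) c])
qed

text \<open>
  The form \<open>a * h - h'\<close> is the one in which a difference of two consecutive projections arises.
\<close>

lemma translate_space_lincomb:
  assumes g: "orthonormal_translates g" and h: "h \<in> translate_space g" "h' \<in> translate_space g"
  shows "(\<lambda>x. a * h x - h' x) \<in> translate_space g"
proof -
  interpret orthonormal_family "\<lambda>k x. g (x - of_int k)" by (rule orthonormal_translatesD[OF g])
  obtain c c' where hL: "h \<in> L2_fun" "h' \<in> L2_fun"
      and c: "(\<lambda>k. (c k)\<^sup>2) summable_on UNIV" "(\<lambda>k. (c' k)\<^sup>2) summable_on UNIV"
    "((\<lambda>S. LINT x|lborel. (h x - (\<Sum>k\<in>S. c k * g (x - of_int k)))\<^sup>2) \<longlongrightarrow> 0) (finite_subsets_at_top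
        UNIV)"
    "((\<lambda>S. LINT x|lborel. (h' x - (\<Sum>k\<in>S. c' k * g (x - of_int k)))\<^sup>2) \<longlongrightarrow> 0) (finite_subsets_at_top
        UNIV)"
    using h unfolding translate_space_def by blast
  have ineq: "(a * x - y)\<^sup>2 \<le> 2 * a\<^sup>2 * x\<^sup>2 + 2 * y\<^sup>2" for x y :: real
  proof -
    have "0 \<le> (a * x + y)\<^sup>2" by simp
    then show ?thesis by (simp add: power2_eq_square algebra_simps)
  qed
  have "(\<lambda>k. (a * c k - c' k)\<^sup>2) summable_on UNIV"
  proof (rule summable_on_comparison_test)
    show "(\<lambda>k. 2 * a\<^sup>2 * (c k)\<^sup>2 + 2 * (c' k)\<^sup>2) summable_on UNIV"
      using c by (intro summable_on_add summable_on_cmult_right)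
  qed (use ineq in auto)
  moreover have "((\<lambda>S. LINT x|lborel. ((a * h x - h' x) - (\<Sum>k\<in>S. (a * c k - c' k)
      * g (x - of_int k)))\<^sup>2) \<longlongrightarrow> 0) (finite_subsets_at_top UNIV)"
  proof (rule Lim_null_comparison)
    let ?r = "\<lambda>S x. h x - (\<Sum>k\<in>S. c k * g (x - of_int k))"
        and ?r' = "\<lambda>S x. h' x - (\<Sum>k\<in>S. c' k * g (x - of_int k))"
    show "\<forall>\<^sub>F S in finite_subsets_at_top UNIV. norm (LINT x|lborel. ((a * h x - h' x)
        - (\<Sum>k\<in>S. (a * c k - c' k) * g (x - of_int k)))\<^sup>2)
       \<le> 2 * a\<^sup>2 * (LINT x|lborel. (?r S x)\<^sup>2) + 2 * (LINT x|lborel. (?r' S x)\<^sup>2)"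
    proof (rule eventually_finite_subsets_at_top_weakI)
      fix S :: "int set" assume S: "finite S"
      have r: "?r S \<in> L2_fun" "?r' S \<in> L2_fun" using S by (intro L2_diff hL L2_sum L2; simp)+
      have eq: "(a * h x - h' x) - (\<Sum>k\<in>S. (a * c k - c' k) * g (x - of_int k))
          = a * ?r S x - ?r' S x" for x
        by (simp add: algebra_simps sum_subtractf sum_distrib_left)
      have "(LINT x|lborel. (a * ?r S x - ?r' S x)\<^sup>2) \<le> (LINT x|lborel. 2 * a\<^sup>2 * (?r S x)\<^sup>2 + 2
          * (?r' S x)\<^sup>2)"
        using L2_square_integrable[OF r(1)] L2_square_integrable[OF r(2)] ineq
        by (intro integral_mono L2_square_integrable L2_diff L2_scale r
            Bochner_Integration.integrable_add integrable_mult_right)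
      also have "\<dots> = 2 * a\<^sup>2 * (LINT x|lborel. (?r S x)\<^sup>2) + 2 * (LINT x|lborel. (?r' S x)\<^sup>2)"
        using L2_square_integrable[OF r(1)] L2_square_integrable[OF r(2)]
        by (subst Bochner_Integration.integral_add) (auto simp del: mult.assoc)
      finally show "norm (LINT x|lborel. ((a * h x - h' x) - (\<Sum>k\<in>S. (a * c k - c' k)
          * g (x - of_int k)))\<^sup>2)
       \<le> 2 * a\<^sup>2 * (LINT x|lborel. (?r S x)\<^sup>2) + 2 * (LINT x|lborel. (?r' S x)\<^sup>2)" unfolding eq by
           simp
    qed
    show "((\<lambda>S. 2 * a\<^sup>2 * (LINT x|lborel. (?r S x)\<^sup>2) + 2 * (LINT x|lborel. (?r' S x)\<^sup>2)) \<longlongrightarrow> 0)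
        (finite_subsets_at_top UNIV)"
      using tendsto_add[OF tendsto_mult_right_zero[OF c(3), of "2 * a\<^sup>2"] tendsto_mult_right_zero[OF
          c(4), of 2]] by simp
  qed
  moreover have "(\<lambda>x. a * h x - h' x) \<in> L2_fun" by (intro L2_diff L2_scale hL)
  ultimately show ?thesis
    unfolding translate_space_def mem_Collect_eq by (intro conjI exI[of _ "\<lambda>k. a * c k - c' k"])
qed

lemma translate_space_zero: "(\<lambda>x. 0) \<in> translate_space g"
  unfolding translate_space_def by (auto simp: L2_zero intro!: exI[of _ "\<lambda>_. 0"])

lemma translate_space_scale:
  assumes "orthonormal_translates g" "h \<in> translate_space g"
  shows "(\<lambda>x. a * h x) \<in> translate_space g"
  using translate_space_lincomb[OF assms translate_space_zero, of a] by simp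

lemma translate_in_translate_space:
  assumes "orthonormal_translates g"
  shows "(\<lambda>x. g (x - of_int m)) \<in> translate_space g"
proof -
  interpret orthonormal_family "\<lambda>k x. g (x - of_int k)" by (rule orthonormal_translatesD[OF assms])
  let ?c = "\<lambda>k. if k = m then 1 else 0 :: real"
  have "(\<lambda>k. (?c k)\<^sup>2) summable_on UNIV"
    by (rule summable_on_cong_neutral[where T = "{m}", THEN iffD2]) auto
  moreover have "((\<lambda>S. LINT x|lborel. (g (x - of_int m) - (\<Sum>k\<in>S. ?c k * g (x - of_int k)))\<^sup>2) \<longlongrightarrow> 0)
      (finite_subsets_at_top UNIV)"
  proof (rule tendsto_eventually)
    show "\<forall>\<^sub>F S in finite_subsets_at_top UNIV. (LINT x|lborel. (g (x - of_int m) - (\<Sum>k\<in>S. ?c k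
        * g (x - of_int k)))\<^sup>2) = 0"
      unfolding eventually_finite_subsets_at_top
      by (intro exI[of _ "{m}"]) (auto simp: if_distrib[of "\<lambda>x. x * _"] cong: if_cong)
  qed
  ultimately show ?thesis
    unfolding translate_space_def mem_Collect_eq by (intro conjI L2 exI[of _ ?c])
qed

section \<open>One step of the multiresolution\<close>

text \<open>
  A uniform bound on the sums of \<open>\<bar>\<phi>\<bar>\<close> over all integer translates. It makes the orthogonal
  projection onto the translates of \<open>\<phi>\<close> available and turns suprema of coefficients into estimates
  of inner products.
\<close>

locale bounded_mra =
  fixes \<phi> \<psi> :: "real \<Rightarrow> real" and C :: real
  assumes scaling: "scaling_function \<phi>" and wavelet: "associated_wavelet \<phi> \<psi>"
    and sum_bound: "AE x in lborel. \<forall>S. finite S \<longrightarrow> (\<Sum>k\<in>S. \<bar>\<phi> (x - of_int k)\<bar>) \<le> C"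
begin

definition e :: "int \<Rightarrow> real \<Rightarrow> real" where "e k x = \<phi> (x - of_int k)"
definition w :: "int \<Rightarrow> real \<Rightarrow> real" where "w k x = \<psi> (x - of_int k)"

lemma e_eq: "(\<lambda>x. \<phi> (x - of_int k)) = e k" and w_eq: "(\<lambda>x. \<psi> (x - of_int k)) = w k"
  by (auto simp: e_def w_def)

lemma ortho_phi: "orthonormal_translates \<phi>" and ortho_psi: "orthonormal_translates \<psi>"
    and psi_int: "integrable lborel \<psi>"
  using scaling wavelet by (auto simp: scaling_function_def associated_wavelet_def)

sublocale E: orthonormal_family e
  using orthonormal_translatesD[OF ortho_phi] unfolding e_eq .

sublocale W: orthonormal_family w
  using orthonormal_translatesD[OF ortho_psi] unfolding w_eq .

lemmas expand = translate_space_expand[OF ortho_phi, unfolded e_eq]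
lemmas expand_psi = translate_space_expand[OF ortho_psi, unfolded w_eq]

definition proj :: "(real \<Rightarrow> real) \<Rightarrow> real \<Rightarrow> real" where
  "proj f = (SOME h. h \<in> L2_fun \<and>
    ((\<lambda>S. LINT x|lborel. (h x - (\<Sum>k\<in>S. L2_inner f (e k) * e k x))\<^sup>2) \<longlongrightarrow> 0) (finite_subsets_at_top
        UNIV))"

lemma proj:
  assumes "f \<in> L2_fun"
  shows proj_L2: "proj f \<in> L2_fun"
      and proj_lim: "((\<lambda>S. LINT x|lborel. (proj f x - (\<Sum>k\<in>S. L2_inner f (e k) * e k x))\<^sup>2) \<longlongrightarrow> 0)
      (finite_subsets_at_top UNIV)"
proof -
  have "\<exists>h. h \<in> L2_fun \<and>
    ((\<lambda>S. LINT x|lborel. (h x - (\<Sum>k\<in>S. L2_inner f (e k) * e k x))\<^sup>2) \<longlongrightarrow> 0) (finite_subsets_at_top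
        UNIV)"
    using E.projection_exists[OF assms sum_bound[folded e_def]] by blast
  from someI_ex[OF this, folded proj_def]
  show "proj f \<in> L2_fun" "((\<lambda>S. LINT x|lborel. (proj f x - (\<Sum>k\<in>S. L2_inner f (e k) * e k x))\<^sup>2) \<longlongrightarrow> 0)
      (finite_subsets_at_top UNIV)"
    by simp_all
qed

lemma proj_in: "f \<in> L2_fun \<Longrightarrow> proj f \<in> translate_space \<phi>"
  unfolding translate_space_def mem_Collect_eq e_def[symmetric]
  using proj_L2 proj_lim E.Bessel_summable
  by (intro conjI exI[of _ "\<lambda>k. L2_inner f (e k)"]) auto

lemma proj_coeff: "f \<in> L2_fun \<Longrightarrow> L2_inner (proj f) (e k) = L2_inner f (e k)"
  using E.expansion_coefficients[OF proj_L2 proj_lim] by simp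

lemma proj_inner:
  assumes "f \<in> L2_fun" "\<theta> \<in> L2_fun"
  shows "((\<lambda>k. L2_inner f (e k) * L2_inner (e k) \<theta>) has_sum L2_inner (proj f) \<theta>) UNIV"
  using E.expansion_inner[OF proj_L2 assms(2) proj_lim] assms(1) by blast

lemma proj_orth:
  assumes f: "f \<in> L2_fun" and v: "v \<in> translate_space \<phi>"
  shows "L2_inner (proj f) v = L2_inner f v"
proof -
  have "((\<lambda>k. L2_inner v (e k) * L2_inner (e k) f) has_sum L2_inner v f) UNIV"
    by (rule expand[OF v f])
  moreover have "((\<lambda>k. L2_inner v (e k) * L2_inner (e k) (proj f)) has_sum L2_inner v (proj f))
      UNIV"
    by (rule expand[OF v proj_L2[OF f]])
  ultimately have "L2_inner v (proj f) = L2_inner v f"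
    using proj_coeff[OF f] has_sum_unique by (simp add: L2_inner_commute[of "e _"])
  then show ?thesis by (simp add: L2_inner_commute)
qed

text \<open>
  The projection is self-adjoint and fixes \<open>h\<close>, so the difference is, up to sign, the inner
  product of \<open>f - h\<close> with \<open>\<theta> - proj \<theta>\<close>.
\<close>

lemma proj_error:
  assumes f: "f \<in> L2_fun" and \<theta>: "\<theta> \<in> L2_fun" and h: "h \<in> translate_space \<phi>"
  shows "\<bar>L2_inner (proj f) \<theta> - L2_inner f \<theta>\<bar> \<le> sqrt (LINT x|lborel. (f x - h x)\<^sup>2)
      * sqrt (L2_inner \<theta> \<theta>)"
proof -
  note hL = translate_space_L2[OF h]
  let ?r = "\<lambda>x. \<theta> x - proj \<theta> x" and ?d = "\<lambda>x. f x - h x"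
  have r: "?r \<in> L2_fun" and d: "?d \<in> L2_fun" by (intro L2_diff f \<theta> hL proj_L2)+
  have 1: "L2_inner (proj f) \<theta> = L2_inner f (proj \<theta>)"
    using proj_orth[OF f proj_in[OF \<theta>]] proj_orth[OF \<theta> proj_in[OF f]]
        by (simp add: L2_inner_commute)
  have rf: "L2_inner ?r g = L2_inner \<theta> g - L2_inner (proj \<theta>) g" if "g \<in> L2_fun" for g
    by (rule L2_inner_diff_left[OF \<theta> proj_L2[OF \<theta>] that])
  have "L2_inner ?d ?r = L2_inner f ?r - L2_inner h ?r" by (rule L2_inner_diff_left[OF f hL r])
  also have "L2_inner h ?r = 0"
    using rf[OF hL] proj_orth[OF \<theta> h] by (simp add: L2_inner_commute[of h])
  also have "L2_inner f ?r = L2_inner f \<theta> - L2_inner (proj f) \<theta>"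
    using rf[OF f] 1 by (simp add: L2_inner_commute[of f])
  finally have eq: "L2_inner f \<theta> - L2_inner (proj f) \<theta> = L2_inner ?d ?r" by simp
  have "L2_inner ?r ?r = L2_inner \<theta> \<theta> - L2_inner (proj \<theta>) (proj \<theta>)"
  proof -
    have "L2_inner ?r ?r = L2_inner \<theta> ?r - L2_inner (proj \<theta>) ?r" by (rule rf[OF r])
    also have "L2_inner \<theta> ?r = L2_inner \<theta> \<theta> - L2_inner (proj \<theta>) \<theta>"
      using rf[OF \<theta>] by (simp add: L2_inner_commute[of \<theta> ?r])
    also have "L2_inner (proj \<theta>) ?r = L2_inner \<theta> (proj \<theta>) - L2_inner (proj \<theta>) (proj \<theta>)"
      using rf[OF proj_L2[OF \<theta>]] by (simp add: L2_inner_commute[of "proj \<theta>" ?r])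
    also have "L2_inner (proj \<theta>) (proj \<theta>) = L2_inner \<theta> (proj \<theta>)"
        by (rule proj_orth[OF \<theta> proj_in[OF \<theta>]])
    finally show ?thesis using proj_orth[OF \<theta> proj_in[OF \<theta>]] by (simp add: L2_inner_commute)
  qed
  then have "L2_inner ?r ?r \<le> L2_inner \<theta> \<theta>" using L2_inner_nonneg[of "proj \<theta>"] by simp
  then have "sqrt (L2_inner ?d ?d) * sqrt (L2_inner ?r ?r) \<le> sqrt (L2_inner ?d ?d)
      * sqrt (L2_inner \<theta> \<theta>)"
    by (intro mult_left_mono) (auto simp: L2_inner_nonneg)
  then have "\<bar>L2_inner ?d ?r\<bar> \<le> sqrt (L2_inner ?d ?d) * sqrt (L2_inner \<theta> \<theta>)"
    using L2_Cauchy_Schwarz_abs[OF d r] by linarith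
  then show ?thesis unfolding eq[symmetric] by (simp add: L2_inner_self abs_minus_commute)
qed

definition undilate :: "(real \<Rightarrow> real) \<Rightarrow> real \<Rightarrow> real" where
  "undilate f x = sqrt 2 * f (2 * x)"

lemma powr_half: "2 powr (- (1 / 2)) = 1 / sqrt (2::real)"
proof -
  have "2 powr (1 / 2) = sqrt (2::real)" by (rule powr_half_sqrt) simp
  moreover have "2 powr (- (1 / 2)) = 1 / (2::real) powr (1 / 2)" by (rule powr_minus_divide)
  ultimately show ?thesis by simp
qed

lemma dilate_undilate: "dilate (Suc 0) (undilate f) = f"
  by (auto simp: dilate_def undilate_def powr_half)

lemma dilate_stretch: "dilate (Suc 0) (\<lambda>x. h (2 * x)) = (\<lambda>x. (1 / sqrt 2) * h x)"
  by (auto simp: dilate_def powr_half)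

lemma undilate_L2:
  assumes "f \<in> L2_fun" shows "undilate f \<in> L2_fun"
proof -
  have "integrable lborel (\<lambda>x. (f (2 * x))\<^sup>2)"
    using lborel_integrable_real_affine_iff[of 2 "\<lambda>x. (f x)\<^sup>2" 0] L2_square_integrable[OF assms]
        by simp
  moreover have "(\<lambda>x. f (2 * x)) \<in> borel_measurable borel" using L2_measurable[OF assms]
      by measurable
  ultimately have "(\<lambda>x. f (2 * x)) \<in> L2_fun" by (simp add: L2_fun_def)
  then show ?thesis unfolding undilate_def[abs_def] by (rule L2_scale)
qed

lemma undilate_inner: "g \<in> L2_fun \<Longrightarrow> L2_inner (undilate f) g = L2_inner f (dilate (Suc 0) g)"
  using dilate_inner[of "Suc 0" "undilate f" g] by (simp add: dilate_undilate)

definition K :: real where "K = C * (LINT y|lborel. \<bar>2 powr (- 1 / 2) * \<psi> (y / 2)\<bar>)"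

text \<open>
  Translating by \<open>2 * m\<close> at the finer level moves the translation from \<open>\<psi>\<close> to \<open>\<phi>\<close>. Thus the
  estimate rests on the bound for the translates of \<open>\<phi>\<close>, with \<open>\<psi>\<close> as an integrable weight.
\<close>

lemma psi_phi_bound:
  assumes "finite S"
  shows "(\<Sum>m\<in>S. \<bar>L2_inner (w m) (undilate (e k))\<bar>) \<le> K"
proof -
  have [measurable]: "\<phi> \<in> borel_measurable borel" "\<psi> \<in> borel_measurable borel"
    using ortho_phi ortho_psi by (auto simp: orthonormal_translates_def L2_measurable)
  have eq: "L2_inner (w m) (undilate (e k)) = (LINT y|lborel. (2 powr (- 1 / 2) * \<psi> (y / 2))
      * \<phi> (y - of_int (k - 2 * m)))" for m
  proof -
    have "L2_inner (w m) (undilate (e k)) = (LINT y|lborel. (2 powr (- 1 / 2) * \<psi> (y / 2 - of_int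
        m)) * \<phi> (y - of_int k))"
      unfolding L2_inner_commute[of "w m" "undilate (e k)"] undilate_inner[OF W.L2]
          unfolding L2_inner_def
      by (intro Bochner_Integration.integral_cong) (auto simp: dilate_def w_def e_def)
    also have "\<dots> = (LINT y|lborel. (2 powr (- 1 / 2) * \<psi> ((y + 2 * of_int m) / 2 - of_int m))
        * \<phi> ((y + 2 * of_int m) - of_int k))"
      by (rule lborel_translate_integral[symmetric])
    also have "\<dots> = (LINT y|lborel. (2 powr (- 1 / 2) * \<psi> (y / 2)) * \<phi> (y - of_int (k - 2 * m)))"
      by (intro Bochner_Integration.integral_cong) (auto simp: add_divide_distrib algebra_simps)
    finally show ?thesis .
  qed
  have inj: "inj_on (\<lambda>m. k - 2 * m) S" by (auto simp: inj_on_def)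
  have "(\<Sum>m\<in>S. \<bar>L2_inner (w m) (undilate (e k))\<bar>) = (\<Sum>j\<in>(\<lambda>m. k - 2 * m) ` S. \<bar>LINT y|lborel.
      (2 powr (- 1 / 2) * \<psi> (y / 2)) * \<phi> (y - of_int j)\<bar>)"
    unfolding eq by (subst sum.reindex[OF inj]) simp
  also have "\<dots> \<le> K"
    unfolding K_def
  proof (rule sum_translates_inner_bound)
    show "integrable lborel (\<lambda>y. 2 powr (- 1 / 2) * \<psi> (y / 2))"
      using lborel_dilate_integrable[of \<psi> 1] psi_int by (intro integrable_mult_right) simp
  qed (use assms sum_bound in auto)
  finally show ?thesis .
qed

text \<open>
  The difference of two consecutive projections of \<open>f\<close> lies in \<open>V\<^sub>1\<close> and is orthogonal to \<open>V\<^sub>0\<close>,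
  so it is an expansion in the translates of \<open>\<psi>\<close> with coefficients bounded by \<open>M\<close>. The function
  \<open>\<psi>\<close> is merely integrable, so its inner products with \<open>\<theta>\<close> cannot be estimated by parts. Therefore
  the difference is expanded once more, in the translates of the regular function \<open>\<phi>\<close> at the finer
  level, which raises the bound on the coefficients only by the factor \<open>K\<close>.
\<close>

lemma detail_bound:
  assumes f: "f \<in> L2_fun" and \<theta>: "\<theta> \<in> L2_fun" and M: "\<And>m. \<bar>L2_inner f (w m)\<bar> \<le> M"
    and T: "\<And>S. finite S \<Longrightarrow> (\<Sum>k\<in>S. \<bar>L2_inner (e k) (dilate (Suc 0) \<theta>)\<bar>) \<le> T"
  shows "\<bar>L2_inner (proj (dilate (Suc 0) f)) (dilate (Suc 0) \<theta>) - L2_inner (proj f) \<theta>\<bar> \<le> M * K * T"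
proof -
  have M0: "0 \<le> M" using M[of 0] by linarith
  have nest: "mra_space \<phi> 0 \<subseteq> mra_space \<phi> 1" using scaling by (simp add: scaling_function_def)
  have V0: "mra_space \<phi> 0 = translate_space \<phi>" by (simp add: mra_space_def)
  define p where "p = proj (dilate (Suc 0) f)"
  have df: "dilate (Suc 0) f \<in> L2_fun" by (rule dilate_L2[OF f])
  have pL: "p \<in> L2_fun" "p \<in> translate_space \<phi>" unfolding p_def by (intro proj_L2 proj_in df)+
  obtain h where h: "h \<in> translate_space \<phi>" and ph: "proj f = (\<lambda>x. h (2 * x))"
    using nest proj_in[OF f] unfolding V0 by (auto simp: mra_space_def)
  \<comment> \<open>\<open>undilate p\<close> is the projection of \<open>f\<close> onto \<open>V\<^sub>1\<close>, and \<open>G\<close> below is what it adds to \<open>proj f\<close>\<close>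
  define g where "g x = sqrt 2 * p x - h x" for x
  have gV: "g \<in> translate_space \<phi>" unfolding g_def[abs_def]
      by (rule translate_space_lincomb[OF ortho_phi pL(2) h])
  define G where "G x = g (2 * x)" for x
  have G_eq: "G = (\<lambda>x. undilate p x - proj f x)" by (auto simp: G_def g_def undilate_def ph)
  have GL: "G \<in> L2_fun" unfolding G_eq by (intro L2_diff undilate_L2 pL proj_L2 f)
  have G_in: "L2_inner G \<eta> = L2_inner p (dilate (Suc 0) \<eta>) - L2_inner (proj f) \<eta>" if "\<eta> \<in> L2_fun"
      for \<eta>
    unfolding G_eq using that by (simp add: L2_inner_diff_left undilate_L2 pL proj_L2 f
        undilate_inner)
  have fine: "L2_inner p (dilate (Suc 0) v) = L2_inner f v" if "v \<in> mra_space \<phi> 1" for v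
  proof -
    obtain v' where v': "v' \<in> translate_space \<phi>" "v = (\<lambda>x. v' (2 * x))" using \<open>v \<in> mra_space \<phi> 1\<close>
        by (auto simp: mra_space_def)
    have "dilate (Suc 0) v \<in> translate_space \<phi>" unfolding v'(2) dilate_stretch
        by (rule translate_space_scale[OF ortho_phi v'(1)])
    from proj_orth[OF df this] show ?thesis unfolding p_def dilate_inner .
  qed
  have "L2_inner G v = 0" if "v \<in> mra_space \<phi> 0" for v
  proof -
    have v: "v \<in> translate_space \<phi>" "v \<in> mra_space \<phi> 1" "v \<in> L2_fun"
        using that nest V0 translate_space_L2 by auto
    show ?thesis using G_in[OF v(3)] fine[OF v(2)] proj_orth[OF f v(1)] by simp
  qed
  moreover have "G \<in> mra_space \<phi> 1" unfolding mra_space_def using gV by (auto simp: G_def[abs_def])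
  ultimately have GW: "G \<in> translate_space \<psi>" using wavelet unfolding associated_wavelet_def
      by blast
  have Gw: "L2_inner G (w m) = L2_inner f (w m)" for m
  proof -
    have "w m \<in> translate_space \<psi>" using translate_in_translate_space[OF ortho_psi] unfolding w_eq .
    then have wm: "w m \<in> mra_space \<phi> 1" "\<forall>v\<in>mra_space \<phi> 0. L2_inner (w m) v = 0"
      using wavelet unfolding associated_wavelet_def by blast+
    have "L2_inner (proj f) (w m) = 0"
      using wm(2) proj_in[OF f] unfolding V0 by (simp add: L2_inner_commute[of "proj f"])
    then show ?thesis using G_in[OF W.L2] fine[OF wm(1)] by simp
  qed
  have \<gamma>: "\<bar>L2_inner (dilate (Suc 0) G) (e k)\<bar> \<le> M * K" for k
  proof -
    have "L2_inner (dilate (Suc 0) G) (e k) = L2_inner G (undilate (e k))"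
      using dilate_inner[of "Suc 0" G "undilate (e k)"] by (simp add: dilate_undilate)
    moreover have "((\<lambda>m. L2_inner G (w m) * L2_inner (w m) (undilate (e k))) has_sum L2_inner G
        (undilate (e k))) UNIV"
      by (rule expand_psi[OF GW undilate_L2[OF E.L2]])
    moreover have "(\<Sum>m\<in>S. \<bar>L2_inner G (w m) * L2_inner (w m) (undilate (e k))\<bar>) \<le> M * K"
        if "finite S" for S
    proof -
      have "(\<Sum>m\<in>S. \<bar>L2_inner G (w m) * L2_inner (w m) (undilate (e k))\<bar>)
          \<le> (\<Sum>m\<in>S. M * \<bar>L2_inner (w m) (undilate (e k))\<bar>)"
        unfolding abs_mult Gw using M by (intro sum_mono mult_right_mono) auto
      also have "\<dots> \<le> M * K" unfolding sum_distrib_left[symmetric] using psi_phi_bound[OF that] M0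
          by (intro mult_left_mono)
      finally show ?thesis .
    qed
    ultimately show ?thesis by (simp add: has_sum_abs_le)
  qed
  have MK: "0 \<le> M * K" using \<gamma>[of 0] by linarith
  have dG: "dilate (Suc 0) G \<in> translate_space \<phi>"
    unfolding G_def[abs_def] dilate_stretch by (rule translate_space_scale[OF ortho_phi gV])
  have "((\<lambda>k. L2_inner (dilate (Suc 0) G) (e k) * L2_inner (e k) (dilate (Suc 0) \<theta>)) has_sum
      L2_inner (dilate (Suc 0) G) (dilate (Suc 0) \<theta>)) UNIV"
    by (rule expand[OF dG dilate_L2[OF \<theta>]])
  moreover have "(\<Sum>k\<in>S. \<bar>L2_inner (dilate (Suc 0) G) (e k) * L2_inner (e k) (dilate (Suc 0) \<theta>)\<bar>)
      \<le> M * K * T" if "finite S" for S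
  proof -
    have "(\<Sum>k\<in>S. \<bar>L2_inner (dilate (Suc 0) G) (e k) * L2_inner (e k) (dilate (Suc 0) \<theta>)\<bar>)
        \<le> (\<Sum>k\<in>S. M * K * \<bar>L2_inner (e k) (dilate (Suc 0) \<theta>)\<bar>)"
      unfolding abs_mult using \<gamma> by (intro sum_mono mult_right_mono) auto
    also have "\<dots> \<le> M * K * T" unfolding sum_distrib_left[symmetric] using T[OF that] MK
        by (intro mult_left_mono)
    finally show ?thesis .
  qed
  ultimately have "\<bar>L2_inner (dilate (Suc 0) G) (dilate (Suc 0) \<theta>)\<bar> \<le> M * K * T"
      by (rule has_sum_abs_le)
  then show ?thesis using G_in[OF \<theta>] unfolding dilate_inner p_def by simp
qed

lemma coarse_bound:
  assumes f: "f \<in> L2_fun" and \<theta>: "\<theta> \<in> L2_fun" and M: "\<And>k. \<bar>L2_inner f (e k)\<bar> \<le> M"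
    and T: "\<And>S. finite S \<Longrightarrow> (\<Sum>k\<in>S. \<bar>L2_inner (e k) \<theta>\<bar>) \<le> T"
  shows "\<bar>L2_inner (proj f) \<theta>\<bar> \<le> M * T"
proof (rule has_sum_abs_le[OF proj_inner[OF f \<theta>]])
  fix S :: "int set" assume S: "finite S"
  have M0: "0 \<le> M" using M[of 0] by linarith
  have "(\<Sum>k\<in>S. \<bar>L2_inner f (e k) * L2_inner (e k) \<theta>\<bar>) \<le> (\<Sum>k\<in>S. M * \<bar>L2_inner (e k) \<theta>\<bar>)"
    unfolding abs_mult using M by (intro sum_mono mult_right_mono) auto
  also have "\<dots> \<le> M * T" unfolding sum_distrib_left[symmetric] using T[OF S] M0
      by (intro mult_left_mono)
  finally show "(\<Sum>k\<in>S. \<bar>L2_inner f (e k) * L2_inner (e k) \<theta>\<bar>) \<le> M * T" .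
qed

text \<open>
  The union of the multiresolution spaces is dense, and the dilation is unitary.
\<close>

lemma inner_dense:
  assumes f: "f \<in> L2_fun" and \<theta>: "\<theta> \<in> L2_fun" and \<epsilon>: "0 < \<epsilon>"
  obtains J where "\<bar>L2_inner (proj (dilate J f)) (dilate J \<theta>) - L2_inner f \<theta>\<bar> \<le> \<epsilon>"
proof -
  define N where "N = sqrt (L2_inner \<theta> \<theta>) + 1"
  have N: "N > 0" unfolding N_def using real_sqrt_ge_zero[OF L2_inner_nonneg[of \<theta>]] by linarith
  obtain J h where h: "h \<in> mra_space \<phi> J" and hf: "(LINT x|lborel. (f x - h x)\<^sup>2) < (\<epsilon> / N)\<^sup>2"
    using scaling f \<epsilon> N unfolding scaling_function_def by (meson divide_pos_pos zero_less_power)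
  obtain h' where h': "h' \<in> translate_space \<phi>" "h = (\<lambda>x. h' (2 ^ J * x))"
    using h by (auto simp: mra_space_def)
  have "dilate J h = (\<lambda>x. 2 powr (- real J / 2) * h' x)" by (auto simp: dilate_def h'(2))
  then have dh: "dilate J h \<in> translate_space \<phi>" using translate_space_scale[OF ortho_phi h'(1)]
      by simp
  have "(LINT x|lborel. (dilate J f x - dilate J h x)\<^sup>2) = L2_inner (dilate J (\<lambda>x. f x - h x))
      (dilate J (\<lambda>x. f x - h x))"
    unfolding L2_inner_self by (simp add: dilate_def right_diff_distrib)
  also have "\<dots> = L2_inner (\<lambda>x. f x - h x) (\<lambda>x. f x - h x)" by (rule dilate_inner)
  also have "\<dots> = (LINT x|lborel. (f x - h x)\<^sup>2)" by (rule L2_inner_self)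
  finally have eq: "(LINT x|lborel. (dilate J f x - dilate J h x)\<^sup>2)
      = (LINT x|lborel. (f x - h x)\<^sup>2)" .
  have "\<bar>L2_inner (proj (dilate J f)) (dilate J \<theta>) - L2_inner (dilate J f) (dilate J \<theta>)\<bar>
      \<le> sqrt (LINT x|lborel. (f x - h x)\<^sup>2) * sqrt (L2_inner \<theta> \<theta>)"
    using proj_error[OF dilate_L2[OF f, of J] dilate_L2[OF \<theta>, of J] dh]
        unfolding eq dilate_inner[of J \<theta> \<theta>] .
  also have "\<dots> \<le> \<epsilon> / N * N"
  proof (intro mult_mono)
    show "sqrt (LINT x|lborel. (f x - h x)\<^sup>2) \<le> \<epsilon> / N"
      using hf \<epsilon> N by (intro real_le_lsqrt) auto
  qed (use \<epsilon> N L2_inner_nonneg[of \<theta>] in \<open>auto simp: N_def\<close>)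
  also have "\<dots> = \<epsilon>" using N by simp
  finally show ?thesis unfolding dilate_inner by (rule that)
qed

text \<open>
  Telescoping over the levels. All estimates are of the form supremum of the coefficients of \<open>f\<close>
  times sum of the coefficients of \<open>\<theta>\<close>.
\<close>

lemma multiscale_bound:
  assumes f: "f \<in> L2_fun" and \<theta>: "\<theta> \<in> L2_fun"
    and M0: "\<And>k. \<bar>L2_inner f (e k)\<bar> \<le> M0" and M: "\<And>j m. \<bar>L2_inner (dilate j f) (w m)\<bar> \<le> M j"
    and T: "\<And>J S. finite S \<Longrightarrow> (\<Sum>k\<in>S. \<bar>L2_inner (e k) (dilate J \<theta>)\<bar>) \<le> T J"
    and sm: "summable (\<lambda>j. M j * K * T (Suc j))"
  shows "\<bar>L2_inner f \<theta>\<bar> \<le> M0 * T 0 + (\<Sum>j. M j * K * T (Suc j))"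
proof (rule field_le_epsilon)
  fix \<epsilon> :: real assume "0 < \<epsilon>"
  define b where "b J = L2_inner (proj (dilate J f)) (dilate J \<theta>)" for J
  obtain J where J: "\<bar>b J - L2_inner f \<theta>\<bar> \<le> \<epsilon>"
    using inner_dense[OF f \<theta> \<open>0 < \<epsilon>\<close>] unfolding b_def by blast
  have b0: "\<bar>b 0\<bar> \<le> M0 * T 0"
    unfolding b_def dilate_0 using T[of _ 0] by (intro coarse_bound[OF f \<theta> M0]) (simp add: dilate_0)
  have step: "\<bar>b (Suc j) - b j\<bar> \<le> M j * K * T (Suc j)" for j
    using detail_bound[OF dilate_L2[OF f, of j] dilate_L2[OF \<theta>, of j] M, of "T (Suc j)"] T[of _ "Suc
        j"]
    unfolding b_def dilate_Suc by blast
  have "\<bar>b J\<bar> \<le> \<bar>b 0\<bar> + (\<Sum>j<J. \<bar>b (Suc j) - b j\<bar>)"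
    by (induction J) auto
  also have "\<dots> \<le> M0 * T 0 + (\<Sum>j<J. M j * K * T (Suc j))"
    using b0 step by (intro add_mono sum_mono) auto
  also have "(\<Sum>j<J. M j * K * T (Suc j)) \<le> (\<Sum>j. M j * K * T (Suc j))"
    using step abs_ge_zero order_trans by (intro sum_le_suminf[OF sm]) blast+
  finally show "\<bar>L2_inner f \<theta>\<bar> \<le> M0 * T 0 + (\<Sum>j. M j * K * T (Suc j)) + \<epsilon>" using J by linarith
qed

end

section \<open>Weak derivatives and exponential decay\<close>

lemma locally_integrable_measurable:
  assumes "locally_integrable g" shows "g \<in> borel_measurable borel"
proof (rule borel_measurable_LIMSEQ_real)
  fix x
  show "(\<lambda>n. indicator {- real n..real n} x * g x) \<longlonglongrightarrow> g x"
  proof (rule tendsto_eventually)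
    show "\<forall>\<^sub>F n in sequentially. indicator {- real n..real n} x * g x = g x"
      using eventually_ge_at_top[of "nat \<lceil>\<bar>x\<bar>\<rceil>"]
    proof eventually_elim
      case (elim n)
      then have "\<bar>x\<bar> \<le> real n" by linarith
      then have "x \<in> {- real n..real n}" by auto
      then show ?case by simp
    qed
  qed
next
  fix n show "(\<lambda>x. indicator {- real n..real n} x * g x) \<in> borel_measurable borel"
  proof -
    have "integrable lborel (\<lambda>x. indicat_real {- real n..real n} x * g x)"
      using assms by (simp add: locally_integrable_def set_integrable_def)
    then show ?thesis by (auto dest: borel_measurable_integrable)
  qed
qed

lemma locally_integrable_mult:
  assumes g: "locally_integrable g" and \<eta>: "\<eta> \<in> borel_measurable borel" "\<And>x. \<bar>\<eta> x\<bar>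
      \<le> 1" "\<And>x. x \<notin> {a..b} \<Longrightarrow> \<eta> x = 0"
  shows "integrable lborel (\<lambda>x. g x * \<eta> x)"
proof (rule Bochner_Integration.integrable_bound)
  show "integrable lborel (\<lambda>x. indicat_real {a..b} x *\<^sub>R g x)"
    using g by (auto simp: locally_integrable_def set_integrable_def)
  show "(\<lambda>x. g x * \<eta> x) \<in> borel_measurable lborel"
    using locally_integrable_measurable[OF g] \<eta>(1) by simp
  have "norm (g x * \<eta> x) \<le> norm (indicat_real {a..b} x *\<^sub>R g x)" for x
  proof (cases "x \<in> {a..b}")
    case True
    have "\<bar>g x\<bar> * \<bar>\<eta> x\<bar> \<le> \<bar>g x\<bar> * 1" using \<eta>(2) by (intro mult_left_mono) auto
    then show ?thesis using True by (simp add: abs_mult)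
  qed (simp add: \<eta>(3))
  then show "AE x in lborel. norm (g x * \<eta> x) \<le> norm (indicat_real {a..b} x *\<^sub>R g x)" by simp
qed

lemma plateau_limit:
  assumes g: "locally_integrable g" and ab: "a \<le> b"
  shows "(\<lambda>n. LINT x|lborel. g x * plateau (real (Suc n)) a b x)
      \<longlonglongrightarrow> (LINT x|lborel. g x * indicator {a<..b} x)"
proof (rule integral_dominated_convergence[where w = "\<lambda>x. \<bar>indicat_real {a..b + 1} x *\<^sub>R g x\<bar>"])
  have [measurable]: "g \<in> borel_measurable borel" by (rule locally_integrable_measurable[OF g])
  show "(\<lambda>x. g x * indicator {a<..b} x) \<in> borel_measurable lborel" by measurable
  show "(\<lambda>x. g x * plateau (real (Suc n)) a b x) \<in> borel_measurable lborel" for n by measurable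
  show "integrable lborel (\<lambda>x. \<bar>indicat_real {a..b + 1} x *\<^sub>R g x\<bar>)"
    using g by (intro integrable_abs) (auto simp: locally_integrable_def set_integrable_def)
  have "norm (g x * plateau (real (Suc n)) a b x) \<le> \<bar>indicat_real {a..b + 1} x *\<^sub>R g x\<bar>" for x n
  proof (cases "x \<in> {a..b + 1}")
    case True
    have "\<bar>g x\<bar> * \<bar>plateau (real (Suc n)) a b x\<bar> \<le> \<bar>g x\<bar> * 1"
      using plateau_bounds[of "real (Suc n)" a b x] ab by (intro mult_left_mono) auto
    then show ?thesis using True by (simp add: abs_mult)
  next
    case False
    have "1 / real (Suc n) \<le> 1" by simp
    moreover have "x < a \<or> b + 1 < x" using False by auto
    ultimately have "x \<le> a \<or> b + 1 / real (Suc n) \<le> x" by linarith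
    then have "plateau (real (Suc n)) a b x = 0" using ab by (intro plateau_outside) auto
    then show ?thesis by simp
  qed
  then show "AE x in lborel. norm (g x * plateau (real (Suc n)) a b x) \<le> \<bar>indicat_real {a..b
      + 1} x *\<^sub>R g x\<bar>" for n by simp
  have "(\<lambda>n. plateau (real (Suc n)) a b x) \<longlonglongrightarrow> indicator {a<..b} x" for x
  proof (rule tendsto_eventually)
    have big: "\<forall>\<^sub>F n in sequentially. 1 \<le> real (Suc n) * y" if "y > 0" for y :: real
      using eventually_ge_at_top[of "nat \<lceil>1 / y\<rceil>"]
    proof eventually_elim
      case (elim n)
      then have "1 / y \<le> real (Suc n)" by linarith
      then show ?case using that by (simp add: pos_divide_le_eq)
    qed
    have neg: "real (Suc n) * y \<le> 0" if "y \<le> 0" for n y using that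
        by (intro mult_nonneg_nonpos) auto
    consider "x \<le> a" | "a < x" "x \<le> b" | "a < x" "b < x" by linarith
    then show "\<forall>\<^sub>F n in sequentially. plateau (real (Suc n)) a b x = indicator {a<..b} x"
    proof cases
      case 1
      then show ?thesis using ab by (auto intro!: always_eventually plateau_outside)
    next
      case 2
      show ?thesis using big[of "x - a"]  2
        by (auto elim!: eventually_mono simp: plateau_def smooth_step_one smooth_step_zero[OF neg]
            simp del: of_nat_Suc)
    next
      case 3
      have "\<forall>\<^sub>F n in sequentially. 1 \<le> real (Suc n) * (x - a) \<and> 1 \<le> real (Suc n) * (x - b)"
        using big[of "x - a"] big[of "x - b"] 3
            by (auto intro: eventually_conj simp del: of_nat_Suc)
      then show ?thesis using 3
        by (auto elim!: eventually_mono simp: plateau_def smooth_step_one simp del: of_nat_Suc)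
    qed
  qed
  then show "AE x in lborel. (\<lambda>n. g x * plateau (real (Suc n)) a b x) \<longlonglongrightarrow> g x * indicator {a<..b} x"
    by (auto intro!: tendsto_mult)
qed

text \<open>
  The positive and the negative part of \<open>u\<close>, cut off to a bounded interval, are densities of
  finite measures that agree on all half-lines, hence coincide.
\<close>

lemma AE_zero_if_integrals_zero:
  fixes u :: "real \<Rightarrow> real"
  assumes u: "locally_integrable u" and z: "\<And>a b. a \<le> b \<Longrightarrow> (LINT x|lborel. u x * indicator {a<..b} x)
      = 0"
  shows "AE x in lborel. u x = 0"
proof -
  have [measurable]: "u \<in> borel_measurable borel" by (rule locally_integrable_measurable[OF u])
  have "AE x in lborel. u x * indicator {- real n<..real n} x = 0" for n
  proof -
    define v where "v x = u x * indicator {- real n<..real n} x" for x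
    have [measurable]: "v \<in> borel_measurable borel" unfolding v_def[abs_def] by measurable
    have v: "integrable lborel v"
      unfolding v_def[abs_def]
      by (rule locally_integrable_mult[OF u, where a = "- real n"
          and b = "real n"]) (auto simp: indicator_def)
    have vi: "integrable lborel (\<lambda>y. max 0 (w y) * indicator {x<..} y)" if "integrable lborel w"
        for w :: "real \<Rightarrow> real" and x :: real
      using integrable_real_mult_indicator[of "{x<..}" lborel "\<lambda>y. max 0 (w y)"] that
          by (simp add: mult.commute)
    have em: "emeasure (density lborel (\<lambda>y. ennreal (max 0 (w y)))) {x<..}
        = ennreal (LINT y|lborel. max 0 (w y) * indicator {x<..} y)"
      if w: "integrable lborel w" for w :: "real \<Rightarrow> real" and x :: real
    proof -
      have [measurable]: "w \<in> borel_measurable borel" using w by auto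
      have "emeasure (density lborel (\<lambda>y. ennreal (max 0 (w y)))) {x<..}
          = (\<integral>\<^sup>+y. ennreal (max 0 (w y) * indicator {x<..} y) \<partial>lborel)"
        by (subst emeasure_density) (auto intro!: nn_integral_cong simp: indicator_def)
      also have "\<dots> = ennreal (LINT y|lborel. max 0 (w y) * indicator {x<..} y)"
        by (rule nn_integral_eq_integral[OF vi[OF w]]) (auto simp: indicator_def)
      finally show ?thesis .
    qed
    have mv: "integrable lborel (\<lambda>y. - v y)" using v by simp
    have eq: "(LINT y|lborel. max 0 (v y) * indicator {x<..} y) = (LINT y|lborel. max 0 (- v y)
        * indicator {x<..} y)" for x
    proof -
      have "(LINT y|lborel. max 0 (v y) * indicator {x<..} y) - (LINT y|lborel. max 0 (- v y)
          * indicator {x<..} y)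
        = (LINT y|lborel. max 0 (v y) * indicator {x<..} y - max 0 (- v y) * indicator {x<..} y)"
        using vi[OF v] vi[OF mv] by simp
      also have "\<dots> = (LINT y|lborel. u y * indicator {min (max x (- real n)) (real n)<..real n} y)"
      proof (intro Bochner_Integration.integral_cong refl)
        fix y
        have "max 0 (v y) * indicat_real {x<..} y - max 0 (- v y) * indicat_real {x<..} y
            = v y * indicator {x<..} y"
          by (simp add: left_diff_distrib[symmetric] max_def)
        also have "\<dots> = u y * indicator ({- real n<..real n} \<inter> {x<..}) y"
            by (simp add: v_def indicator_inter_arith)
        also have "{- real n<..real n} \<inter> {x<..} = {min (max x (- real n)) (real n)<..real n}"
            by auto
        finally show "max 0 (v y) * indicat_real {x<..} y - max 0 (- v y) * indicat_real {x<..} y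
          = u y * indicator {min (max x (- real n)) (real n)<..real n} y" .
      qed
      also have "\<dots> = 0" by (intro z) simp
      finally show ?thesis by simp
    qed
    have "density lborel (\<lambda>y. ennreal (max 0 (v y))) = density lborel (\<lambda>y. ennreal (max 0 (- v y)))"
    proof (rule measure_eqI_lessThan)
      show "emeasure (density lborel (\<lambda>y. ennreal (max 0 (v y)))) {x<..} < \<infinity>" for x
        unfolding em[OF v] by simp
      show "emeasure (density lborel (\<lambda>y. ennreal (max 0 (v y)))) {x<..}
          = emeasure (density lborel (\<lambda>y. ennreal (max 0 (- v y)))) {x<..}" for x
        unfolding em[OF v] em[OF mv] eq ..
    qed simp_all
    then have "AE y in lborel. ennreal (max 0 (v y)) = ennreal (max 0 (- v y))"
      by (intro sigma_finite_measure.density_unique[OF sigma_finite_lborel]) auto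
    then show ?thesis
    proof eventually_elim
      case (elim y)
      then have "max 0 (v y) = max 0 (- v y)" by (subst (asm) ennreal_inj) auto
      then have "v y = 0" by (auto simp: max_def split: if_splits)
      then show ?case unfolding v_def .
    qed
  qed
  then have "AE x in lborel. \<forall>n. u x * indicator {- real n<..real n} x = 0"
      by (subst AE_all_countable) auto
  then show ?thesis
  proof eventually_elim
    case (elim x)
    have "\<bar>x\<bar> < real (nat \<lceil>\<bar>x\<bar>\<rceil> + 1)" by linarith
    then have "x \<in> {- real (nat \<lceil>\<bar>x\<bar>\<rceil> + 1)<..real (nat \<lceil>\<bar>x\<bar>\<rceil> + 1)}" by auto
    then show ?case using elim[rule_format, of "nat \<lceil>\<bar>x\<bar>\<rceil> + 1"] by simp
  qed
qed

text \<open>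
  Plateau functions are test functions, and they approximate indicators of intervals.
\<close>

lemma weak_derivative_0_AE_eq:
  assumes "weak_derivative 0 g g'"
  shows "AE x in lborel. g x = g' x"
proof -
  have l: "locally_integrable g" "locally_integrable g'" and t: "\<And>\<eta>. test_function \<eta>
      \<Longrightarrow> (LINT x|lborel. g x * \<eta> x) = (LINT x|lborel. g' x * \<eta> x)"
    using assms by (auto simp: weak_derivative_def)
  have eq: "(LINT x|lborel. g x * indicator {a<..b} x) = (LINT x|lborel. g' x * indicator {a<..b}
      x)" if "a \<le> b" for a b
  proof (rule LIMSEQ_unique[OF plateau_limit[OF l(1) that]])
    show "(\<lambda>n. LINT x|lborel. g x * plateau (real (Suc n)) a b x) \<longlonglongrightarrow> (LINT x|lborel. g' x * indicator
        {a<..b} x)"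
      using plateau_limit[OF l(2) that] t[OF test_function_plateau[OF _ that]] by simp
  qed
  have lu: "locally_integrable (\<lambda>x. g x - g' x)"
    using l by (auto simp: locally_integrable_def intro: set_integral_diff)
  have int: "integrable lborel (\<lambda>x. h x * indicat_real {a<..b} x)" if "locally_integrable h"
      for h a b
    by (rule locally_integrable_mult[OF that, where a = a and b = b]) (auto simp: indicator_def)
  have "AE x in lborel. g x - g' x = 0"
    by (rule AE_zero_if_integrals_zero[OF lu]) (simp add: left_diff_distrib int l eq)
  then show ?thesis by simp
qed

lemma geometric_int_sum:
  fixes q :: real and S :: "int set"
  assumes q: "0 \<le> q" "q < 1" and S: "finite S"
  shows "(\<Sum>k\<in>S. q ^ nat \<bar>k - m\<bar>) \<le> 2 / (1 - q)"
proof -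
  have half: "(\<Sum>k\<in>A. q ^ nat \<bar>k - m\<bar>) \<le> 1 / (1 - q)" if A: "finite A"
      and inj: "inj_on (\<lambda>k. nat \<bar>k - m\<bar>) A" for A
  proof -
    have "(\<Sum>k\<in>A. q ^ nat \<bar>k - m\<bar>) = (\<Sum>j\<in>(\<lambda>k. nat \<bar>k - m\<bar>) ` A. q ^ j)"
      by (simp add: sum.reindex[OF inj])
    also have "\<dots> \<le> (\<Sum>j. q ^ j)" using q A by (intro sum_le_suminf summable_geometric) auto
    also have "\<dots> = 1 / (1 - q)" using q by (intro suminf_geometric) auto
    finally show ?thesis .
  qed
  have "(\<Sum>k\<in>S. q ^ nat \<bar>k - m\<bar>) = (\<Sum>k\<in>S \<inter> {m..}. q ^ nat \<bar>k - m\<bar>) + (\<Sum>k\<in>S - {m..}. q ^ nat \<bar>k - m\<bar>)"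
    by (rule sum.Int_Diff[OF S])
  also have "\<dots> \<le> 1 / (1 - q) + 1 / (1 - q)"
    using S by (intro add_mono half) (auto simp: inj_on_def)
  finally show ?thesis by simp
qed

text \<open>
  Comparison with a geometric series in the distance of \<open>k\<close> from the floor of \<open>x\<close>.
\<close>

lemma exponentially_decaying_translates:
  assumes h: "h \<in> borel_measurable borel" and dec: "exponentially_decaying h"
  obtains C where "0 \<le> C" "AE x in lborel. \<forall>S. finite S \<longrightarrow> (\<Sum>k\<in>S. \<bar>h (x - of_int k)\<bar>) \<le> C"
proof -
  obtain C0 c where c: "0 < c" and C0: "AE x in lborel. \<bar>h x\<bar> \<le> C0 * exp (- c * \<bar>x\<bar>)"
    using dec by (auto simp: exponentially_decaying_def)
  define C where "C = \<bar>C0\<bar> * exp c * (2 / (1 - exp (- c)))"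
  have "AE x in lborel. \<bar>h (- of_int k + 1 * x)\<bar> \<le> C0 * exp (- c * \<bar>- of_int k + 1 * x\<bar>)"
      for k :: int
    by (rule AE_borel_affine[OF _ _ C0]) (use h in auto)
  then have "AE x in lborel. \<forall>k :: int. \<bar>h (x - of_int k)\<bar> \<le> C0 * exp (- c * \<bar>x - of_int k\<bar>)"
    by (subst AE_all_countable) simp
  then have "AE x in lborel. \<forall>S. finite S \<longrightarrow> (\<Sum>k\<in>S. \<bar>h (x - of_int k)\<bar>) \<le> C"
  proof eventually_elim
    case (elim x)
    show ?case
    proof (intro allI impI)
      fix S :: "int set" assume S: "finite S"
      have "\<bar>h (x - of_int k)\<bar> \<le> \<bar>C0\<bar> * exp c * exp (- c) ^ nat \<bar>k - \<lfloor>x\<rfloor>\<bar>" for k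
      proof -
        have "real (nat \<bar>k - \<lfloor>x\<rfloor>\<bar>) - 1 \<le> \<bar>x - of_int k\<bar>" by linarith
        then have "c * (real (nat \<bar>k - \<lfloor>x\<rfloor>\<bar>) - 1) \<le> c * \<bar>x - of_int k\<bar>" using c
            by (intro mult_left_mono) auto
        then have "exp (- c * \<bar>x - of_int k\<bar>) \<le> exp (c + real (nat \<bar>k - \<lfloor>x\<rfloor>\<bar>) * (- c))"
          by (simp add: algebra_simps)
        also have "\<dots> = exp c * exp (- c) ^ nat \<bar>k - \<lfloor>x\<rfloor>\<bar>" by (simp only: exp_add exp_of_nat_mult)
        finally have "\<bar>C0\<bar> * exp (- c * \<bar>x - of_int k\<bar>) \<le> \<bar>C0\<bar> * (exp c * exp (- c) ^ nat \<bar>k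
            - \<lfloor>x\<rfloor>\<bar>)"
          by (intro mult_left_mono) auto
        moreover have "C0 * exp (- c * \<bar>x - of_int k\<bar>) \<le> \<bar>C0\<bar> * exp (- c * \<bar>x - of_int k\<bar>)"
          by (intro mult_right_mono) auto
        ultimately show ?thesis using elim[rule_format, of k] unfolding mult.assoc by linarith
      qed
      then have "(\<Sum>k\<in>S. \<bar>h (x - of_int k)\<bar>) \<le> (\<Sum>k\<in>S. \<bar>C0\<bar> * exp c * exp (- c) ^ nat \<bar>k - \<lfloor>x\<rfloor>\<bar>)"
        by (intro sum_mono)
      also have "\<dots> \<le> C"
        unfolding C_def sum_distrib_left[symmetric] using c S
            by (intro mult_left_mono geometric_int_sum) auto
      finally show "(\<Sum>k\<in>S. \<bar>h (x - of_int k)\<bar>) \<le> C" .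
    qed
  qed
  moreover have "0 \<le> C" unfolding C_def using c by (intro mult_nonneg_nonneg divide_nonneg_nonneg)
      auto
  ultimately show ?thesis by (rule that[rotated])
qed

lemma L2_bounded_integrable:
  assumes g: "integrable lborel g" and B: "\<And>x. \<bar>g x\<bar> \<le> B"
  shows "g \<in> L2_fun"
proof -
  have "integrable lborel (\<lambda>x. (g x)\<^sup>2)"
  proof (rule Bochner_Integration.integrable_bound)
    show "integrable lborel (\<lambda>x. B * \<bar>g x\<bar>)" using g by simp
    show "(\<lambda>x. (g x)\<^sup>2) \<in> borel_measurable lborel" using g
        by (auto dest: borel_measurable_integrable)
    have "norm ((g x)\<^sup>2) \<le> norm (B * \<bar>g x\<bar>)" for x
    proof -
      have "\<bar>g x\<bar> * \<bar>g x\<bar> \<le> \<bar>B\<bar> * \<bar>g x\<bar>" using B[of x] by (intro mult_right_mono) auto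
      then show ?thesis by (simp add: power2_eq_square abs_mult)
    qed
    then show "AE x in lborel. norm ((g x)\<^sup>2) \<le> norm (B * \<bar>g x\<bar>)" by simp
  qed
  moreover have "g \<in> borel_measurable borel" using g by (auto dest: borel_measurable_integrable)
  ultimately show ?thesis by (simp add: L2_fun_def)
qed

lemma bump_bounded: "\<exists>B. \<forall>x. \<bar>bump x\<bar> \<le> B"
proof -
  have "compact (bump ` {0..1})" by (intro compact_continuous_image bump_continuous) auto
  then obtain P where P: "\<And>x. x \<in> {0..1} \<Longrightarrow> \<bar>bump x\<bar> \<le> P"
    by (metis bounded_iff compact_imp_bounded imageI real_norm_def)
  have "\<bar>bump x\<bar> \<le> \<bar>P\<bar>" for x
    using P[of x] bump_outside[of x] by (cases "x \<in> {0..1}") auto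
  then show ?thesis by blast
qed

lemma dipole_L2:
  assumes "0 < r" shows "dipole r a b \<in> L2_fun"
proof -
  obtain B where B: "\<And>x. \<bar>bump x\<bar> \<le> B" using bump_bounded by blast
  have "\<bar>dipole r a b z\<bar> \<le> r * B + r * B" for z
    unfolding dipole_def using B[of "r * (z - a)"] B[of "r * (z - b)"] assms
    by (intro order_trans[OF abs_triangle_ineq4] add_mono) (auto simp: abs_mult intro!:
        mult_left_mono)
  then show ?thesis by (rule L2_bounded_integrable[OF dipole_L1(1)[OF assms]])
qed

lemma plateau_L1:
  assumes "0 < r" "a \<le> b"
  shows "integrable lborel (plateau r a b)" "(LINT z|lborel. \<bar>plateau r a b z\<bar>) \<le> b - a + 1 / r"
proof -
  have le: "\<bar>plateau r a b z\<bar> \<le> indicat_real {a..b + 1 / r} z" for z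
    using plateau_bounds[OF assms, of z] plateau_outside[OF assms, of z]
        by (cases "z \<in> {a..b + 1 / r}") auto
  have i: "integrable lborel (indicat_real {a..b + 1 / r})"
    by (intro integrable_real_indicator) (auto simp: emeasure_lborel_Icc_eq)
  show int: "integrable lborel (plateau r a b)"
    by (rule Bochner_Integration.integrable_bound[OF i]) (use le in auto)
  have "(LINT z|lborel. \<bar>plateau r a b z\<bar>) \<le> (LINT z|lborel. indicat_real {a..b + 1 / r} z)"
    using int i le by (intro integral_mono) auto
  also have "\<dots> = b - a + 1 / r" using assms by (simp add: add_increasing2)
  finally show "(LINT z|lborel. \<bar>plateau r a b z\<bar>) \<le> b - a + 1 / r" .
qed

text \<open>
  Continuity of \<open>f\<close> at the two points; dominated convergence after rescaling.
\<close>

lemma dipole_limit: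
  assumes cont: "continuous_on UNIV f" and bnd: "\<And>x. \<bar>f x\<bar> \<le> B"
  shows "(\<lambda>n. L2_inner f (dipole (real (Suc n)) a b)) \<longlonglongrightarrow> f a - f b"
proof -
  have [measurable]: "f \<in> borel_measurable borel" by (rule borel_measurable_continuous_onI[OF cont])
  have bi: "integrable lborel bump" "(LINT x|lborel. bump x) = 1" using bump_lborel
      by (auto simp: has_bochner_integral_iff)
  have one: "(\<lambda>n. LINT z|lborel. f z * (real (Suc n) * bump (real (Suc n) * (z - a)))) \<longlonglongrightarrow> f a" for a
  proof -
    have "(LINT z|lborel. f z * (r * bump (r * (z - a)))) = (LINT y|lborel. f (a + (1 / r) * y)
        * bump y)" if "r > 0" for r
      using lborel_integral_real_affine[of "1 / r" "\<lambda>z. f z * (r * bump (r * (z - a)))" a] that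
      by (simp add: mult_ac)
    then have eq: "(\<lambda>n. LINT z|lborel. f z * (real (Suc n) * bump (real (Suc n) * (z - a))))
        = (\<lambda>n. LINT y|lborel. f (a + (1 / real (Suc n)) * y) * bump y)"
      by (simp del: of_nat_Suc)
    have "(\<lambda>n. LINT y|lborel. f (a + (1 / real (Suc n)) * y) * bump y)
        \<longlonglongrightarrow> (LINT y|lborel. f a * bump y)"
    proof (rule integral_dominated_convergence[where w = "\<lambda>y. B * bump y"])
      show "AE y in lborel. (\<lambda>n. f (a + 1 / real (Suc n) * y) * bump y) \<longlonglongrightarrow> f a * bump y"
      proof (intro always_eventually allI tendsto_mult tendsto_const)
        fix y
        have "(\<lambda>n. a + 1 / real (Suc n) * y) \<longlonglongrightarrow> a + 0 * y"
            by (intro tendsto_intros LIMSEQ_Suc[OF lim_1_over_n])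
        then have "(\<lambda>n. a + 1 / real (Suc n) * y) \<longlonglongrightarrow> a" by simp
        moreover have "isCont f a" using cont by (simp add: continuous_on_eq_continuous_at)
        ultimately show "(\<lambda>n. f (a + 1 / real (Suc n) * y)) \<longlonglongrightarrow> f a"
            by (rule isCont_tendsto_compose[rotated])
      qed
      show "AE y in lborel. norm (f (a + 1 / real (Suc n) * y) * bump y) \<le> B * bump y" for n
        using bnd bump_nonneg by (intro always_eventually allI) (auto simp: abs_mult intro!:
            mult_right_mono)
    qed (use bi in auto)
    then show ?thesis unfolding eq using bi by simp
  qed
  have int: "integrable lborel (\<lambda>z. f z * (r * bump (r * (z - a))))" if "r > 0" for r a
  proof (rule Bochner_Integration.integrable_bound)
    show "integrable lborel (\<lambda>z. B * (r * bump (r * (z - a))))" using scaled_bump_lborel[OF that]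
        by (auto simp: has_bochner_integral_iff intro!: integrable_mult_right)
    show "AE z in lborel. norm (f z * (r * bump (r * (z - a))))
        \<le> norm (B * (r * bump (r * (z - a))))"
    proof (intro always_eventually allI)
      fix z
      have "\<bar>f z\<bar> * \<bar>r * bump (r * (z - a))\<bar> \<le> \<bar>B\<bar> * \<bar>r * bump (r * (z - a))\<bar>" using bnd[of z]
          by (intro mult_right_mono) auto
      then show "norm (f z * (r * bump (r * (z - a)))) \<le> norm (B * (r * bump (r * (z - a))))"
          by (simp only: abs_mult real_norm_def)
    qed
  qed measurable
  have "L2_inner f (dipole (real (Suc n)) a b) = (LINT z|lborel. f z * (real (Suc n)
      * bump (real (Suc n) * (z - a)))) - (LINT z|lborel. f z * (real (Suc n) * bump (real (Suc n)
      * (z - b))))" for n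
  proof -
    have "f z * dipole (real (Suc n)) a b z = f z * (real (Suc n) * bump (real (Suc n) * (z - a)))
        - f z * (real (Suc n) * bump (real (Suc n) * (z - b)))" for z
      unfolding dipole_def by (rule right_diff_distrib)
    then show ?thesis unfolding L2_inner_def
        by (simp only: Bochner_Integration.integral_diff[OF int int] of_nat_0_less_iff
        zero_less_Suc)
  qed
  then show ?thesis using tendsto_diff[OF one[of a] one[of b]] by simp
qed

section \<open>Uniform Hoelder continuity of the density class\<close>

lemma min_one_le_powr:
  fixes y \<beta> :: real
  assumes "0 < y" "0 \<le> \<beta>" "\<beta> \<le> 1"
  shows "min 1 y \<le> y powr \<beta>"
proof (cases "y \<le> 1")
  case True
  then have "y powr 1 \<le> y powr \<beta>" using assms by (intro powr_mono') auto
  then show ?thesis using assms True by simp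
next
  case False
  then show ?thesis using assms ge_one_powr_ge_zero[of y \<beta>] by simp
qed

text \<open>
  Integration by parts: the dipole is the derivative of a plateau, which is a test function.
\<close>

lemma weak_derivative_dilated_dipole:
  assumes w: "weak_derivative 1 g g'" and r: "0 < r" "a \<le> b"
  shows "L2_inner (\<lambda>x. g (x - of_int k)) (dilate J (dipole r a b)) =
     - (2 powr (real J / 2) * (LINT y|lborel. plateau r a b (y / 2 ^ J) * g' (y - of_int k)))"
proof -
  define \<eta> where "\<eta> y = plateau r a b ((1 / 2 ^ J) * y + of_int k / 2 ^ J)" for y
  have t: "test_function \<eta>"
    unfolding \<eta>_def[abs_def] by (rule test_function_smooth_affine[OF test_function_plateau[OF r]])
        simp
  have "(\<eta> has_field_derivative dipole r a b ((1 / 2 ^ J) * y + of_int k / 2 ^ J) * (1 / 2 ^ J))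
      (at y)" for y
    unfolding \<eta>_def[abs_def] by (rule DERIV_chain'[OF _ plateau_derivative]) (auto intro!:
        derivative_eq_intros)
  then have d: "deriv \<eta> = (\<lambda>y. dipole r a b ((1 / 2 ^ J) * y + of_int k / 2 ^ J) * (1 / 2 ^ J))"
    by (intro ext DERIV_imp_deriv)
  have p: "2 powr (- real J / 2) = 2 powr (real J / 2) * (1 / (2::real) ^ J)"
  proof -
    have "2 powr (real J / 2) * (1 / (2::real) ^ J) = 2 powr (real J / 2) * 2 powr (- real J)"
      by (simp add: powr_minus_divide powr_realpow)
    also have "\<dots> = 2 powr (- real J / 2)" unfolding powr_add[symmetric]
        by (rule arg_cong[where f = "(powr) 2"]) simp
    finally show ?thesis by simp
  qed
  have "L2_inner (\<lambda>x. g (x - of_int k)) (dilate J (dipole r a b)) = (LINT x|lborel. g (x - of_int k)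
      * (2 powr (- real J / 2) * dipole r a b (x / 2 ^ J)))"
    by (simp add: L2_inner_def dilate_def)
  also have "\<dots> = (LINT x|lborel. g (x + of_int k - of_int k) * (2 powr (- real J / 2) * dipole r a b
      ((x + of_int k) / 2 ^ J)))"
    by (rule lborel_translate_integral[symmetric])
  also have "\<dots> = (LINT x|lborel. 2 powr (real J / 2) * (g x * deriv \<eta> x))"
    unfolding p d by (intro Bochner_Integration.integral_cong) (simp_all add: add_divide_distrib)
  also have "\<dots> = 2 powr (real J / 2) * (LINT x|lborel. g x * deriv \<eta> x)"
      by (rule integral_mult_right_zero)
  also have "(LINT x|lborel. g x * deriv \<eta> x) = - (LINT x|lborel. g' x * \<eta> x)"
    using w t by (simp add: weak_derivative_def)
  also have "(LINT x|lborel. g' x * \<eta> x) = (LINT x|lborel. g' (x - of_int k) * \<eta> (x - of_int k))"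
    using lborel_translate_integral[of "\<lambda>x. g' x * \<eta> x" "- of_int k"] by simp
  also have "\<dots> = (LINT x|lborel. plateau r a b (x / 2 ^ J) * g' (x - of_int k))"
    by (intro Bochner_Integration.integral_cong) (simp_all add: \<eta>_def mult.commute
        diff_divide_distrib)
  finally show ?thesis by simp
qed

lemma wavelet_norm_coefficients:
  assumes "wavelet_norm \<phi> \<psi> \<alpha> f \<le> ereal D"
  shows "\<bar>scaling_coeff \<phi> f k\<bar> \<le> D" "\<bar>wavelet_coeff \<psi> f l k\<bar> \<le> D * 2 powr (- real l * (\<alpha> + 1 / 2))"
proof -
  let ?A = "SUP k. ereal \<bar>scaling_coeff \<phi> f k\<bar>"
  let ?B = "SUP l. SUP k. ereal (2 powr (real l * (\<alpha> + 1 / 2)) * \<bar>wavelet_coeff \<psi> f l k\<bar>)"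
  have a: "ereal \<bar>scaling_coeff \<phi> f k\<bar> \<le> ?A" for k by (rule SUP_upper) simp
  have b: "ereal (2 powr (real l * (\<alpha> + 1 / 2)) * \<bar>wavelet_coeff \<psi> f l k\<bar>) \<le> ?B" for l k
    by (rule SUP_upper2[of l]) (auto intro: SUP_upper)
  have "0 \<le> ?A" using a[of 0] by (rule order_trans[rotated]) simp
  moreover have "0 \<le> ?B" using b[of 0 0] by (rule order_trans[rotated]) simp
  moreover have "?A + ?B \<le> ereal D" using assms by (simp add: wavelet_norm_def)
  ultimately have AB: "?A \<le> ereal D" "?B \<le> ereal D"
    using add_increasing2[of ?B ?A ?A] add_increasing[of ?A ?B ?B]
        by (meson order_trans order_refl)+
  show "\<bar>scaling_coeff \<phi> f k\<bar> \<le> D" using order_trans[OF a AB(1)] by simp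
  have "2 powr (real l * (\<alpha> + 1 / 2)) * \<bar>wavelet_coeff \<psi> f l k\<bar> \<le> D" using order_trans[OF b AB(2)]
      by simp
  then have "\<bar>wavelet_coeff \<psi> f l k\<bar> \<le> D / 2 powr (real l * (\<alpha> + 1 / 2))"
    by (simp add: pos_le_divide_eq mult.commute)
  then show "\<bar>wavelet_coeff \<psi> f l k\<bar> \<le> D * 2 powr (- real l * (\<alpha> + 1 / 2))"
    by (simp add: powr_minus_divide)
qed

text \<open>
  For a dipole that vanishes outside an interval of length \<open>h\<close>, dilated to level \<open>J\<close>, the sum of
  the coefficients with respect to the translates of \<open>\<phi>\<close> is \<open>O (2 powr (J / 2))\<close>, since its \<open>L\<^sup>1\<close>
  norm is, and \<open>O (2 powr (J / 2) * (2 ^ J * h))\<close>, by integration by parts. Interpolation gives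
  \<open>O (2 powr (J / 2) * (2 ^ J * h) powr \<beta>)\<close>. The wavelet coefficients of \<open>f\<close> are
  \<open>O (2 powr (- J * (\<alpha> + 1 / 2)))\<close>, so the series over the levels is geometric for every \<open>\<beta> < \<alpha>\<close>.
  Letting the poles of the dipole shrink to points turns the bound on inner products into one on
  differences of values. The exponent obtained is below \<open>\<alpha>\<close>, which is no loss: any positive
  exponent makes the modulus of continuity at dyadic scales negligible compared with \<open>1 / l\<close>.
\<close>

theorem density_class_holder:
  fixes \<phi> \<psi> :: "real \<Rightarrow> real"
  assumes \<alpha>: "0 < \<alpha>" and D: "0 < D" and sc: "scaling_function \<phi>" and wa: "associated_wavelet \<phi> \<psi>"
    and reg: "s_regular s \<phi>" and s: "\<alpha> < real s"
  obtains C \<beta> where "0 \<le> C" "0 < \<beta>" 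
    "\<And>f a b. f \<in> density_class \<phi> \<psi> \<alpha> D \<delta> F \<Longrightarrow> \<bar>f a - f b\<bar> \<le> C * \<bar>a - b\<bar> powr \<beta>"
proof -
  have s1: "1 \<le> s" using \<alpha> s by (cases s) auto
  obtain g0 where g0: "weak_derivative 0 \<phi> g0" "exponentially_decaying g0" using reg
      by (auto simp: s_regular_def)
  obtain g1 where g1: "weak_derivative 1 \<phi> g1" "exponentially_decaying g1" using reg s1
      by (auto simp: s_regular_def)
  have \<phi>m: "\<phi> \<in> borel_measurable borel" and g1m: "g1 \<in> borel_measurable borel"
    using g1(1) locally_integrable_measurable by (auto simp: weak_derivative_def)
  have "exponentially_decaying \<phi>"
  proof -
    obtain C c where "0 < c" "AE x in lborel. \<bar>g0 x\<bar> \<le> C * exp (- c * \<bar>x\<bar>)" using g0(2)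
        by (auto simp: exponentially_decaying_def)
    moreover from this(2) weak_derivative_0_AE_eq[OF g0(1)] have "AE x in lborel. \<bar>\<phi> x\<bar>
        \<le> C * exp (- c * \<bar>x\<bar>)"
      by eventually_elim simp
    ultimately show ?thesis by (auto simp: exponentially_decaying_def)
  qed
  then obtain C0 where C0: "0 \<le> C0" "AE x in lborel. \<forall>S. finite S \<longrightarrow> (\<Sum>k\<in>S. \<bar>\<phi> (x - of_int k)\<bar>) \<le> C0"
    using exponentially_decaying_translates[OF \<phi>m] by blast
  obtain C1 where C1: "0 \<le> C1" "AE x in lborel. \<forall>S. finite S \<longrightarrow> (\<Sum>k\<in>S. \<bar>g1 (x - of_int k)\<bar>) \<le> C1"
    using exponentially_decaying_translates[OF g1m g1(2)] by blast
  interpret mra: bounded_mra \<phi> \<psi> C0 by unfold_locales (rule sc wa C0(2))+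
  define Cm where "Cm = max (2 * C0) C1"
  have Cm: "0 \<le> Cm" using C1(1) by (simp add: Cm_def)
  \<comment> \<open>any exponent below \<open>\<alpha>\<close> and at most 1 would do\<close>
  define \<beta> where "\<beta> = min \<alpha> 1 / 2"
  have \<beta>: "0 < \<beta>" "\<beta> < \<alpha>" "\<beta> \<le> 1" using \<alpha> by (auto simp: \<beta>_def)
  have T: "(\<Sum>k\<in>S. \<bar>L2_inner (mra.e k) (dilate J (dipole r a b))\<bar>) \<le> Cm * 2 powr (real J / 2)
      * (2 ^ J * (b - a + 1 / r)) powr \<beta>"
    if S: "finite S" and r: "0 < r" "a \<le> b" for S J r a b
  proof -
    define h where "h = 2 ^ J * (b - a + 1 / r)"
    have "1 / r > 0" using r by simp
    then have "b - a + 1 / r > 0" using r by linarith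
    then have h: "h > 0" by (simp add: h_def)
    have d1: "integrable lborel (dilate J (dipole r a b))"
      unfolding dilate_def[abs_def] using dipole_L1(1)[OF r(1)]
          by (intro integrable_mult_right) (simp add: lborel_dilate_integrable)
    have "(\<Sum>k\<in>S. \<bar>L2_inner (mra.e k) (dilate J (dipole r a b))\<bar>)
        \<le> C0 * (LINT x|lborel. \<bar>dilate J (dipole r a b) x\<bar>)"
      unfolding L2_inner_commute[of "mra.e _"] unfolding L2_inner_def mra.e_def
      by (rule sum_translates_inner_bound[OF d1 \<phi>m C0(2) S])
    also have "(LINT x|lborel. \<bar>dilate J (dipole r a b) x\<bar>) = 2 powr (- real J / 2)
        * (2 ^ J * (LINT x|lborel. \<bar>dipole r a b x\<bar>))"
      unfolding dilate_def by (simp add: abs_mult lborel_dilate_integral[of "\<lambda>x. \<bar>dipole r a b x\<bar>"])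
    also have "\<dots> = 2 powr (real J / 2) * (LINT x|lborel. \<bar>dipole r a b x\<bar>)"
    proof -
      have "2 powr (- real J / 2) * 2 ^ J = (2::real) powr (real J / 2)"
        by (simp add: powr_realpow[symmetric] powr_add[symmetric])
      then show ?thesis by (simp only: mult.assoc[symmetric])
    qed
    also have "C0 * (2 powr (real J / 2) * (LINT x|lborel. \<bar>dipole r a b x\<bar>))
        \<le> C0 * (2 powr (real J / 2) * 2)"
      using C0(1) dipole_L1(2)[OF r(1)] by (intro mult_left_mono) auto
    also have "\<dots> = (2 * C0) * 2 powr (real J / 2)" by simp
    also have "\<dots> \<le> Cm * 2 powr (real J / 2)" by (intro mult_right_mono) (auto simp: Cm_def)
    finally have one: "(\<Sum>k\<in>S. \<bar>L2_inner (mra.e k) (dilate J (dipole r a b))\<bar>)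
        \<le> Cm * 2 powr (real J / 2)" .
    have pi: "integrable lborel (\<lambda>y. plateau r a b (y / 2 ^ J))"
      using plateau_L1(1)[OF r] by (simp add: lborel_dilate_integrable)
    have "(\<Sum>k\<in>S. \<bar>L2_inner (mra.e k) (dilate J (dipole r a b))\<bar>)
       = 2 powr (real J / 2) * (\<Sum>k\<in>S. \<bar>LINT y|lborel. plateau r a b (y / 2 ^ J)
           * g1 (y - of_int k)\<bar>)"
      unfolding mra.e_def[abs_def] weak_derivative_dilated_dipole[OF g1(1) r]
          by (simp add: abs_mult sum_distrib_left)
    also have "\<dots> \<le> 2 powr (real J / 2) * (C1 * (LINT y|lborel. \<bar>plateau r a b (y / 2 ^ J)\<bar>))"
      by (intro mult_left_mono sum_translates_inner_bound[OF pi g1m C1(2) S]) simp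
    also have "(LINT y|lborel. \<bar>plateau r a b (y / 2 ^ J)\<bar>) = 2 ^ J * (LINT y|lborel. \<bar>plateau r a b
        y\<bar>)"
      by (rule lborel_dilate_integral)
    also have "2 powr (real J / 2) * (C1 * (2 ^ J * (LINT y|lborel. \<bar>plateau r a b y\<bar>)))
        \<le> 2 powr (real J / 2) * (Cm * h)"
      using plateau_L1(2)[OF r] C1(1) h by (intro mult_left_mono mult_mono) (auto simp: Cm_def
          h_def)
    finally have two: "(\<Sum>k\<in>S. \<bar>L2_inner (mra.e k) (dilate J (dipole r a b))\<bar>)
        \<le> Cm * 2 powr (real J / 2) * h"
      by (simp add: mult_ac)
    have "(\<Sum>k\<in>S. \<bar>L2_inner (mra.e k) (dilate J (dipole r a b))\<bar>) \<le> Cm * 2 powr (real J / 2)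
        * min 1 h"
      using one two by (simp add: min_def)
    also have "\<dots> \<le> Cm * 2 powr (real J / 2) * h powr \<beta>"
      using Cm h \<beta> by (intro mult_left_mono min_one_le_powr) auto
    finally show ?thesis unfolding h_def .
  qed
  define q where "q = (2::real) powr (\<beta> - \<alpha>)"
  have q: "0 < q" "q < 1" using \<beta> by (simp_all add: q_def powr_less_one)
  define C where "C = D * Cm + D * mra.K * Cm * 2 powr (1 / 2 + \<beta>) * (1 / (1 - q))"
  have main: "\<bar>f a - f b\<bar> \<le> C * \<bar>a - b\<bar> powr \<beta>" if f: "f \<in> density_class \<phi> \<psi> \<alpha> D \<delta> F"
      and ab: "a \<le> b" for f a b
  proof -
    have cont: "continuous_on UNIV f" and "bounded (range f)" and fi: "integrable lborel f" and
      wn: "wavelet_norm \<phi> \<psi> \<alpha> f \<le> ereal D"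
      using f by (auto simp: density_class_def has_bochner_integral_iff)
    then obtain B where B: "\<And>x. \<bar>f x\<bar> \<le> B" by (auto simp: bounded_iff)
    have fL: "f \<in> L2_fun" by (rule L2_bounded_integrable[OF fi B])
    have "\<bar>L2_inner f (dipole r a b)\<bar> \<le> C * (b - a + 1 / r) powr \<beta>" if r: "0 < r" for r
    proof -
      define h where "h = b - a + 1 / r"
      have "1 / r > 0" using r by simp
      then have h: "h > 0" using ab unfolding h_def by linarith
      define M where "M j = D * 2 powr (- real j * (\<alpha> + 1 / 2))" for j
      define TT where "TT J = Cm * 2 powr (real J / 2) * (2 ^ J * h) powr \<beta>" for J
      have eq: "M j * mra.K * TT (Suc j) = (D * mra.K * Cm * 2 powr (1 / 2 + \<beta>) * h powr \<beta>) * q ^ j"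
          for j
      proof -
        have "q ^ j = 2 powr ((\<beta> - \<alpha>) * real j)" unfolding q_def
            by (simp add: powr_powr[symmetric] powr_realpow)
        moreover have "(2 ^ Suc j * h) powr \<beta> = 2 powr (real (Suc j) * \<beta>) * h powr \<beta>"
          using h by (simp add: powr_mult powr_powr powr_realpow[symmetric] del: power_Suc
              of_nat_Suc)
        moreover have "2 powr (- real j * (\<alpha> + 1 / 2)) * (2 powr (real (Suc j) / 2) * 2 powr
            (real (Suc j) * \<beta>)) = 2 powr (1 / 2 + \<beta>) * (2::real) powr ((\<beta> - \<alpha>) * real j)"
          unfolding powr_add[symmetric] by (rule arg_cong[where f = "(powr) 2"]) (simp add:
              field_simps)
        ultimately show ?thesis unfolding M_def TT_def by (simp only: mult_ac)
      qed
      have "\<bar>L2_inner f (dipole r a b)\<bar> \<le> D * TT 0 + (\<Sum>j. M j * mra.K * TT (Suc j))"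
      proof (rule mra.multiscale_bound[OF fL dipole_L2[OF r]])
        show "\<bar>L2_inner f (mra.e k)\<bar> \<le> D" for k
          using wavelet_norm_coefficients(1)[OF wn, of k]
              by (simp add: L2_inner_def scaling_coeff_def mra.e_def)
        show "\<bar>L2_inner (dilate j f) (mra.w m)\<bar> \<le> M j" for j m
          using wavelet_norm_coefficients(2)[OF wn, of j m]
              unfolding wavelet_coeff_dilate[symmetric] M_def mra.w_def[abs_def] .
        show "(\<Sum>k\<in>S. \<bar>L2_inner (mra.e k) (dilate J (dipole r a b))\<bar>) \<le> TT J" if "finite S" for J S
          using T[OF that r ab] unfolding TT_def h_def .
        show "summable (\<lambda>j. M j * mra.K * TT (Suc j))"
          unfolding eq using q by (intro summable_mult summable_geometric) simp
      qed
      also have "(\<Sum>j. M j * mra.K * TT (Suc j)) = (D * mra.K * Cm * 2 powr (1 / 2 + \<beta>) * h powr \<beta>)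
          * (1 / (1 - q))"
        unfolding eq using q by (subst suminf_mult) (auto intro: summable_geometric simp:
            suminf_geometric)
      also have "D * TT 0 = D * Cm * h powr \<beta>" by (simp add: TT_def)
      finally show ?thesis unfolding C_def h_def by (simp add: algebra_simps)
    qed
    then have le: "\<bar>L2_inner f (dipole (real (Suc n)) a b)\<bar> \<le> C * (b - a + 1 / real (Suc n)) powr \<beta>"
        for n
      by (simp del: of_nat_Suc)
    have "\<bar>f a - f b\<bar> \<le> C * (b - a + 0) powr \<beta>"
    proof (rule LIMSEQ_le)
      show "(\<lambda>n. \<bar>L2_inner f (dipole (real (Suc n)) a b)\<bar>) \<longlonglongrightarrow> \<bar>f a - f b\<bar>"
        by (intro tendsto_rabs dipole_limit[OF cont B])
      show "(\<lambda>n. C * (b - a + 1 / real (Suc n)) powr \<beta>) \<longlonglongrightarrow> C * (b - a + 0) powr \<beta>"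
        using \<beta>(1) ab by (intro tendsto_mult tendsto_const tendsto_powr2 tendsto_add LIMSEQ_Suc[OF
            lim_1_over_n]) auto
    qed (use le in blast)
    then show ?thesis using ab by simp
  qed
  show ?thesis
  proof (rule that[of "\<bar>C\<bar>" \<beta>])
    fix f a b assume f: "f \<in> density_class \<phi> \<psi> \<alpha> D \<delta> F"
    have "\<bar>f a - f b\<bar> \<le> C * \<bar>a - b\<bar> powr \<beta>"
      using main[OF f, of a b] main[OF f, of b a] by (cases "a \<le> b") (auto simp: abs_minus_commute)
    also have "\<dots> \<le> \<bar>C\<bar> * \<bar>a - b\<bar> powr \<beta>" by (intro mult_right_mono) auto
    finally show "\<bar>f a - f b\<bar> \<le> \<bar>C\<bar> * \<bar>a - b\<bar> powr \<beta>" .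
  qed (use \<beta> in auto)
qed

section \<open>The Gumbel level\<close>

definition gumbel_level :: "real \<Rightarrow> nat \<Rightarrow> real" where
  "gumbel_level x l = x / A_norm l + B_norm l"

lemma gumbel_level_over_A: "(\<lambda>l. gumbel_level x l / A_norm l) \<longlonglongrightarrow> 1"
  unfolding gumbel_level_def A_norm_def B_norm_def by real_asymp

lemma gumbel_level_square_over: "(\<lambda>l. (gumbel_level x l)\<^sup>2 / real l) \<longlonglongrightarrow> 2 * ln 2"
proof -
  have "(\<lambda>l. (gumbel_level x l / A_norm l)\<^sup>2 * (2 * ln 2)) \<longlonglongrightarrow> 1\<^sup>2 * (2 * ln 2)"
    by (intro tendsto_intros gumbel_level_over_A)
  moreover have "\<forall>\<^sub>F l in sequentially. (gumbel_level x l / A_norm l)\<^sup>2 * (2 * ln 2)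
      = (gumbel_level x l)\<^sup>2 / real l"
    using eventually_gt_at_top[of 0]
  proof eventually_elim
    case (elim l)
    have "(A_norm l)\<^sup>2 = 2 * ln 2 * real l" by (simp add: A_norm_def)
    then show ?case using elim by (simp add: power_divide)
  qed
  ultimately show ?thesis by (simp add: Lim_transform_eventually)
qed

lemma gumbel_level_at_top: "filterlim (gumbel_level x) at_top sequentially"
  unfolding gumbel_level_def[abs_def] A_norm_def B_norm_def by real_asymp

text \<open>
  Complete the square. The logarithmic correction in the centring constant cancels the polynomial
  factor of the Gaussian tail; half of \<open>exp (- x)\<close> is left for each of the two tails.
\<close>

lemma gumbel_tail:
  "(\<lambda>l. 2 ^ l * exp (- (gumbel_level x l)\<^sup>2 / 2) / (sqrt (2 * pi) * gumbel_level x l))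
      \<longlonglongrightarrow> exp (- x) / 2"
proof -
  define c where "c l = x - (ln (real l) + ln (pi * ln 2)) / 2" for l :: nat
  have c0: "(\<lambda>l. (c l)\<^sup>2 / (2 * (2 * ln 2 * real l))) \<longlonglongrightarrow> 0"
    unfolding c_def by real_asymp
  have "(\<lambda>l. exp (- x) / 2 * exp (- ((c l)\<^sup>2 / (2 * (2 * ln 2 * real l)))) / (gumbel_level x l
      / A_norm l)) \<longlonglongrightarrow> exp (- x) / 2 * exp (- 0) / 1"
    by (intro tendsto_intros c0 gumbel_level_over_A) simp
  moreover have "\<forall>\<^sub>F l in sequentially. exp (- x) / 2
      * exp (- ((c l)\<^sup>2 / (2 * (2 * ln 2 * real l)))) / (gumbel_level x l / A_norm l)
     = 2 ^ l * exp (- (gumbel_level x l)\<^sup>2 / 2) / (sqrt (2 * pi) * gumbel_level x l)"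
    using eventually_gt_at_top[of 0]
  proof eventually_elim
    case (elim l)
    define A where "A = A_norm l"
    have A2: "A\<^sup>2 = 2 * ln 2 * real l" and A0: "A > 0" using elim
        by (simp_all add: A_def A_norm_def)
    have u: "gumbel_level x l = A + c l / A"
      unfolding gumbel_level_def B_norm_def A_def[symmetric] c_def using A0
          by (simp add: field_simps)
    define H where "H = (ln (real l) + ln (pi * ln 2)) / 2"
    have cH: "c l = x - H" by (simp add: c_def H_def)
    have u2: "- (gumbel_level x l)\<^sup>2 / 2 = - (ln 2 * real l) - c l - (c l)\<^sup>2
        / (2 * (2 * ln 2 * real l))"
    proof -
      have "(A + c l / A)\<^sup>2 = A\<^sup>2 + 2 * c l + (c l)\<^sup>2 / A\<^sup>2" using A0
          by (simp add: power2_sum power_divide)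
      moreover have "- (P + 2 * C + Q / P) / 2 = - (P / 2) - C - Q / (2 * P)" for P C Q :: real
        by (simp add: add_divide_distrib diff_divide_distrib mult.commute)
      ultimately have "- (gumbel_level x l)\<^sup>2 / 2 = - (2 * ln 2 * real l / 2) - c l - (c l)\<^sup>2
          / (2 * (2 * ln 2 * real l))"
        unfolding u A2 by simp
      then show ?thesis by simp
    qed
    have e1: "exp (- (ln 2 * real l)) = 1 / 2 ^ l"
      by (simp add: exp_minus exp_of_nat2_mult inverse_eq_divide)
    have e2: "exp H = sqrt (real l * (pi * ln 2))"
    proof -
      have "(ln (real l) + ln (pi * ln 2)) / 2 = ln (sqrt (real l * (pi * ln 2)))"
        using elim by (simp add: ln_sqrt ln_mult)
      then show ?thesis using elim by (simp add: H_def)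
    qed
    have e3: "sqrt (real l * (pi * ln 2)) = sqrt (2 * pi) * (A / 2)"
    proof (rule real_sqrt_unique)
      show "(sqrt (2 * pi) * (A / 2))\<^sup>2 = real l * (pi * ln 2)"
          by (simp add: power_mult_distrib power_divide A2)
    qed (use A0 in simp)
    have eq: "2 ^ l * exp (- (gumbel_level x l)\<^sup>2 / 2) = exp (- x) * (sqrt (2 * pi) * (A / 2))
        * exp (- ((c l)\<^sup>2 / (2 * (2 * ln 2 * real l))))"
    proof -
      have "exp (- a - (x - H) - q) = exp (- a) * (exp (- x) * exp H * exp (- q))" for a q
        by (simp flip: exp_add)
      then show ?thesis unfolding u2 cH e3[symmetric] e2[symmetric] by (simp add: e1)
    qed
    have gen: "X / 2 * Q / (u / A) = X * (S * (A / 2)) * Q / (S * u)" if "S \<noteq> 0" for X Q u S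
      using that by simp
    have S: "sqrt (2 * pi) \<noteq> 0" by simp
    show ?case unfolding A_def[symmetric] gen[OF S] eq ..
  qed
  ultimately show ?thesis by (simp add: Lim_transform_eventually)
qed

text \<open>
  The Poisson limit; the logarithm of \<open>1 - q\<close> is \<open>- q + O (q\<^sup>2)\<close>.
\<close>

lemma power_to_exponential:
  fixes q :: "nat \<Rightarrow> real" and K :: "nat \<Rightarrow> nat"
  assumes q0: "q \<longlonglongrightarrow> 0" and Kq: "(\<lambda>n. real (K n) * q n) \<longlonglongrightarrow> c"
  shows "(\<lambda>n. (1 - q n) ^ K n) \<longlonglongrightarrow> exp (- c)"
proof -
  have ev: "\<forall>\<^sub>F n in sequentially. \<bar>q n\<bar> < 1/2" using tendsto_rabs[OF q0]
      by (rule order_tendstoD) simp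
  have "(\<lambda>n. real (K n) * (ln (1 - q n) + q n)) \<longlonglongrightarrow> 0"
  proof (rule Lim_null_comparison)
    show "\<forall>\<^sub>F n in sequentially. norm (real (K n) * (ln (1 - q n) + q n)) \<le> 2 * \<bar>(real (K n) * q n)
        * q n\<bar>"
      using ev
    proof eventually_elim
      case (elim n)
      have "\<bar>ln (1 + - q n) - - q n\<bar> \<le> 2 * (- q n)\<^sup>2" using elim
          by (intro abs_ln_one_plus_x_minus_x_bound) simp
      then have "real (K n) * \<bar>ln (1 - q n) + q n\<bar> \<le> real (K n) * (2 * (q n)\<^sup>2)"
          by (intro mult_left_mono) simp_all
      then show ?case by (simp add: abs_mult power2_eq_square mult_ac)
    qed
    show "(\<lambda>n. 2 * \<bar>(real (K n) * q n) * q n\<bar>) \<longlonglongrightarrow> 0"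
      using tendsto_mult_right_zero[OF tendsto_rabs_zero[OF tendsto_mult[OF Kq q0, simplified]]]
          by simp
  qed
  from tendsto_diff[OF this Kq] have "(\<lambda>n. exp (real (K n) * (ln (1 - q n) + q n) - real (K n)
      * q n)) \<longlonglongrightarrow> exp (0 - c)"
    by (rule tendsto_exp)
  moreover have "\<forall>\<^sub>F n in sequentially. exp (real (K n) * (ln (1 - q n) + q n) - real (K n) * q n)
      = (1 - q n) ^ K n"
    using ev
  proof eventually_elim
    case (elim n)
    have "exp (real (K n) * (ln (1 - q n) + q n) - real (K n) * q n)
        = exp (real (K n) * ln (1 - q n))" by (simp add: algebra_simps)
    also have "\<dots> = (1 - q n) ^ K n" using elim by (simp only: exp_of_nat_mult) simp
    finally show ?case .
  qed
  ultimately show ?thesis by (simp add: Lim_transform_eventually)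
qed

text \<open>
  The Gaussian tail depends on \<open>w\<close> through \<open>w\<^sup>2\<close>, so an error \<open>o(1)\<close> in the square is harmless.
\<close>

lemma tail_at_gumbel_level:
  fixes w :: "nat \<Rightarrow> real" and l :: "nat \<Rightarrow> nat"
  assumes l: "filterlim l at_top sequentially"
    and w: "(\<lambda>n. (w n)\<^sup>2 - (gumbel_level x (l n))\<^sup>2) \<longlonglongrightarrow> 0" and w0: "filterlim w at_top sequentially"
    and T: "(\<lambda>n. T n * (sqrt (2 * pi) * w n * exp ((w n)\<^sup>2 / 2))) \<longlonglongrightarrow> 1"
  shows "(\<lambda>n. 2 ^ l n * T n) \<longlonglongrightarrow> exp (- x) / 2"
proof -
  define u where "u n = gumbel_level x (l n)" for n
  have u0: "filterlim u at_top sequentially" unfolding u_def[abs_def]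
      by (rule filterlim_compose[OF gumbel_level_at_top l])
  have upos: "\<forall>\<^sub>F n in sequentially. 1 < u n" using u0 unfolding filterlim_at_top_dense by blast
  have wpos: "\<forall>\<^sub>F n in sequentially. 0 < w n" using w0 unfolding filterlim_at_top_dense by blast
  have "(\<lambda>n. 1 + ((w n)\<^sup>2 - (u n)\<^sup>2) * (inverse (u n))\<^sup>2) \<longlonglongrightarrow> 1 + 0 * 0\<^sup>2"
    unfolding u_def by (intro tendsto_intros w tendsto_inverse_0_at_top u0[unfolded u_def[abs_def]])
  then have "(\<lambda>n. sqrt (1 + ((w n)\<^sup>2 - (u n)\<^sup>2) * (inverse (u n))\<^sup>2)) \<longlonglongrightarrow> sqrt (1 + 0 * 0\<^sup>2)"
      by (rule tendsto_real_sqrt)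
  moreover have "\<forall>\<^sub>F n in sequentially. sqrt (1 + ((w n)\<^sup>2 - (u n)\<^sup>2) * (inverse (u n))\<^sup>2)
      = w n / u n"
    using upos wpos
  proof eventually_elim
    case (elim n)
    have "1 + ((w n)\<^sup>2 - (u n)\<^sup>2) * (inverse (u n))\<^sup>2 = (w n / u n)\<^sup>2"
      using elim by (simp add: left_diff_distrib power_divide divide_inverse
          power_mult_distrib[symmetric])
    then show ?case using elim by simp
  qed
  ultimately have ratio: "(\<lambda>n. w n / u n) \<longlonglongrightarrow> 1" by (simp add: Lim_transform_eventually)
  have g: "(\<lambda>n. 2 ^ l n * exp (- (u n)\<^sup>2 / 2) / (sqrt (2 * pi) * u n)) \<longlonglongrightarrow> exp (- x) / 2"
    unfolding u_def by (rule filterlim_compose[OF gumbel_tail l])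
  have e: "(\<lambda>n. exp (- (((w n)\<^sup>2 - (u n)\<^sup>2) / 2))) \<longlonglongrightarrow> exp (- (0 / 2))"
    unfolding u_def by (intro tendsto_intros w) simp
  have "(\<lambda>n. T n * (sqrt (2 * pi) * w n * exp ((w n)\<^sup>2 / 2)) * (2 ^ l n * exp (- (u n)\<^sup>2 / 2)
      / (sqrt (2 * pi) * u n))
      * exp (- (((w n)\<^sup>2 - (u n)\<^sup>2) / 2)) / (w n / u n)) \<longlonglongrightarrow> 1 * (exp (- x) / 2) * exp (- (0 / 2))
          / 1"
    by (intro tendsto_mult tendsto_divide T g e ratio) simp
  moreover have "\<forall>\<^sub>F n in sequentially. T n * (sqrt (2 * pi) * w n * exp ((w n)\<^sup>2 / 2)) * (2 ^ l n
      * exp (- (u n)\<^sup>2 / 2) / (sqrt (2 * pi) * u n))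
      * exp (- (((w n)\<^sup>2 - (u n)\<^sup>2) / 2)) / (w n / u n) = 2 ^ l n * T n"
    using upos wpos
  proof eventually_elim
    case (elim n)
    have ex: "exp ((w n)\<^sup>2 / 2) * exp (- (u n)\<^sup>2 / 2) * exp (- (((w n)\<^sup>2 - (u n)\<^sup>2) / 2)) = 1"
      unfolding exp_add[symmetric] by (simp add: field_simps)
    have "T n * (S * W * a) * (L * b / (S * U)) * d / (W / U) = L * T n * (a * b * d)"
        if "S \<noteq> 0" "W \<noteq> 0" "U \<noteq> 0" for S W U a b d L :: real
      using that by simp
    then show ?case using elim ex by simp
  qed
  ultimately show ?thesis by (simp add: Lim_transform_eventually)
qed

text \<open>
  Here \<open>p\<close> is the mass of a bin, \<open>r\<close> the mass left when it is reached, \<open>\<iota>\<close> a local value of the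
  density and \<open>t\<close> the number of observations left. The tail is centred at \<open>N * p\<close> and scaled by
  \<open>sqrt (N * \<iota> / 2 ^ l)\<close>, whereas the count has mean and nearly variance \<open>t * p / r\<close>. The relative
  error \<open>l / sqrt N\<close> of the mean and the relative error \<open>o(1 / l)\<close> of the variance change the
  squared level, which is of order \<open>l\<close>, only by \<open>o(1)\<close>.
\<close>

lemma single_bin_tails:
  fixes l N t :: "nat \<Rightarrow> nat" and p r \<iota> :: "nat \<Rightarrow> real" and c1 c2 \<kappa> x :: real
  assumes l: "filterlim l at_top sequentially" and NL: "(\<lambda>n. real (l n) ^ 3 * 2 ^ l n / real (N n))
      \<longlonglongrightarrow> 0"
    and N: "\<And>n. 0 < N n" and t: "\<And>n. 0 < t n" and \<kappa>: "0 < \<kappa>" and r: "\<And>n. \<kappa> \<le> r n"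
    and c: "0 < c1" "\<And>n. c1 \<le> 2 ^ l n * p n" "\<And>n. 2 ^ l n * p n \<le> c2"
    and \<iota>: "(\<lambda>n. real (l n) * (\<iota> n / (2 ^ l n * p n) - 1)) \<longlonglongrightarrow> 0"
    and good: "\<And>n. \<bar>real (t n) / r n - real (N n)\<bar> \<le> real (l n) * sqrt (real (N n))"
  defines "\<theta> \<equiv> \<lambda>n. gumbel_level x (l n) * sqrt (real (N n) * \<iota> n / 2 ^ l n)"
  shows "(\<lambda>n. 2 ^ l n * (\<Sum>m | m \<le> t n \<and> real (N n) * p n + \<theta> n < real m. Bernstein (t n) m (p n
      / r n))) \<longlonglongrightarrow> exp (- x) / 2" (is ?up)
    and "(\<lambda>n. 2 ^ l n * (\<Sum>m | m \<le> t n \<and> real m < real (N n) * p n - \<theta> n. Bernstein (t n) m (p n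
        / r n))) \<longlonglongrightarrow> exp (- x) / 2" (is ?lo)
proof -
  define u where "u n = gumbel_level x (l n)" for n
  define \<rho> where "\<rho> n = p n / r n" for n
  define \<mu> where "\<mu> n = real (t n) * \<rho> n" for n
  define a where "a n = \<mu> n / (real (N n) * p n) - 1" for n
  define b where "b n = \<iota> n / (2 ^ l n * p n) - 1" for n
  define y where "y n = \<theta> n / sqrt (\<mu> n)" for n
  define z where "z n = (\<mu> n - real (N n) * p n) / sqrt (\<mu> n)" for n
  have pp: "p n > 0" for n using c(1) c(2)[of n] by (smt (verit) zero_less_mult_pos zero_less_power)
  have rp: "r n > 0" for n using \<kappa> r[of n] by linarith
  have \<rho>p: "\<rho> n > 0" for n using pp rp by (simp add: \<rho>_def)
  have \<mu>p: "\<mu> n > 0" for n using \<rho>p t by (simp add: \<mu>_def)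
  have l_lim: "(\<lambda>n. f (l n)) \<longlonglongrightarrow> L" if "f \<longlonglongrightarrow> L" for f :: "nat \<Rightarrow> real" and L
    by (rule filterlim_compose[OF that l])
  have ev_l: "\<forall>\<^sub>F n in sequentially. 1 \<le> l n" using l unfolding filterlim_at_top by blast
  \<comment> \<open>the relative error of the mean\<close>
  have a_bound: "\<bar>a n\<bar> \<le> real (l n) / sqrt (real (N n))" for n
  proof -
    have "a n = (real (t n) / r n - real (N n)) / real (N n)"
      using pp[of n] rp[of n] N[of n] by (simp add: a_def \<mu>_def \<rho>_def diff_divide_distrib)
    then have "\<bar>a n\<bar> \<le> real (l n) * sqrt (real (N n)) / real (N n)"
      using good[of n] N[of n] by (simp add: divide_right_mono)
    also have "\<dots> = real (l n) / sqrt (real (N n))"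
      using N[of n] real_sqrt_mult_self[of "real (N n)"] by (simp add: field_simps)
    finally show ?thesis .
  qed
  have l4: "(\<lambda>n. real (l n) ^ 4 / real (N n)) \<longlonglongrightarrow> 0"
  proof (rule Lim_null_comparison[OF _ NL])
    show "\<forall>\<^sub>F n in sequentially. norm (real (l n) ^ 4 / real (N n)) \<le> real (l n) ^ 3 * 2 ^ l n
        / real (N n)"
    proof (intro always_eventually allI)
      fix n
      have "real (l n) \<le> 2 ^ l n" using of_nat_less_two_power[of "l n", where ?'a = real]
          by linarith
      then have "real (l n) ^ 3 * real (l n) \<le> real (l n) ^ 3 * 2 ^ l n"
          by (intro mult_left_mono) auto
      then have "real (l n) ^ 4 \<le> real (l n) ^ 3 * 2 ^ l n"
          by (simp add: power_numeral_reduce mult_ac)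
      then show "norm (real (l n) ^ 4 / real (N n)) \<le> real (l n) ^ 3 * 2 ^ l n / real (N n)"
        by (simp add: divide_right_mono)
    qed
  qed
  have l2: "(\<lambda>n. real (l n) ^ 2 / sqrt (real (N n))) \<longlonglongrightarrow> 0"
  proof -
    have "(\<lambda>n. sqrt (real (l n) ^ 4 / real (N n))) \<longlonglongrightarrow> sqrt 0" by (rule tendsto_real_sqrt[OF l4])
    moreover have "sqrt (real (l n) ^ 4 / real (N n)) = real (l n) ^ 2 / sqrt (real (N n))" for n
    proof -
      have "sqrt (real (l n) ^ 4) = real (l n) ^ 2" by (rule real_sqrt_unique) simp_all
      then show ?thesis by (simp add: real_sqrt_divide)
    qed
    ultimately show ?thesis by simp
  qed
  have la: "(\<lambda>n. real (l n) * a n) \<longlonglongrightarrow> 0"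
  proof (rule Lim_null_comparison[OF _ l2])
    show "\<forall>\<^sub>F n in sequentially. norm (real (l n) * a n) \<le> real (l n) ^ 2 / sqrt (real (N n))"
    proof (intro always_eventually allI)
      fix n
      have "real (l n) * \<bar>a n\<bar> \<le> real (l n) * (real (l n) / sqrt (real (N n)))" using a_bound[of n]
          by (intro mult_left_mono) auto
      then show "norm (real (l n) * a n) \<le> real (l n) ^ 2 / sqrt (real (N n))"
          by (simp add: abs_mult power2_eq_square)
    qed
  qed
  have lb: "(\<lambda>n. real (l n) * b n) \<longlonglongrightarrow> 0" unfolding b_def by (rule \<iota>)
  have from_l: "f \<longlonglongrightarrow> 0" if "(\<lambda>n. real (l n) * f n) \<longlonglongrightarrow> 0" for f
  proof (rule Lim_null_comparison[OF _ tendsto_rabs_zero[OF that]])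
    show "\<forall>\<^sub>F n in sequentially. norm (f n) \<le> \<bar>real (l n) * f n\<bar>"
      using ev_l
    proof eventually_elim
      case (elim n)
      have "1 * \<bar>f n\<bar> \<le> real (l n) * \<bar>f n\<bar>" using elim by (intro mult_right_mono) auto
      then show ?case by (simp add: abs_mult)
    qed
  qed
  have a0: "a \<longlonglongrightarrow> 0" and b0: "b \<longlonglongrightarrow> 0" by (rule from_l[OF la], rule from_l[OF lb])
  have ev_a: "\<forall>\<^sub>F n in sequentially. \<bar>a n\<bar> < 1/2" using tendsto_rabs[OF a0]
      by (rule order_tendstoD) simp
  have ev_b: "\<forall>\<^sub>F n in sequentially. \<bar>b n\<bar> < 1/2" using tendsto_rabs[OF b0]
      by (rule order_tendstoD) simp
  have u_top: "filterlim u at_top sequentially" unfolding u_def[abs_def]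
      by (rule filterlim_compose[OF gumbel_level_at_top l])
  have ev_u: "\<forall>\<^sub>F n in sequentially. 1 \<le> u n" using u_top unfolding filterlim_at_top by blast
  have u2l: "(\<lambda>n. (u n)\<^sup>2 / real (l n)) \<longlonglongrightarrow> 2 * ln 2" unfolding u_def
      by (rule l_lim[OF gumbel_level_square_over])
  have \<mu>_eq: "\<mu> n = real (N n) * p n * (1 + a n)" for n using pp[of n] N[of n] by (simp add: a_def)
  \<comment> \<open>the errors of variance and mean multiply the squared level by \<open>(1 + b) / (1 + a)\<close>\<close>
  have y2: "\<forall>\<^sub>F n in sequentially. (y n)\<^sup>2 - (u n)\<^sup>2 = (u n)\<^sup>2 / real (l n) * ((real (l n) * b n
      - real (l n) * a n) / (1 + a n)) \<and> 0 < y n"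
    using ev_a ev_b ev_l ev_u
  proof eventually_elim
    case (elim n)
    have \<iota>e: "\<iota> n = 2 ^ l n * p n * (1 + b n)" using pp[of n] by (simp add: b_def)
    have ip: "0 \<le> real (N n) * \<iota> n / 2 ^ l n" "0 < \<iota> n" unfolding \<iota>e using elim pp[of n]
        by (auto intro!: divide_nonneg_nonneg mult_nonneg_nonneg mult_pos_pos)
    have "(y n)\<^sup>2 = (u n)\<^sup>2 * (real (N n) * \<iota> n / 2 ^ l n) / \<mu> n"
      unfolding y_def \<theta>_def u_def using ip(1) \<mu>p[of n]
          by (simp add: power_divide power_mult_distrib)
    also have "real (N n) * \<iota> n / 2 ^ l n = real (N n) * p n * (1 + b n)" unfolding \<iota>e by simp
    also have "(u n)\<^sup>2 * (real (N n) * p n * (1 + b n)) / \<mu> n = (u n)\<^sup>2 * (1 + b n) / (1 + a n)"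
      unfolding \<mu>_eq using pp[of n] N[of n] by simp
    finally have "(y n)\<^sup>2 = (u n)\<^sup>2 * (1 + b n) / (1 + a n)" .
    moreover have "U * (1 + B) / (1 + A) - U = U / L * ((L * B - L * A) / (1 + A))"
        if "1 + A \<noteq> 0" "L \<noteq> 0" for U A B L :: real
    proof -
      have "U * (1 + B) / (1 + A) - U = U * ((B - A) / (1 + A))"
        using that(1) by (simp add: field_simps)
      also have "\<dots> = U / L * ((L * B - L * A) / (1 + A))" using that(2)
          by (simp add: right_diff_distrib[symmetric])
      finally show ?thesis .
    qed
    ultimately have "(y n)\<^sup>2 - (u n)\<^sup>2 = (u n)\<^sup>2 / real (l n) * ((real (l n) * b n - real (l n)
        * a n) / (1 + a n))"
      using elim by force
    moreover have "0 < y n" unfolding y_def \<theta>_def using elim ip(2) N[of n] \<mu>p[of n]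
        by (simp add: u_def)
    ultimately show ?case ..
  qed
  have yu: "(\<lambda>n. (y n)\<^sup>2 - (u n)\<^sup>2) \<longlonglongrightarrow> 0"
  proof (rule Lim_transform_eventually)
    show "(\<lambda>n. (u n)\<^sup>2 / real (l n) * ((real (l n) * b n - real (l n) * a n) / (1 + a n))) \<longlonglongrightarrow> 0"
      using tendsto_mult[OF u2l tendsto_divide[OF tendsto_diff[OF lb la] tendsto_add[OF
          tendsto_const[of 1] a0]]] by simp
  qed (use y2 in eventually_elim, simp)
  \<comment> \<open>the shift of the mean stays negligible after multiplication by the level\<close>
  have lz: "(\<lambda>n. real (l n) * (z n)\<^sup>2) \<longlonglongrightarrow> 0"
  proof (rule Lim_null_comparison)
    have lim: "(\<lambda>k. 2 * c2 * (real k ^ 3 / 2 ^ k)) \<longlonglongrightarrow> 0" by real_asymp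
    show "(\<lambda>n. 2 * c2 * (real (l n) ^ 3 / 2 ^ l n)) \<longlonglongrightarrow> 0" by (rule l_lim[OF lim])
    show "\<forall>\<^sub>F n in sequentially. norm (real (l n) * (z n)\<^sup>2) \<le> 2 * c2 * (real (l n) ^ 3 / 2 ^ l n)"
      using ev_a
    proof eventually_elim
      case (elim n)
      have "(z n)\<^sup>2 = (real (N n) * p n * a n)\<^sup>2 / \<mu> n" unfolding z_def using \<mu>p[of n]
          by (simp add: power_divide \<mu>_eq algebra_simps)
      also have "\<dots> = real (N n) * p n * (a n)\<^sup>2 / (1 + a n)"
        unfolding \<mu>_eq using pp[of n] N[of n] by (simp add: power2_eq_square)
      also have "\<dots> \<le> real (N n) * p n * (a n)\<^sup>2 / (1/2)"
        using elim pp[of n] by (intro divide_left_mono mult_nonneg_nonneg mult_pos_pos) auto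
      also have "\<dots> \<le> real (N n) * p n * ((real (l n))\<^sup>2 / real (N n)) / (1/2)"
      proof (intro divide_right_mono mult_left_mono)
        have "(a n)\<^sup>2 \<le> (real (l n) / sqrt (real (N n)))\<^sup>2" using a_bound[of n]
            by (metis abs_ge_zero power2_abs power_mono)
        then show "(a n)\<^sup>2 \<le> (real (l n))\<^sup>2 / real (N n)" by (simp add: power_divide)
      qed (use pp[of n] in auto)
      also have "\<dots> = 2 * p n * (real (l n))\<^sup>2" using N[of n] by simp
      also have "\<dots> \<le> 2 * (c2 / 2 ^ l n) * (real (l n))\<^sup>2"
        using c(3)[of n] by (intro mult_right_mono mult_left_mono) (auto simp: field_simps)
      finally have "real (l n) * (z n)\<^sup>2 \<le> real (l n) * (2 * (c2 / 2 ^ l n) * (real (l n))\<^sup>2)"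
          by (intro mult_left_mono) auto
      moreover have "real (l n) * (2 * (c2 / 2 ^ l n) * (real (l n))\<^sup>2) = 2 * c2 * (real (l n) ^ 3
          / 2 ^ l n)"
        by (simp add: power2_eq_square power3_eq_cube)
      moreover have "0 \<le> real (l n) * (z n)\<^sup>2" by simp
      ultimately show ?case by (simp only: real_norm_def abs_of_nonneg)
    qed
  qed
  have z0: "(\<lambda>n. (z n)\<^sup>2) \<longlonglongrightarrow> 0" by (rule from_l[OF lz])
  have z0': "z \<longlonglongrightarrow> 0" using tendsto_real_sqrt[OF z0] by (simp add: tendsto_rabs_zero_iff)
  have y2l: "(\<lambda>n. (y n)\<^sup>2 / real (l n)) \<longlonglongrightarrow> 2 * ln 2"
  proof -
    have "(\<lambda>k. 1 / real k) \<longlonglongrightarrow> 0" by (rule lim_1_over_n)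
    from tendsto_add[OF tendsto_mult[OF yu l_lim[OF this]] u2l]
    have "(\<lambda>n. ((y n)\<^sup>2 - (u n)\<^sup>2) * (1 / real (l n)) + (u n)\<^sup>2 / real (l n)) \<longlonglongrightarrow> 2 * ln 2" by simp
    moreover have "((y n)\<^sup>2 - (u n)\<^sup>2) * (1 / real (l n)) + (u n)\<^sup>2 / real (l n)
        = (y n)\<^sup>2 / real (l n)" for n
      by (simp add: diff_divide_distrib)
    ultimately show ?thesis by simp
  qed
  have yz: "(\<lambda>n. y n * z n) \<longlonglongrightarrow> 0"
  proof -
    have "(\<lambda>n. sqrt ((y n)\<^sup>2 / real (l n) * (real (l n) * (z n)\<^sup>2))) \<longlonglongrightarrow> sqrt (2 * ln 2 * 0)"
      by (intro tendsto_real_sqrt tendsto_mult y2l lz)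
    moreover have "\<forall>\<^sub>F n in sequentially. sqrt ((y n)\<^sup>2 / real (l n) * (real (l n) * (z n)\<^sup>2))
        = \<bar>y n * z n\<bar>"
      using ev_l by eventually_elim (simp add: real_sqrt_mult abs_mult)
    ultimately have "(\<lambda>n. \<bar>y n * z n\<bar>) \<longlonglongrightarrow> sqrt (2 * ln 2 * 0)" by (rule Lim_transform_eventually)
    then show ?thesis by (simp add: tendsto_rabs_zero_iff)
  qed
  have y_top: "filterlim y at_top sequentially"
  proof -
    have "filterlim (\<lambda>n. u n * u n) at_top sequentially"
        by (rule filterlim_at_top_mult_at_top[OF u_top u_top])
    from filterlim_tendsto_add_at_top[OF yu this] have "filterlim (\<lambda>n. (y n)\<^sup>2) at_top sequentially"
      by (simp add: power2_eq_square)
    from filterlim_compose[OF sqrt_at_top this] show ?thesis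
      by (rule filterlim_cong[THEN iffD1, OF refl refl, rotated]) (use y2 in eventually_elim, simp)
  qed
  \<comment> \<open>both tails at once: \<open>\<sigma> = -1\<close> for the upper tail and \<open>\<sigma> = 1\<close> for the lower tail\<close>
  have both: "filterlim w at_top sequentially \<and> (\<lambda>n. (w n)\<^sup>2 - (u n)\<^sup>2) \<longlonglongrightarrow> 0
      \<and> (\<lambda>n. w n ^ 3 / sqrt (\<mu> n)) \<longlonglongrightarrow> 0 \<and> (\<lambda>n. \<rho> n * (w n)\<^sup>2) \<longlonglongrightarrow> 0"
    if w: "\<And>n. w n = \<sigma> * z n + y n" and \<sigma>: "\<sigma>\<^sup>2 = 1" for w :: "nat \<Rightarrow> real" and \<sigma> :: real
  proof -
    have w_top: "filterlim w at_top sequentially"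
      unfolding w[abs_def] by (rule filterlim_tendsto_add_at_top[OF tendsto_mult[OF tendsto_const
          z0'] y_top])
    have "(\<lambda>n. ((y n)\<^sup>2 - (u n)\<^sup>2) + 2 * \<sigma> * (y n * z n) + (z n)\<^sup>2) \<longlonglongrightarrow> 0 + 2 * \<sigma> * 0 + 0"
      by (intro tendsto_intros yu yz z0)
    moreover have "((y n)\<^sup>2 - (u n)\<^sup>2) + 2 * \<sigma> * (y n * z n) + (z n)\<^sup>2 = (w n)\<^sup>2 - (u n)\<^sup>2" for n
      unfolding w power2_sum power_mult_distrib \<sigma> by (simp add: algebra_simps)
    ultimately have wu: "(\<lambda>n. (w n)\<^sup>2 - (u n)\<^sup>2) \<longlonglongrightarrow> 0" by simp
    have w2l: "(\<lambda>n. (w n)\<^sup>2 / real (l n)) \<longlonglongrightarrow> 2 * ln 2"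
    proof -
      have "(\<lambda>k. 1 / real k) \<longlonglongrightarrow> 0" by (rule lim_1_over_n)
      from tendsto_add[OF tendsto_mult[OF wu l_lim[OF this]] u2l]
      have "(\<lambda>n. ((w n)\<^sup>2 - (u n)\<^sup>2) * (1 / real (l n)) + (u n)\<^sup>2 / real (l n)) \<longlonglongrightarrow> 2 * ln 2" by simp
      moreover have "((w n)\<^sup>2 - (u n)\<^sup>2) * (1 / real (l n)) + (u n)\<^sup>2 / real (l n)
          = (w n)\<^sup>2 / real (l n)" for n
        by (simp add: diff_divide_distrib)
      ultimately show ?thesis by simp
    qed
    have w6: "(\<lambda>n. (w n)\<^sup>2 ^ 3 / \<mu> n) \<longlonglongrightarrow> 0"
    proof (rule Lim_null_comparison)
      show "(\<lambda>n. ((w n)\<^sup>2 / real (l n)) ^ 3 * (real (l n) ^ 3 * 2 ^ l n / real (N n)) * (2 / c1))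
          \<longlonglongrightarrow> 0"
        using tendsto_mult[OF tendsto_mult[OF tendsto_power[OF w2l, of 3] NL] tendsto_const[of "2
            / c1"]] by simp
      show "\<forall>\<^sub>F n in sequentially. norm ((w n)\<^sup>2 ^ 3 / \<mu> n) \<le> ((w n)\<^sup>2 / real (l n)) ^ 3
          * (real (l n) ^ 3 * 2 ^ l n / real (N n)) * (2 / c1)"
        using ev_a ev_l
      proof eventually_elim
        case (elim n)
        have "c1 / 2 ^ l n \<le> p n" using c(2)[of n] by (simp add: pos_divide_le_eq mult.commute)
        then have "real (N n) * (c1 / 2 ^ l n) * (1/2) \<le> real (N n) * p n * (1 + a n)"
          using elim c(1) pp[of n] by (intro mult_mono mult_left_mono) auto
        then have low: "real (N n) * (c1 / 2 ^ l n) * (1/2) \<le> \<mu> n" unfolding \<mu>_eq .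
        have "(w n)\<^sup>2 ^ 3 / \<mu> n \<le> (w n)\<^sup>2 ^ 3 / (real (N n) * (c1 / 2 ^ l n) * (1/2))"
          using low c(1) N[of n] \<mu>p[of n] by (intro divide_left_mono) auto
        also have "\<dots> = ((w n)\<^sup>2 / real (l n)) ^ 3 * (real (l n) ^ 3 * 2 ^ l n / real (N n))
            * (2 / c1)"
          using elim c(1) N[of n] by (simp add: power_divide)
        finally show ?case using \<mu>p[of n] by simp
      qed
    qed
    have "(\<lambda>n. sqrt ((w n)\<^sup>2 ^ 3 / \<mu> n)) \<longlonglongrightarrow> 0" using tendsto_real_sqrt[OF w6] by simp
    moreover have "sqrt ((w n)\<^sup>2 ^ 3 / \<mu> n) = \<bar>w n ^ 3 / sqrt (\<mu> n)\<bar>" for n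
    proof -
      have "(w n)\<^sup>2 ^ 3 = (w n ^ 3)\<^sup>2" by (simp add: power_mult[symmetric])
      then have "sqrt ((w n)\<^sup>2 ^ 3) = \<bar>w n ^ 3\<bar>" by (simp only: real_sqrt_abs)
      then show ?thesis using \<mu>p[of n] unfolding real_sqrt_divide abs_divide by simp
    qed
    ultimately have "(\<lambda>n. \<bar>w n ^ 3 / sqrt (\<mu> n)\<bar>) \<longlonglongrightarrow> 0" by (simp only:)
    then have w3: "(\<lambda>n. w n ^ 3 / sqrt (\<mu> n)) \<longlonglongrightarrow> 0" by (rule tendsto_rabs_zero_cancel)
    have "(\<lambda>n. \<rho> n * (w n)\<^sup>2) \<longlonglongrightarrow> 0"
    proof (rule Lim_null_comparison)
      have lim: "(\<lambda>k. real k / 2 ^ k) \<longlonglongrightarrow> 0" by real_asymp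
      show "(\<lambda>n. c2 / \<kappa> * (real (l n) / 2 ^ l n) * ((w n)\<^sup>2 / real (l n))) \<longlonglongrightarrow> 0"
        using tendsto_mult[OF tendsto_mult[OF tendsto_const[of "c2 / \<kappa>"] l_lim[OF lim]] w2l] by simp
      show "\<forall>\<^sub>F n in sequentially. norm (\<rho> n * (w n)\<^sup>2) \<le> c2 / \<kappa> * (real (l n) / 2 ^ l n) * ((w n)\<^sup>2
          / real (l n))"
        using ev_l
      proof eventually_elim
        case (elim n)
        have "p n \<le> c2 / 2 ^ l n" using c(3)[of n] by (simp add: pos_le_divide_eq mult.commute)
        then have "\<rho> n \<le> (c2 / 2 ^ l n) / \<kappa>"
          unfolding \<rho>_def using r[of n] \<kappa> pp[of n] by (intro frac_le) auto
        then have "\<rho> n * (w n)\<^sup>2 \<le> (c2 / 2 ^ l n) / \<kappa> * (w n)\<^sup>2" by (intro mult_right_mono) auto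
        also have "\<dots> = c2 / \<kappa> * (real (l n) / 2 ^ l n) * ((w n)\<^sup>2 / real (l n))" using elim by simp
        finally show ?case using \<rho>p[of n] by simp
      qed
    qed
    then show ?thesis using w_top wu w3 by simp
  qed
  define wu where "wu n = ((real (N n) * p n + \<theta> n) - \<mu> n) / sqrt (\<mu> n)" for n
  define wl where "wl n = (\<mu> n - (real (N n) * p n - \<theta> n)) / sqrt (\<mu> n)" for n
  have wu: "wu n = -1 * z n + y n" and wl: "wl n = 1 * z n + y n" for n
    by (simp_all add: wu_def wl_def z_def y_def diff_divide_distrib add_divide_distrib)
  have Bu: "filterlim wu at_top sequentially" "(\<lambda>n. (wu n)\<^sup>2 - (u n)\<^sup>2)
      \<longlonglongrightarrow> 0" "(\<lambda>n. wu n ^ 3 / sqrt (\<mu> n)) \<longlonglongrightarrow> 0" "(\<lambda>n. \<rho> n * (wu n)\<^sup>2) \<longlonglongrightarrow> 0"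
    using both[of wu "-1", OF wu] by simp_all
  have Bl: "filterlim wl at_top sequentially" "(\<lambda>n. (wl n)\<^sup>2 - (u n)\<^sup>2)
      \<longlonglongrightarrow> 0" "(\<lambda>n. wl n ^ 3 / sqrt (\<mu> n)) \<longlonglongrightarrow> 0" "(\<lambda>n. \<rho> n * (wl n)\<^sup>2) \<longlonglongrightarrow> 0"
    using both[of wl 1, OF wl] by simp_all
  have "(\<lambda>n. (\<Sum>m | m \<le> t n \<and> real (N n) * p n + \<theta> n < real m. Bernstein (t n) m (\<rho> n))
      * (sqrt (2 * pi) * wu n * exp ((wu n)\<^sup>2 / 2))) \<longlonglongrightarrow> 1"
    using binomial_upper_tail[of "\<lambda>n. real (N n) * p n + \<theta> n" t \<rho>] Bu \<rho>p \<mu>p unfolding wu_def \<mu>_def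
        by blast
  from tail_at_gumbel_level[OF l Bu(2)[unfolded u_def] Bu(1) this] show ?up unfolding \<rho>_def .
  have "(\<lambda>n. (\<Sum>m | m \<le> t n \<and> real m < real (N n) * p n - \<theta> n. Bernstein (t n) m (\<rho> n))
      * (sqrt (2 * pi) * wl n * exp ((wl n)\<^sup>2 / 2))) \<longlonglongrightarrow> 1"
    using binomial_lower_tail[of t \<rho> "\<lambda>n. real (N n) * p n - \<theta> n"] Bl \<rho>p \<mu>p unfolding wl_def \<mu>_def
        by blast
  from tail_at_gumbel_level[OF l Bl(2)[unfolded u_def] Bl(1) this] show ?lo unfolding \<rho>_def .
qed

section \<open>The Haar statistic of a density\<close>

definition dyadic_bin :: "nat \<Rightarrow> nat \<Rightarrow> real set" where
  "dyadic_bin l k = {real k / 2 ^ l..<(real k + 1) / 2 ^ l}"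

lemma in_dyadic_bin: "z \<in> dyadic_bin l k \<longleftrightarrow> \<lfloor>2 ^ l * z\<rfloor> = int k"
proof -
  have "z \<in> dyadic_bin l k \<longleftrightarrow> real k \<le> 2 ^ l * z \<and> 2 ^ l * z < real k + 1"
    by (simp add: dyadic_bin_def pos_divide_le_eq pos_less_divide_eq mult.commute)
  also have "\<dots> \<longleftrightarrow> \<lfloor>2 ^ l * z\<rfloor> = int k" by (simp add: floor_eq_iff)
  finally show ?thesis .
qed

lemma haar_kernel_floor: "haar_kernel x y = (if \<lfloor>x\<rfloor> = \<lfloor>y\<rfloor> then 1 else 0)"
proof -
  have ind: "indicat_real {0..<1} (z - of_int k) = (if k = \<lfloor>z\<rfloor> then 1 else 0)" for z k
  proof -
    have "z - of_int k \<in> {0..<1} \<longleftrightarrow> k = \<lfloor>z\<rfloor>"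
      unfolding eq_commute[of k] floor_eq_iff by auto
    then show ?thesis by (simp add: indicator_def)
  qed
  have "haar_kernel x y = (\<Sum>\<^sub>\<infinity>k\<in>{\<lfloor>x\<rfloor>}. indicat_real {0..<1} (x - of_int k) * indicat_real {0..<1} (y
      - of_int k))"
    unfolding haar_kernel_def by (rule infsum_cong_neutral) (auto simp: ind)
  then show ?thesis by (simp add: ind)
qed

lemma haar_estimator_count:
  assumes "y \<in> dyadic_bin l k"
  shows "haar_estimator N y l X = 2 ^ l / real N * real (card {i\<in>{1..N}. X i \<in> dyadic_bin l k})"
proof -
  have "(\<Sum>i=1..N. haar_kernel (2 ^ l * y) (2 ^ l * X i)) = (\<Sum>i=1..N. if X i \<in> dyadic_bin l k then 1
      else 0)"
    using assms by (intro sum.cong) (auto simp: haar_kernel_floor in_dyadic_bin)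
  also have "\<dots> = real (card {i\<in>{1..N}. X i \<in> dyadic_bin l k})"
    by (simp add: sum.If_cases Int_def)
  finally show ?thesis by (simp add: haar_estimator_def)
qed

locale probability_density =
  fixes f :: "real \<Rightarrow> real"
  assumes cont: "continuous_on UNIV f" and integral: "has_bochner_integral lborel f 1"
      and nonneg: "\<And>x. 0 \<le> f x"
begin

definition \<nu> :: "real measure" where "\<nu> = density lborel (\<lambda>x. ennreal (f x))"

lemma f_borel[measurable]: "f \<in> borel_measurable borel"
  by (rule borel_measurable_continuous_onI[OF cont])

lemma f_integrable: "integrable lborel f" and f_total: "(LINT x|lborel. f x) = 1"
  using integral by (auto simp: has_bochner_integral_iff)

lemma sets_nu[simp]: "sets \<nu> = sets borel" and space_nu[simp]: "space \<nu> = UNIV"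
  by (simp_all add: \<nu>_def)

lemma measure_nu: 
  assumes "B \<in> sets borel" shows "measure \<nu> B = (LINT x|lborel. f x * indicator B x)"
proof -
  have i: "integrable lborel (\<lambda>x. f x * indicator B x)"
    using assms f_integrable by (intro integrable_real_mult_indicator) auto
  have "emeasure \<nu> B = (\<integral>\<^sup>+x. ennreal (f x * indicator B x) \<partial>lborel)"
    unfolding \<nu>_def using assms by (subst emeasure_density) (auto intro!: nn_integral_cong simp:
        indicator_def)
  also have "\<dots> = ennreal (LINT x|lborel. f x * indicator B x)"
    by (rule nn_integral_eq_integral[OF i]) (simp add: nonneg)
  finally show ?thesis unfolding measure_def using nonneg by (simp add: integral_nonneg_AE)
qed

lemma prob_nu: "prob_space \<nu>"
proof
  have "emeasure \<nu> (space \<nu>) = (\<integral>\<^sup>+x. ennreal (f x) \<partial>lborel)"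
    by (simp add: \<nu>_def emeasure_density)
  also have "\<dots> = ennreal 1"
    using nn_integral_eq_integral[OF f_integrable] nonneg f_total by simp
  finally show "emeasure \<nu> (space \<nu>) = 1" by simp
qed

lemma iid_law_eq: "iid_law f = PiM UNIV (\<lambda>_::nat. \<nu>)"
  by (simp add: iid_law_def \<nu>_def)

lemma haar_estimator_expectation:
  assumes y: "y \<in> dyadic_bin l k" and N: "0 < N"
  shows "(LINT Z|iid_law f. haar_estimator N y l Z) = 2 ^ l * measure \<nu> (dyadic_bin l k)"
proof -
  interpret P: prob_space "iid_law f" unfolding iid_law_eq by (intro prob_space_PiM prob_nu)
  let ?B = "dyadic_bin l k"
  define E where "E i = {X \<in> space (iid_law f). X i \<in> ?B}" for i :: nat
  have B: "?B \<in> sets \<nu>" by (simp add: dyadic_bin_def)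
  have E: "E i \<in> sets (iid_law f)" "measure (iid_law f) (E i) = measure \<nu> ?B" for i
  proof -
    have eq: "E i = {X \<in> space (PiM UNIV (\<lambda>_::nat. \<nu>)). \<forall>j\<in>{i}. X j \<in> ?B}"
      by (auto simp: E_def iid_law_eq)
    show "E i \<in> sets (iid_law f)"
      unfolding eq iid_law_eq by (rule prod_cylinder_measure(1)[OF prob_nu _ B]) simp
    show "measure (iid_law f) (E i) = measure \<nu> ?B"
      unfolding eq iid_law_eq by (subst prod_cylinder_measure(2)[OF prob_nu _ B]) simp_all
  qed
  have "(LINT Z|iid_law f. haar_estimator N y l Z) = (LINT Z|iid_law f. 2 ^ l / real N
      * (\<Sum>i=1..N. indicat_real (E i) Z))"
  proof (rule Bochner_Integration.integral_cong[OF refl])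
    fix Z assume Z: "Z \<in> space (iid_law f)"
    have "haar_kernel (2 ^ l * y) (2 ^ l * Z i) = indicat_real (E i) Z" for i
      using y Z by (auto simp: haar_kernel_floor in_dyadic_bin E_def indicator_def)
    then show "haar_estimator N y l Z = 2 ^ l / real N * (\<Sum>i=1..N. indicat_real (E i) Z)"
        by (simp add: haar_estimator_def)
  qed
  also have "\<dots> = 2 ^ l / real N * (\<Sum>i=1..N. LINT Z|iid_law f. indicat_real (E i) Z)"
  proof -
    have "integrable (iid_law f) (indicat_real (E i))" for i
      using E(1) by (intro integrable_real_indicator) (auto simp: P.emeasure_eq_measure)
    then show ?thesis by (simp add: Bochner_Integration.integral_sum)
  qed
  also have "\<dots> = 2 ^ l / real N * (\<Sum>i=1..N. measure \<nu> ?B)"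
  proof -
    have "(LINT Z|iid_law f. indicat_real (E i) Z) = measure \<nu> ?B" for i
      using E sets.sets_into_space[OF E(1)[of i]] by (simp add: Int_absorb2)
    then show ?thesis by simp
  qed
  finally show ?thesis using N by simp
qed

text \<open>
  Bins are half-open, so the infimum need not be attained.
\<close>

definition bin_inf :: "nat \<Rightarrow> nat \<Rightarrow> real" where
  "bin_inf l k = (INF y\<in>dyadic_bin l k \<inter> {0..1}. f y)"

lemma bin_left_end: "k \<le> 2 ^ l \<Longrightarrow> real k / 2 ^ l \<in> dyadic_bin l k \<inter> {0..1}"
proof -
  assume "k \<le> 2 ^ l"
  then have "real k \<le> 2 ^ l" by (metis of_nat_le_iff of_nat_numeral of_nat_power)
  then show ?thesis by (auto simp: dyadic_bin_def divide_strict_right_mono)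
qed

lemma bin_inf_lower: "y \<in> dyadic_bin l k \<inter> {0..1} \<Longrightarrow> bin_inf l k \<le> f y"
  unfolding bin_inf_def by (rule cINF_lower) (auto intro!: bdd_belowI[of _ 0] nonneg)

lemma bin_inf_greatest: "k \<le> 2 ^ l \<Longrightarrow> (\<And>y. y \<in> dyadic_bin l k \<inter> {0..1} \<Longrightarrow> c \<le> f y) \<Longrightarrow> c \<le> bin_inf l k"
  unfolding bin_inf_def using bin_left_end by (intro cINF_greatest) blast+

text \<open>
  On a bin only the normalisation varies with the point, so the supremum over the bin replaces the
  density by its infimum there. There are \<open>2 ^ l + 1\<close> bins, since the point 1 lies in the bin with
  index \<open>2 ^ l\<close>.
\<close>

lemma haar_deviation_le_iff:
  assumes \<delta>: "0 < \<delta>" "\<And>x. x \<in> {0..1} \<Longrightarrow> \<delta> \<le> f x" and N: "0 < N" and u: "0 \<le> u"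
  shows "haar_deviation f N l X \<le> u \<longleftrightarrow>
    (\<forall>k<Suc (2 ^ l). \<bar>real (card {i\<in>{1..N}. X i \<in> dyadic_bin l k}) - real N * measure \<nu> (dyadic_bin
        l k)\<bar>
       \<le> u * sqrt (real N * bin_inf l k / 2 ^ l))"
proof -
  interpret nu: prob_space \<nu> by (rule prob_nu)
  define c where "c k = \<bar>real (card {i\<in>{1..N}. X i \<in> dyadic_bin l k}) - real N * measure \<nu>
      (dyadic_bin l k)\<bar>" for k
  define S where "S y = sqrt (real N / 2 ^ l) * \<bar>(haar_estimator N y l X - (LINT Z|iid_law f.
      haar_estimator N y l Z)) / sqrt (f y)\<bar>" for y
  have fp: "0 < f y" if "y \<in> {0..1}" for y using \<delta>(1) \<delta>(2)[OF that] by linarith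
  have S_eq: "S y = c k / sqrt (real N * f y / 2 ^ l)" if "y \<in> dyadic_bin l k" "y \<in> {0..1}" for y k
  proof -
    have "haar_estimator N y l X - (LINT Z|iid_law f. haar_estimator N y l Z) =
       2 ^ l / real N * (real (card {i\<in>{1..N}. X i \<in> dyadic_bin l k}) - real N * measure \<nu>
           (dyadic_bin l k))"
      unfolding haar_estimator_count[OF that(1), of N X] haar_estimator_expectation[OF that(1) N]
          using N by (simp add: right_diff_distrib)
    then have "S y = sqrt (real N / 2 ^ l) * (2 ^ l / real N * c k / sqrt (f y))"
      unfolding S_def c_def using fp[OF that(2)] by (simp add: abs_mult)
    also have "sqrt (real N / 2 ^ l) * (2 ^ l / real N * c k / sqrt (f y))
        = c k / sqrt (real N * f y / 2 ^ l)"
    proof -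
      have s: "sqrt (real N / 2 ^ l) * sqrt (real N / 2 ^ l) = real N / 2 ^ l" by simp
      have e: "sqrt (real N * f y / 2 ^ l) = sqrt (real N / 2 ^ l) * sqrt (f y)"
        by (simp add: real_sqrt_mult[symmetric])
      have q: "sqrt (real N / 2 ^ l) > 0" using N by simp
      have i: "2 ^ l / real N = 1 / (sqrt (real N / 2 ^ l) * sqrt (real N / 2 ^ l))" unfolding s
          using N by simp
      have "a * (1 / (a * a) * b / d) = b / (a * d)" if "a > 0" for a b d :: real using that by simp
      then show ?thesis unfolding e i using q by blast
    qed
    finally show ?thesis .
  qed
  have cover: "\<exists>k<Suc (2 ^ l). y \<in> dyadic_bin l k" if "y \<in> {0..1}" for y
  proof -
    have y: "0 \<le> 2 ^ l * y" "2 ^ l * y \<le> 2 ^ l" using that by auto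
    have "\<lfloor>2 ^ l * y\<rfloor> \<le> \<lfloor>(2::real) ^ l\<rfloor>" using y(2) by (rule floor_mono)
    then have "\<lfloor>2 ^ l * y\<rfloor> \<le> 2 ^ l" by (metis floor_of_int of_int_numeral of_int_power)
    then have "nat \<lfloor>2 ^ l * y\<rfloor> < Suc (2 ^ l)" by (simp add: nat_less_iff less_Suc_eq_le nat_le_iff)
    moreover have "y \<in> dyadic_bin l (nat \<lfloor>2 ^ l * y\<rfloor>)" using y by (simp add: in_dyadic_bin)
    ultimately show ?thesis by blast
  qed
  have cb: "c k \<le> 2 * real N" for k
  proof -
    have "card {i\<in>{1..N}. X i \<in> dyadic_bin l k} \<le> card {1..N}" by (intro card_mono) auto
    then have "real (card {i\<in>{1..N}. X i \<in> dyadic_bin l k}) \<le> real N" by simp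
    moreover have "real N * measure \<nu> (dyadic_bin l k) \<le> real N * 1"
        by (intro mult_left_mono nu.prob_le_1) simp
    moreover have "0 \<le> real N * measure \<nu> (dyadic_bin l k)" by simp
    ultimately show ?thesis unfolding c_def by linarith
  qed
  have S_bound: "S y \<le> 2 * real N / sqrt (real N * \<delta> / 2 ^ l)" if y: "y \<in> {0..1}" for y
  proof -
    obtain k where k: "y \<in> dyadic_bin l k" using cover[OF y] by blast
    have "sqrt (real N * \<delta> / 2 ^ l) \<le> sqrt (real N * f y / 2 ^ l)"
      using \<delta>(2)[OF y] by (intro real_sqrt_le_mono divide_right_mono mult_left_mono) auto
    then show ?thesis unfolding S_eq[OF k y] using cb[of k] \<delta>(1) N fp[OF y]
      by (intro frac_le) (auto simp: c_def)
  qed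
  have "haar_deviation f N l X = (SUP y\<in>{0..1}. S y)"
  proof -
    define g where "g y = \<bar>(haar_estimator N y l X - (LINT Z|iid_law f. haar_estimator N y l Z))
        / sqrt (f y)\<bar>" for y
    define a where "a = sqrt (real N / 2 ^ l)"
    have a: "0 < a" using N by (simp add: a_def)
    have Sg: "S y = a * g y" for y by (simp add: S_def g_def a_def)
    have bdd: "bdd_above (g ` {0..1})"
    proof (rule bdd_aboveI2)
      fix y :: real assume "y \<in> {0..1}"
      then have "a * g y \<le> 2 * real N / sqrt (real N * \<delta> / 2 ^ l)" using S_bound[of y] unfolding Sg
          by blast
      then show "g y \<le> 2 * real N / sqrt (real N * \<delta> / 2 ^ l) / a"
        unfolding pos_le_divide_eq[OF a] by (simp add: mult.commute)
    qed
    have bddS: "bdd_above (S ` {0..1})" using S_bound by (rule bdd_aboveI2)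
    have "a * (SUP y\<in>{0..1}. g y) = (SUP y\<in>{0..1}. S y)"
    proof (rule antisym)
      have "(SUP y\<in>{0..1}. g y) \<le> (SUP y\<in>{0..1}. S y) / a"
      proof (rule cSUP_least)
        fix y :: real assume "y \<in> {0..1}"
        then have "a * g y \<le> (SUP y\<in>{0..1}. S y)" unfolding Sg[symmetric] using bddS
            by (intro cSUP_upper)
        then show "g y \<le> (SUP y\<in>{0..1}. S y) / a" using a
            by (simp add: pos_le_divide_eq mult.commute)
      qed simp
      then show "a * (SUP y\<in>{0..1}. g y) \<le> (SUP y\<in>{0..1}. S y)" using a
          by (simp add: pos_le_divide_eq mult.commute)
      show "(SUP y\<in>{0..1}. S y) \<le> a * (SUP y\<in>{0..1}. g y)"
        unfolding Sg using a bdd by (intro cSUP_least mult_left_mono cSUP_upper) auto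
    qed
    then show ?thesis unfolding haar_deviation_def a_def g_def .
  qed
  also have "(SUP y\<in>{0..1}. S y) \<le> u \<longleftrightarrow> (\<forall>y\<in>{0..1}. S y \<le> u)"
    by (rule cSUP_le_iff) (simp, rule bdd_aboveI2[OF S_bound])
  also have "\<dots> \<longleftrightarrow> (\<forall>k<Suc (2 ^ l). c k \<le> u * sqrt (real N * bin_inf l k / 2 ^ l))"
  proof safe
    fix k assume all: "\<forall>y\<in>{0..1}. S y \<le> u" and k: "k < Suc (2 ^ l)"
    have le: "c k \<le> u * sqrt (real N * f y / 2 ^ l)" if "y \<in> dyadic_bin l k \<inter> {0..1}" for y
    proof -
      have "S y \<le> u" "0 < sqrt (real N * f y / 2 ^ l)" using all that fp N by auto
      then show ?thesis using S_eq[of y k] that by (simp add: pos_divide_le_eq)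
    qed
    \<comment> \<open>the bound passes to the infimum once it is solved for \<open>f y\<close>, which requires division by \<open>u\<close>\<close>
    show "c k \<le> u * sqrt (real N * bin_inf l k / 2 ^ l)"
    proof (cases "u = 0")
      case True
      then show ?thesis using le[OF bin_left_end[of k l]] k by simp
    next
      case False
      then have u0: "u > 0" using u by simp
      have "(c k / u)\<^sup>2 * 2 ^ l / real N \<le> bin_inf l k"
      proof (rule bin_inf_greatest)
        fix y assume y: "y \<in> dyadic_bin l k \<inter> {0..1}"
        have "c k / u \<le> sqrt (real N * f y / 2 ^ l)" using le[OF y] u0
            by (simp add: pos_divide_le_eq mult.commute)
        then have "(c k / u)\<^sup>2 \<le> (sqrt (real N * f y / 2 ^ l))\<^sup>2" using u0
            by (intro power_mono) (auto simp: c_def)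
        also have "\<dots> = real N * f y / 2 ^ l" using fp[of y] y by simp
        finally show "(c k / u)\<^sup>2 * 2 ^ l / real N \<le> f y" using N
            by (simp add: pos_divide_le_eq pos_le_divide_eq mult.commute)
      qed (use k in simp)
      then have "(c k / u)\<^sup>2 \<le> real N * bin_inf l k / 2 ^ l" using N
          by (simp add: pos_divide_le_eq pos_le_divide_eq mult.commute)
      then have "c k / u \<le> sqrt (real N * bin_inf l k / 2 ^ l)" by (rule real_le_rsqrt)
      then show ?thesis using u0 by (simp add: pos_divide_le_eq mult.commute)
    qed
  next
    fix y :: real assume all: "\<forall>k<Suc (2 ^ l). c k \<le> u * sqrt (real N * bin_inf l k / 2 ^ l)"
        and y: "y \<in> {0..1}"
    obtain k where k: "k < Suc (2 ^ l)" "y \<in> dyadic_bin l k" using cover[OF y] by blast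
    have "c k \<le> u * sqrt (real N * bin_inf l k / 2 ^ l)" using all k by blast
    also have "\<dots> \<le> u * sqrt (real N * f y / 2 ^ l)"
      using bin_inf_lower[of y l k] k y u
          by (intro mult_left_mono real_sqrt_le_mono divide_right_mono) auto
    finally show "S y \<le> u" unfolding S_eq[OF k(2) y] using fp[OF y] N
        by (simp add: pos_divide_le_eq)
  qed
  finally show ?thesis unfolding c_def .
qed

lemma bin_mass_bounds:
  assumes "\<And>y. y \<in> dyadic_bin l k \<Longrightarrow> a \<le> f y \<and> f y \<le> b"
  shows "a \<le> 2 ^ l * measure \<nu> (dyadic_bin l k)" "2 ^ l * measure \<nu> (dyadic_bin l k) \<le> b"
proof -
  have B[measurable]: "dyadic_bin l k \<in> sets borel" by (simp add: dyadic_bin_def)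
  have len: "measure lborel (dyadic_bin l k) = 1 / 2 ^ l"
    by (simp add: dyadic_bin_def divide_right_mono diff_divide_distrib[symmetric])
  have fin: "emeasure lborel (dyadic_bin l k) < \<infinity>" by (simp add: dyadic_bin_def divide_right_mono)
  have ci: "integrable lborel (\<lambda>x. c * indicat_real (dyadic_bin l k) x)" for c
    using fin by (intro integrable_mult_right integrable_real_indicator) auto
  have cint: "(LINT x|lborel. c * indicat_real (dyadic_bin l k) x) = c / 2 ^ l" for c
    using len by simp
  have fi: "integrable lborel (\<lambda>x. f x * indicat_real (dyadic_bin l k) x)"
    using f_integrable by (intro integrable_real_mult_indicator) auto
  have "a / 2 ^ l \<le> measure \<nu> (dyadic_bin l k)"
    unfolding measure_nu[OF B] cint[symmetric] using assms
        by (intro integral_mono ci fi) (auto simp: indicator_def)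
  moreover have "measure \<nu> (dyadic_bin l k) \<le> b / 2 ^ l"
    unfolding measure_nu[OF B] cint[symmetric] using assms
        by (intro integral_mono ci fi) (auto simp: indicator_def)
  ultimately show "a \<le> 2 ^ l * measure \<nu> (dyadic_bin l k)" "2 ^ l * measure \<nu> (dyadic_bin l k) \<le> b"
    by (simp_all add: pos_divide_le_eq pos_le_divide_eq mult.commute)
qed

lemma bins_disjoint: "disjoint_family_on (dyadic_bin l) A"
  by (auto simp: disjoint_family_on_def in_dyadic_bin)

text \<open>
  The bins lie to the right of 0, and the density is at least \<open>\<delta>\<close> between \<open>F1\<close> and 0.
\<close>

lemma leftover_mass:
  assumes \<delta>: "\<And>x. x \<in> {F1..<0} \<Longrightarrow> \<delta> \<le> f x" and F: "F1 < 0"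
  shows "(\<Sum>k<K. measure \<nu> (dyadic_bin l k)) \<le> 1 - \<delta> * (- F1)"
proof -
  interpret nu: prob_space \<nu> by (rule prob_nu)
  have B: "dyadic_bin l k \<in> sets borel" for k by (simp add: dyadic_bin_def)
  have "(LINT x|lborel. \<delta> * indicat_real {F1..<0} x) \<le> (LINT x|lborel. f x * indicat_real {F1..<0}
      x)"
    using \<delta> F by (intro integral_mono integrable_mult_right integrable_real_indicator
        integrable_real_mult_indicator f_integrable)
      (auto simp: indicator_def)
  then have neg: "\<delta> * (- F1) \<le> measure \<nu> {F1..<0}" using F by (simp add: measure_nu)
  have "(\<Sum>k<K. measure \<nu> (dyadic_bin l k)) + measure \<nu> {F1..<0} = measure \<nu> (\<Union>k<K. dyadic_bin l k)
      + measure \<nu> {F1..<0}"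
    using bins_disjoint B by (subst nu.finite_measure_finite_Union) auto
  also have "\<dots> = measure \<nu> ((\<Union>k<K. dyadic_bin l k) \<union> {F1..<0})"
  proof (rule nu.finite_measure_Union[symmetric])
    show "(\<Union>k<K. dyadic_bin l k) \<inter> {F1..<0} = {}"
    proof -
      have "0 \<le> z" if "z \<in> dyadic_bin l k" for z k
        using that order_trans[of 0 "real k / 2 ^ l" z] by (auto simp: dyadic_bin_def)
      then show ?thesis by fastforce
    qed
  qed (use B in auto)
  also have "\<dots> \<le> 1" by (rule nu.prob_le_1)
  finally show ?thesis using neg by linarith
qed

end

section \<open>The limit along a sequence of densities\<close>

text \<open>
  Otherwise the mass of an interval of length 1 starting at \<open>y\<close> would exceed 1.
\<close>

lemma (in probability_density) density_upper_bound:
  assumes holder: "\<And>a b. \<bar>f a - f b\<bar> \<le> C * \<bar>a - b\<bar> powr \<beta>" and C: "0 \<le> C" and \<beta>: "0 < \<beta>"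
  shows "f y \<le> 1 + C"
proof -
  have ii: "integrable lborel (\<lambda>z. c * indicat_real {y..y + 1} z)" for c
      by (intro integrable_mult_right integrable_real_indicator) auto
  have fi: "integrable lborel (\<lambda>z. f z * indicat_real {y..y + 1} z)"
    using f_integrable by (intro integrable_real_mult_indicator) auto
  have "f y - C = (LINT z|lborel. (f y - C) * indicat_real {y..y + 1} z)" by simp
  also have "\<dots> \<le> (LINT z|lborel. f z * indicat_real {y..y + 1} z)"
  proof (intro integral_mono ii fi)
    fix z
    show "(f y - C) * indicat_real {y..y + 1} z \<le> f z * indicat_real {y..y + 1} z"
    proof (cases "z \<in> {y..y + 1}")
      case True
      then have "\<bar>y - z\<bar> \<le> 1" by auto
      then have "\<bar>y - z\<bar> powr \<beta> \<le> 1" using powr_mono2[of \<beta> "\<bar>y - z\<bar>" 1] \<beta> by simp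
      then have "C * \<bar>y - z\<bar> powr \<beta> \<le> C * 1" using C by (intro mult_left_mono) auto
      then have "f y - C \<le> f z" using holder[of y z] by linarith
      then show ?thesis using True by simp
    qed simp
  qed
  also have "\<dots> \<le> (LINT z|lborel. f z)"
    by (intro integral_mono fi f_integrable) (auto simp: indicator_def nonneg)
  finally show ?thesis using f_total by linarith
qed

lemma (in probability_density) bin_inf_close:
  assumes holder: "\<And>a b. \<bar>f a - f b\<bar> \<le> C * \<bar>a - b\<bar> powr \<beta>" and C: "0 \<le> C" and \<beta>: "0 < \<beta>"
      and k: "k \<le> 2 ^ l"
  shows "\<bar>bin_inf l k - 2 ^ l * measure \<nu> (dyadic_bin l k)\<bar> \<le> C * (1 / 2 ^ l) powr \<beta>"
proof -
  define \<omega> where "\<omega> = C * (1 / 2 ^ l) powr \<beta>"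
  have close: "\<bar>f y - f z\<bar> \<le> \<omega>" if "y \<in> dyadic_bin l k" "z \<in> dyadic_bin l k" for y z
  proof -
    have "\<bar>y - z\<bar> \<le> 1 / 2 ^ l" using that by (auto simp: dyadic_bin_def add_divide_distrib)
    then have "\<bar>y - z\<bar> powr \<beta> \<le> (1 / 2 ^ l) powr \<beta>" using \<beta> by (intro powr_mono2) auto
    then have "C * \<bar>y - z\<bar> powr \<beta> \<le> \<omega>" unfolding \<omega>_def using C by (intro mult_left_mono) auto
    then show ?thesis using holder[of y z] by linarith
  qed
  have near: "bin_inf l k - \<omega> \<le> f y \<and> f y \<le> bin_inf l k + \<omega>" if y: "y \<in> dyadic_bin l k" for y
  proof
    have "bin_inf l k \<le> f (real k / 2 ^ l)" using bin_inf_lower[OF bin_left_end[OF k]] .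
    moreover have "\<bar>f (real k / 2 ^ l) - f y\<bar> \<le> \<omega>" using bin_left_end[OF k] y by (intro close) auto
    ultimately show "bin_inf l k - \<omega> \<le> f y" by linarith
    have "f y - \<omega> \<le> bin_inf l k"
    proof (rule bin_inf_greatest[OF k])
      fix z assume "z \<in> dyadic_bin l k \<inter> {0..1}"
      then have "\<bar>f y - f z\<bar> \<le> \<omega>" using y by (intro close) auto
      then show "f y - \<omega> \<le> f z" by linarith
    qed
    then show "f y \<le> bin_inf l k + \<omega>" by linarith
  qed
  have "bin_inf l k - \<omega> \<le> 2 ^ l * measure \<nu> (dyadic_bin l k)" "2 ^ l * measure \<nu> (dyadic_bin l k)
      \<le> bin_inf l k + \<omega>"
    by (rule bin_mass_bounds[OF near], assumption)+
  then show ?thesis unfolding \<omega>_def[symmetric] by linarith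
qed

text \<open>
  The bins are read from left to right. A pair of a bin and a number of remaining observations is
  good if that number, divided by the mass left, is within \<open>l * sqrt N\<close> of the sample size. For
  good pairs the probability of an exceedance is asymptotic to \<open>exp (- x) / 2 ^ l\<close> along every
  sequence of pairs, hence uniformly. The chain stays in good pairs except with probability
  \<open>O (1 / l\<^sup>2)\<close>.
\<close>

lemma gumbel_limit_along_sequence_aux:
  fixes f :: "nat \<Rightarrow> real \<Rightarrow> real" and N l :: "nat \<Rightarrow> nat" and x C \<beta> \<delta> F1 F2 :: real
  assumes dens: "\<And>n. probability_density (f n)"
    and lower: "\<And>n y. y \<in> {F1..F2} \<Longrightarrow> \<delta> \<le> f n y" and \<delta>: "0 < \<delta>" and F: "F1 < 0" "1 < F2"
    and holder: "\<And>n a b. \<bar>f n a - f n b\<bar> \<le> C * \<bar>a - b\<bar> powr \<beta>" and C: "0 \<le> C" and \<beta>: "0 < \<beta>"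
    and l: "filterlim l at_top sequentially" and NL: "(\<lambda>n. real (l n) ^ 3 * 2 ^ l n / real (N n))
        \<longlonglongrightarrow> 0"
    and ev: "\<And>n. 0 < N n" "\<And>n. 1 \<le> l n" "\<And>n. 1 / 2 ^ l n \<le> F2 - 1" "\<And>n. 0 \<le> gumbel_level x (l n)"
      "\<And>n. real (l n) < sqrt (real (N n))"
  shows "(\<lambda>n. measure (iid_law (f n)) {X \<in> space (iid_law (f n)). haar_deviation (f n) (N n) (l n) X
      \<le> gumbel_level x (l n)})
     \<longlonglongrightarrow> exp (- exp (- x))"
proof -
  define K where "K n = Suc (2 ^ l n)" for n
  define nu where "nu n = probability_density.\<nu> (f n)" for n
  define p where "p n k = measure (nu n) (dyadic_bin (l n) k)" for n k
  define r where "r n k = 1 - (\<Sum>j<k. p n j)" for n k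
  define \<iota> where "\<iota> n k = probability_density.bin_inf (f n) (l n) k" for n k
  define \<theta> where "\<theta> n k = gumbel_level x (l n) * sqrt (real (N n) * \<iota> n k / 2 ^ l n)" for n k
  define A where "A n k = {m :: nat. \<bar>real m - real (N n) * p n k\<bar> \<le> \<theta> n k}" for n k
  define good where "good n k t \<longleftrightarrow> \<bar>real t / r n k - real (N n)\<bar> \<le> real (l n) * sqrt (real (N n))"
      for n k t
  define S where "S n k t = (\<Sum>m\<in>{..t} \<inter> A n k. Bernstein t m (p n k / r n k))" for n k t
  define \<kappa> where "\<kappa> = \<delta> * (- F1)"
  have \<kappa>: "0 < \<kappa>" using \<delta> F by (simp add: \<kappa>_def mult_pos_neg)
  have kK: "k \<le> 2 ^ l n" if "k < K n" for k n using that by (simp add: K_def)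
  have mass: "\<delta> \<le> 2 ^ l n * p n k" "2 ^ l n * p n k \<le> 1 + C" if k: "k < K n" for n k
  proof -
    interpret probability_density "f n" by (rule dens)
    have "\<delta> \<le> f n y \<and> f n y \<le> 1 + C" if y: "y \<in> dyadic_bin (l n) k" for y
    proof
      have "real k \<le> 2 ^ l n" using kK[OF k] by (metis of_nat_le_iff of_nat_numeral of_nat_power)
      then have "(real k + 1) / 2 ^ l n \<le> 1 + 1 / 2 ^ l n"
          by (simp add: add_divide_distrib pos_divide_le_eq)
      then have "y \<le> F2" using y ev(3)[of n] by (auto simp: dyadic_bin_def)
      moreover have "0 \<le> y" using y order_trans[of 0 "real k / 2 ^ l n" y]
          by (auto simp: dyadic_bin_def)
      ultimately show "\<delta> \<le> f n y" using F by (intro lower) auto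
      show "f n y \<le> 1 + C" by (rule density_upper_bound[OF holder C \<beta>])
    qed
    then show "\<delta> \<le> 2 ^ l n * p n k" "2 ^ l n * p n k \<le> 1 + C"
      unfolding p_def nu_def by (intro bin_mass_bounds; blast)+
  qed
  have p0: "0 < p n k" if "k < K n" for n k
  proof -
    have "0 < 2 ^ l n * p n k" using mass(1)[OF that] \<delta> by linarith
    then show ?thesis by (simp add: zero_less_mult_iff)
  qed
  have pn: "0 \<le> p n k" for n k by (simp add: p_def)
  have r_lower: "\<kappa> \<le> r n k" for n k
  proof -
    interpret probability_density "f n" by (rule dens)
    have "(\<Sum>j<k. p n j) \<le> 1 - \<delta> * (- F1)"
      unfolding p_def nu_def using F by (intro leftover_mass lower) auto
    then show ?thesis by (simp add: r_def \<kappa>_def)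
  qed
  have r0: "0 < r n k" for n k using r_lower[of n k] \<kappa> by linarith
  have r_Suc: "r n (Suc k) = r n k - p n k" for n k by (simp add: r_def)
  have \<rho>01: "0 \<le> p n k / r n k \<and> p n k / r n k \<le> 1" for n k
    using pn[of n k] r0[of n k] r0[of n "Suc k"] r_Suc[of n k] by simp
  have close: "\<bar>\<iota> n k - 2 ^ l n * p n k\<bar> \<le> C * (1 / 2 ^ l n) powr \<beta>" if "k < K n" for n k
  proof -
    interpret probability_density "f n" by (rule dens)
    show ?thesis unfolding \<iota>_def p_def nu_def by (rule bin_inf_close[OF holder C \<beta> kK[OF that]])
  qed
  have \<iota>0: "0 \<le> \<iota> n k" if "k < K n" for n k
  proof -
    interpret probability_density "f n" by (rule dens)
    show ?thesis unfolding \<iota>_def by (rule bin_inf_greatest[OF kK[OF that]]) (rule nonneg)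
  qed
  have \<theta>0: "0 \<le> \<theta> n k" if "k < K n" for n k
    unfolding \<theta>_def using ev(4)[of n] \<iota>0[OF that] by simp
  \<comment> \<open>an arbitrary choice of bin and remaining sample size for each \<open>n\<close>, which yields uniformity\<close>
  have single: "(\<lambda>n. 2 ^ l n * (1 - S n (k n) (t n))) \<longlonglongrightarrow> exp (- x)"
    if k: "\<And>n. k n < K n" and g: "\<And>n. good n (k n) (t n)" for k t
  proof -
    have tpos: "0 < t n" for n
    proof (rule ccontr)
      assume "\<not> 0 < t n"
      then have "real (N n) \<le> real (l n) * sqrt (real (N n))" using g[of n] by (simp add: good_def)
      moreover have "real (l n) * sqrt (real (N n)) < sqrt (real (N n)) * sqrt (real (N n))"
        using ev(5)[of n] ev(1)[of n] by (intro mult_strict_right_mono) auto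
      ultimately show False by simp
    qed
    have \<iota>l: "(\<lambda>n. real (l n) * (\<iota> n (k n) / (2 ^ l n * p n (k n)) - 1)) \<longlonglongrightarrow> 0"
    proof (rule Lim_null_comparison)
      have "(\<lambda>m. C / \<delta> * (real m * (1 / 2 ^ m) powr \<beta>)) \<longlonglongrightarrow> 0" using \<beta> by real_asymp
      then show "(\<lambda>n. C / \<delta> * (real (l n) * (1 / 2 ^ l n) powr \<beta>)) \<longlonglongrightarrow> 0"
          by (rule filterlim_compose[OF _ l])
      show "\<forall>\<^sub>F n in sequentially. norm (real (l n) * (\<iota> n (k n) / (2 ^ l n * p n (k n)) - 1))
          \<le> C / \<delta> * (real (l n) * (1 / 2 ^ l n) powr \<beta>)"
      proof (intro always_eventually allI)
        fix n
        define P where "P = 2 ^ l n * p n (k n)"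
        have P: "\<delta> \<le> P" "0 < P" using mass(1)[OF k[of n]] \<delta> by (simp_all add: P_def)
        have "\<iota> n (k n) / P - 1 = (\<iota> n (k n) - P) / P" using P by (simp add: diff_divide_distrib)
        then have "\<bar>\<iota> n (k n) / P - 1\<bar> = \<bar>\<iota> n (k n) - P\<bar> / P" using P by (simp add: abs_divide)
        also have "\<dots> \<le> C * (1 / 2 ^ l n) powr \<beta> / \<delta>"
          using close[OF k[of n]] P \<delta> C unfolding P_def[symmetric] by (intro frac_le) auto
        finally have "real (l n) * \<bar>\<iota> n (k n) / P - 1\<bar> \<le> real (l n) * (C * (1 / 2 ^ l n) powr \<beta>
            / \<delta>)"
          by (intro mult_left_mono) auto
        then show "norm (real (l n) * (\<iota> n (k n) / (2 ^ l n * p n (k n)) - 1))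
            \<le> C / \<delta> * (real (l n) * (1 / 2 ^ l n) powr \<beta>)"
          unfolding P_def[symmetric] by (simp add: abs_mult mult_ac)
      qed
    qed
    note sb = single_bin_tails[OF l NL ev(1) tpos \<kappa> r_lower \<delta> mass(1)[OF k] mass(2)[OF k] \<iota>l
        g[unfolded good_def], of x, folded \<theta>_def]
    have "1 - S n (k n) (t n) =
       (\<Sum>m | m \<le> t n \<and> real (N n) * p n (k n) + \<theta> n (k n) < real m. Bernstein (t n) m (p n (k n)
           / r n (k n))) +
       (\<Sum>m | m \<le> t n \<and> real m < real (N n) * p n (k n) - \<theta> n (k n). Bernstein (t n) m (p n (k n)
           / r n (k n)))" for n
    proof -
      let ?B = "\<lambda>m. Bernstein (t n) m (p n (k n) / r n (k n))"
      let ?U = "{m. m \<le> t n \<and> real (N n) * p n (k n) + \<theta> n (k n) < real m}"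
      let ?L = "{m. m \<le> t n \<and> real m < real (N n) * p n (k n) - \<theta> n (k n)}"
      have "1 = (\<Sum>m\<le>t n. ?B m)" by simp
      also have "\<dots> = S n (k n) (t n) + (\<Sum>m\<in>{..t n} - A n (k n). ?B m)"
        unfolding S_def by (rule sum.Int_Diff) simp
      also have "{..t n} - A n (k n) = ?U \<union> ?L" by (auto simp: A_def)
      also have "(\<Sum>m\<in>?U \<union> ?L. ?B m) = (\<Sum>m\<in>?U. ?B m) + (\<Sum>m\<in>?L. ?B m)"
        using \<theta>0[OF k[of n]] by (intro sum.union_disjoint) auto
      finally show ?thesis by linarith
    qed
    then show ?thesis using tendsto_add[OF sb] by (simp add: distrib_left)
  qed
  have S01: "0 \<le> S n k t \<and> S n k t \<le> 1" for n k t
  proof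
    have B: "0 \<le> Bernstein t m (p n k / r n k)" for m using \<rho>01[of n k]
        by (intro Bernstein_nonneg) auto
    show "0 \<le> S n k t" unfolding S_def by (intro sum_nonneg B)
    have "S n k t \<le> (\<Sum>m\<le>t. Bernstein t m (p n k / r n k))" unfolding S_def
        by (intro sum_mono2 B) auto
    then show "S n k t \<le> 1" by simp
  qed
  \<comment> \<open>the extreme exceedance probabilities are attained, so \<open>single\<close> applies to them\<close>
  define Q where "Q n = {(k, t). k < K n \<and> t \<le> N n \<and> good n k t}" for n
  have finQ: "finite (Q n)" for n
    by (rule finite_subset[of _ "{..<K n} \<times> {..N n}"]) (auto simp: Q_def)
  have neQ: "(0, N n) \<in> Q n" for n by (auto simp: Q_def K_def good_def r_def)
  define q1 where "q1 n = Max ((\<lambda>(k, t). 1 - S n k t) ` Q n)" for n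
  define q2 where "q2 n = Min ((\<lambda>(k, t). 1 - S n k t) ` Q n)" for n
  have "\<forall>n. \<exists>kt\<in>Q n. q1 n = (\<lambda>(k, t). 1 - S n k t) kt"
  proof
    fix n have "q1 n \<in> (\<lambda>(k, t). 1 - S n k t) ` Q n" unfolding q1_def using finQ neQ
        by (intro Max_in) auto
    then show "\<exists>kt\<in>Q n. q1 n = (\<lambda>(k, t). 1 - S n k t) kt" by blast
  qed
  then obtain m1 where m1: "\<And>n. m1 n \<in> Q n" "\<And>n. q1 n = (\<lambda>(k, t). 1 - S n k t) (m1 n)" by metis
  have "\<forall>n. \<exists>kt\<in>Q n. q2 n = (\<lambda>(k, t). 1 - S n k t) kt"
  proof
    fix n have "q2 n \<in> (\<lambda>(k, t). 1 - S n k t) ` Q n" unfolding q2_def using finQ neQ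
        by (intro Min_in) auto
    then show "\<exists>kt\<in>Q n. q2 n = (\<lambda>(k, t). 1 - S n k t) kt" by blast
  qed
  then obtain m2 where m2: "\<And>n. m2 n \<in> Q n" "\<And>n. q2 n = (\<lambda>(k, t). 1 - S n k t) (m2 n)" by metis
  have q_lim: "(\<lambda>n. 2 ^ l n * q n) \<longlonglongrightarrow> exp (- x)" if "\<And>n. m n \<in> Q n" "\<And>n. q n
      = (\<lambda>(k, t). 1 - S n k t) (m n)" for q m
    using single[of "\<lambda>n. fst (m n)" "\<lambda>n. snd (m n)"] that by (simp add: Q_def case_prod_beta)
  have pow: "(\<lambda>n. (1 - q n) ^ K n) \<longlonglongrightarrow> exp (- exp (- x))" if "(\<lambda>n. 2 ^ l n * q n) \<longlonglongrightarrow> exp (- x)" for q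
  proof (rule power_to_exponential)
    have "(\<lambda>m. 1 / 2 ^ m :: real) \<longlonglongrightarrow> 0" by real_asymp
    then have h: "(\<lambda>n. 1 / 2 ^ l n :: real) \<longlonglongrightarrow> 0" by (rule filterlim_compose[OF _ l])
    show q0: "q \<longlonglongrightarrow> 0" using tendsto_mult[OF that h] by simp
    show "(\<lambda>n. real (K n) * q n) \<longlonglongrightarrow> exp (- x)"
      using tendsto_add[OF that q0] by (simp add: K_def algebra_simps)
  qed
  have lim1: "(\<lambda>n. (1 - q1 n) ^ K n) \<longlonglongrightarrow> exp (- exp (- x))" by (rule pow[OF q_lim[OF m1]])
  have lim2: "(\<lambda>n. (1 - q2 n) ^ K n) \<longlonglongrightarrow> exp (- exp (- x))" by (rule pow[OF q_lim[OF m2]])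
  \<comment> \<open>As in Kolmogorov's inequality: the squared distance from the centre plus a bound on
    the variance still to come, to which bin \<open>j\<close> contributes at most \<open>N * p n j / \<kappa> ^ 3\<close>, is a
    supermartingale; it is divided by the squared width of the good region.\<close>
  define b where "b n k t = ((real t / r n k - real (N n))\<^sup>2 + real (N n) / \<kappa> ^ 3 * (\<Sum>j\<in>{k..<K n}. p
      n j)) / (real (N n) * (real (l n))\<^sup>2)" for n k t
  have b_nonneg: "0 \<le> b n k t" for n k t
    unfolding b_def using \<kappa> pn by (intro divide_nonneg_nonneg add_nonneg_nonneg mult_nonneg_nonneg
        sum_nonneg) auto
  have b_bad: "1 \<le> b n k t" if "\<not> good n k t" for n k t
  proof -
    have "(real (l n) * sqrt (real (N n)))\<^sup>2 \<le> \<bar>real t / r n k - real (N n)\<bar>\<^sup>2"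
      using that unfolding good_def by (intro power_mono) auto
    then have "real (N n) * (real (l n))\<^sup>2 \<le> (real t / r n k - real (N n))\<^sup>2"
        by (simp add: power_mult_distrib mult.commute)
    also have "\<dots> \<le> (real t / r n k - real (N n))\<^sup>2 + real (N n) / \<kappa> ^ 3 * (\<Sum>j\<in>{k..<K n}. p n j)"
      using \<kappa> pn by (simp add: sum_nonneg)
    finally show ?thesis unfolding b_def using ev(1,2)[of n] by (subst le_divide_eq_1_pos) auto
  qed
  have b_step: "(\<Sum>m\<le>t. Bernstein t m (p n k / r n k) * b n (Suc k) (t - m)) \<le> b n k t"
      if k: "k < K n" and t: "t \<le> N n" for n k t
  proof -
    let ?\<rho> = "p n k / r n k"
    define V where "V = real (N n) * (real (l n))\<^sup>2"
    have V: "V > 0" using ev(1,2)[of n] by (simp add: V_def)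
    define W where "W = real (N n) / \<kappa> ^ 3 * (\<Sum>j\<in>{Suc k..<K n}. p n j)"
    have rS: "r n k * (1 - ?\<rho>) = r n (Suc k)" using r0[of n k]
        by (simp add: r_Suc right_diff_distrib)
    have \<rho>1: "?\<rho> \<noteq> 1" using r0[of n "Suc k"] rS by auto
    have WB: "(\<Sum>m\<le>t. W * Bernstein t m ?\<rho>) = W" by (simp add: sum_distrib_left[symmetric])
    have "(\<Sum>m\<le>t. Bernstein t m ?\<rho> * b n (Suc k) (t - m)) =
       ((\<Sum>m\<le>t. Bernstein t m ?\<rho> * (real (t - m) / r n (Suc k) - real (N n))\<^sup>2) + W
           * (\<Sum>m\<le>t. Bernstein t m ?\<rho>)) / V"
      unfolding b_def W_def[symmetric] V_def[symmetric]
      by (simp add: sum_divide_distrib[symmetric] distrib_left sum.distrib sum_distrib_left WB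
          mult.commute)
    also have "\<dots> = ((real t / r n k - real (N n))\<^sup>2 + real t * ?\<rho> * (1 - ?\<rho>) / (r n (Suc k))\<^sup>2 + W)
        / V"
      using Bernstein_square_step[OF _ \<rho>1, of "r n k" t "real (N n)"] r0[of n k] unfolding rS
          by simp
    also have "real t * ?\<rho> * (1 - ?\<rho>) / (r n (Suc k))\<^sup>2 \<le> real (N n) / \<kappa> ^ 3 * p n k"
    proof -
      have e: "1 - ?\<rho> = r n (Suc k) / r n k" unfolding rS[symmetric] using r0[of n k] by simp
      have "real t * ?\<rho> * (1 - ?\<rho>) / (r n (Suc k))\<^sup>2 = real t * p n k / (r n k * r n k
          * r n (Suc k))"
        unfolding e using r0[of n k] r0[of n "Suc k"] by (simp add: power2_eq_square)
      also have "\<dots> \<le> real (N n) * p n k / (\<kappa> * \<kappa> * \<kappa>)"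
        using t pn[of n k] \<kappa> r_lower[of n k] r_lower[of n "Suc k"]
            by (intro frac_le mult_mono mult_pos_pos mult_nonneg_nonneg) auto
      finally show ?thesis by (simp add: power3_eq_cube)
    qed
    also have "((real t / r n k - real (N n))\<^sup>2 + real (N n) / \<kappa> ^ 3 * p n k + W) / V = b n k t"
      unfolding b_def V_def W_def using k
          by (simp add: sum.atLeast_Suc_lessThan distrib_left add.assoc)
    finally show ?thesis using V by (simp add: divide_right_mono)
  qed
  have b_init: "b n 0 (N n) \<le> (1 / \<kappa> ^ 3) * (1 / (real (l n))\<^sup>2)" for n
  proof -
    have "(\<Sum>j\<in>{0..<K n}. p n j) \<le> 1" using r0[of n "K n"] by (simp add: r_def atLeast0LessThan)
    then have "real (N n) / \<kappa> ^ 3 * (\<Sum>j\<in>{0..<K n}. p n j) \<le> real (N n) / \<kappa> ^ 3 * 1" using \<kappa>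
        by (intro mult_left_mono) auto
    then have "b n 0 (N n) \<le> (real (N n) / \<kappa> ^ 3) / (real (N n) * (real (l n))\<^sup>2)"
      unfolding b_def by (intro divide_right_mono) (auto simp: r_def)
    also have "\<dots> = (1 / \<kappa> ^ 3) * (1 / (real (l n))\<^sup>2)" using ev(1)[of n] by simp
    finally show ?thesis .
  qed
  have b_lim: "(\<lambda>n. b n 0 (N n)) \<longlonglongrightarrow> 0"
  proof (rule Lim_null_comparison)
    have "(\<lambda>m. (1 / \<kappa> ^ 3) * (1 / (real m)\<^sup>2)) \<longlonglongrightarrow> 0" using \<kappa> by real_asymp
    then show "(\<lambda>n. (1 / \<kappa> ^ 3) * (1 / (real (l n))\<^sup>2)) \<longlonglongrightarrow> 0" by (rule filterlim_compose[OF _ l])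
    show "\<forall>\<^sub>F n in sequentially. norm (b n 0 (N n)) \<le> (1 / \<kappa> ^ 3) * (1 / (real (l n))\<^sup>2)"
      using b_init b_nonneg by (intro always_eventually allI) simp
  qed
  define occ where "occ n = occupancy (K n) (\<lambda>k. p n k / r n k) (A n) (N n)" for n
  have sandwich: "(1 - q1 n) ^ K n - b n 0 (N n) \<le> occ n \<and> occ n \<le> (1 - q2 n) ^ K n + b n 0 (N n)"
      for n
  proof -
    have SQ: "1 - q1 n \<le> S n k t \<and> S n k t \<le> 1 - q2 n" if "k < K n" "t \<le> N n" "good n k t" for k t
    proof -
      have m: "1 - S n k t \<in> (\<lambda>(k, t). 1 - S n k t) ` Q n" using that by (force simp: Q_def)
      have "1 - S n k t \<le> q1 n" unfolding q1_def by (rule Max_ge[OF _ m]) (simp add: finQ)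
      moreover have "q2 n \<le> 1 - S n k t" unfolding q2_def by (rule Min_le[OF _ m]) (simp add: finQ)
      ultimately show ?thesis by linarith
    qed
    have q01: "0 \<le> q1 n" "q1 n \<le> 1" "0 \<le> q2 n" "q2 n \<le> 1"
      unfolding m1(2) m2(2) using S01 by (auto split: prod.splits)
    show ?thesis
      unfolding occ_def
      using occupancy_bounds(1)[of "K n" "\<lambda>k. p n k / r n k" "N n" "good n" "q1 n" "A n" "q2 n" "b
          n" "N n"]
        occupancy_bounds(2)[of "K n" "\<lambda>k. p n k / r n k" "N n" "good n" "q1 n" "A n" "q2 n" "b n" "N
            n"]
        \<rho>01 SQ[unfolded S_def] q01 b_nonneg b_bad b_step by blast
  qed
  have occ_lim: "occ \<longlonglongrightarrow> exp (- exp (- x))"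
  proof (rule tendsto_sandwich)
    show "\<forall>\<^sub>F n in sequentially. (1 - q1 n) ^ K n - b n 0 (N n) \<le> occ n" "\<forall>\<^sub>F n in sequentially. occ
        n \<le> (1 - q2 n) ^ K n + b n 0 (N n)"
      using sandwich by simp_all
    show "(\<lambda>n. (1 - q1 n) ^ K n - b n 0 (N n)) \<longlonglongrightarrow> exp (- exp (- x))"
        using tendsto_diff[OF lim1 b_lim] by simp
    show "(\<lambda>n. (1 - q2 n) ^ K n + b n 0 (N n)) \<longlonglongrightarrow> exp (- exp (- x))" using tendsto_add[OF lim2 b_lim]
        by simp
  qed
  have "measure (iid_law (f n)) {X \<in> space (iid_law (f n)). haar_deviation (f n) (N n) (l n) X
      \<le> gumbel_level x (l n)} = occ n" for n
  proof -
    interpret probability_density "f n" by (rule dens)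
    have "haar_deviation (f n) (N n) (l n) X \<le> gumbel_level x (l n)
        \<longleftrightarrow> (\<forall>k<K n. card {i\<in>{1..N n}. X i \<in> dyadic_bin (l n) k} \<in> A n k)" for X
      unfolding A_def \<theta>_def \<iota>_def p_def nu_def K_def mem_Collect_eq
      by (rule haar_deviation_le_iff[OF \<delta> lower ev(1) ev(4)]) (use F in auto)
    then have "measure (iid_law (f n)) {X \<in> space (iid_law (f n)). haar_deviation (f n) (N n) (l n)
        X \<le> gumbel_level x (l n)}
       = measure (PiM UNIV (\<lambda>_::nat. \<nu>)) {X \<in> space (PiM UNIV (\<lambda>_::nat. \<nu>)). \<forall>k<K n. card {i\<in>{1..N
           n}. X i \<in> dyadic_bin (l n) k} \<in> A n k}"
      by (simp add: iid_law_eq)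
    also have "\<dots> = occupancy (K n) (\<lambda>k. measure \<nu> (dyadic_bin (l n) k)
        / (1 - (\<Sum>j<k. measure \<nu> (dyadic_bin (l n) j)))) (A n) (card {1..N n})"
    proof (rule occupancy_probability[OF prob_nu])
      show "dyadic_bin (l n) k \<in> sets \<nu>" for k by (simp add: dyadic_bin_def)
      show "(\<Sum>k<K n. measure \<nu> (dyadic_bin (l n) k)) < 1" using r0[of n "K n"]
          by (simp add: r_def p_def nu_def)
    qed (auto intro: bins_disjoint)
    finally show ?thesis by (simp add: occ_def r_def p_def nu_def)
  qed
  then show ?thesis using occ_lim by simp
qed

text \<open>
  The side conditions hold from some index on, and a limit does not see finitely many terms.
\<close>

lemma gumbel_limit_along_sequence:
  fixes f :: "nat \<Rightarrow> real \<Rightarrow> real" and N l :: "nat \<Rightarrow> nat" and x C \<beta> \<delta> F1 F2 :: real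
  assumes dens: "\<And>n. probability_density (f n)"
    and lower: "\<And>n y. y \<in> {F1..F2} \<Longrightarrow> \<delta> \<le> f n y" and \<delta>: "0 < \<delta>" and F: "F1 < 0" "1 < F2"
    and holder: "\<And>n a b. \<bar>f n a - f n b\<bar> \<le> C * \<bar>a - b\<bar> powr \<beta>" and C: "0 \<le> C" and \<beta>: "0 < \<beta>"
    and l: "filterlim l at_top sequentially" and NL: "(\<lambda>n. real (l n) ^ 3 * 2 ^ l n / real (N n))
        \<longlonglongrightarrow> 0"
    and N: "\<forall>\<^sub>F n in sequentially. 0 < N n"
  shows "(\<lambda>n. measure (iid_law (f n)) {X \<in> space (iid_law (f n)). haar_deviation (f n) (N n) (l n) X
      \<le> gumbel_level x (l n)})
     \<longlonglongrightarrow> exp (- exp (- x))"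
proof -
  have l1: "\<forall>\<^sub>F n in sequentially. 1 \<le> l n" using l unfolding filterlim_at_top by blast
  have "(\<lambda>m. 1 / 2 ^ m :: real) \<longlonglongrightarrow> 0" by real_asymp
  then have "(\<lambda>n. 1 / 2 ^ l n :: real) \<longlonglongrightarrow> 0" by (rule filterlim_compose[OF _ l])
  then have l2: "\<forall>\<^sub>F n in sequentially. 1 / 2 ^ l n < F2 - 1" using F
      by (intro order_tendstoD(2)) auto
  have "filterlim (\<lambda>n. gumbel_level x (l n)) at_top sequentially"
      by (rule filterlim_compose[OF gumbel_level_at_top l])
  then have l3: "\<forall>\<^sub>F n in sequentially. 0 \<le> gumbel_level x (l n)" unfolding filterlim_at_top
      by blast
  have l4: "\<forall>\<^sub>F n in sequentially. real (l n) ^ 3 * 2 ^ l n / real (N n) < 1" using NL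
      by (rule order_tendstoD) simp
  have "\<forall>\<^sub>F n in sequentially. 0 < N n \<and> 1 \<le> l n \<and> 1 / 2 ^ l n \<le> F2 - 1 \<and> 0 \<le> gumbel_level x (l n)
      \<and> real (l n) < sqrt (real (N n))"
    using N l1 l2 l3 l4
  proof eventually_elim
    case (elim n)
    have "real (l n) ^ 2 \<le> real (l n) ^ 3" using elim by (intro power_increasing) auto
    also have "\<dots> * 1 \<le> real (l n) ^ 3 * 2 ^ l n" by (intro mult_left_mono) auto
    also have "\<dots> < real (N n)" using elim by (simp add: pos_divide_less_eq)
    finally have "real (l n) < sqrt (real (N n))" by (intro real_less_rsqrt) simp
    then show ?case using elim by auto
  qed
  then obtain n0 where n0: "\<And>n. n0 \<le> n \<Longrightarrow> 0 < N n \<and> 1 \<le> l n \<and> 1 / 2 ^ l n \<le> F2 - 1 \<and> 0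
      \<le> gumbel_level x (l n) \<and> real (l n) < sqrt (real (N n))"
    unfolding eventually_sequentially by blast
  have sh: "filterlim (\<lambda>n. n + n0) at_top sequentially" by (rule filterlim_add_const_nat_at_top)
  have "(\<lambda>n. measure (iid_law (f (n + n0))) {X \<in> space (iid_law (f (n + n0))). haar_deviation
      (f (n + n0)) (N (n + n0)) (l (n + n0)) X \<le> gumbel_level x (l (n + n0))})
     \<longlonglongrightarrow> exp (- exp (- x))"
    by (rule gumbel_limit_along_sequence_aux[where f = "\<lambda>n. f (n + n0)" and N = "\<lambda>n. N (n + n0)"
        and l = "\<lambda>n. l (n + n0)",
        OF dens lower \<delta> F holder C \<beta> filterlim_compose[OF l sh] filterlim_compose[OF NL sh]])
      (use n0[of "_ + n0"] in auto)
  then show ?thesis by (rule LIMSEQ_offset)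
qed

text \<open>
  Both growth conditions are needed at the extremes of the range: the smallest resolution must
  tend to infinity, and at the largest one \<open>2 ^ l = O (n2 / (ln n2) ^ 4)\<close> leaves a factor
  \<open>1 / ln n2\<close> after \<open>l ^ 3 = O ((ln n2) ^ 3)\<close> has been absorbed.
\<close>

lemma resolution_growth:
  fixes n1 n2 jmin jmax l :: "nat \<Rightarrow> nat"
  assumes n: "\<And>n. n1 n + n2 n = n"
    and n12: "(\<lambda>n. real (n1 n)) \<simeq> (\<lambda>n. real (n2 n))"
    and jmin: "(\<lambda>n. 2 ^ jmin n) \<simeq> (\<lambda>n. (real (n2 n) / ln (real (n2 n))) powr (1 / (2 * 1 + 1)))"
    and jmax: "(\<lambda>n. 2 ^ jmax n) \<simeq> (\<lambda>n. real (n2 n) / (ln (real (n2 n))) ^ 4)"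
    and l: "\<And>n. l n \<in> {jmin n..jmax n}"
  shows "filterlim l at_top sequentially" "(\<lambda>n. real (l n) ^ 3 * 2 ^ l n / real (n1 n)) \<longlonglongrightarrow> 0"
    "\<forall>\<^sub>F n in sequentially. 0 < n1 n"
proof -
  obtain c C where c: "0 < c" and cC: "\<forall>\<^sub>F n in sequentially. c \<le> real (n1 n) / real (n2 n)
      \<and> real (n1 n) / real (n2 n) \<le> C"
    using n12 unfolding bounded_ratio_def by blast
  obtain c' C' where c': "0 < c'" and cC': "\<forall>\<^sub>F n in sequentially. c' \<le> 2 ^ jmin n / (real (n2 n)
      / ln (real (n2 n))) powr (1 / (2 * 1 + 1)) \<and>
      2 ^ jmin n / (real (n2 n) / ln (real (n2 n))) powr (1 / (2 * 1 + 1)) \<le> C'"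
    using jmin unfolding bounded_ratio_def by blast
  obtain c'' C'' where c'': "0 < c''" and cC'': "\<forall>\<^sub>F n in sequentially. c''
      \<le> 2 ^ jmax n / (real (n2 n) / (ln (real (n2 n))) ^ 4) \<and>
      2 ^ jmax n / (real (n2 n) / (ln (real (n2 n))) ^ 4) \<le> C''"
    using jmax unfolding bounded_ratio_def by blast
  have pos: "\<forall>\<^sub>F n in sequentially. 0 < n2 n \<and> c * real (n2 n) \<le> real (n1 n) \<and> real (n1 n)
      \<le> C * real (n2 n)"
    using cC
  proof eventually_elim
    case (elim n)
    have "n2 n \<noteq> 0"
    proof
      assume "n2 n = 0"
      then show False using elim c by simp
    qed
    then show ?case using elim by (simp add: pos_le_divide_eq pos_divide_le_eq)
  qed
  show n1pos: "\<forall>\<^sub>F n in sequentially. 0 < n1 n"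
    using pos
  proof eventually_elim
    case (elim n)
    then have "0 < c * real (n2 n)" using c by simp
    then show ?case using elim by (metis less_le_trans of_nat_0_less_iff)
  qed
  have n2_top: "filterlim (\<lambda>n. real (n2 n)) at_top sequentially"
  proof (rule filterlim_at_top_mono)
    show "filterlim (\<lambda>n. 1 / (1 + \<bar>C\<bar>) * real n) at_top sequentially"
      by (rule filterlim_tendsto_pos_mult_at_top[OF tendsto_const _ filterlim_real_sequentially])
          simp
    show "\<forall>\<^sub>F n in sequentially. 1 / (1 + \<bar>C\<bar>) * real n \<le> real (n2 n)"
      using pos
    proof eventually_elim
      case (elim n)
      have "real n = real (n1 n) + real (n2 n)" using n[of n] by linarith
      also have "\<dots> \<le> C * real (n2 n) + real (n2 n)" using elim by simp
      also have "\<dots> \<le> \<bar>C\<bar> * real (n2 n) + real (n2 n)" by (intro add_right_mono mult_right_mono) auto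
      also have "\<dots> = (1 + \<bar>C\<bar>) * real (n2 n)" by (simp add: algebra_simps)
      finally show ?case by (simp add: pos_divide_le_eq mult.commute)
    qed
  qed
  have n2_big: "\<forall>\<^sub>F n in sequentially. 3 \<le> real (n2 n)" using n2_top unfolding filterlim_at_top
      by blast
  have ln1: "1 \<le> ln y" if "3 \<le> y" for y :: real
  proof -
    have "exp 1 \<le> y" using exp_le that by linarith
    then show ?thesis using that by (subst ln_ge_iff) auto
  qed
  show l_top: "filterlim l at_top sequentially"
  proof -
    have "filterlim (\<lambda>y::real. c' * (y / ln y) powr (1 / (2 * 1 + 1))) at_top at_top" using c'
        by real_asymp
    then have top: "filterlim (\<lambda>n. c' * (real (n2 n) / ln (real (n2 n))) powr (1 / (2 * 1 + 1)))
        at_top sequentially"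
      by (rule filterlim_compose[OF _ n2_top])
    have two: "filterlim (\<lambda>n. (2::real) ^ l n) at_top sequentially"
    proof (rule filterlim_at_top_mono[OF top])
      show "\<forall>\<^sub>F n in sequentially. c' * (real (n2 n) / ln (real (n2 n))) powr (1 / (2 * 1 + 1))
          \<le> 2 ^ l n"
        using cC' n2_big
      proof eventually_elim
        case (elim n)
        have "0 < (real (n2 n) / ln (real (n2 n))) powr (1 / (2 * 1 + 1))"
            using elim(2) ln1[OF elim(2)] by simp
        then have "c' * (real (n2 n) / ln (real (n2 n))) powr (1 / (2 * 1 + 1)) \<le> 2 ^ jmin n"
          using elim(1) by (metis pos_le_divide_eq)
        also have "(2::real) ^ jmin n \<le> 2 ^ l n" using l[of n] by (intro power_increasing) auto
        finally show ?case .
      qed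
    qed
    show ?thesis
      unfolding filterlim_at_top
    proof
      fix Z
      have "\<forall>\<^sub>F n in sequentially. (2::real) ^ Z \<le> 2 ^ l n" using two unfolding filterlim_at_top
          by blast
      then show "\<forall>\<^sub>F n in sequentially. Z \<le> l n" by eventually_elim simp
    qed
  qed
  define B where "B = max 1 C''"
  have B: "1 \<le> B" "C'' \<le> B" by (simp_all add: B_def)
  have bound: "\<forall>\<^sub>F n in sequentially. norm (real (l n) ^ 3 * 2 ^ l n / real (n1 n))
      \<le> ((ln B + 1) / ln 2) ^ 3 * B / c * (1 / ln (real (n2 n)))"
    using cC'' n2_big pos n1pos
  proof eventually_elim
    case (elim n)
    define L where "L = ln (real (n2 n))"
    have L: "1 \<le> L" unfolding L_def by (rule ln1[OF elim(2)])
    have "(2::real) ^ l n \<le> 2 ^ jmax n" using l[of n] by (intro power_increasing) auto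
    also have "\<dots> \<le> C'' * (real (n2 n) / L ^ 4)"
    proof -
      have q: "0 < real (n2 n) / L ^ 4" using elim(2) L by simp
      show ?thesis using elim(1) unfolding L_def[symmetric] pos_divide_le_eq[OF q] by blast
    qed
    also have "\<dots> \<le> B * (real (n2 n) / L ^ 4)" using B L by (intro mult_right_mono) auto
    finally have two: "(2::real) ^ l n \<le> B * (real (n2 n) / L ^ 4)" .
    have "real (n2 n) / L ^ 4 \<le> real (n2 n) / 1" using L
        by (intro divide_left_mono) (auto intro: one_le_power)
    then have "(2::real) ^ l n \<le> B * real (n2 n)" using two B
        by (smt (verit) mult_left_mono div_by_1)
    then have "ln ((2::real) ^ l n) \<le> ln (B * real (n2 n))" using B elim(2)
        by (subst ln_le_cancel_iff) auto
    then have "real (l n) * ln 2 \<le> ln B + L" using B elim(2) by (simp add: ln_realpow ln_mult L_def)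
    also have "\<dots> \<le> (ln B + 1) * L"
    proof -
      have "ln B * 1 \<le> ln B * L" using B L by (intro mult_left_mono) auto
      then show ?thesis by (simp add: distrib_right)
    qed
    finally have "real (l n) \<le> (ln B + 1) / ln 2 * L" by (simp add: pos_le_divide_eq)
    then have "real (l n) ^ 3 \<le> ((ln B + 1) / ln 2 * L) ^ 3" by (intro power_mono) auto
    then have "real (l n) ^ 3 * 2 ^ l n \<le> ((ln B + 1) / ln 2 * L) ^ 3 * (B * (real (n2 n) / L ^ 4))"
      using two B L by (intro mult_mono zero_le_power mult_nonneg_nonneg divide_nonneg_nonneg
          add_nonneg_nonneg) auto
    then have "real (l n) ^ 3 * 2 ^ l n / real (n1 n) \<le> ((ln B + 1) / ln 2 * L) ^ 3
        * (B * (real (n2 n) / L ^ 4)) / (c * real (n2 n))"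
      using elim(3,4) c B L by (intro frac_le mult_nonneg_nonneg zero_le_power divide_nonneg_nonneg
          add_nonneg_nonneg) auto
    also have "\<dots> = ((ln B + 1) / ln 2) ^ 3 * B / c * (1 / L)"
    proof -
      have alg: "(a * L) ^ 3 * (B * (y / L ^ 4)) / (c * y) = a ^ 3 * B / c * (1 / L)"
          if "y \<noteq> 0" "L \<noteq> 0" for a y L :: real
        using that c by (simp add: power_mult_distrib power3_eq_cube power4_eq_xxxx mult_ac)
      show ?thesis using elim(2) L by (intro alg) auto
    qed
    finally show ?case using elim unfolding L_def by simp
  qed
  show "(\<lambda>n. real (l n) ^ 3 * 2 ^ l n / real (n1 n)) \<longlonglongrightarrow> 0"
  proof (rule Lim_null_comparison[OF bound])
    have "((\<lambda>y::real. ((ln B + 1) / ln 2) ^ 3 * B / c * (1 / ln y)) \<longlongrightarrow> 0) at_top" by real_asymp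
    then show "(\<lambda>n. ((ln B + 1) / ln 2) ^ 3 * B / c * (1 / ln (real (n2 n)))) \<longlonglongrightarrow> 0"
      by (rule filterlim_compose[OF _ n2_top])
  qed
qed

theorem proposition2:
  fixes \<phi> \<psi> :: "real \<Rightarrow> real" and s :: nat
    and \<alpha> D \<delta> F1 F2 x :: real
    and n1 n2 jmin jmax l :: "nat \<Rightarrow> nat"
  assumes "\<And>n. n1 n + n2 n = n"
    and "(\<lambda>n. real (n1 n)) \<simeq> (\<lambda>n. real (n2 n))"
    and "\<And>n. 0 < jmin n" and "\<And>n. jmin n < jmax n"
    and "(\<lambda>n. 2 ^ jmin n) \<simeq> (\<lambda>n. (real (n2 n) / ln (real (n2 n))) powr (1 / (2 * 1 + 1)))"
    and "(\<lambda>n. 2 ^ jmax n) \<simeq> (\<lambda>n. real (n2 n) / (ln (real (n2 n))) ^ 4)"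
    and "\<And>n. l n \<in> {jmin n..jmax n}"
    and "0 < \<alpha>" and "0 < D"
    and "scaling_function \<phi>" and "associated_wavelet \<phi> \<psi>"
    and "s_regular s \<phi>" and "\<alpha> < real s"
    and "0 < \<delta>" and "F1 < 0" and "1 < F2"
    and "density_class \<phi> \<psi> \<alpha> D \<delta> {F1..F2} \<noteq> {}"
  shows "(\<lambda>n. SUP f\<in>density_class \<phi> \<psi> \<alpha> D \<delta> {F1..F2}.
            \<bar>measure (iid_law f)
               {X \<in> space (iid_law f).
                  haar_deviation f (n1 n) (l n) X \<le> x / A_norm (l n) + B_norm (l n)}
             - exp (- exp (- x))\<bar>) \<longlonglongrightarrow> 0"
proof -
  let ?D = "density_class \<phi> \<psi> \<alpha> D \<delta> {F1..F2}"
  define P where "P f n = measure (iid_law f) {X \<in> space (iid_law f). haar_deviation f (n1 n) (l n)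
      X \<le> gumbel_level x (l n)}" for f n
  define G where "G f n = \<bar>P f n - exp (- exp (- x))\<bar>" for f n
  have dens: "probability_density f" if "f \<in> ?D" for f
    using that by (simp add: density_class_def probability_density_def)
  have lower: "\<delta> \<le> f y" if "f \<in> ?D" "y \<in> {F1..F2}" for f y
    using that by (simp add: density_class_def)
  obtain C \<beta> where C: "0 \<le> C" and \<beta>: "0 < \<beta>" and holder: "\<And>f a b. f \<in> ?D \<Longrightarrow> \<bar>f a - f b\<bar>
      \<le> C * \<bar>a - b\<bar> powr \<beta>"
    using density_class_holder[OF assms(8-13)] by blast
  note growth = resolution_growth[OF assms(1,2,5-7)]
  have G_le: "G f n \<le> 1" if "f \<in> ?D" for f n
  proof -
    interpret probability_density f by (rule dens[OF that])
    interpret I: prob_space "iid_law f" unfolding iid_law_eq by (intro prob_space_PiM prob_nu)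
    have "0 \<le> P f n" "P f n \<le> 1" unfolding P_def by (auto intro: I.prob_le_1)
    moreover have "0 < exp (- exp (- x))" "exp (- exp (- x)) \<le> 1" by simp_all
    ultimately show ?thesis unfolding G_def by linarith
  qed
  have bdd: "bdd_above ((\<lambda>f. G f n) ` ?D)" for n using G_le by (rule bdd_aboveI2)
  \<comment> \<open>near-maximisers, since the supremum need not be attained\<close>
  have "\<exists>f\<in>?D. (SUP f\<in>?D. G f n) - 1 / real (Suc n) < G f n" for n
  proof -
    have "(SUP f\<in>?D. G f n) - 1 / real (Suc n) < (SUP f\<in>?D. G f n)" by simp
    then show ?thesis using less_cSUP_iff[OF assms(17) bdd] by blast
  qed
  then obtain f where f: "\<And>n. f n \<in> ?D" "\<And>n. (SUP f\<in>?D. G f n) - 1 / real (Suc n) < G (f n) n"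
      by metis
  have "(\<lambda>n. P (f n) n) \<longlonglongrightarrow> exp (- exp (- x))"
    unfolding P_def
    by (rule gumbel_limit_along_sequence[OF dens[OF f(1)] lower[OF f(1)] assms(14-16) holder[OF
        f(1)] C \<beta> growth])
  then have "(\<lambda>n. G (f n) n) \<longlonglongrightarrow> 0" unfolding G_def by (intro tendsto_rabs_zero) (simp add: LIM_zero)
  from tendsto_add[OF this LIMSEQ_Suc[OF lim_1_over_n]]
  have up: "(\<lambda>n. G (f n) n + 1 / real (Suc n)) \<longlonglongrightarrow> 0" by simp
  have "(\<lambda>n. SUP f\<in>?D. G f n) \<longlonglongrightarrow> 0"
  proof (rule tendsto_sandwich[OF _ _ tendsto_const up])
    have "0 \<le> (SUP f\<in>?D. G f n)" for n
    proof -
      have "0 \<le> G (f n) n" by (simp add: G_def)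
      also have "\<dots> \<le> (SUP f\<in>?D. G f n)" by (rule cSUP_upper[OF f(1) bdd])
      finally show ?thesis .
    qed
    then show "\<forall>\<^sub>F n in sequentially. 0 \<le> (SUP f\<in>?D. G f n)" by simp
    have "(SUP f\<in>?D. G f n) \<le> G (f n) n + 1 / real (Suc n)" for n using f(2)[of n] by linarith
    then show "\<forall>\<^sub>F n in sequentially. (SUP f\<in>?D. G f n) \<le> G (f n) n + 1 / real (Suc n)" by simp
  qed
  then show ?thesis unfolding G_def P_def gumbel_level_def .
qed

end
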